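(* Let $k$ be a field, let $V$ be a finite-dimensional $k$-vector space (concentrated in degree $0$), let $A$ be an associative unital $k$-algebra, and let $\varrho:A\to\mathrm{End}\,V$ be a representation of $A$ on $V$, i.e. a $k$-point of $\mathrm{Rep}_V(A)$. Then $$\mathrm{T}^i_\varrho\,\mathrm{DRep}_V(A)\cong\begin{cases}\mathrm{Der}_k(A,\mathrm{End}\,V) & \text{if } i=0,\\ \mathrm{H}^{i+1}(A,\mathrm{End}\,V) & \text{if } i\ge 1,\end{cases}$$ where $\mathrm{End}\,V$ is an $A$-bimodule via $\varrho$ and $\mathrm{H}^{\bullet}(A,\mathrm{End}\,V)$ is Hochschild cohomology.
   Context: All algebras are associative and unital over $k$; DG algebras are $\mathbb{Z}$-graded with differential of degree $+1$; commutators and commutativity are in the graded sense. For a DG algebra $R$, let $R*_k\mathrm{End}\,V$ be the coproduct of DG algebras, $\sqrt[V]{R}:=\{w\in R*_k\mathrm{End}\,V:[w,m]=0\ \forall\, m\in\mathrm{End}\,V\}$, and $R_V:=(\sqrt[V]{R})_\natural$, where $S_\natural:=S/S[S,S]S$ is the abelianization of a DG algebra $S$. The commutative DG algebra $R_V$ represents the functor $B\mapsto\mathrm{Hom}_{\mathrm{DGA}}(R,B\otimes\mathrm{End}\,V)$ on commutative DG algebras. An almost free resolution of $A$ is a quasi-isomorphism of DG algebras $R\to A$, where the underlying graded algebra of $R$ is free and $R^i=0$ for all $i>0$. Put $A_V^\bullet:=\mathrm{H}^\bullet(R_V)$ (independent of the choice of $R\to A$) and $\mathrm{DRep}_V^\bullet(A):=\mathbf{Spec}(A_V^\bullet)$,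 the underlying derived scheme of the affine DG scheme $\mathrm{Rep}_V(R)$ with coordinate ring $R_V$. The representation $\varrho$ gives, by composition with $R\to A$, a DG algebra map $R\to\mathrm{End}\,V$ (again denoted $\varrho$), corresponding to a DG algebra homomorphism $\rho:R_V\to k$, which makes $k$ a DG $R_V$-module. For a DG algebra $S$ and a DG $S$-bimodule $N$, $\underline{\mathrm{Der}}_k^\bullet(S,N)$ denotes the complex of $k$-linear graded derivations $S\to N$, with differential $\delta\mapsto d_N\circ\delta-(-1)^{|\delta|}\delta\circ d_S$. The derived tangent spaces are defined by $$\mathrm{T}^i_\varrho\,\mathrm{DRep}_V(A):=\mathrm{H}^i\big(\underline{\mathrm{Der}}_k^\bullet(R_V,k)\big).$$ $\mathrm{Der}_k(A,\mathrm{End}\,V)$ is the space of $k$-linear derivations from $A$ to the $A$-bimodule $\mathrm{End}\,V$. *)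

theory Defs
  imports "Jordan_Normal_Form.Missing_VectorSpace" "HOL-Algebra.QuotRing"
begin

section \<open>Algebras and DG algebras over a field\<close>

definition alg_hom where
  "alg_hom K A B = module_hom K A B \<inter> ring_hom A B"

definition vs_iso where
  "vs_iso K M N \<longleftrightarrow> (\<exists>f \<in> module_hom K M N. bij_betw f (carrier M) (carrier N))"

definition ksign :: "('k, 'c) ring_scheme \<Rightarrow> int \<Rightarrow> 'k" where
  "ksign K n = (if even n then \<one>\<^bsub>K\<^esub> else \<ominus>\<^bsub>K\<^esub> \<one>\<^bsub>K\<^esub>)"

text \<open>The locale \<open>algebra\<close> of HOL-Algebra requires commutativity, hence the following.\<close>

locale assoc_algebra = vectorspace K A + ring A
  for K :: "('k, 'c) ring_scheme" and A :: "('k, 'a, 'd) module_scheme" +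
  assumes smult_mult_left: "\<lbrakk>c \<in> carrier K; x \<in> carrier A; y \<in> carrier A\<rbrakk> \<Longrightarrow>
      (c \<odot>\<^bsub>A\<^esub> x) \<otimes>\<^bsub>A\<^esub> y = c \<odot>\<^bsub>A\<^esub> (x \<otimes>\<^bsub>A\<^esub> y)"
    and smult_mult_right: "\<lbrakk>c \<in> carrier K; x \<in> carrier A; y \<in> carrier A\<rbrakk> \<Longrightarrow>
      x \<otimes>\<^bsub>A\<^esub> (c \<odot>\<^bsub>A\<^esub> y) = c \<odot>\<^bsub>A\<^esub> (x \<otimes>\<^bsub>A\<^esub> y)"

text \<open>\<open>Gr M n\<close> is the homogeneous part of degree \<open>n\<close> and \<open>dif M\<close> is the differential, defined on
  the whole carrier. The record is also used for complexes, whose \<open>mult\<close> and \<open>one\<close> are ignored.\<close>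

record ('k, 'a) dg_alg = "('k, 'a) module" +
  Gr :: "int \<Rightarrow> 'a set"
  dif :: "'a \<Rightarrow> 'a"

definition hdecomp :: "('k, 'a, 'd) dg_alg_scheme \<Rightarrow> 'a \<Rightarrow> (int \<Rightarrow> 'a) \<Rightarrow> bool" where
  "hdecomp M x c \<longleftrightarrow> (\<forall>n. c n \<in> Gr M n) \<and> finite {n. c n \<noteq> \<zero>\<^bsub>M\<^esub>} \<and>
     x = (\<Oplus>\<^bsub>M\<^esub>n \<in> {n. c n \<noteq> \<zero>\<^bsub>M\<^esub>}. c n)"

definition hcomp :: "('k, 'a, 'd) dg_alg_scheme \<Rightarrow> 'a \<Rightarrow> int \<Rightarrow> 'a" where
  "hcomp M x = (THE c. hdecomp M x c)"

definition hsupp :: "('k, 'a, 'd) dg_alg_scheme \<Rightarrow> 'a \<Rightarrow> int set" where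
  "hsupp M x = {n. hcomp M x n \<noteq> \<zero>\<^bsub>M\<^esub>}"

locale dg_algebra = assoc_algebra K R
  for K :: "('k, 'c) ring_scheme" and R :: "('k, 'a, 'd) dg_alg_scheme" +
  assumes Gr_subspace: "subspace K (Gr R n) R"
    and Gr_direct_sum: "x \<in> carrier R \<Longrightarrow> \<exists>!c. hdecomp R x c"
    and Gr_one: "\<one>\<^bsub>R\<^esub> \<in> Gr R 0"
    and Gr_mult: "\<lbrakk>x \<in> Gr R m; y \<in> Gr R n\<rbrakk> \<Longrightarrow> x \<otimes>\<^bsub>R\<^esub> y \<in> Gr R (m + n)"
    and dif_linear: "dif R \<in> module_hom K R R"
    and dif_degree: "x \<in> Gr R n \<Longrightarrow> dif R x \<in> Gr R (n + 1)"
    and dif_dif: "x \<in> carrier R \<Longrightarrow> dif R (dif R x) = \<zero>\<^bsub>R\<^esub>"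
    and dif_mult: "\<lbrakk>x \<in> Gr R n; y \<in> carrier R\<rbrakk> \<Longrightarrow>
      dif R (x \<otimes>\<^bsub>R\<^esub> y) = dif R x \<otimes>\<^bsub>R\<^esub> y \<oplus>\<^bsub>R\<^esub> ksign K n \<odot>\<^bsub>R\<^esub> (x \<otimes>\<^bsub>R\<^esub> dif R y)"

definition dg_hom where
  "dg_hom K R S = {f \<in> alg_hom K R S.
     (\<forall>n. f ` Gr R n \<subseteq> Gr S n) \<and> (\<forall>x \<in> carrier R. f (dif R x) = dif S (f x))}"

definition deg0 :: "('k, 'a) module \<Rightarrow> ('k, 'a) dg_alg" where
  "deg0 A = module.extend A
     (dg_alg.fields (\<lambda>n. if n = 0 then carrier A else {\<zero>\<^bsub>A\<^esub>}) (\<lambda>x. \<zero>\<^bsub>A\<^esub>))"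

definition base_alg :: "('k, 'c) ring_scheme \<Rightarrow> ('k, 'k) module" where
  "base_alg K = \<lparr>carrier = carrier K, mult = mult K, one = \<one>\<^bsub>K\<^esub>, zero = \<zero>\<^bsub>K\<^esub>,
     add = add K, smult = mult K\<rparr>"

definition End_alg :: "('k, 'c) ring_scheme \<Rightarrow> ('k, 'v, 'd) module_scheme \<Rightarrow>
    ('k, 'v \<Rightarrow> 'v) module" where
  "End_alg K V = \<lparr>carrier = module_hom K V V \<inter> extensional (carrier V),
     mult = compose (carrier V), one = (\<lambda>x \<in> carrier V. x), zero = (\<lambda>x \<in> carrier V. \<zero>\<^bsub>V\<^esub>),
     add = (\<lambda>f g. \<lambda>x \<in> carrier V. f x \<oplus>\<^bsub>V\<^esub> g x),
     smult = (\<lambda>c f. \<lambda>x \<in> carrier V. c \<odot>\<^bsub>V\<^esub> f x)\<rparr>"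

section \<open>Quotients and cohomology\<close>

text \<open>This is the quotient algebra for a two-sided ideal \<open>I\<close>, and the quotient space for a subspace
  \<open>I\<close>, in which case \<open>mult\<close> and \<open>one\<close> carry no meaning.\<close>

definition quot :: "('k, 'a, 'd) module_scheme \<Rightarrow> 'a set \<Rightarrow> ('k, 'a set) module" where
  "quot M I = ring.extend (M Quot I) (module.fields (\<lambda>c X. \<Union>x \<in> X. I +>\<^bsub>M\<^esub> (c \<odot>\<^bsub>M\<^esub> x)))"

definition dg_quot :: "('k, 'a, 'd) dg_alg_scheme \<Rightarrow> 'a set \<Rightarrow> ('k, 'a set) dg_alg" where
  "dg_quot S I = module.extend (quot S I)
     (dg_alg.fields (\<lambda>n. (\<lambda>x. I +>\<^bsub>S\<^esub> x) ` Gr S n) (\<lambda>X. \<Union>x \<in> X. I +>\<^bsub>S\<^esub> dif S x))"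

definition cocycles :: "('k, 'a, 'd) dg_alg_scheme \<Rightarrow> int \<Rightarrow> 'a set" where
  "cocycles M n = {x \<in> Gr M n. dif M x = \<zero>\<^bsub>M\<^esub>}"

definition coboundaries :: "('k, 'a, 'd) dg_alg_scheme \<Rightarrow> int \<Rightarrow> 'a set" where
  "coboundaries M n = dif M ` Gr M (n - 1)"

definition cohomology :: "('k, 'a, 'd) dg_alg_scheme \<Rightarrow> int \<Rightarrow> ('k, 'a set) module" where
  "cohomology M n = quot (M\<lparr>carrier := cocycles M n\<rparr>) (coboundaries M n)"

definition cohomology_map :: "('k, 'b, 'e) dg_alg_scheme \<Rightarrow> ('a \<Rightarrow> 'b) \<Rightarrow> int \<Rightarrow> 'a set \<Rightarrow> 'b set" where
  "cohomology_map N f n X = (\<Union>x \<in> X. coboundaries N n +>\<^bsub>N\<^esub> f x)"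

definition quasi_iso where
  "quasi_iso K R S f \<longleftrightarrow> f \<in> dg_hom K R S \<and>
     (\<forall>n. bij_betw (cohomology_map S f n) (carrier (cohomology R n)) (carrier (cohomology S n)))"

section \<open>Free algebras and almost free resolutions\<close>

text \<open>The free algebra on a set \<open>X\<close>: finitely supported functions on the words over \<open>X\<close>, with the
  convolution product.\<close>

definition free_alg :: "('k, 'c) ring_scheme \<Rightarrow> 'x set \<Rightarrow> ('k, 'x list \<Rightarrow> 'k) module" where
  "free_alg K X = \<lparr>carrier = {f. range f \<subseteq> carrier K \<and> finite {w. f w \<noteq> \<zero>\<^bsub>K\<^esub>} \<and>
                               {w. f w \<noteq> \<zero>\<^bsub>K\<^esub>} \<subseteq> lists X},
     mult = (\<lambda>f g w. \<Oplus>\<^bsub>K\<^esub>i \<in> {..length w}. f (take i w) \<otimes>\<^bsub>K\<^esub> g (drop i w)),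
     one = (\<lambda>w. if w = [] then \<one>\<^bsub>K\<^esub> else \<zero>\<^bsub>K\<^esub>), zero = (\<lambda>w. \<zero>\<^bsub>K\<^esub>),
     add = (\<lambda>f g w. f w \<oplus>\<^bsub>K\<^esub> g w), smult = (\<lambda>c f w. c \<otimes>\<^bsub>K\<^esub> f w)\<rparr>"

definition word :: "('k, 'c) ring_scheme \<Rightarrow> 'x list \<Rightarrow> 'x list \<Rightarrow> 'k" where
  "word K w = (\<lambda>v. if v = w then \<one>\<^bsub>K\<^esub> else \<zero>\<^bsub>K\<^esub>)"

definition lin_ext :: "('k, 'c) ring_scheme \<Rightarrow> ('k, 'a, 'd) module_scheme \<Rightarrow> ('x list \<Rightarrow> 'a) \<Rightarrow>
    ('x list \<Rightarrow> 'k) \<Rightarrow> 'a" where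
  "lin_ext K M F f = (\<Oplus>\<^bsub>M\<^esub>w \<in> {w. f w \<noteq> \<zero>\<^bsub>K\<^esub>}. f w \<odot>\<^bsub>M\<^esub> F w)"

text \<open>The generators are homogeneous, so the canonical bijection from the free algebra to \<open>R\<close> below
  is an isomorphism of graded algebras.\<close>

definition free_graded :: "('k, 'c) ring_scheme \<Rightarrow> ('k, 'a, 'd) dg_alg_scheme \<Rightarrow> bool" where
  "free_graded K R \<longleftrightarrow> (\<exists>X \<subseteq> (\<Union>n. Gr R n).
     bij_betw (lin_ext K R (\<lambda>w. foldr (mult R) w \<one>\<^bsub>R\<^esub>)) (carrier (free_alg K X)) (carrier R))"

definition almost_free_resolution ::
    "('k, 'c) ring_scheme \<Rightarrow> ('k, 'a) module \<Rightarrow> ('k, 'r, 'd) dg_alg_scheme \<Rightarrow> ('r \<Rightarrow> 'a) \<Rightarrow> bool" where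
  "almost_free_resolution K A R p \<longleftrightarrow> dg_algebra K R \<and> free_graded K R \<and>
     (\<forall>n > 0. Gr R n = {\<zero>\<^bsub>R\<^esub>}) \<and> quasi_iso K R (deg0 A) p"

section \<open>The coproduct of two DG algebras\<close>

text \<open>The coproduct is presented by one generator for each element of \<open>R\<close> or \<open>S\<close>, homogeneous or
  not, subject to the relations that make both inclusions algebra homomorphisms. On the free algebra
  on these generators the differential is the derivation extending those of \<open>R\<close> and \<open>S\<close>, twisted by
  the involution that multiplies the degree-\<open>n\<close> part by \<open>(-1)^n\<close>. The family \<open>Gr\<close> on the free algebra
  is spanned by words in homogeneous letters; only modulo the relations is it a grading.\<close>

definition sgn_inv :: "('k, 'c) ring_scheme \<Rightarrow> ('k, 'a, 'd) dg_alg_scheme \<Rightarrow> 'a \<Rightarrow> 'a" where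
  "sgn_inv K R x = (\<Oplus>\<^bsub>R\<^esub>n \<in> hsupp R x. ksign K n \<odot>\<^bsub>R\<^esub> hcomp R x n)"

primrec word_deg :: "(int \<Rightarrow> 'x set) \<Rightarrow> int \<Rightarrow> 'x list \<Rightarrow> bool" where
  "word_deg G n [] \<longleftrightarrow> n = 0"
| "word_deg G n (x # w) \<longleftrightarrow> (\<exists>i. x \<in> G i \<and> word_deg G (n - i) w)"

primrec word_dif :: "('k, 'c) ring_scheme \<Rightarrow> 'x set \<Rightarrow> ('x \<Rightarrow> 'x) \<Rightarrow> ('x \<Rightarrow> 'x) \<Rightarrow> 'x list \<Rightarrow>
    'x list \<Rightarrow> 'k" where
  "word_dif K X d s [] = \<zero>\<^bsub>free_alg K X\<^esub>"
| "word_dif K X d s (x # w) = word K (d x # w) \<oplus>\<^bsub>free_alg K X\<^esub>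
     (word K [s x] \<otimes>\<^bsub>free_alg K X\<^esub> word_dif K X d s w)"

definition gens :: "('k, 'r, 'd) dg_alg_scheme \<Rightarrow> ('k, 's, 'e) dg_alg_scheme \<Rightarrow> ('r + 's) set" where
  "gens R S = Inl ` carrier R \<union> Inr ` carrier S"

definition pre_coprod :: "('k, 'c) ring_scheme \<Rightarrow> ('k, 'r, 'd) dg_alg_scheme \<Rightarrow>
    ('k, 's, 'e) dg_alg_scheme \<Rightarrow> ('k, ('r + 's) list \<Rightarrow> 'k) dg_alg" where
  "pre_coprod K R S = module.extend (free_alg K (gens R S)) (dg_alg.fields
     (\<lambda>n. {f \<in> carrier (free_alg K (gens R S)).
            \<forall>w. f w \<noteq> \<zero>\<^bsub>K\<^esub> \<longrightarrow> word_deg (\<lambda>i. Inl ` Gr R i \<union> Inr ` Gr S i) n w})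
     (lin_ext K (free_alg K (gens R S)) (word_dif K (gens R S)
        (map_sum (dif R) (dif S)) (map_sum (sgn_inv K R) (sgn_inv K S)))))"

definition hom_relations :: "('k, 'c) ring_scheme \<Rightarrow> ('k, 'a, 'd) module_scheme \<Rightarrow>
    ('k, 'f, 'e) module_scheme \<Rightarrow> ('a \<Rightarrow> 'f) \<Rightarrow> 'f set" where
  "hom_relations K A F g =
     {g (a \<oplus>\<^bsub>A\<^esub> b) \<ominus>\<^bsub>F\<^esub> (g a \<oplus>\<^bsub>F\<^esub> g b) | a b. a \<in> carrier A \<and> b \<in> carrier A} \<union>
     {g (c \<odot>\<^bsub>A\<^esub> a) \<ominus>\<^bsub>F\<^esub> (c \<odot>\<^bsub>F\<^esub> g a) | c a. c \<in> carrier K \<and> a \<in> carrier A} \<union>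
     {g (a \<otimes>\<^bsub>A\<^esub> b) \<ominus>\<^bsub>F\<^esub> (g a \<otimes>\<^bsub>F\<^esub> g b) | a b. a \<in> carrier A \<and> b \<in> carrier A} \<union>
     {g \<one>\<^bsub>A\<^esub> \<ominus>\<^bsub>F\<^esub> \<one>\<^bsub>F\<^esub>}"

definition coprod_ideal :: "('k, 'c) ring_scheme \<Rightarrow> ('k, 'r, 'd) dg_alg_scheme \<Rightarrow>
    ('k, 's, 'e) dg_alg_scheme \<Rightarrow> (('r + 's) list \<Rightarrow> 'k) set" where
  "coprod_ideal K R S = genideal (pre_coprod K R S)
     (hom_relations K R (pre_coprod K R S) (\<lambda>a. word K [Inl a]) \<union>
      hom_relations K S (pre_coprod K R S) (\<lambda>a. word K [Inr a]))"

definition coprod :: "('k, 'c) ring_scheme \<Rightarrow> ('k, 'r, 'd) dg_alg_scheme \<Rightarrow>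
    ('k, 's, 'e) dg_alg_scheme \<Rightarrow> ('k, (('r + 's) list \<Rightarrow> 'k) set) dg_alg" where
  "coprod K R S = dg_quot (pre_coprod K R S) (coprod_ideal K R S)"

definition incl1 :: "('k, 'c) ring_scheme \<Rightarrow> ('k, 'r, 'd) dg_alg_scheme \<Rightarrow>
    ('k, 's, 'e) dg_alg_scheme \<Rightarrow> 'r \<Rightarrow> (('r + 's) list \<Rightarrow> 'k) set" where
  "incl1 K R S r = coprod_ideal K R S +>\<^bsub>pre_coprod K R S\<^esub> word K [Inl r]"

definition incl2 :: "('k, 'c) ring_scheme \<Rightarrow> ('k, 'r, 'd) dg_alg_scheme \<Rightarrow>
    ('k, 's, 'e) dg_alg_scheme \<Rightarrow> 's \<Rightarrow> (('r + 's) list \<Rightarrow> 'k) set" where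
  "incl2 K R S m = coprod_ideal K R S +>\<^bsub>pre_coprod K R S\<^esub> word K [Inr m]"

section \<open>The representation algebra\<close>

text \<open>Graded commutator, extended bilinearly from homogeneous elements.\<close>

definition gcomm :: "('k, 'c) ring_scheme \<Rightarrow> ('k, 'a, 'd) dg_alg_scheme \<Rightarrow> 'a \<Rightarrow> 'a \<Rightarrow> 'a" where
  "gcomm K S x y = (\<Oplus>\<^bsub>S\<^esub>i \<in> hsupp S x. \<Oplus>\<^bsub>S\<^esub>j \<in> hsupp S y.
     (hcomp S x i \<otimes>\<^bsub>S\<^esub> hcomp S y j) \<ominus>\<^bsub>S\<^esub>
       (ksign K (i * j) \<odot>\<^bsub>S\<^esub> (hcomp S y j \<otimes>\<^bsub>S\<^esub> hcomp S x i)))"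

definition comm_ideal :: "('k, 'c) ring_scheme \<Rightarrow> ('k, 'a, 'd) dg_alg_scheme \<Rightarrow> 'a set" where
  "comm_ideal K S = genideal S {gcomm K S x y | x y. x \<in> carrier S \<and> y \<in> carrier S}"

definition abelianization :: "('k, 'c) ring_scheme \<Rightarrow> ('k, 'a, 'd) dg_alg_scheme \<Rightarrow>
    ('k, 'a set) dg_alg" where
  "abelianization K S = dg_quot S (comm_ideal K S)"

definition End_coprod :: "('k, 'c) ring_scheme \<Rightarrow> ('k, 'r, 'd) dg_alg_scheme \<Rightarrow>
    ('k, 'v, 'e) module_scheme \<Rightarrow> ('k, (('r + ('v \<Rightarrow> 'v)) list \<Rightarrow> 'k) set) dg_alg" where
  "End_coprod K R V = coprod K R (deg0 (End_alg K V))"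

text \<open>The centralizer of \<open>End V\<close> in the coproduct of \<open>R\<close> and \<open>End V\<close>.\<close>

definition root_carrier :: "('k, 'c) ring_scheme \<Rightarrow> ('k, 'r, 'd) dg_alg_scheme \<Rightarrow>
    ('k, 'v, 'e) module_scheme \<Rightarrow> (('r + ('v \<Rightarrow> 'v)) list \<Rightarrow> 'k) set set" where
  "root_carrier K R V = {w \<in> carrier (End_coprod K R V). \<forall>m \<in> carrier (End_alg K V).
     gcomm K (End_coprod K R V) w (incl2 K R (deg0 (End_alg K V)) m) = \<zero>\<^bsub>End_coprod K R V\<^esub>}"

definition root_alg :: "('k, 'c) ring_scheme \<Rightarrow> ('k, 'r, 'd) dg_alg_scheme \<Rightarrow>
    ('k, 'v, 'e) module_scheme \<Rightarrow> ('k, (('r + ('v \<Rightarrow> 'v)) list \<Rightarrow> 'k) set) dg_alg" where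
  "root_alg K R V = (End_coprod K R V)\<lparr>carrier := root_carrier K R V,
     Gr := (\<lambda>n. Gr (End_coprod K R V) n \<inter> root_carrier K R V)\<rparr>"

definition rep_alg :: "('k, 'c) ring_scheme \<Rightarrow> ('k, 'r, 'd) dg_alg_scheme \<Rightarrow>
    ('k, 'v, 'e) module_scheme \<Rightarrow> ('k, (('r + ('v \<Rightarrow> 'v)) list \<Rightarrow> 'k) set set) dg_alg" where
  "rep_alg K R V = abelianization K (root_alg K R V)"

text \<open>A DG algebra map \<open>f\<close> from \<open>rep_alg K R V\<close> to the base field corresponds to a DG algebra map
  \<open>\<phi>\<close> from \<open>R\<close> to \<open>End V\<close> as follows. The coproduct is the tensor product of the centralizer
  \<open>root_alg\<close> of \<open>End V\<close> with \<open>End V\<close>, so \<open>f\<close> induces a map \<open>g\<close> from it to \<open>End V\<close>, equal to the class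
  map followed by \<open>f\<close> on the first factor and to the identity on the second; then \<open>\<phi>\<close> is the
  restriction of \<open>g\<close> to \<open>R\<close>.\<close>

definition corresponds :: "('k, 'c) ring_scheme \<Rightarrow> ('k, 'r, 'd) dg_alg_scheme \<Rightarrow>
    ('k, 'v, 'e) module_scheme \<Rightarrow> ((('r + ('v \<Rightarrow> 'v)) list \<Rightarrow> 'k) set set \<Rightarrow> 'k) \<Rightarrow>
    ('r \<Rightarrow> 'v \<Rightarrow> 'v) \<Rightarrow> bool" where
  "corresponds K R V f \<phi> \<longleftrightarrow> (\<exists>g \<in> dg_hom K (End_coprod K R V) (deg0 (End_alg K V)).
     (\<forall>w \<in> carrier (root_alg K R V). g w =
        f (comm_ideal K (root_alg K R V) +>\<^bsub>root_alg K R V\<^esub> w) \<odot>\<^bsub>End_alg K V\<^esub> \<one>\<^bsub>End_alg K V\<^esub>) \<and>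
     (\<forall>m \<in> carrier (End_alg K V). g (incl2 K R (deg0 (End_alg K V)) m) = m) \<and>
     (\<forall>r \<in> carrier R. \<phi> r = g (incl1 K R (deg0 (End_alg K V)) r)))"

text \<open>For \<open>V \<noteq> 0\<close> there is exactly one such \<open>f\<close> for each DG algebra map \<open>\<phi>\<close>. For \<open>V = 0\<close> there
  is none, since \<open>rep_alg K R V\<close> is the zero algebra. The default value is immaterial: every
  derivation on the zero algebra is zero.\<close>

definition point_of :: "('k, 'c) ring_scheme \<Rightarrow> ('k, 'r, 'd) dg_alg_scheme \<Rightarrow>
    ('k, 'v, 'e) module_scheme \<Rightarrow> ('r \<Rightarrow> 'v \<Rightarrow> 'v) \<Rightarrow>
    ((('r + ('v \<Rightarrow> 'v)) list \<Rightarrow> 'k) set set \<Rightarrow> 'k) \<Rightarrow> bool" where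
  "point_of K R V \<phi> f \<longleftrightarrow> f \<in> dg_hom K (rep_alg K R V) (deg0 (base_alg K)) \<and>
     f \<in> extensional (carrier (rep_alg K R V)) \<and> corresponds K R V f \<phi>"

definition rep_point :: "('k, 'c) ring_scheme \<Rightarrow> ('k, 'r, 'd) dg_alg_scheme \<Rightarrow>
    ('k, 'v, 'e) module_scheme \<Rightarrow> ('r \<Rightarrow> 'v \<Rightarrow> 'v) \<Rightarrow>
    (('r + ('v \<Rightarrow> 'v)) list \<Rightarrow> 'k) set set \<Rightarrow> 'k" where
  "rep_point K R V \<phi> =
     (if \<exists>f. point_of K R V \<phi> f then THE f. point_of K R V \<phi> f else (\<lambda>w. \<zero>\<^bsub>K\<^esub>))"

section \<open>Derivations and derived tangent spaces\<close>

record ('k, 's, 'm) dg_bimod = "('k, 'm) dg_alg" +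
  lact :: "'s \<Rightarrow> 'm \<Rightarrow> 'm"
  ract :: "'m \<Rightarrow> 's \<Rightarrow> 'm"

definition bimod_via :: "('s \<Rightarrow> 'm) \<Rightarrow> ('k, 'm) dg_alg \<Rightarrow> ('k, 's, 'm) dg_bimod" where
  "bimod_via f T = dg_alg.extend T
     (dg_bimod.fields (\<lambda>s m. f s \<otimes>\<^bsub>T\<^esub> m) (\<lambda>m s. m \<otimes>\<^bsub>T\<^esub> f s))"

definition fun_space :: "'x set \<Rightarrow> ('k, 'm, 'd) module_scheme \<Rightarrow> ('x \<Rightarrow> 'm) set \<Rightarrow>
    ('k, 'x \<Rightarrow> 'm) module" where
  "fun_space X N C = \<lparr>carrier = C,
     mult = (\<lambda>f g. \<lambda>x \<in> X. \<zero>\<^bsub>N\<^esub>), one = (\<lambda>x \<in> X. \<zero>\<^bsub>N\<^esub>), zero = (\<lambda>x \<in> X. \<zero>\<^bsub>N\<^esub>),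
     add = (\<lambda>f g. \<lambda>x \<in> X. f x \<oplus>\<^bsub>N\<^esub> g x), smult = (\<lambda>c f. \<lambda>x \<in> X. c \<odot>\<^bsub>N\<^esub> f x)\<rparr>"

definition dg_der :: "('k, 'c) ring_scheme \<Rightarrow> ('k, 's, 'd) dg_alg_scheme \<Rightarrow>
    ('k, 's, 'm, 'e) dg_bimod_scheme \<Rightarrow> int \<Rightarrow> ('s \<Rightarrow> 'm) set" where
  "dg_der K S N i = {\<delta> \<in> module_hom K S N \<inter> extensional (carrier S).
     (\<forall>n. \<delta> ` Gr S n \<subseteq> Gr N (n + i)) \<and>
     (\<forall>n. \<forall>x \<in> Gr S n. \<forall>y \<in> carrier S. \<delta> (x \<otimes>\<^bsub>S\<^esub> y) =
        ract N (\<delta> x) y \<oplus>\<^bsub>N\<^esub> ksign K (i * n) \<odot>\<^bsub>N\<^esub> lact N x (\<delta> y))}"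

definition dg_der_dif :: "('k, 'c) ring_scheme \<Rightarrow> ('k, 's, 'd) dg_alg_scheme \<Rightarrow>
    ('k, 's, 'm, 'e) dg_bimod_scheme \<Rightarrow> int \<Rightarrow> ('s \<Rightarrow> 'm) \<Rightarrow> 's \<Rightarrow> 'm" where
  "dg_der_dif K S N i \<delta> = (\<lambda>x \<in> carrier S.
     dif N (\<delta> x) \<ominus>\<^bsub>N\<^esub> (ksign K i \<odot>\<^bsub>N\<^esub> \<delta> (dif S x)))"

definition dg_der_cohomology :: "('k, 'c) ring_scheme \<Rightarrow> ('k, 's, 'd) dg_alg_scheme \<Rightarrow>
    ('k, 's, 'm, 'e) dg_bimod_scheme \<Rightarrow> int \<Rightarrow> ('k, ('s \<Rightarrow> 'm) set) module" where
  "dg_der_cohomology K S N i = quot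
     (fun_space (carrier S) N {\<delta> \<in> dg_der K S N i. dg_der_dif K S N i \<delta> = (\<lambda>x \<in> carrier S. \<zero>\<^bsub>N\<^esub>)})
     (dg_der_dif K S N (i - 1) ` dg_der K S N (i - 1))"

definition derived_tangent :: "('k, 'c) ring_scheme \<Rightarrow> ('k, 'r, 'd) dg_alg_scheme \<Rightarrow>
    ('k, 'v, 'e) module_scheme \<Rightarrow> ('r \<Rightarrow> 'v \<Rightarrow> 'v) \<Rightarrow> int \<Rightarrow>
    ('k, ((('r + ('v \<Rightarrow> 'v)) list \<Rightarrow> 'k) set set \<Rightarrow> 'k) set) module" where
  "derived_tangent K R V \<phi> i = dg_der_cohomology K (rep_alg K R V)
     (bimod_via (rep_point K R V \<phi>) (deg0 (base_alg K))) i"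

definition Der_space :: "('k, 'c) ring_scheme \<Rightarrow> ('k, 'a, 'd) module_scheme \<Rightarrow>
    ('k, 'a, 'm, 'e) dg_bimod_scheme \<Rightarrow> ('k, 'a \<Rightarrow> 'm) module" where
  "Der_space K A M = fun_space (carrier A) M {\<delta> \<in> module_hom K A M \<inter> extensional (carrier A).
     \<forall>x \<in> carrier A. \<forall>y \<in> carrier A. \<delta> (x \<otimes>\<^bsub>A\<^esub> y) = ract M (\<delta> x) y \<oplus>\<^bsub>M\<^esub> lact M x (\<delta> y)}"

section \<open>Hochschild cohomology\<close>

text \<open>Cohomology of the standard complex. An \<open>n\<close>-cochain is a multilinear function of \<open>n\<close>
  arguments, encoded as a function on lists of length \<open>n\<close>.\<close>

definition tuples :: "('k, 'a, 'd) module_scheme \<Rightarrow> nat \<Rightarrow> 'a list set" where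
  "tuples A n = {w \<in> lists (carrier A). length w = n}"

definition hochschild_cochains :: "('k, 'c) ring_scheme \<Rightarrow> ('k, 'a, 'd) module_scheme \<Rightarrow>
    ('k, 'a, 'm, 'e) dg_bimod_scheme \<Rightarrow> nat \<Rightarrow> ('a list \<Rightarrow> 'm) set" where
  "hochschild_cochains K A M n = {f \<in> tuples A n \<rightarrow>\<^sub>E carrier M.
     \<forall>u \<in> lists (carrier A). \<forall>v \<in> lists (carrier A). length u + length v + 1 = n \<longrightarrow>
       (\<lambda>a. f (u @ a # v)) \<in> module_hom K A M}"

definition hochschild_dif :: "('k, 'c) ring_scheme \<Rightarrow> ('k, 'a, 'd) module_scheme \<Rightarrow>
    ('k, 'a, 'm, 'e) dg_bimod_scheme \<Rightarrow> nat \<Rightarrow> ('a list \<Rightarrow> 'm) \<Rightarrow> 'a list \<Rightarrow> 'm" where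
  "hochschild_dif K A M n f = (\<lambda>w \<in> tuples A (n + 1).
     lact M (w ! 0) (f (drop 1 w)) \<oplus>\<^bsub>M\<^esub>
     (\<Oplus>\<^bsub>M\<^esub>i \<in> {..<n}. ksign K (int i + 1) \<odot>\<^bsub>M\<^esub>
        f (take i w @ [w ! i \<otimes>\<^bsub>A\<^esub> w ! (i + 1)] @ drop (i + 2) w)) \<oplus>\<^bsub>M\<^esub>
     ksign K (int n + 1) \<odot>\<^bsub>M\<^esub> ract M (f (take n w)) (w ! n))"

definition hochschild_coboundaries :: "('k, 'c) ring_scheme \<Rightarrow> ('k, 'a, 'd) module_scheme \<Rightarrow>
    ('k, 'a, 'm, 'e) dg_bimod_scheme \<Rightarrow> nat \<Rightarrow> ('a list \<Rightarrow> 'm) set" where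
  "hochschild_coboundaries K A M n = (case n of 0 \<Rightarrow> {\<lambda>w \<in> tuples A 0. \<zero>\<^bsub>M\<^esub>}
     | Suc m \<Rightarrow> hochschild_dif K A M m ` hochschild_cochains K A M m)"

definition hochschild_cohomology :: "('k, 'c) ring_scheme \<Rightarrow> ('k, 'a, 'd) module_scheme \<Rightarrow>
    ('k, 'a, 'm, 'e) dg_bimod_scheme \<Rightarrow> nat \<Rightarrow> ('k, ('a list \<Rightarrow> 'm) set) module" where
  "hochschild_cohomology K A M n = quot
     (fun_space (tuples A n) M {f \<in> hochschild_cochains K A M n.
        hochschild_dif K A M n f = (\<lambda>w \<in> tuples A (n + 1). \<zero>\<^bsub>M\<^esub>)})
     (hochschild_coboundaries K A M n)"

end

theory Submission
  imports Defs
begin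

text \<open>For \<open>V \<noteq> 0\<close> the coproduct of \<open>R\<close> and \<open>End V\<close> is the matrix algebra over the centralizer of
  \<open>End V\<close>, so derivations from \<open>R_V\<close> to \<open>k\<close> correspond to derivations from \<open>R\<close> to \<open>End V\<close>. These are the
  kernel of the Hochschild differential on the first column of the double complex of multilinear
  cochains on \<open>R\<close>. Its rows are exact because \<open>R\<close> is free, and a contraction of \<open>R\<close> onto \<open>A\<close> makes its
  columns exact in positive degrees, with kernels the Hochschild cochains of \<open>A\<close>.\<close>

\<comment> \<open>The shift by one between tangent spaces and Hochschild cohomology is a count of
  arguments. A derivation of degree \<open>i\<close> is a cochain in one argument of internal degree
  \<open>i\<close>; each step of the staircase through the double complex trades one internal degree
  for one argument, so it ends in cochains on \<open>A\<close> with \<open>i + 1\<close> arguments.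
  Cochains without arguments are left out of the complex: inner derivations are never divided out,
  and in degree 0 all of Der survives. Signs are the main obstacle. Elements may be inhomogeneous,
  and the free algebra presenting the coproduct is not graded before the relations are imposed.
  Koszul signs are therefore carried by the involution \<open>sgn_inv\<close>, which makes the
  Leibniz rule valid for all elements. On the target side they disappear: End V sits in degree 0 and
  the representation kills all other degrees. The field is arbitrary: scalars are read off scalar
  matrices as a diagonal entry, not as a normalized trace, and the contraction of \<open>R\<close>
  rests on linear splittings. Isomorphisms are obtained from linear relations, because lifts in a
  staircase are not unique.\<close>
syntax (input) "_index" :: "logic \<Rightarrow> index" ("\<^sub>_" [1000] 1000)

abbreviation (input) in_carrier :: "'a \<Rightarrow> ('a, 'b) partial_object_scheme \<Rightarrow> bool" (infix ":." 50) where
  "x :. A \<equiv> x \<in> carrier A"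

section \<open>Additive groups and linear maps\<close>

context abelian_group begin

lemma minus_telescope:
 assumes "x :. G" "y :. G" "z :. G"
 shows "(z \<ominus> x) \<oplus> (x \<ominus> y) = z \<ominus> y"
proof -
 have "(z \<ominus> x) \<oplus> (x \<ominus> y) = z \<oplus> (\<ominus> x \<oplus> (x \<oplus> \<ominus> y))"
  using assms by (simp add: minus_eq a_assoc)
 then show ?thesis using assms by (simp add: r_neg1 minus_eq)
qed

lemma minus_minus_cancel:
 assumes "x :. G" "y :. G" "z :. G"
 shows "(z \<ominus> y) \<ominus> (x \<ominus> y) = z \<ominus> x"
proof -
 have "(z \<ominus> y) \<ominus> (x \<ominus> y) = (z \<ominus> y) \<oplus> (y \<ominus> x)"
  using assms by (simp add: minus_eq minus_add a_comm)
 then show ?thesis using assms minus_telescope[of y x z] by simp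
qed

lemma minus_zero_right: "x :. G ==> x \<ominus> \<zero> = x"
 by (simp add: minus_eq)

lemma eq_if_minus_zero: "x :. G ==> y :. G ==> x \<ominus> y = \<zero> ==> x = y"
 using minus_telescope[of y \<zero> x] by (simp add: minus_zero_right)

lemma minus_self: "x :. G ==> x \<ominus> x = \<zero>"
 by (simp add: minus_eq r_neg)

end

lemma module_homI:
 assumes "!!x. x :. M ==> f x :. N"
  and "!!x y. [|x :. M; y :. M|] ==> f (x \<oplus>\<^sub>M y) = f x \<oplus>\<^sub>N f y"
  and "!!c x. [|c :. K; x :. M|] ==> f (c \<odot>\<^sub>M x) = c \<odot>\<^sub>N f x"
 shows "f \<in> module_hom K M N"
 using assms by (auto simp: module_hom_def)

lemma module_hom_in: "f \<in> module_hom K M N ==> x :. M ==> f x :. N"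
 by (auto simp: module_hom_def)

lemma module_hom_zero:
 assumes "module K M" "module K N" "f \<in> module_hom K M N"
 shows "f \<zero>\<^sub>M = \<zero>\<^sub>N"
proof -
 interpret M: module K M by fact
 interpret N: module K N by fact
 have "f (\<zero>\<^sub>K \<odot>\<^sub>M \<zero>\<^sub>M) = \<zero>\<^sub>K \<odot>\<^sub>N f \<zero>\<^sub>M"
  using assms(3) by (intro module_hom_smult) auto
 then show ?thesis using module_hom_in[OF assms(3)] by simp
qed

text \<open>Negatives become scalar multiples, so that linearity and closure under subtraction
  follow from sums and scalars.\<close>

lemma (in module) neg_eq_smult: "x :. M ==> \<ominus>\<^sub>M x = (\<ominus> \<one>) \<odot>\<^sub>M x"
 by (simp add: smult_l_minus)

lemma module_hom_neg:
 assumes "module K M" "module K N" "f \<in> module_hom K M N" "x :. M"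
 shows "f (\<ominus>\<^sub>M x) = \<ominus>\<^sub>N f x"
proof -
 interpret M: module K M by fact
 interpret N: module K N by fact
 show ?thesis using assms(3,4) module_hom_in[OF assms(3,4)]
  by (simp add: M.neg_eq_smult N.neg_eq_smult module_hom_smult)
qed

lemma module_hom_minus:
 assumes "module K M" "module K N" "f \<in> module_hom K M N" "x :. M" "y :. M"
 shows "f (x \<ominus>\<^sub>M y) = f x \<ominus>\<^sub>N f y"
proof -
 interpret M: module K M by fact
 interpret N: module K N by fact
 show ?thesis using assms(3-5)
  by (simp add: M.minus_eq N.minus_eq module_hom_add module_hom_neg[OF assms(1-3)])
qed

lemma module_hom_finsum:
 assumes "module K M" "module K N" "f \<in> module_hom K M N" "finite S" "g \<in> S \<rightarrow> carrier M"
 shows "f (\<Oplus>\<^sub>M i\<in>S. g i) = (\<Oplus>\<^sub>N i\<in>S. f (g i))"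
 using assms(4,5)
proof induction
 interpret M: module K M by fact
 interpret N: module K N by fact
 case empty show ?case using module_hom_zero[OF assms(1-3)] by simp
next
 interpret M: module K M by fact
 interpret N: module K N by fact
 case (insert i S)
 have *: "(%i. f (g i)) \<in> S \<rightarrow> carrier N" "f (g i) :. N"
  using insert module_hom_in[OF assms(3)] by auto
 show ?case using insert * by (simp add: module_hom_add[OF assms(3)] M.finsum_closed Pi_def)
qed

lemma module_hom_comp:
 "f \<in> module_hom K L M ==> g \<in> module_hom K M N ==> (%x. g (f x)) \<in> module_hom K L N"
 by (auto simp: module_hom_def Pi_def)

subsection \<open>Quotients\<close>

text \<open>A purely linear setting, because \<open>quot\<close> is applied to spaces of cocycles
  whose product is meaningless. Two-sided ideals of algebras enter later as a special case.\<close>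

locale quot_setup = module K M for K :: "('k,'c) ring_scheme" and M :: "('k,'a,'d) module_scheme" +
 fixes I assumes sub: "submodule K I M"
begin

lemma I_sub: "I <= carrier M" using sub by (simp add: submodule_def)
lemma I_zero: "\<zero>\<^sub>M \<in> I" using sub by (simp add: submodule_def)
lemma I_add: "x \<in> I ==> y \<in> I ==> x \<oplus>\<^sub>M y \<in> I" using sub by (simp add: submodule_def)
lemma I_smult: "c :. K ==> x \<in> I ==> c \<odot>\<^sub>M x \<in> I" using sub by (simp add: submodule_def)
lemma I_neg: "x \<in> I ==> \<ominus>\<^sub>M x \<in> I" using I_smult[of "\<ominus>\<^sub>K \<one>\<^sub>K" x] I_sub by (auto simp: neg_eq_smult)
lemma I_minus: "x \<in> I ==> y \<in> I ==> x \<ominus>\<^sub>M y \<in> I" using I_add I_neg by (simp add: M.minus_eq)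

lemma additive_subgroup_I: "additive_subgroup I M"
proof -
 have "subgroup I (add_monoid M)"
  by (rule M.add.subgroupI) (use I_sub I_zero I_add I_neg in "auto simp: a_inv_def")
 then show ?thesis by (simp add: additive_subgroup_def)
qed

sublocale Q: abelian_subgroup I M
 by (rule abelian_subgroupI3[OF additive_subgroup_I M.abelian_group_axioms])

lemma quot_carrier: "carrier (quot M I) = (%x. I +>\<^sub>M x) ` carrier M"
 by (auto simp: quot_def ring.extend_def FactRing_def A_RCOSETS_def RCOSETS_def a_r_coset_def)

lemma mem_coset_iff: "x :. M ==> y \<in> I +>\<^sub>M x \<longleftrightarrow> y :. M & y \<ominus>\<^sub>M x \<in> I"
proof
 assume x: "x :. M" and "y \<in> I +>\<^sub>M x"
 then obtain h where h: "h \<in> I" "y = h \<oplus>\<^sub>M x" by (auto simp: a_r_coset_def')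
 then have "h :. M" using I_sub by auto
 then have "y \<ominus>\<^sub>M x = h" using h x by (simp add: M.minus_eq M.a_assoc M.r_neg)
 then show "y :. M & y \<ominus>\<^sub>M x \<in> I" using h x \<open>h :. M\<close> by simp
next
 assume x: "x :. M" and y: "y :. M & y \<ominus>\<^sub>M x \<in> I"
 then have "y = (y \<ominus>\<^sub>M x) \<oplus>\<^sub>M x" by (simp add: M.minus_eq M.a_assoc M.l_neg)
 then show "y \<in> I +>\<^sub>M x" using y unfolding a_r_coset_def' by blast
qed

lemma mem_coset: "y \<in> I +>\<^sub>M x ==> x :. M ==> y :. M & y \<ominus>\<^sub>M x \<in> I"
 by (simp add: mem_coset_iff)

lemma coset_self: "x :. M ==> x \<in> I +>\<^sub>M x"
 by (simp add: mem_coset_iff M.minus_eq M.r_neg I_zero)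

lemma quot_eq:
 assumes x: "x :. M" and y: "y :. M"
 shows "I +>\<^sub>M x = I +>\<^sub>M y \<longleftrightarrow> x \<ominus>\<^sub>M y \<in> I"
proof
 assume "I +>\<^sub>M x = I +>\<^sub>M y"
 then show "x \<ominus>\<^sub>M y \<in> I" using coset_self[OF x] mem_coset_iff[OF y] by simp
next
 assume d: "x \<ominus>\<^sub>M y \<in> I"
 have "z \<ominus>\<^sub>M x \<in> I \<longleftrightarrow> z \<ominus>\<^sub>M y \<in> I" if z: "z :. M" for z
 proof -
  have 1: "z \<ominus>\<^sub>M y = (z \<ominus>\<^sub>M x) \<oplus>\<^sub>M (x \<ominus>\<^sub>M y)"
   using x y z by (simp add: M.minus_telescope)
  have 2: "z \<ominus>\<^sub>M x = (z \<ominus>\<^sub>M y) \<ominus>\<^sub>M (x \<ominus>\<^sub>M y)"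
   using x y z by (simp add: M.minus_minus_cancel)
  show ?thesis
  proof
   assume "z \<ominus>\<^sub>M x \<in> I"
   then show "z \<ominus>\<^sub>M y \<in> I" unfolding 1 using d by (rule I_add)
  next
   assume "z \<ominus>\<^sub>M y \<in> I"
   then show "z \<ominus>\<^sub>M x \<in> I" unfolding 2 using d by (rule I_minus)
  qed
 qed
 then show "I +>\<^sub>M x = I +>\<^sub>M y"
  using mem_coset_iff[OF x] mem_coset_iff[OF y] by blast
qed

lemma coset_zero: "I +>\<^sub>M \<zero>\<^sub>M = I"
 using I_sub by (auto simp: mem_coset_iff M.minus_eq)

lemma quot_zero_eq: "x :. M ==> I +>\<^sub>M x = I \<longleftrightarrow> x \<in> I"
 using quot_eq[of x "\<zero>\<^sub>M"] coset_zero M.minus_zero_right by simp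

lemma quot_add: "x :. M ==> y :. M ==> (I +>\<^sub>M x) \<oplus>\<^bsub>quot M I\<^esub> (I +>\<^sub>M y) = I +>\<^sub>M (x \<oplus>\<^sub>M y)"
 by (simp add: quot_def ring.extend_def FactRing_def Q.a_rcos_sum)

text \<open>Operations on \<open>quot\<close> and \<open>dg_quot\<close> are defined as unions over
  all representatives. If the operation preserves \<open>I\<close>, all these cosets coincide and
  the union collapses to one of them.\<close>

lemma union_map:
 assumes "f \<in> module_hom K M M" "!!x. x \<in> I ==> f x \<in> I" "x :. M"
 shows "(\<Union>y \<in> I +>\<^sub>M x. I +>\<^sub>M f y) = I +>\<^sub>M f x"
proof -
 have "I +>\<^sub>M f y = I +>\<^sub>M f x" if "y \<in> I +>\<^sub>M x" for y
 proof -
  have y: "y :. M" "y \<ominus>\<^sub>M x \<in> I" using mem_coset[OF that assms(3)] by auto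
  have "f y \<ominus>\<^sub>M f x \<in> I"
   using assms(2)[OF y(2)] module_hom_minus[OF module_axioms module_axioms assms(1) y(1) assms(3)] by simp
  then show ?thesis using quot_eq module_hom_in[OF assms(1)] y assms(3) by blast
 qed
 then show ?thesis using coset_self[OF assms(3)] by blast
qed

lemma smult_hom: "c :. K ==> (%x. c \<odot>\<^sub>M x) \<in> module_hom K M M"
 by (rule module_homI) (auto simp: smult_r_distr smult_assoc1[symmetric] R.m_comm)

lemma quot_smult: "c :. K ==> x :. M ==> c \<odot>\<^bsub>quot M I\<^esub> (I +>\<^sub>M x) = I +>\<^sub>M (c \<odot>\<^sub>M x)"
 using union_map[OF smult_hom, of c x] I_smult
 by (simp add: quot_def ring.extend_def module.fields_def FactRing_def)

end

text \<open>A linear relation replaces a map, because the correspondences used later are multivalued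
  on representatives. Being total on both sides and matching \<open>I\<close> with \<open>J\<close>
  makes it the graph of an isomorphism of the quotients.\<close>

lemma vs_iso_quotI:
 assumes "quot_setup K M I" "quot_setup K N J"
  and tot: "!!x. x :. M ==> \<exists>y \<in> carrier N. Z x y"
  and sur: "!!y. y :. N ==> \<exists>x \<in> carrier M. Z x y"
  and add: "!!x y x' y'. [|Z x y; Z x' y'; x :. M; x' :. M; y :. N; y' :. N|]
    ==> Z (x \<oplus>\<^sub>M x') (y \<oplus>\<^sub>N y')"
  and smult: "!!c x y. [|Z x y; c :. K; x :. M; y :. N|] ==> Z (c \<odot>\<^sub>M x) (c \<odot>\<^sub>N y)"
  and IJ: "!!x y. [|Z x y; x :. M; y :. N|] ==> x \<in> I \<longleftrightarrow> y \<in> J"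
 shows "vs_iso K (quot M I) (quot N J)"
proof -
 interpret M: quot_setup K M I by fact
 interpret N: quot_setup K N J by fact
 have minus: "Z (x \<ominus>\<^sub>M x') (y \<ominus>\<^sub>N y')"
  if "Z x y" "Z x' y'" "x :. M" "x' :. M" "y :. N" "y' :. N" for x y x' y'
  using add[OF that(1) smult[OF that(2), of "\<ominus>\<^sub>K \<one>\<^sub>K"]] that
  by (simp add: M.M.minus_eq N.M.minus_eq M.neg_eq_smult N.neg_eq_smult)
 have eq: "I +>\<^sub>M x = I +>\<^sub>M x' \<longleftrightarrow> J +>\<^sub>N y = J +>\<^sub>N y'"
  if "Z x y" "Z x' y'" "x :. M" "x' :. M" "y :. N" "y' :. N" for x y x' y'
  using that IJ[OF minus[OF that]] by (simp add: M.quot_eq N.quot_eq)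
 \<comment> \<open>The description is unique by \<open>eq\<close>: representatives of one class are
   related only to representatives of one class.\<close>
 define f where "f X = (THE Y. \<exists>x y. x :. M & y :. N & Z x y & X = I +>\<^sub>M x & Y = J +>\<^sub>N y)" for X
 have f: "f (I +>\<^sub>M x) = J +>\<^sub>N y" if "Z x y" "x :. M" "y :. N" for x y
  unfolding f_def
 proof (rule the_equality)
  show "\<exists>x' y'. x' :. M & y' :. N & Z x' y' & I +>\<^sub>M x = I +>\<^sub>M x' & J +>\<^sub>N y = J +>\<^sub>N y'"
   using that by blast
  fix Y assume "\<exists>x' y'. x' :. M & y' :. N & Z x' y' & I +>\<^sub>M x = I +>\<^sub>M x' & Y = J +>\<^sub>N y'"
  then show "Y = J +>\<^sub>N y" using eq that by metis
 qed
 have hom: "f \<in> module_hom K (quot M I) (quot N J)"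
 proof (rule module_homI)
  fix X assume "X :. (quot M I)"
  then obtain x where x: "x :. M" "X = I +>\<^sub>M x" by (auto simp: M.quot_carrier)
  obtain y where y: "y :. N" "Z x y" using tot x by blast
  show "f X :. (quot N J)" using f[OF y(2) x(1) y(1)] x y by (simp add: N.quot_carrier)
  fix X' assume "X' :. (quot M I)"
  then obtain x' where x': "x' :. M" "X' = I +>\<^sub>M x'" by (auto simp: M.quot_carrier)
  obtain y' where y': "y' :. N" "Z x' y'" using tot x' by blast
  show "f (X \<oplus>\<^bsub>quot M I\<^esub> X') = f X \<oplus>\<^bsub>quot N J\<^esub> f X'"
   using f[OF y(2) x(1) y(1)] f[OF y'(2) x'(1) y'(1)] f[OF add[OF y(2) y'(2)]] x x' y y'
   by (simp add: M.quot_add N.quot_add)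
 next
  fix c X assume c: "c :. K" and "X :. (quot M I)"
  then obtain x where x: "x :. M" "X = I +>\<^sub>M x" by (auto simp: M.quot_carrier)
  obtain y where y: "y :. N" "Z x y" using tot x by blast
  show "f (c \<odot>\<^bsub>quot M I\<^esub> X) = c \<odot>\<^bsub>quot N J\<^esub> f X"
   using f[OF y(2) x(1) y(1)] f[OF smult[OF y(2) c x(1) y(1)]] c x y
   by (simp add: M.quot_smult N.quot_smult)
 qed
 have "inj_on f (carrier (quot M I))"
 proof (rule inj_onI)
  fix X X' assume a: "X :. (quot M I)" "X' :. (quot M I)" "f X = f X'"
  obtain x where x: "x :. M" "X = I +>\<^sub>M x" using a by (auto simp: M.quot_carrier)
  obtain x' where x': "x' :. M" "X' = I +>\<^sub>M x'" using a by (auto simp: M.quot_carrier)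
  obtain y where y: "y :. N" "Z x y" using tot x by blast
  obtain y' where y': "y' :. N" "Z x' y'" using tot x' by blast
  show "X = X'" using a(3) f[OF y(2) x(1) y(1)] f[OF y'(2) x'(1) y'(1)] eq[OF y(2) y'(2) x(1) x'(1) y(1) y'(1)] x x' by simp
 qed
 moreover have "Y \<in> f ` carrier (quot M I)" if Y: "Y :. (quot N J)" for Y
 proof -
  obtain y where y: "y :. N" "Y = J +>\<^sub>N y" using Y by (auto simp: N.quot_carrier)
  obtain x where x: "x :. M" "Z x y" using sur y by blast
  show ?thesis using f[OF x(2) x(1) y(1)] x y by (auto simp: M.quot_carrier intro!: rev_image_eqI)
 qed
 ultimately have "bij_betw f (carrier (quot M I)) (carrier (quot N J))"
  using module_hom_in[OF hom] by (auto simp: bij_betw_def)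
 then show ?thesis using hom by (auto simp: vs_iso_def)
qed

subsection \<open>Comparison of the two edges of a double complex\<close>

text \<open>A first-quadrant double complex with commuting differentials, \<open>b\<close> raising
  the first index and \<open>d\<close> the second. Exactness fails only at first index 0 for
  \<open>b\<close> and at second index 0 for \<open>d\<close>, so the cohomology is visible on two
  edges: the kernel of \<open>b\<close> at \<open>p = 0\<close> and the kernel of \<open>d\<close>
  at \<open>q = 0\<close>.\<close>

locale double_complex =
 fixes K :: "('k, 'c) ring_scheme" and M :: "nat => nat => ('k, 'x, 'd) module_scheme"
  and b d :: "nat => nat => 'x => 'x"
 assumes module: "module K (M p q)"
  and b_hom: "b p q \<in> module_hom K (M p q) (M (Suc p) q)"
  and d_hom: "d p q \<in> module_hom K (M p q) (M p (Suc q))"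
  and b_b: "x :. (M p q) ==> b (Suc p) q (b p q x) = \<zero>\<^bsub>M (Suc (Suc p)) q\<^esub>"
  and d_d: "x :. (M p q) ==> d p (Suc q) (d p q x) = \<zero>\<^bsub>M p (Suc (Suc q))\<^esub>"
  and b_d: "x :. (M p q) ==> b p (Suc q) (d p q x) = d (Suc p) q (b p q x)"
  and row_exact: "[|x :. (M (Suc p) q); b (Suc p) q x = \<zero>\<^bsub>M (Suc (Suc p)) q\<^esub>|]
   ==> \<exists>c \<in> carrier (M p q). b p q c = x"
  and column_exact: "[|x :. (M p (Suc q)); d p (Suc q) x = \<zero>\<^bsub>M p (Suc (Suc q))\<^esub>|]
   ==> \<exists>c \<in> carrier (M p q). d p q c = x"
begin

text \<open>The staircase of a double complex: lift through \<open>d\<close>, push along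
  \<open>b\<close>, and repeat until the second index is 0. The lifts involve choices, so this is a
  relation. It replaces a passage through the total complex and carries no alternating
  signs.\<close>

primrec zigzag :: "nat => nat => 'x => 'x => bool" where
 "zigzag 0 p u y \<longleftrightarrow> u = y"
| "zigzag (Suc q) p u y \<longleftrightarrow> (\<exists>c \<in> carrier (M p q). d p q c = u & zigzag q (Suc p) (b p q c) y)"

lemma b_in: "x :. (M p q) ==> b p q x :. (M (Suc p) q)"
 by (rule module_hom_in[OF b_hom])

lemma d_in: "x :. (M p q) ==> d p q x :. (M p (Suc q))"
 by (rule module_hom_in[OF d_hom])

lemmas b_minus = module_hom_minus[OF module module b_hom]
 and d_minus = module_hom_minus[OF module module d_hom]
 and b_zero = module_hom_zero[OF module module b_hom]
 and d_zero = module_hom_zero[OF module module d_hom]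

lemma ab: "abelian_group (M p q)"
 using module by (simp add: module_def)

text \<open>Column exactness supplies each lift \<open>c\<close>; then \<open>b c\<close> is again
  closed for both differentials, by commutation and \<open>b b = 0\<close>.\<close>

lemma zigzag_total:
 assumes "u :. (M p q)" "d p q u = \<zero>\<^bsub>M p (Suc q)\<^esub>" "b p q u = \<zero>\<^bsub>M (Suc p) q\<^esub>"
 shows "\<exists>y \<in> carrier (M (p + q) 0). zigzag q p u y &
  d (p + q) 0 y = \<zero>\<^bsub>M (p + q) (Suc 0)\<^esub> & b (p + q) 0 y = \<zero>\<^bsub>M (Suc (p + q)) 0\<^esub>"
 using assms
proof (induction q arbitrary: p u)
 case 0 then show ?case by auto
next
 case (Suc q)
 then obtain c where c: "c :. (M p q)" "d p q c = u" using column_exact by blast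
 have 1: "d (Suc p) q (b p q c) = \<zero>\<^bsub>M (Suc p) (Suc q)\<^esub>" using b_d[OF c(1)] c(2) Suc by simp
 show ?case using Suc.IH[OF b_in[OF c(1)] 1 b_b[OF c(1)]] c by auto
qed

text \<open>The same staircase climbed from its end: row exactness writes the current element as
  \<open>b c\<close>, and \<open>d c\<close> is the next one. The end \<open>y\<close> stays fixed
  while \<open>p + q = m\<close>.\<close>

lemma zigzag_surj:
 assumes "y :. (M m 0)" "d m 0 y = \<zero>\<^bsub>M m (Suc 0)\<^esub>" "b m 0 y = \<zero>\<^bsub>M (Suc m) 0\<^esub>" "p + q = m"
 shows "\<exists>u \<in> carrier (M p q). zigzag q p u y &
  d p q u = \<zero>\<^bsub>M p (Suc q)\<^esub> & b p q u = \<zero>\<^bsub>M (Suc p) q\<^esub>"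
 using assms(4)
proof (induction q arbitrary: p)
 case 0 then show ?case using assms by auto
next
 case (Suc q)
 then obtain v where v: "v :. (M (Suc p) q)" "zigzag q (Suc p) v y"
  "d (Suc p) q v = \<zero>\<^bsub>M (Suc p) (Suc q)\<^esub>" "b (Suc p) q v = \<zero>\<^bsub>M (Suc (Suc p)) q\<^esub>"
  by (metis add_Suc_right add_Suc)
 obtain c where c: "c :. (M p q)" "b p q c = v" using row_exact v by blast
 show ?case
  by (rule bexI[of _ "d p q c"]) (use c v b_d[OF c(1)] d_d[OF c(1)] d_in[OF c(1)] in auto)
qed

lemma zigzag_add:
 assumes "zigzag q p u y" "zigzag q p u' y'"
  "u :. (M p q)" "u' :. (M p q)"
 shows "zigzag q p (u \<oplus>\<^bsub>M p q\<^esub> u') (y \<oplus>\<^bsub>M (p + q) 0\<^esub> y')"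
 using assms
proof (induction q arbitrary: p u u')
 case 0 then show ?case by auto
next
 case (Suc q)
 then obtain c c' where c: "c :. (M p q)" "d p q c = u" "zigzag q (Suc p) (b p q c) y"
  "c' :. (M p q)" "d p q c' = u'" "zigzag q (Suc p) (b p q c') y'" by auto
 interpret ab: abelian_group "M p q" by (rule ab)
 have "d p q (c \<oplus>\<^bsub>M p q\<^esub> c') = u \<oplus>\<^bsub>M p (Suc q)\<^esub> u'" using c module_hom_add[OF d_hom] by auto
 moreover have "b p q (c \<oplus>\<^bsub>M p q\<^esub> c') = b p q c \<oplus>\<^bsub>M (Suc p) q\<^esub> b p q c'" using c module_hom_add[OF b_hom] by auto
 ultimately show ?case using Suc.IH[OF c(3,6) b_in b_in] c by auto
qed

lemma zigzag_smult:
 assumes "zigzag q p u y" "u :. (M p q)" "k :. K"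
 shows "zigzag q p (k \<odot>\<^bsub>M p q\<^esub> u) (k \<odot>\<^bsub>M (p + q) 0\<^esub> y)"
 using assms
proof (induction q arbitrary: p u)
 case 0 then show ?case by auto
next
 case (Suc q)
 then obtain c where c: "c :. (M p q)" "d p q c = u" "zigzag q (Suc p) (b p q c) y" by auto
 interpret mo: module K "M p q" by (rule module)
 have "d p q (k \<odot>\<^bsub>M p q\<^esub> c) = k \<odot>\<^bsub>M p (Suc q)\<^esub> u" using c module_hom_smult[OF d_hom] Suc by auto
 moreover have "b p q (k \<odot>\<^bsub>M p q\<^esub> c) = k \<odot>\<^bsub>M (Suc p) q\<^esub> b p q c" using c module_hom_smult[OF b_hom] Suc by auto
 ultimately show ?case using Suc.IH[OF c(3) b_in] c Suc.prems by auto
qed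

text \<open>The lift \<open>c\<close> chosen by the staircase is compared with the given lift
  \<open>k\<close>: the difference is \<open>d\<close>-closed. At the last step it is itself the
  required element \<open>l\<close>. Before that it equals \<open>d e\<close>, and
  \<open>b e\<close> takes over the role of \<open>k\<close> one step further.\<close>

lemma zigzag_boundary:
 assumes "zigzag (Suc q) p (d p q k) y" "k :. (M p q)" "b p q k = \<zero>\<^bsub>M (Suc p) q\<^esub>"
 shows "\<exists>l \<in> carrier (M (p + q) 0). d (p + q) 0 l = \<zero>\<^bsub>M (p + q) (Suc 0)\<^esub> & b (p + q) 0 l = y"
 using assms
proof (induction q arbitrary: p k)
 case 0
 then obtain c where c: "c :. (M p 0)" "d p 0 c = d p 0 k" "b p 0 c = y" by auto
 interpret ab: abelian_group "M p 0" by (rule ab)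
 interpret ab1: abelian_group "M (Suc p) 0" by (rule ab)
 interpret ab2: abelian_group "M p (Suc 0)" by (rule ab)
 show ?case
  by (rule bexI[of _ "c \<ominus>\<^bsub>M p 0\<^esub> k"])
   (use c 0 b_in[of c p 0] d_in[of k p 0] in "auto simp: d_minus b_minus ab2.minus_self ab1.minus_zero_right")
next
 case (Suc q)
 then obtain c where c: "c :. (M p (Suc q))" "d p (Suc q) c = d p (Suc q) k"
  "zigzag (Suc q) (Suc p) (b p (Suc q) c) y" by auto
 interpret ab: abelian_group "M p (Suc q)" by (rule ab)
 interpret ab1: abelian_group "M (Suc p) (Suc q)" by (rule ab)
 interpret ab2: abelian_group "M p (Suc (Suc q))" by (rule ab)
 have "d p (Suc q) (c \<ominus>\<^bsub>M p (Suc q)\<^esub> k) = \<zero>\<^bsub>M p (Suc (Suc q))\<^esub>"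
  using c Suc.prems d_in[of k p "Suc q"] by (simp add: d_minus ab2.minus_self)
 then obtain e where e: "e :. (M p q)" "d p q e = c \<ominus>\<^bsub>M p (Suc q)\<^esub> k"
  using column_exact c Suc.prems ab.minus_closed by metis
 have "d (Suc p) q (b p q e) = b p (Suc q) c"
  using b_d[OF e(1)] e(2) c Suc.prems b_in[of c p "Suc q"] by (simp add: b_minus ab1.minus_zero_right)
 then show ?case using Suc.IH[of "Suc p" "b p q e"] c(3) b_b[OF e(1)] b_in[OF e(1)] by auto
qed

text \<open>The dual argument. The induction hypothesis gives \<open>k'\<close> with
  \<open>d k' = b c\<close> and \<open>b k' = 0\<close>; row exactness writes
  \<open>k' = b e\<close>, and subtracting \<open>d e\<close> from \<open>c\<close> makes it
  \<open>b\<close>-closed without changing its image under \<open>d\<close>.\<close>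

lemma zigzag_boundary_conv:
 assumes "zigzag (Suc q) p u (b (p + q) 0 l)" "l :. (M (p + q) 0)"
  "d (p + q) 0 l = \<zero>\<^bsub>M (p + q) (Suc 0)\<^esub>"
 shows "\<exists>k \<in> carrier (M p q). b p q k = \<zero>\<^bsub>M (Suc p) q\<^esub> & d p q k = u"
 using assms
proof (induction q arbitrary: p u)
 case 0
 then obtain c where c: "c :. (M p 0)" "d p 0 c = u" "b p 0 c = b p 0 l" by auto
 interpret ab: abelian_group "M p 0" by (rule ab)
 interpret ab1: abelian_group "M (Suc p) 0" by (rule ab)
 interpret ab2: abelian_group "M p (Suc 0)" by (rule ab)
 show ?case
  by (rule bexI[of _ "c \<ominus>\<^bsub>M p 0\<^esub> l"])
   (use c 0 b_in[of l p 0] d_in[of c p 0] in "auto simp: d_minus b_minus ab1.minus_self ab2.minus_zero_right")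
next
 case (Suc q)
 then obtain c where c: "c :. (M p (Suc q))" "d p (Suc q) c = u"
  "zigzag (Suc q) (Suc p) (b p (Suc q) c) (b (Suc p + q) 0 l)" by auto
 obtain k' where k': "k' :. (M (Suc p) q)" "b (Suc p) q k' = \<zero>\<^bsub>M (Suc (Suc p)) q\<^esub>"
  "d (Suc p) q k' = b p (Suc q) c" using Suc.IH[OF c(3)] Suc.prems by auto
 obtain e where e: "e :. (M p q)" "b p q e = k'" using row_exact k' by blast
 interpret ab: abelian_group "M p (Suc q)" by (rule ab)
 interpret ab1: abelian_group "M (Suc p) (Suc q)" by (rule ab)
 interpret ab2: abelian_group "M p (Suc (Suc q))" by (rule ab)
 have b: "b p (Suc q) (d p q e) = b p (Suc q) c" using b_d[OF e(1)] e k' by simp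
 show ?case
  by (rule bexI[of _ "c \<ominus>\<^bsub>M p (Suc q)\<^esub> d p q e"])
   (use c b d_in[OF e(1)] d_d[OF e(1)] b_in[OF c(1)] d_in[OF c(1)] in
    \<open>auto simp: d_minus b_minus ab1.minus_self ab2.minus_zero_right\<close>)
qed

end

subsection \<open>Linear sections\<close>

text \<open>Zorn's lemma gives a maximal subspace \<open>W\<close> of \<open>M\<close> that meets
  the kernel of \<open>f\<close> trivially. On it \<open>f\<close> is a bijection onto
  \<open>N\<close>, and the inverse is the section. No finiteness is available, since
  \<open>R\<close> and \<open>A\<close> may be infinite-dimensional.\<close>

lemma linear_section:
 assumes M: "vectorspace K M" and N: "module K N" and f: "f \<in> module_hom K M N"
  and surj: "f ` carrier M = carrier N"
 shows "\<exists>g \<in> module_hom K N M. \<forall>y \<in> carrier N. f (g y) = y"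
proof -
 interpret M: vectorspace K M by fact
 interpret N: module K N by fact
 define \<S> where "\<S> = {W. submodule K W M & (\<forall>x \<in> W. f x = \<zero>\<^sub>N --> x = \<zero>\<^sub>M)}"
 have "\<exists>W\<in>\<S>. \<forall>X\<in>\<S>. W <= X --> X = W"
 proof (rule subset_Zorn_nonempty)
  have "{\<zero>\<^sub>M} \<in> \<S>" using M.module_axioms by (auto simp: \<S>_def submodule_def)
  then show "\<S> ~= {}" by blast
  fix C assume C: "C ~= {}" "subset.chain \<S> C"
  then have CS: "C <= \<S>" by (auto simp: subset.chain_def)
  have tot: "U <= W \<or> W <= U" if "U \<in> C" "W \<in> C" for U W
   using C that by (auto simp: subset.chain_def)
  have "submodule K (\<Union>C) M"
   unfolding submodule_def
  proof (intro conjI allI impI M.module_axioms)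
   show "\<Union>C <= carrier M" using CS by (auto simp: \<S>_def submodule_def)
   show "\<zero>\<^sub>M \<in> \<Union>C" using C CS by (auto simp: \<S>_def submodule_def)
   fix v w assume "v \<in> \<Union>C" "w \<in> \<Union>C"
   then obtain U W where "v \<in> U" "U \<in> C" "w \<in> W" "W \<in> C" by blast
   then obtain X where "v \<in> X" "w \<in> X" "X \<in> C" using tot[of U W] by auto
   moreover have "submodule K X M" using CS \<open>X \<in> C\<close> by (auto simp: \<S>_def)
   ultimately have "v \<oplus>\<^sub>M w \<in> X" by (simp add: submodule_def)
   then show "v \<oplus>\<^sub>M w \<in> \<Union>C" using \<open>X \<in> C\<close> by blast
  next
   fix c v assume "c :. K" "v \<in> \<Union>C"
   then show "c \<odot>\<^sub>M v \<in> \<Union>C" using CS by (auto simp: \<S>_def submodule_def)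
  qed
  then show "\<Union>C \<in> \<S>" using CS by (auto simp: \<S>_def)
 qed
 then obtain W where W: "W \<in> \<S>" "!!X. X \<in> \<S> ==> W <= X ==> X = W" by blast
 have sub: "submodule K W M" and inj0: "!!x. x \<in> W ==> f x = \<zero>\<^sub>N ==> x = \<zero>\<^sub>M"
  using W(1) by (auto simp: \<S>_def)
 interpret W: quot_setup K M W using sub M.module_axioms by (simp add: quot_setup_def quot_setup_axioms_def)
 have Wc: "w :. M" if "w \<in> W" for w using W.I_sub that by auto
 have fM: "f x :. N" if "x :. M" for x using module_hom_in[OF f that] .
 \<comment> \<open>If \<open>f x\<close> were missed, \<open>W + K x\<close> would still meet the
   kernel trivially, against maximality: a kernel element with nonzero coefficient \<open>c\<close>
   of \<open>x\<close> could be solved for \<open>f x\<close> by inverting \<open>c\<close>.\<close>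
 have onto: "\<exists>w \<in> W. f w = f x" if x: "x :. M" for x
 proof (rule ccontr)
  assume no: "\<not> ?thesis"
  define W' where "W' = {w \<oplus>\<^sub>M c \<odot>\<^sub>M x | w c. w \<in> W & c :. K}"
  have "submodule K W' M"
   unfolding submodule_def
  proof (intro conjI allI impI M.module_axioms)
   show "W' <= carrier M" using x Wc by (auto simp: W'_def)
   show "\<zero>\<^sub>M \<in> W'" unfolding W'_def using W.I_zero x
    by (auto intro!: exI[of _ "\<zero>\<^sub>M"] exI[of _ "\<zero>\<^sub>K"])
   fix v u assume "v \<in> W'" "u \<in> W'"
   then obtain w c w' c' where "v = w \<oplus>\<^sub>M c \<odot>\<^sub>M x" "u = w' \<oplus>\<^sub>M c' \<odot>\<^sub>M x" "w \<in> W" "w' \<in> W"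
    "c :. K" "c' :. K" by (auto simp: W'_def)
   moreover from this have "v \<oplus>\<^sub>M u = (w \<oplus>\<^sub>M w') \<oplus>\<^sub>M (c \<oplus>\<^sub>K c') \<odot>\<^sub>M x"
    using x Wc by (simp add: M.smult_l_distr M.a_ac)
   ultimately show "v \<oplus>\<^sub>M u \<in> W'" using W.I_add unfolding W'_def by blast
  next
   fix a v assume a: "a :. K" and "v \<in> W'"
   then obtain w c where "v = w \<oplus>\<^sub>M c \<odot>\<^sub>M x" "w \<in> W" "c :. K" by (auto simp: W'_def)
   moreover from this have "a \<odot>\<^sub>M v = (a \<odot>\<^sub>M w) \<oplus>\<^sub>M (a \<otimes>\<^sub>K c) \<odot>\<^sub>M x"
    using x Wc a by (simp add: M.smult_r_distr M.smult_assoc1)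
   ultimately show "a \<odot>\<^sub>M v \<in> W'" using W.I_smult a unfolding W'_def by blast
  qed
  moreover have "v = \<zero>\<^sub>M" if v: "v \<in> W'" and 0: "f v = \<zero>\<^sub>N" for v
  proof -
   obtain w c where w: "v = w \<oplus>\<^sub>M c \<odot>\<^sub>M x" "w \<in> W" "c :. K" using v by (auto simp: W'_def)
   have fw: "f w \<oplus>\<^sub>N c \<odot>\<^sub>N f x = \<zero>\<^sub>N"
    using w 0 x Wc module_hom_add[OF f] module_hom_smult[OF f] by auto
   have "c = \<zero>\<^sub>K"
   proof (rule ccontr)
    assume "c ~= \<zero>\<^sub>K"
    then have u: "c \<in> Units K" using w M.field_Units by auto
    have i: "inv\<^bsub>K\<^esub> c :. K" "inv\<^bsub>K\<^esub> c \<otimes>\<^sub>K c = \<one>\<^sub>K" using u by auto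
    have "c \<odot>\<^sub>N f x = \<ominus>\<^sub>N f w"
     using fw w x fM Wc by (metis N.M.minus_equality N.M.a_comm N.smult_closed N.M.minus_minus)
    then have "(inv\<^bsub>K\<^esub> c) \<odot>\<^sub>N (c \<odot>\<^sub>N f x) = (inv\<^bsub>K\<^esub> c) \<odot>\<^sub>N (\<ominus>\<^sub>N f w)" by simp
    then have "f x = (inv\<^bsub>K\<^esub> c) \<odot>\<^sub>N (\<ominus>\<^sub>N f w)"
     using i w fM x by (simp add: N.smult_assoc1[symmetric])
    also have "\<dots> = f ((inv\<^bsub>K\<^esub> c) \<odot>\<^sub>M (\<ominus>\<^sub>M w))"
     using i w Wc module_hom_neg[OF M.module_axioms N f] module_hom_smult[OF f] by simp
    finally show False using no w i W.I_smult W.I_neg by metis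
   qed
   then show ?thesis using w fw inj0 fM x Wc by auto
  qed
  ultimately have "W' \<in> \<S>" by (auto simp: \<S>_def)
  moreover have "W <= W'" 
  proof
   fix w assume "w \<in> W"
   then have "w = w \<oplus>\<^sub>M \<zero>\<^sub>K \<odot>\<^sub>M x" using x Wc by simp
   then show "w \<in> W'" using \<open>w \<in> W\<close> unfolding W'_def by blast
  qed
  ultimately have "W' = W" using W(2) by blast
  moreover have "x \<in> W'" unfolding W'_def using x W.I_zero
   by (auto intro!: exI[of _ "\<zero>\<^sub>M"] exI[of _ "\<one>\<^sub>K"])
  ultimately show False using no by auto
 qed
 have inj: "w = w'" if "w \<in> W" "w' \<in> W" "f w = f w'" for w w'
 proof -
  have "f (w \<ominus>\<^sub>M w') = \<zero>\<^sub>N"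
   using that Wc fM module_hom_minus[OF M.module_axioms N f] by (simp add: N.M.minus_self)
  then show ?thesis using inj0[of "w \<ominus>\<^sub>M w'"] W.I_minus that Wc M.eq_if_minus_zero by metis
 qed
 define g where "g y = (THE w. w \<in> W & f w = y)" for y
 have g: "g y \<in> W & f (g y) = y" if y: "y :. N" for y
  unfolding g_def
 proof (rule theI')
  obtain x where "x :. M" "f x = y" using y unfolding surj[symmetric] by blast
  then show "\<exists>!w. w \<in> W & f w = y" using onto[of x] inj by metis
 qed
 have "g \<in> module_hom K N M"
 proof (rule module_homI)
  fix y assume y: "y :. N"
  show "g y :. M" using g y Wc by blast
  fix y' assume y': "y' :. N"
  show "g (y \<oplus>\<^sub>N y') = g y \<oplus>\<^sub>M g y'"
   using g y y' Wc module_hom_add[OF f] by (intro inj) (auto intro: W.I_add)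
 next
  fix c y assume "c :. K" "y :. N"
  then show "g (c \<odot>\<^sub>N y) = c \<odot>\<^sub>M g y"
   using g Wc module_hom_smult[OF f] by (intro inj) (auto intro: W.I_smult)
 qed
 then show ?thesis using g by blast
qed

subsection \<open>Graded spaces\<close>

context cring begin

lemma ksign_in: "ksign R n :. R"
 by (simp add: ksign_def)

lemma ksign_add: "ksign R (m + n) = ksign R m \<otimes> ksign R n"
 by (simp add: ksign_def l_minus)

lemma ksign_self: "ksign R n \<otimes> ksign R n = \<one>"
 by (simp add: ksign_def l_minus)

end

text \<open>The linear part of a grading, separated from the product so that components and glued
  maps can be treated by linear algebra alone.\<close>

locale graded_space = vectorspace K M
 for K :: "('k, 'c) ring_scheme" and M :: "('k, 'a, 'd) dg_alg_scheme" +
 assumes Gr_sub: "subspace K (Gr M n) M"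
  and Gr_sum: "x :. M ==> \<exists>!c. hdecomp M x c"
begin

lemma Gr_submodule: "submodule K (Gr M n) M"
 using Gr_sub by (simp add: subspace_def)

lemma Gr_in: "x \<in> Gr M n ==> x :. M"
 using Gr_submodule[of n] by (auto simp: submodule_def)

lemma Gr_zero: "\<zero>\<^sub>M \<in> Gr M n"
 using Gr_submodule[of n] by (auto simp: submodule_def)

lemma Gr_add: "x \<in> Gr M n ==> y \<in> Gr M n ==> x \<oplus>\<^sub>M y \<in> Gr M n"
 using Gr_submodule[of n] by (auto simp: submodule_def)

lemma Gr_smult: "c :. K ==> x \<in> Gr M n ==> c \<odot>\<^sub>M x \<in> Gr M n"
 using Gr_submodule[of n] by (auto simp: submodule_def)

lemma Gr_neg: "x \<in> Gr M n ==> \<ominus>\<^sub>M x \<in> Gr M n"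
 using Gr_smult[of "\<ominus>\<^sub>K \<one>\<^sub>K" x n] Gr_in[of x n] by (simp add: neg_eq_smult)

lemma hdecomp_hcomp: "x :. M ==> hdecomp M x (hcomp M x)"
 unfolding hcomp_def by (rule theI'[OF Gr_sum])

lemma hdecomp_unique: "x :. M ==> hdecomp M x c ==> hcomp M x = c"
 unfolding hcomp_def using Gr_sum by (blast intro: the1_equality)

lemma hcomp_Gr: "x :. M ==> hcomp M x n \<in> Gr M n"
 using hdecomp_hcomp by (auto simp: hdecomp_def)

lemma hcomp_in: "x :. M ==> hcomp M x n :. M"
 using hcomp_Gr Gr_in by blast

lemma hsupp_finite: "x :. M ==> finite (hsupp M x)"
 using hdecomp_hcomp by (auto simp: hdecomp_def hsupp_def)

lemma finsum_superset:
 assumes "finite F" "S <= F" "!!i. i \<in> F - S ==> h i = \<zero>\<^sub>M" "!!i. i \<in> F ==> h i :. M"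
 shows "(\<Oplus>\<^sub>M i\<in>S. h i) = (\<Oplus>\<^sub>M i\<in>F. h i)"
 by (rule M.add.finprod_mono_neutral_cong_left) (use assms in auto)

lemma hcomp_sum:
 assumes "x :. M" "finite F" "hsupp M x <= F"
 shows "x = (\<Oplus>\<^sub>M n\<in>F. hcomp M x n)"
proof -
 have "x = (\<Oplus>\<^sub>M n\<in>hsupp M x. hcomp M x n)"
  using hdecomp_hcomp[OF assms(1)] by (simp add: hdecomp_def hsupp_def)
 also have "\<dots> = (\<Oplus>\<^sub>M n\<in>F. hcomp M x n)"
  by (rule finsum_superset) (use assms hcomp_in in "auto simp: hsupp_def")
 finally show ?thesis .
qed

lemma hdecompI:
 assumes "finite F" "!!n. c n \<in> Gr M n" "!!n. n \<notin> F ==> c n = \<zero>\<^sub>M" "x = (\<Oplus>\<^sub>M n\<in>F. c n)"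
 shows "hdecomp M x c"
proof -
 have 1: "{n. c n ~= \<zero>\<^sub>M} <= F" using assms(3) by auto
 have "(\<Oplus>\<^sub>M n\<in>{n. c n ~= \<zero>\<^sub>M}. c n) = (\<Oplus>\<^sub>M n\<in>F. c n)"
  by (rule finsum_superset) (use assms(1,3) 1 Gr_in[OF assms(2)] in auto)
 then show ?thesis using assms 1 finite_subset by (auto simp: hdecomp_def)
qed

lemma hcomp_eqI:
 assumes "finite F" "!!n. c n \<in> Gr M n" "!!n. n \<notin> F ==> c n = \<zero>\<^sub>M" "x = (\<Oplus>\<^sub>M n\<in>F. c n)"
 shows "hcomp M x = c"
proof -
 have "x :. M" unfolding assms(4) using assms(2) Gr_in by (intro M.finsum_closed) auto
 then show ?thesis using hdecompI[OF assms] hdecomp_unique by blast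
qed

lemma hcomp_homogeneous:
 assumes "x \<in> Gr M n" shows "hcomp M x m = (if m = n then x else \<zero>\<^sub>M)"
proof -
 have "hcomp M x = (%m. if m = n then x else \<zero>\<^sub>M)"
  by (rule hcomp_eqI[of "{n}"]) (use assms Gr_zero Gr_in in auto)
 then show ?thesis by simp
qed

lemma hsupp_homogeneous: "x \<in> Gr M n ==> hsupp M x <= {n}"
 by (auto simp: hsupp_def hcomp_homogeneous)

lemma hcomp_add:
 assumes "x :. M" "y :. M"
 shows "hcomp M (x \<oplus>\<^sub>M y) n = hcomp M x n \<oplus>\<^sub>M hcomp M y n"
proof -
 let ?F = "hsupp M x \<union> hsupp M y"
 have F: "finite ?F" using assms hsupp_finite by auto
 have "hcomp M (x \<oplus>\<^sub>M y) = (%n. hcomp M x n \<oplus>\<^sub>M hcomp M y n)"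
 proof (rule hcomp_eqI[OF F])
  show "x \<oplus>\<^sub>M y = (\<Oplus>\<^sub>M n\<in>?F. hcomp M x n \<oplus>\<^sub>M hcomp M y n)"
   using hcomp_sum[OF assms(1) F] hcomp_sum[OF assms(2) F] hcomp_in assms
   by (subst M.finsum_addf) auto
 qed (use assms hcomp_Gr Gr_add in "auto simp: hsupp_def")
 then show ?thesis by simp
qed

lemma hcomp_smult:
 assumes "x :. M" "k :. K"
 shows "hcomp M (k \<odot>\<^sub>M x) n = k \<odot>\<^sub>M hcomp M x n"
proof -
 have F: "finite (hsupp M x)" using assms hsupp_finite by auto
 have "hcomp M (k \<odot>\<^sub>M x) = (%n. k \<odot>\<^sub>M hcomp M x n)"
 proof (rule hcomp_eqI[OF F])
  show "k \<odot>\<^sub>M x = (\<Oplus>\<^sub>M n\<in>hsupp M x. k \<odot>\<^sub>M hcomp M x n)"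
   using hcomp_in assms F
   by (subst finsum_smult_ldistr[symmetric]) (auto simp: hcomp_sum[OF assms(1) F, symmetric])
 qed (use assms hcomp_Gr Gr_smult in "auto simp: hsupp_def")
 then show ?thesis by simp
qed

lemma homogeneous_induct [consumes 1, case_names homogeneous add]:
 assumes x: "x :. M" and hom: "!!n x. x \<in> Gr M n ==> P x"
  and add: "!!x y. [|x :. M; y :. M; P x; P y|] ==> P (x \<oplus>\<^sub>M y)"
 shows "P x"
proof -
 have "P (\<Oplus>\<^sub>M n\<in>F. hcomp M x n)" if "finite F" for F
  using that
 proof induction
  case empty then show ?case using hom[OF Gr_zero] by simp
 next
  case (insert n F)
  have "(\<Oplus>\<^sub>M n\<in>F. hcomp M x n) :. M" using hcomp_in[OF x] by (intro M.finsum_closed) auto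
  then show ?case using insert hcomp_in[OF x] add[OF _ _ hom[OF hcomp_Gr[OF x]]] by (subst M.finsum_insert) auto
 qed
 then show ?thesis using hcomp_sum[OF x hsupp_finite[OF x]] by (metis order_refl hsupp_finite[OF x])
qed

text \<open>One linear map assembled from maps on the homogeneous parts. The sign involution, the
  shift representation of the coproduct and the contracting homotopy are all built in this
  way.\<close>

definition glue :: "('k, 'b, 'e) module_scheme => (int => 'a => 'b) => 'a => 'b" where
 "glue N h x = (\<Oplus>\<^sub>N n\<in>hsupp M x. h n (hcomp M x n))"

lemma glue:
 assumes "module K N"
  and h: "!!n. h n \<in> module_hom K (M\<lparr>carrier := Gr M n\<rparr>) N"
 shows glue_hom: "glue N h \<in> module_hom K M N"
  and glue_Gr: "x \<in> Gr M n ==> glue N h x = h n x"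
proof -
 interpret N: module K N by fact
 have h_in: "h n x :. N" if "x \<in> Gr M n" for n x
  using module_hom_in[OF h] that by simp
 have h_add: "h n (x \<oplus>\<^sub>M y) = h n x \<oplus>\<^sub>N h n y" if "x \<in> Gr M n" "y \<in> Gr M n" for n x y
  using module_hom_add[OF h] that by simp
 have h_smult: "h n (c \<odot>\<^sub>M x) = c \<odot>\<^sub>N h n x" if "x \<in> Gr M n" "c :. K" for n x c
  using module_hom_smult[OF h] that by simp
 have h0: "h n \<zero>\<^sub>M = \<zero>\<^sub>N" for n
  using h_smult[OF Gr_zero R.zero_closed, of n] h_in[OF Gr_zero, of n] by simp
 \<comment> \<open>The support of a sum can be smaller than the union of the supports, so all sums
   are rewritten over one finite superset.\<close>
 have sup: "glue N h x = (\<Oplus>\<^sub>N n\<in>F. h n (hcomp M x n))"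
  if "x :. M" "finite F" "hsupp M x <= F" for x F
  unfolding glue_def
  by (rule N.M.add.finprod_mono_neutral_cong_left) (use that h0 h_in hcomp_Gr in "auto simp: hsupp_def")
 show "glue N h \<in> module_hom K M N"
 proof (rule module_homI)
  fix x assume x: "x :. M"
  show "glue N h x :. N" unfolding glue_def using h_in hcomp_Gr x by (intro N.M.finsum_closed) auto
  fix y assume y: "y :. M"
  let ?F = "hsupp M x \<union> hsupp M y \<union> hsupp M (x \<oplus>\<^sub>M y)"
  have F: "finite ?F" using x y hsupp_finite by auto
  show "glue N h (x \<oplus>\<^sub>M y) = glue N h x \<oplus>\<^sub>N glue N h y"
   using x y hcomp_Gr h_in sup[OF x F] sup[OF y F] sup[OF _ F, of "x \<oplus>\<^sub>M y"]
   by (simp add: hcomp_add h_add[OF hcomp_Gr hcomp_Gr] N.M.finsum_addf Pi_def Un_upper1 Un_upper2 le_supI1)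
 next
  fix c x assume c: "c :. K" and x: "x :. M"
  let ?F = "hsupp M x \<union> hsupp M (c \<odot>\<^sub>M x)"
  have F: "finite ?F" using x c hsupp_finite by auto
  show "glue N h (c \<odot>\<^sub>M x) = c \<odot>\<^sub>N glue N h x"
   using x c hcomp_Gr h_in F
   using sup[OF x F] sup[OF _ F, of "c \<odot>\<^sub>M x"]
   by (simp add: hcomp_smult h_smult[OF hcomp_Gr] N.finsum_smult_ldistr Pi_def)
 qed
 show "glue N h x = h n x" if x: "x \<in> Gr M n"
  using sup[OF Gr_in[OF x] _ hsupp_homogeneous[OF x]] h_in[OF x] by (simp add: hcomp_homogeneous[OF x])
qed

lemma hom_eq_if_eq_on_Gr:
 assumes f: "f \<in> module_hom K M N" and g: "g \<in> module_hom K M N"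
  and eq: "!!n x. x \<in> Gr M n ==> f x = g x" and x: "x :. M"
 shows "f x = g x"
 using x by (rule homogeneous_induct) (auto simp: eq module_hom_add[OF f] module_hom_add[OF g])

lemma sgn_inv_glue: "sgn_inv K M = glue M (%n x. ksign K n \<odot>\<^sub>M x)"
 by (simp add: sgn_inv_def glue_def fun_eq_iff)

lemma ksign_hom: "(%x. ksign K n \<odot>\<^sub>M x) \<in> module_hom K (M\<lparr>carrier := Gr M n\<rparr>) M"
 by (rule module_homI) (auto simp: Gr_in R.ksign_in smult_r_distr smult_assoc1[symmetric] R.m_comm)

lemma sgn_inv_hom: "sgn_inv K M \<in> module_hom K M M"
 unfolding sgn_inv_glue by (rule glue_hom[OF module_axioms ksign_hom])

lemma sgn_inv_Gr_eq: "x \<in> Gr M n ==> sgn_inv K M x = ksign K n \<odot>\<^sub>M x"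
 unfolding sgn_inv_glue by (rule glue_Gr[OF module_axioms ksign_hom])

lemma sgn_inv_in: "x :. M ==> sgn_inv K M x :. M"
 by (rule module_hom_in[OF sgn_inv_hom])

lemma sgn_inv_Gr: "x \<in> Gr M n ==> sgn_inv K M x \<in> Gr M n"
 by (simp add: sgn_inv_Gr_eq Gr_smult R.ksign_in)

end

sublocale dg_algebra \<subseteq> graded_space K R
 by (intro graded_space.intro graded_space_axioms.intro vectorspace_axioms Gr_subspace Gr_direct_sum)

context dg_algebra begin

lemma sgn_inv_one: "sgn_inv K R \<one>\<^sub>R = \<one>\<^sub>R"
 using sgn_inv_Gr_eq[OF Gr_one] by (simp add: ksign_def)

lemma sgn_inv_mult:
 assumes "x :. R" "y :. R"
 shows "sgn_inv K R (x \<otimes>\<^sub>R y) = sgn_inv K R x \<otimes>\<^sub>R sgn_inv K R y"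
 using assms(1)
proof (induction x rule: homogeneous_induct)
 case (homogeneous m x)
 show ?case using assms(2)
 proof (induction y rule: homogeneous_induct)
  case (homogeneous n y)
  then show ?case using \<open>x \<in> Gr R m\<close> Gr_in[of x m] Gr_in[of y n] Gr_mult[of x m y n]
   by (simp add: sgn_inv_Gr_eq[of _ "m + n"] sgn_inv_Gr_eq[of x m] sgn_inv_Gr_eq[of y n] R.ksign_add
    smult_mult_left smult_mult_right smult_assoc1[symmetric] R.m_comm R.ksign_in)
 next
  case (add y z)
  then show ?case using Gr_in[OF \<open>x \<in> Gr R m\<close>] by (simp add: r_distr module_hom_add[OF sgn_inv_hom] sgn_inv_in)
 qed
next
 case (add x z)
 with assms(2) show ?case by (simp add: l_distr module_hom_add[OF sgn_inv_hom] sgn_inv_in)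
qed

lemma dif_in: "x :. R ==> dif R x :. R"
 by (rule module_hom_in[OF dif_linear])

text \<open>Absorbing the sign in the involution frees the Leibniz rule from homogeneity. In this
  form it can be imposed on arbitrary generators of the coproduct.\<close>

lemma dif_mult_sgn:
 assumes "x :. R" "y :. R"
 shows "dif R (x \<otimes>\<^sub>R y) = dif R x \<otimes>\<^sub>R y \<oplus>\<^sub>R sgn_inv K R x \<otimes>\<^sub>R dif R y"
 using assms(1)
proof (induction x rule: homogeneous_induct)
 case (homogeneous m x)
 with assms(2) show ?case using Gr_in[of x m] by (simp add: dif_mult sgn_inv_Gr_eq[of x m] smult_mult_left dif_in R.ksign_in)
next
 case (add x z)
 with assms(2) show ?case by (simp add: l_distr module_hom_add[OF sgn_inv_hom] module_hom_add[OF dif_linear] sgn_inv_in dif_in a_ac)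
qed

text \<open>The differential shifts the degree by one, hence flips the sign. This anticommutation is
  what makes the twisted derivation on the coproduct, and later the differential of cochains, square
  to zero.\<close>

lemma dif_sgn_inv:
 assumes "x :. R" shows "dif R (sgn_inv K R x) = \<ominus>\<^sub>R sgn_inv K R (dif R x)"
 using assms
proof (induction x rule: homogeneous_induct)
 case (homogeneous n x)
 then show ?case using Gr_in[of x n] dif_degree[of x n]
  by (simp add: sgn_inv_Gr_eq[of _ "n+1"] sgn_inv_Gr_eq[of x n] module_hom_smult[OF dif_linear] R.ksign_in
   smult_l_minus[symmetric] dif_in)(simp add: ksign_def)
next
 case (add x y)
 then show ?case by (simp add: module_hom_add[OF sgn_inv_hom] module_hom_add[OF dif_linear] sgn_inv_in dif_in minus_add)
qed

text \<open>The Leibniz rule for the product of two units gives the sum of two copies of the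
  differential of the unit.\<close>

lemma dif_one: "dif R \<one>\<^sub>R = \<zero>\<^sub>R"
proof -
 have "dif R \<one>\<^sub>R = dif R \<one>\<^sub>R \<oplus>\<^sub>R dif R \<one>\<^sub>R"
  using dif_mult_sgn[of "\<one>\<^sub>R" "\<one>\<^sub>R"] by (simp add: sgn_inv_one dif_in)
 then show ?thesis using dif_in[OF one_closed] by (metis add.l_cancel_one' )
qed

end

subsection \<open>Algebras\<close>

lemma (in abelian_monoid) a_interchange:
 "[|a :. G; b :. G; c :. G; d :. G|] ==> (a \<oplus> b) \<oplus> (c \<oplus> d) = (a \<oplus> c) \<oplus> (b \<oplus> d)"
 by (simp add: a_ac)

lemma assoc_algebraI:
 assumes "field K" "abelian_group A" "monoid A"
  and "!!x y z. [|x :. A; y :. A; z :. A|] ==> (x \<oplus>\<^sub>A y) \<otimes>\<^sub>A z = x \<otimes>\<^sub>A z \<oplus>\<^sub>A y \<otimes>\<^sub>A z"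
  and "!!x y z. [|x :. A; y :. A; z :. A|] ==> z \<otimes>\<^sub>A (x \<oplus>\<^sub>A y) = z \<otimes>\<^sub>A x \<oplus>\<^sub>A z \<otimes>\<^sub>A y"
  and "!!c x. [|c :. K; x :. A|] ==> c \<odot>\<^sub>A x :. A"
  and "!!a b x. [|a :. K; b :. K; x :. A|] ==> (a \<oplus>\<^sub>K b) \<odot>\<^sub>A x = a \<odot>\<^sub>A x \<oplus>\<^sub>A b \<odot>\<^sub>A x"
  and "!!a x y. [|a :. K; x :. A; y :. A|] ==> a \<odot>\<^sub>A (x \<oplus>\<^sub>A y) = a \<odot>\<^sub>A x \<oplus>\<^sub>A a \<odot>\<^sub>A y"
  and "!!a b x. [|a :. K; b :. K; x :. A|] ==> (a \<otimes>\<^sub>K b) \<odot>\<^sub>A x = a \<odot>\<^sub>A (b \<odot>\<^sub>A x)"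
  and "!!x. x :. A ==> \<one>\<^sub>K \<odot>\<^sub>A x = x"
  and "!!c x y. [|c :. K; x :. A; y :. A|] ==> (c \<odot>\<^sub>A x) \<otimes>\<^sub>A y = c \<odot>\<^sub>A (x \<otimes>\<^sub>A y)"
  and "!!c x y. [|c :. K; x :. A; y :. A|] ==> x \<otimes>\<^sub>A (c \<odot>\<^sub>A y) = c \<odot>\<^sub>A (x \<otimes>\<^sub>A y)"
 shows "assoc_algebra K A"
proof -
 interpret K: field K by fact
 have "module K A" by (rule moduleI) (use assms K.is_cring in auto)
 then have "vectorspace K A" using assms(1) by (simp add: vectorspace_def)
 moreover have "ring A" by (rule ringI) (use assms in auto)
 ultimately show ?thesis using assms(11,12) by (simp add: assoc_algebra_def assoc_algebra_axioms_def)
qed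

lemma fun_space_simps:
 "carrier (fun_space X N C) = C" "\<zero>\<^bsub>fun_space X N C\<^esub> = (\<lambda>x \<in> X. \<zero>\<^sub>N)"
 "f \<oplus>\<^bsub>fun_space X N C\<^esub> g = (\<lambda>x \<in> X. f x \<oplus>\<^sub>N g x)"
 "c \<odot>\<^bsub>fun_space X N C\<^esub> f = (\<lambda>x \<in> X. c \<odot>\<^sub>N f x)"
 by (simp_all add: fun_space_def)

lemma fun_space_module:
 assumes "module K N" and C: "C <= X \<rightarrow>\<^sub>E carrier N"
  and zero: "(\<lambda>x \<in> X. \<zero>\<^sub>N) \<in> C"
  and add: "!!f g. [|f \<in> C; g \<in> C|] ==> (\<lambda>x \<in> X. f x \<oplus>\<^sub>N g x) \<in> C"
  and smult: "!!c f. [|c :. K; f \<in> C|] ==> (\<lambda>x \<in> X. c \<odot>\<^sub>N f x) \<in> C"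
 shows "module K (fun_space X N C)"
proof -
 interpret N: module K N by fact
 have v: "f x :. N" if "f \<in> C" "x \<in> X" for f x using that C by auto
 have e: "f = g" if "f \<in> C" "g \<in> C" "!!x. x \<in> X ==> f x = g x" for f g
  using that C by (metis PiE_ext subsetD)
 note s = fun_space_simps
 have ab: "abelian_group (fun_space X N C)"
 proof (rule abelian_groupI)
  fix f assume f: "f :. (fun_space X N C)"
  then have fC: "f \<in> C" by (simp add: s)
  have "(\<lambda>x \<in> X. (\<ominus>\<^sub>K \<one>\<^sub>K) \<odot>\<^sub>N f x) \<in> C" by (rule smult[OF _ fC]) simp
  moreover have "(\<lambda>x \<in> X. (\<ominus>\<^sub>K \<one>\<^sub>K) \<odot>\<^sub>N f x) \<oplus>\<^bsub>fun_space X N C\<^esub> f = \<zero>\<^bsub>fun_space X N C\<^esub>"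
   unfolding s using v[OF fC] by (intro restrict_ext) (simp add: N.smult_l_minus N.M.l_neg)
  ultimately show "\<exists>y\<in>carrier (fun_space X N C). y \<oplus>\<^bsub>fun_space X N C\<^esub> f = \<zero>\<^bsub>fun_space X N C\<^esub>"
   unfolding s(1) by blast
  show "\<zero>\<^bsub>fun_space X N C\<^esub> \<oplus>\<^bsub>fun_space X N C\<^esub> f = f"
   unfolding s using v[OF fC] by (intro e add zero fC) simp
 next
  fix f g h assume a: "f :. (fun_space X N C)" "g :. (fun_space X N C)" "h :. (fun_space X N C)"
  show "f \<oplus>\<^bsub>fun_space X N C\<^esub> g \<oplus>\<^bsub>fun_space X N C\<^esub> h = f \<oplus>\<^bsub>fun_space X N C\<^esub> (g \<oplus>\<^bsub>fun_space X N C\<^esub> h)"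
   using a unfolding s by (intro restrict_ext) (simp add: v N.M.a_assoc)
 next
  fix f g assume a: "f :. (fun_space X N C)" "g :. (fun_space X N C)"
  show "f \<oplus>\<^bsub>fun_space X N C\<^esub> g = g \<oplus>\<^bsub>fun_space X N C\<^esub> f"
   using a unfolding s by (intro restrict_ext) (simp add: v N.M.a_comm)
  show "f \<oplus>\<^bsub>fun_space X N C\<^esub> g :. (fun_space X N C)"
   using a add by (simp add: s)
 qed (simp add: s zero)
 show ?thesis
 proof (rule moduleI[OF N.is_cring ab])
  fix f assume "f :. (fun_space X N C)"
  then have fC: "f \<in> C" by (simp add: s)
  show "\<one>\<^sub>K \<odot>\<^bsub>fun_space X N C\<^esub> f = f"
   unfolding s using v[OF fC] by (intro e smult fC) simp_all
 qed (auto simp: s smult v N.smult_l_distr N.smult_r_distr N.smult_assoc1 intro!: restrict_ext)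
qed

lemma fun_space_vectorspace:
 assumes "vectorspace K N" "C <= X \<rightarrow>\<^sub>E carrier N" "(\<lambda>x \<in> X. \<zero>\<^sub>N) \<in> C"
  "!!f g. [|f \<in> C; g \<in> C|] ==> (\<lambda>x \<in> X. f x \<oplus>\<^sub>N g x) \<in> C"
  "!!c f. [|c :. K; f \<in> C|] ==> (\<lambda>x \<in> X. c \<odot>\<^sub>N f x) \<in> C"
 shows "vectorspace K (fun_space X N C)"
 using assms fun_space_module[of K N C X] by (simp add: vectorspace_def)

lemma End_alg_simps:
 "carrier (End_alg K V) = module_hom K V V \<inter> extensional (carrier V)"
 "mult (End_alg K V) = compose (carrier V)" "\<one>\<^bsub>End_alg K V\<^esub> = (\<lambda>x \<in> carrier V. x)"
 "\<zero>\<^bsub>End_alg K V\<^esub> = (\<lambda>x \<in> carrier V. \<zero>\<^sub>V)"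
 "f \<oplus>\<^bsub>End_alg K V\<^esub> g = (\<lambda>x \<in> carrier V. f x \<oplus>\<^sub>V g x)"
 "c \<odot>\<^bsub>End_alg K V\<^esub> f = (\<lambda>x \<in> carrier V. c \<odot>\<^sub>V f x)"
 by (simp_all add: End_alg_def)

lemma End_alg_assoc_algebra:
 assumes "vectorspace K V" shows "assoc_algebra K (End_alg K V)"
proof -
 interpret V: vectorspace K V by fact
 define C where "C = module_hom K V V \<inter> extensional (carrier V)"
 have v: "f x :. V" if "f \<in> C" "x :. V" for f x
  using that by (auto simp: C_def module_hom_in)
 have ha: "f (x \<oplus>\<^sub>V y) = f x \<oplus>\<^sub>V f y" if "f \<in> C" "x :. V" "y :. V" for f x y
  using that by (auto simp: C_def module_hom_add)
 have hs: "f (c \<odot>\<^sub>V x) = c \<odot>\<^sub>V f x" if "f \<in> C" "x :. V" "c :. K" for f x c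
  using that by (auto simp: C_def module_hom_smult)
 have e: "f = g" if "f \<in> C" "g \<in> C" "!!x. x :. V ==> f x = g x" for f g
  using that by (auto simp: C_def intro: extensionalityI)
 have add: "(\<lambda>x \<in> carrier V. f x \<oplus>\<^sub>V g x) \<in> C" if "f \<in> C" "g \<in> C" for f g
  unfolding C_def using v[OF that(1)] v[OF that(2)]
  by (intro IntI module_homI)
   (simp_all add: ha[OF that(1)] ha[OF that(2)] hs[OF that(1)] hs[OF that(2)] V.M.a_interchange V.smult_r_distr)
 have smult: "(\<lambda>x \<in> carrier V. c \<odot>\<^sub>V f x) \<in> C" if "f \<in> C" "c :. K" for f c
  unfolding C_def using v[OF that(1)] that(2)
  by (intro IntI module_homI)
   (simp_all add: ha[OF that(1)] hs[OF that(1)] V.smult_r_distr V.smult_assoc1[symmetric] V.R.m_comm)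
 have zero: "(\<lambda>x \<in> carrier V. \<zero>\<^sub>V) \<in> C"
  unfolding C_def by (auto intro!: module_homI)
 have one: "(\<lambda>x \<in> carrier V. x) \<in> C"
  unfolding C_def by (auto intro!: module_homI)
 have mult: "compose (carrier V) f g \<in> C" if "f \<in> C" "g \<in> C" for f g
  unfolding C_def compose_def using v[OF that(1)] v[OF that(2)]
  by (intro IntI module_homI)
   (simp_all add: ha[OF that(1)] ha[OF that(2)] hs[OF that(1)] hs[OF that(2)])
 interpret F: module K "fun_space (carrier V) V C"
  by (rule fun_space_module) (use V.module_axioms zero add smult v in "auto simp: C_def module_hom_in extensional_def")
 \<comment> \<open>Addition is pointwise, so the additive monoid is literally that of a function
   space and inherits its group laws.\<close>
 have ab: "abelian_group (End_alg K V)"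
 proof -
  have "add_monoid (fun_space (carrier V) V C) = add_monoid (End_alg K V)"
   by (simp add: fun_space_def End_alg_def C_def)
  then show ?thesis using F.M.abelian_group_axioms
   by (simp add: abelian_group_def abelian_group_axioms_def abelian_monoid_def)
 qed
 have mon: "monoid (End_alg K V)"
 proof (rule monoidI, unfold End_alg_simps C_def[symmetric])
  show "compose (carrier V) (compose (carrier V) f g) h = compose (carrier V) f (compose (carrier V) g h)"
   if "f \<in> C" "g \<in> C" "h \<in> C" for f g h
   by (rule e) (use that in "simp_all add: mult v compose_eq")
  show "compose (carrier V) (\<lambda>x \<in> carrier V. x) f = f" if "f \<in> C" for f
   by (rule e) (use that in "simp_all add: mult one v compose_eq")
  show "compose (carrier V) f (\<lambda>x \<in> carrier V. x) = f" if "f \<in> C" for f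
   by (rule e) (use that in "simp_all add: mult one v compose_eq")
 qed (simp_all add: one mult)
 show ?thesis
  by (rule assoc_algebraI[OF V.field_axioms ab mon])
   (simp_all add: End_alg_simps C_def[symmetric] smult, auto simp: compose_def v ha hs
    V.smult_l_distr V.smult_r_distr V.smult_assoc1 smult intro!: restrict_ext e)
qed

lemma base_alg_simps:
 "carrier (base_alg K) = carrier K" "mult (base_alg K) = mult K" "\<one>\<^bsub>base_alg K\<^esub> = \<one>\<^sub>K"
 "\<zero>\<^bsub>base_alg K\<^esub> = \<zero>\<^sub>K" "add (base_alg K) = add K" "smult (base_alg K) = mult K"
 by (simp_all add: base_alg_def)

lemma base_alg_assoc_algebra:
 assumes "field K" shows "assoc_algebra K (base_alg K)"
proof -
 interpret K: field K by fact
 have ab: "abelian_group (base_alg K)"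
  by (rule abelian_groupI) (auto simp: base_alg_simps K.a_ac intro: K.l_neg)
 have mon: "monoid (base_alg K)"
  by (rule monoidI) (auto simp: base_alg_simps K.m_assoc)
 show ?thesis
  by (rule assoc_algebraI[OF assms ab mon]) (auto simp: base_alg_simps K.l_distr K.r_distr K.m_ac)
qed

lemma deg0_simps:
 "carrier (deg0 A) = carrier A" "mult (deg0 A) = mult A" "\<one>\<^bsub>deg0 A\<^esub> = \<one>\<^sub>A"
 "\<zero>\<^bsub>deg0 A\<^esub> = \<zero>\<^sub>A" "add (deg0 A) = add A" "smult (deg0 A) = smult A"
 "Gr (deg0 A) n = (if n = 0 then carrier A else {\<zero>\<^sub>A})" "dif (deg0 A) x = \<zero>\<^sub>A"
 by (simp_all add: deg0_def module.extend_def dg_alg.fields_def)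

lemma assoc_algebra_cong:
 assumes "assoc_algebra K A" "carrier B = carrier A" "mult B = mult A" "\<one>\<^sub>B = \<one>\<^sub>A"
  "\<zero>\<^sub>B = \<zero>\<^sub>A" "add B = add A" "smult B = smult A"
 shows "assoc_algebra K B"
proof -
 interpret A: assoc_algebra K A by fact
 have ab: "abelian_group B"
  by (rule abelian_groupI) (auto simp: assms A.a_ac intro: A.l_neg)
 have mon: "monoid B"
  by (rule monoidI) (auto simp: assms A.m_assoc)
 show ?thesis
  by (rule assoc_algebraI[OF A.field_axioms ab mon])
   (auto simp: assms A.l_distr A.r_distr A.smult_l_distr A.smult_r_distr A.smult_assoc1
    A.smult_mult_left A.smult_mult_right)
qed

lemma deg0_assoc_algebra: "assoc_algebra K A ==> assoc_algebra K (deg0 A)"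
 by (rule assoc_algebra_cong) (simp_all add: deg0_simps)

lemma deg0_dg_algebra:
 assumes "assoc_algebra K A" shows "dg_algebra K (deg0 A)"
proof -
 interpret A: assoc_algebra K A by fact
 interpret D: assoc_algebra K "deg0 A" by (rule deg0_assoc_algebra[OF assms])
 have sub: "subspace K (Gr (deg0 A) n) (deg0 A)" for n
  unfolding subspace_def submodule_def using D.vectorspace_axioms D.module_axioms
  by (auto simp: deg0_simps)
 \<comment> \<open>Components in nonzero degrees lie in the zero space, so the only decomposition
   puts the whole element in degree 0.\<close>
 have dec: "hdecomp (deg0 A) x c \<longleftrightarrow> x :. A & c = (%n. if n = 0 then x else \<zero>\<^sub>A)" for x c
 proof
  assume h: "hdecomp (deg0 A) x c"
  then have c: "c n = \<zero>\<^sub>A" if "n ~= 0" for n using that by (auto simp: hdecomp_def deg0_simps split: if_splits)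
  have c0: "c 0 :. A" using h by (auto simp: hdecomp_def deg0_simps split: if_splits)
  have "x = (\<Oplus>\<^bsub>deg0 A\<^esub>n \<in> {n. c n ~= \<zero>\<^sub>A}. c n)" using h by (simp add: hdecomp_def deg0_simps)
  also have "\<dots> = (\<Oplus>\<^bsub>deg0 A\<^esub>n \<in> {0}. c n)"
   by (rule D.add.finprod_mono_neutral_cong_left) (use c c0 in "auto simp: deg0_simps")
  also have "\<dots> = c 0" using c0 by (simp add: deg0_simps)
  finally show "x :. A & c = (%n. if n = 0 then x else \<zero>\<^sub>A)" using c c0 by auto
 next
  assume h: "x :. A & c = (%n. if n = 0 then x else \<zero>\<^sub>A)"
  have "(\<Oplus>\<^bsub>deg0 A\<^esub>n \<in> {n. c n ~= \<zero>\<^sub>A}. c n) = (\<Oplus>\<^bsub>deg0 A\<^esub>n \<in> {0}. c n)"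
   by (rule D.add.finprod_mono_neutral_cong_left) (use h in "auto simp: deg0_simps")
  moreover have "finite {n. c n ~= \<zero>\<^sub>A}" by (rule finite_subset[of _ "{0}"]) (use h in auto)
  ultimately show "hdecomp (deg0 A) x c" using h by (simp add: hdecomp_def deg0_simps)
 qed
 show ?thesis
 proof (intro dg_algebra.intro D.assoc_algebra_axioms dg_algebra_axioms.intro sub)
  fix x assume "x :. (deg0 A)"
  then show "\<exists>!c. hdecomp (deg0 A) x c" by (auto simp: dec deg0_simps)
 next
  show "dif (deg0 A) \<in> module_hom K (deg0 A) (deg0 A)"
   by (rule module_homI) (auto simp: deg0_simps)
 qed (auto simp: deg0_simps A.R.ksign_in split: if_splits)
qed

subsection \<open>Free algebras\<close>

lemma free_alg_simps:
 "\<one>\<^bsub>free_alg K X\<^esub> = (%w. if w = [] then \<one>\<^sub>K else \<zero>\<^sub>K)" "\<zero>\<^bsub>free_alg K X\<^esub> = (%w. \<zero>\<^sub>K)"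
 "f \<oplus>\<^bsub>free_alg K X\<^esub> g = (%w. f w \<oplus>\<^sub>K g w)" "c \<odot>\<^bsub>free_alg K X\<^esub> f = (%w. c \<otimes>\<^sub>K f w)"
 by (simp_all add: free_alg_def)

locale free_algebra = field K for K :: "('k, 'c) ring_scheme" +
 fixes X :: "'x set"
begin

abbreviation F where "F \<equiv> free_alg K X"

lemma F_carrier: "f :. F \<longleftrightarrow> (\<forall>w. f w :. K) & finite {w. f w ~= \<zero>\<^sub>K} & {w. f w ~= \<zero>\<^sub>K} <= lists X"
 by (auto simp: free_alg_def)

text \<open>Convolution of arbitrary scalar functions on words, so that inductions can pass to
  \<open>%u. f (x # u)\<close> without checking supports.\<close>

definition conv :: "('x list => 'k) => ('x list => 'k) => 'x list => 'k" where
 "conv f g w = (\<Oplus>\<^sub>K i \<in> {..length w}. f (take i w) \<otimes>\<^sub>K g (drop i w))"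

lemma F_mult: "f \<otimes>\<^sub>F g = conv f g"
 by (simp add: free_alg_def conv_def fun_eq_iff)

abbreviation (input) scal where "scal f \<equiv> \<forall>w. f w :. K"

lemma conv_Nil: "scal f ==> scal g ==> conv f g [] = f [] \<otimes>\<^sub>K g []"
 by (simp add: conv_def)

text \<open>The cut before the first letter is split off; all other cuts convolve the left
  derivative \<open>%u. f (x # u)\<close> with \<open>g\<close>. This turns associativity and the
  unit laws into inductions on the word.\<close>

lemma conv_Cons:
 assumes "scal f" "scal g"
 shows "conv f g (x # w) = f [] \<otimes>\<^sub>K g (x # w) \<oplus>\<^sub>K conv (%u. f (x # u)) g w"
 unfolding conv_def length_Cons using assms
 by (subst finsum_Suc2) (auto intro!: a_comm)

lemma conv_in: "scal f ==> scal g ==> conv f g w :. K"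
 unfolding conv_def by (intro finsum_closed) auto

lemma conv_add1: "scal f ==> scal f' ==> scal g ==>
 conv (%u. f u \<oplus>\<^sub>K f' u) g w = conv f g w \<oplus>\<^sub>K conv f' g w"
 by (simp add: conv_def l_distr Pi_def)

lemma conv_add2: "scal f ==> scal g' ==> scal g ==>
 conv f (%u. g u \<oplus>\<^sub>K g' u) w = conv f g w \<oplus>\<^sub>K conv f g' w"
 by (simp add: conv_def r_distr Pi_def)

lemma conv_smult1: "scal f ==> scal g ==> c :. K ==>
 conv (%u. c \<otimes>\<^sub>K f u) g w = c \<otimes>\<^sub>K conv f g w"
 by (simp add: conv_def m_assoc finsum_rdistr Pi_def)

lemma conv_smult2: "scal f ==> scal g ==> c :. K ==>
 conv f (%u. c \<otimes>\<^sub>K g u) w = c \<otimes>\<^sub>K conv f g w"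
 by (simp add: conv_def m_lcomm finsum_rdistr Pi_def)

lemma conv_zero: "scal g ==> conv (%u. \<zero>\<^sub>K) g w = \<zero>\<^sub>K"
 by (simp add: conv_def)

lemma conv_assoc:
 assumes "scal f" "scal g" "scal h"
 shows "conv (conv f g) h w = conv f (conv g h) w"
 using assms
proof (induction w arbitrary: f g)
 case Nil then show ?case by (simp add: conv_Nil conv_in m_assoc)
next
 case (Cons x w)
 have "conv (conv f g) h (x # w) = conv f g [] \<otimes>\<^sub>K h (x # w) \<oplus>\<^sub>K conv (%u. conv f g (x # u)) h w"
  using Cons by (intro conv_Cons) (auto simp: conv_in)
 also have "(%u. conv f g (x # u)) = (%u. f [] \<otimes>\<^sub>K g (x # u) \<oplus>\<^sub>K conv (%u. f (x # u)) g u)"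
  using Cons by (simp add: conv_Cons)
 also have "conv \<dots> h w = f [] \<otimes>\<^sub>K conv (%u. g (x # u)) h w \<oplus>\<^sub>K conv (conv (%u. f (x # u)) g) h w"
  using Cons by (simp add: conv_add1 conv_smult1 conv_in)
 also have "conv (conv (%u. f (x # u)) g) h w = conv (%u. f (x # u)) (conv g h) w"
  using Cons by (intro Cons.IH) auto
 also have "conv f g [] \<otimes>\<^sub>K h (x # w) \<oplus>\<^sub>K (f [] \<otimes>\<^sub>K conv (%u. g (x # u)) h w \<oplus>\<^sub>K conv (%u. f (x # u)) (conv g h) w)
  = f [] \<otimes>\<^sub>K conv g h (x # w) \<oplus>\<^sub>K conv (%u. f (x # u)) (conv g h) w"
  using Cons by (simp add: conv_Nil conv_Cons[of g h] conv_in m_assoc a_assoc r_distr)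
 also have "\<dots> = conv f (conv g h) (x # w)"
  using Cons by (subst conv_Cons) (auto simp: conv_in)
 finally show ?case .
qed

lemma conv_one1: "scal g ==> conv (%w. if w = [] then \<one>\<^sub>K else \<zero>\<^sub>K) g w = g w"
 by (cases w) (simp_all add: conv_Nil conv_Cons conv_zero)

lemma conv_one2: "scal f ==> conv f (%w. if w = [] then \<one>\<^sub>K else \<zero>\<^sub>K) w = f w"
 by (induction w arbitrary: f) (simp_all add: conv_Nil conv_Cons)

lemma conv_nonzero: "scal f ==> scal g ==> conv f g w ~= \<zero>\<^sub>K ==> \<exists>u v. w = u @ v & f u ~= \<zero>\<^sub>K & g v ~= \<zero>\<^sub>K"
proof (rule ccontr)
 assume a: "scal f" "scal g" "conv f g w ~= \<zero>\<^sub>K" "\<not> (\<exists>u v. w = u @ v & f u ~= \<zero>\<^sub>K & g v ~= \<zero>\<^sub>K)"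
 have "f (take i w) \<otimes>\<^sub>K g (drop i w) = \<zero>\<^sub>K" for i
  using a(1,2,4) append_take_drop_id[of i w] by (metis l_null r_null)
 then show False using a(3) by (simp add: conv_def)
qed

lemma conv_F:
 assumes "f :. F" "g :. F" shows "conv f g :. F"
proof -
 let ?s = "%f. {w. f w ~= \<zero>\<^sub>K}"
 have s: "scal f" "scal g" using assms by (auto simp: F_carrier)
 have sub: "?s (conv f g) <= (%(u, v). u @ v) ` (?s f \<times> ?s g)"
  using conv_nonzero[OF s] by fastforce
 have "finite (?s (conv f g))" by (rule finite_subset[OF sub]) (use assms in "auto simp: F_carrier")
 moreover have "?s (conv f g) <= lists X" using sub assms by (fastforce simp: F_carrier)
 ultimately show ?thesis using s conv_in by (simp add: F_carrier)
qed

lemma F_abelian: "abelian_group F"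
proof (rule abelian_groupI)
 fix f g assume a: "f :. F" "g :. F"
 have sub: "{w. f w \<oplus>\<^sub>K g w ~= \<zero>\<^sub>K} <= {w. f w ~= \<zero>\<^sub>K} \<union> {w. g w ~= \<zero>\<^sub>K}"
  by auto
 moreover have "finite {w. f w \<oplus>\<^sub>K g w ~= \<zero>\<^sub>K}"
  by (rule finite_subset[OF sub]) (use a in "auto simp: F_carrier")
 ultimately show "f \<oplus>\<^sub>F g :. F" using a unfolding F_carrier free_alg_simps by blast
next
 fix f assume a: "f :. F"
 have "(%w. \<ominus>\<^sub>K f w) :. F"
 proof -
  have "{w. \<ominus>\<^sub>K f w ~= \<zero>\<^sub>K} <= {w. f w ~= \<zero>\<^sub>K}" by auto
  then show ?thesis using a unfolding F_carrier by (auto intro: finite_subset)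
 qed
 moreover have "(%w. \<ominus>\<^sub>K f w) \<oplus>\<^sub>F f = \<zero>\<^sub>F"
  using a by (simp add: free_alg_simps F_carrier l_neg)
 ultimately show "\<exists>g\<in>carrier F. g \<oplus>\<^sub>F f = \<zero>\<^sub>F" by blast
qed (auto simp: free_alg_simps F_carrier a_ac)

lemma F_assoc_algebra: "assoc_algebra K F"
proof -
 have mon: "monoid F"
 proof (rule monoidI)
  show "\<one>\<^sub>F :. F" by (auto simp: F_carrier free_alg_simps)
  show "f \<otimes>\<^sub>F g :. F" if "f :. F" "g :. F" for f g
   using conv_F[OF that] by (simp add: F_mult)
 qed (simp_all add: F_mult free_alg_simps conv_one1 conv_one2 F_carrier conv_assoc fun_eq_iff)
 have sm: "c \<odot>\<^sub>F f :. F" if "c :. K" "f :. F" for c f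
 proof -
  have "{w. c \<otimes>\<^sub>K f w ~= \<zero>\<^sub>K} <= {w. f w ~= \<zero>\<^sub>K}" using that by auto
  then show ?thesis using that unfolding F_carrier free_alg_simps by (auto intro: finite_subset)
 qed
 show ?thesis
  by (rule assoc_algebraI[OF field_axioms F_abelian mon _ _ sm])
   (auto simp: F_mult free_alg_simps F_carrier conv_add1 conv_add2 conv_smult1 conv_smult2 fun_eq_iff
    m_assoc l_distr r_distr)
qed

sublocale F: assoc_algebra K F by (rule F_assoc_algebra)

lemma word_in: "w \<in> lists X ==> word K w :. F"
 by (auto simp: F_carrier word_def)

lemma word_Nil: "word K [] = \<one>\<^sub>F"
 by (auto simp: word_def free_alg_simps)

lemma word_mult: "word K u \<otimes>\<^sub>F word K v = word K (u @ v)"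
proof -
 have "conv (word K u) (word K v) w = word K (u @ v) w" for w
 proof (induction w arbitrary: u)
  case Nil then show ?case by (simp add: conv_Nil word_def)
 next
  case (Cons x w)
  have s: "scal (word K u)" for u by (simp add: word_def)
  have "(%t. word K u (x # t)) = (case u of [] => (%t. \<zero>\<^sub>K) | y # u' => if x = y then word K u' else (%t. \<zero>\<^sub>K))"
   by (auto simp: word_def split: list.split)
  then show ?case using s Cons
   by (subst conv_Cons) (auto simp: conv_zero conv_in split: list.split, auto simp: word_def)
 qed
 then show ?thesis by (simp add: F_mult fun_eq_iff)
qed

text \<open>Induction on the finite support, erasing one coefficient at a time. The set
  \<open>T\<close> remembers which words may occur; with the words of a fixed degree it yields
  induction on homogeneous elements.\<close>

lemma free_induct_on [consumes 2, case_names zero word add]: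
 assumes f: "f :. F" and T: "{w. f w ~= \<zero>\<^sub>K} <= T" and zero: "P \<zero>\<^sub>F"
  and word: "!!c w. [|c :. K; w \<in> lists X; w \<in> T|] ==> P (c \<odot>\<^sub>F word K w)"
  and add: "!!f g. [|f :. F; g :. F; P f; P g|] ==> P (f \<oplus>\<^sub>F g)"
 shows "P f"
proof -
 have "\<forall>f \<in> carrier F. {w. f w ~= \<zero>\<^sub>K} <= S --> P f" if "finite S" "S <= T" for S
  using that
 proof induction
  case empty
  have "f = \<zero>\<^sub>F" if "{w. f w ~= \<zero>\<^sub>K} <= {}" for f using that by (auto simp: free_alg_simps)
  then show ?case using zero by auto
 next
  case (insert w S)
  show ?case
  proof (intro ballI impI)
   fix f assume f: "f :. F" "{w. f w ~= \<zero>\<^sub>K} <= insert w S"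
   show "P f"
   proof (cases "f w = \<zero>\<^sub>K")
    case True
    then have "{w. f w ~= \<zero>\<^sub>K} <= S" using f by auto
    then show ?thesis using insert f by simp
   next
    case False
    then have w: "w \<in> lists X" using f by (auto simp: F_carrier)
    define g where "g = f(w := \<zero>\<^sub>K)"
    have sub: "{w. g w ~= \<zero>\<^sub>K} <= {w. f w ~= \<zero>\<^sub>K}" by (auto simp: g_def)
    then have g: "g :. F" using f unfolding F_carrier by (auto intro: finite_subset simp: g_def)
    moreover have "{w. g w ~= \<zero>\<^sub>K} <= S" using f by (auto simp: g_def)
    ultimately have Pg: "P g" using insert by simp
    have wT: "w \<in> T" using insert by simp
    have fw: "f w :. K" using f by (auto simp: F_carrier)
    have "f = f w \<odot>\<^sub>F word K w \<oplus>\<^sub>F g"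
     using f by (auto simp: free_alg_simps g_def word_def F_carrier)
    then show ?thesis using add[OF _ g word[OF fw w wT] Pg] F.smult_closed[OF fw word_in[OF w]] by metis
   qed
  qed
 qed
 then show ?thesis using f T by (auto simp: F_carrier)
qed

lemma free_induct [consumes 1, case_names zero word add]:
 assumes "f :. F" "P \<zero>\<^sub>F"
  and "!!c w. [|c :. K; w \<in> lists X|] ==> P (c \<odot>\<^sub>F word K w)"
  and "!!f g. [|f :. F; g :. F; P f; P g|] ==> P (f \<oplus>\<^sub>F g)"
 shows "P f"
 using assms(1) subset_UNIV by (rule free_induct_on) (use assms in auto)

lemma lin_ext_superset:
 assumes "module K M" "!!w. w \<in> lists X ==> G w :. M" "f :. F"
  "finite S" "{w. f w ~= \<zero>\<^sub>K} <= S" "S <= lists X"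
 shows "lin_ext K M G f = (\<Oplus>\<^sub>M w \<in> S. f w \<odot>\<^sub>M G w)"
proof -
 interpret M: module K M by fact
 show ?thesis unfolding lin_ext_def
  by (rule M.add.finprod_mono_neutral_cong_left) (use assms in "auto simp: F_carrier subset_iff")
qed

lemma lin_ext_hom:
 assumes "module K M" and G: "!!w. w \<in> lists X ==> G w :. M"
 shows "lin_ext K M G \<in> module_hom K F M"
proof -
 interpret M: module K M by fact
 have sup: "lin_ext K M G f = (\<Oplus>\<^sub>M w \<in> S. f w \<odot>\<^sub>M G w)"
  if "f :. F" "finite S" "{w. f w ~= \<zero>\<^sub>K} <= S" "S <= lists X" for f S
  by (rule lin_ext_superset[OF assms(1) _ that]) (rule assms(2))
 show ?thesis
 proof (rule module_homI)
 fix f assume f: "f :. F"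
 then have s: "{w. f w ~= \<zero>\<^sub>K} <= lists X" "finite {w. f w ~= \<zero>\<^sub>K}" "scal f" by (auto simp: F_carrier)
 show "lin_ext K M G f :. M"
  unfolding lin_ext_def using s(1,3) G by (intro M.finsum_closed) (auto simp: subset_iff)
 fix g assume g: "g :. F"
 then have s': "{w. g w ~= \<zero>\<^sub>K} <= lists X" "finite {w. g w ~= \<zero>\<^sub>K}" "scal g" by (auto simp: F_carrier)
 let ?S = "{w. f w ~= \<zero>\<^sub>K} \<union> {w. g w ~= \<zero>\<^sub>K}"
 have S: "finite ?S" "?S <= lists X" using s s' by auto
 have fg: "f \<oplus>\<^sub>F g :. F" using f g by simp
 have sub: "{w. (f \<oplus>\<^sub>F g) w ~= \<zero>\<^sub>K} <= ?S" using s s' by (auto simp: free_alg_simps)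
 have GS: "G w :. M" if "w \<in> ?S" for w using subsetD[OF S(2) that] G by simp
 have "lin_ext K M G (f \<oplus>\<^sub>F g) = (\<Oplus>\<^sub>M w\<in>?S. (f \<oplus>\<^sub>F g) w \<odot>\<^sub>M G w)"
  by (rule sup[OF fg S(1) sub S(2)])
 also have "\<dots> = (\<Oplus>\<^sub>M w\<in>?S. f w \<odot>\<^sub>M G w \<oplus>\<^sub>M g w \<odot>\<^sub>M G w)"
  by (rule M.finsum_cong') (use s(3) s'(3) GS in "auto simp: free_alg_simps M.smult_l_distr")
 also have "\<dots> = (\<Oplus>\<^sub>M w\<in>?S. f w \<odot>\<^sub>M G w) \<oplus>\<^sub>M (\<Oplus>\<^sub>M w\<in>?S. g w \<odot>\<^sub>M G w)"
  by (rule M.finsum_addf) (use s(3) s'(3) GS in auto)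
 finally show "lin_ext K M G (f \<oplus>\<^sub>F g) = lin_ext K M G f \<oplus>\<^sub>M lin_ext K M G g"
  unfolding sup[OF f S(1) Un_upper1 S(2)] sup[OF g S(1) Un_upper2 S(2)] .
next
 fix c f assume c: "c :. K" and f: "f :. F"
 then have s: "{w. f w ~= \<zero>\<^sub>K} <= lists X" "finite {w. f w ~= \<zero>\<^sub>K}" "scal f" by (auto simp: F_carrier)
 have cf: "c \<odot>\<^sub>F f :. F" using c f by simp
 have sub: "{w. (c \<odot>\<^sub>F f) w ~= \<zero>\<^sub>K} <= {w. f w ~= \<zero>\<^sub>K}" using c by (auto simp: free_alg_simps)
 have GS: "G w :. M" if "f w ~= \<zero>\<^sub>K" for w using subsetD[OF s(1)] that G by simp
 show "lin_ext K M G (c \<odot>\<^sub>F f) = c \<odot>\<^sub>M lin_ext K M G f"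
  unfolding sup[OF cf s(2) sub s(1)] sup[OF f s(2) order_refl s(1)]
  using s GS c by (subst M.finsum_smult_ldistr) (auto simp: free_alg_simps M.smult_assoc1 intro!: M.finsum_cong')
 qed
qed

lemma lin_ext_word:
 assumes "module K M" and G: "!!w. w \<in> lists X ==> G w :. M" and w: "w \<in> lists X"
 shows "lin_ext K M G (word K w) = G w"
proof -
 interpret M: module K M by fact
 have "lin_ext K M G (word K w) = (\<Oplus>\<^sub>M v \<in> {w}. word K w v \<odot>\<^sub>M G v)"
  by (rule lin_ext_superset[OF assms(1) _ word_in[OF w]]) (use G w in "auto simp: word_def")
 then show ?thesis using G[OF w] by (simp add: word_def)
qed

definition extend_hom :: "('k, 'b, 'e) module_scheme => ('x => 'b) => ('x list => 'k) => 'b" where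
 "extend_hom B l = lin_ext K B (%w. foldr (%x. mult B (l x)) w \<one>\<^sub>B)"

lemma extend_hom:
 assumes "assoc_algebra K B" and l: "!!x. x \<in> X ==> l x :. B"
 shows extend_hom_hom: "extend_hom B l \<in> alg_hom K F B"
  and extend_hom_word: "w \<in> lists X ==> extend_hom B l (word K w) = foldr (%x. mult B (l x)) w \<one>\<^sub>B"
  and extend_hom_letter: "x \<in> X ==> extend_hom B l (word K [x]) = l x"
proof -
 interpret B: assoc_algebra K B by fact
 let ?G = "%w. foldr (%x. mult B (l x)) w \<one>\<^sub>B"
 have G: "?G w :. B" if "w \<in> lists X" for w using that by (induction w) (auto simp: l)
 have GG: "?G (u @ v) = ?G u \<otimes>\<^sub>B ?G v" if "u \<in> lists X" "v \<in> lists X" for u v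
  using that(1) G by (induction u) (auto simp: l that(2) B.m_assoc)
 show w: "extend_hom B l (word K w) = ?G w" if "w \<in> lists X" for w
  unfolding extend_hom_def by (rule lin_ext_word[OF B.module_axioms G that])
 show "extend_hom B l (word K [x]) = l x" if "x \<in> X" using w[of "[x]"] that l by simp
 have hom: "extend_hom B l \<in> module_hom K F B"
  unfolding extend_hom_def by (rule lin_ext_hom[OF B.module_axioms G])
 note in_B = module_hom_in[OF hom]
 \<comment> \<open>With a word on the left the product is concatenation of words. Linearity in the
   left factor then gives multiplicativity in general.\<close>
 have mw: "extend_hom B l (word K u \<otimes>\<^sub>F g) = extend_hom B l (word K u) \<otimes>\<^sub>B extend_hom B l g"
  if u: "u \<in> lists X" and g: "g :. F" for u g
  using g
 proof (induction rule: free_induct)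
  case zero then show ?case using module_hom_zero[OF F.module_axioms B.module_axioms hom] word_in[OF u] in_B by simp
 next
  case (word c v)
  have uv: "u @ v \<in> lists X" using u word by simp
  have "extend_hom B l (word K u \<otimes>\<^sub>F (c \<odot>\<^sub>F word K v)) = extend_hom B l (c \<odot>\<^sub>F word K (u @ v))"
   using u word word_in by (simp add: F.smult_mult_right word_mult)
  then show ?case using u word w[OF u] w[OF word(2)] w[OF uv] GG word_in[OF uv] word_in[OF word(2)] G
   by (simp add: module_hom_smult[OF hom] B.smult_mult_right)
 next
  case (add f g) then show ?case using word_in[OF u] in_B
   by (simp add: module_hom_add[OF hom] F.r_distr B.r_distr)
 qed
 have mult: "extend_hom B l (f \<otimes>\<^sub>F g) = extend_hom B l f \<otimes>\<^sub>B extend_hom B l g"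
  if f: "f :. F" and g: "g :. F" for f g
  using f
 proof (induction rule: free_induct)
  case zero then show ?case using module_hom_zero[OF F.module_axioms B.module_axioms hom] g in_B by simp
 next
  case (word c u) then show ?case using mw[OF word(2) g] word_in[OF word(2)] g in_B
   by (simp add: module_hom_smult[OF hom] F.smult_mult_left B.smult_mult_left)
 next
  case (add f f') then show ?case using g in_B
   by (simp add: module_hom_add[OF hom] F.l_distr B.l_distr)
 qed
 have "extend_hom B l \<in> ring_hom F B"
  using in_B mult w[of "[]"] by (auto intro!: ring_hom_memI simp: module_hom_add[OF hom] word_Nil)
 then show "extend_hom B l \<in> alg_hom K F B" using hom by (simp add: alg_hom_def)
qed

end

subsection \<open>Quotient algebras\<close>

lemma alg_homD:
 assumes "f \<in> alg_hom K A B"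
 shows "f \<in> module_hom K A B" and "x :. A ==> f x :. B"
  and "[|x :. A; y :. A|] ==> f (x \<oplus>\<^sub>A y) = f x \<oplus>\<^sub>B f y"
  and "[|x :. A; y :. A|] ==> f (x \<otimes>\<^sub>A y) = f x \<otimes>\<^sub>B f y"
  and "[|c :. K; x :. A|] ==> f (c \<odot>\<^sub>A x) = c \<odot>\<^sub>B f x"
  and "f \<one>\<^sub>A = \<one>\<^sub>B"
 using assms by (auto simp: alg_hom_def ring_hom_add ring_hom_mult ring_hom_one ring_hom_closed module_hom_smult)

lemma alg_homI:
 assumes "!!x. x :. A ==> f x :. B"
  and "!!x y. [|x :. A; y :. A|] ==> f (x \<oplus>\<^sub>A y) = f x \<oplus>\<^sub>B f y"
  and "!!x y. [|x :. A; y :. A|] ==> f (x \<otimes>\<^sub>A y) = f x \<otimes>\<^sub>B f y"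
  and "!!c x. [|c :. K; x :. A|] ==> f (c \<odot>\<^sub>A x) = c \<odot>\<^sub>B f x"
  and "f \<one>\<^sub>A = \<one>\<^sub>B"
 shows "f \<in> alg_hom K A B"
 using assms by (auto simp: alg_hom_def intro!: module_homI ring_hom_memI)

lemma idealI':
 assumes "assoc_algebra K A" "I <= carrier A" "\<zero>\<^sub>A \<in> I"
  and "!!x y. [|x \<in> I; y \<in> I|] ==> x \<oplus>\<^sub>A y \<in> I"
  and "!!a x. [|a :. A; x \<in> I|] ==> a \<otimes>\<^sub>A x \<in> I"
  and "!!a x. [|a :. A; x \<in> I|] ==> x \<otimes>\<^sub>A a \<in> I"
 shows "ideal I A"
proof -
 interpret A: assoc_algebra K A by fact
 have neg: "\<ominus>\<^sub>A x \<in> I" if "x \<in> I" for x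
  using assms(5)[of "\<ominus>\<^sub>A \<one>\<^sub>A" x] assms(2) that by (auto simp: A.l_minus)
 have "subgroup I (add_monoid A)"
  by (rule A.add.subgroupI) (use assms(2-4) neg in "auto simp: a_inv_def")
 then show ?thesis by (intro idealI A.ring_axioms) (use assms in auto)
qed

lemma alg_hom_kernel_ideal:
 assumes "assoc_algebra K A" "assoc_algebra K B" "f \<in> alg_hom K A B"
 shows "ideal {x \<in> carrier A. f x = \<zero>\<^sub>B} A"
proof -
 interpret A: assoc_algebra K A by fact
 interpret B: assoc_algebra K B by fact
 note f = alg_homD[OF assms(3)]
 show ?thesis
  by (rule idealI'[OF assms(1)])
   (auto simp: f module_hom_zero[OF A.module_axioms B.module_axioms f(1)])
qed

lemma dg_quot_simps:
 "carrier (dg_quot A I) = carrier (quot A I)" "\<zero>\<^bsub>dg_quot A I\<^esub> = I" "add (dg_quot A I) = add (quot A I)"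
 "smult (dg_quot A I) = smult (quot A I)" "\<one>\<^bsub>dg_quot A I\<^esub> = I +>\<^sub>A \<one>\<^sub>A"
 "mult (dg_quot A I) = rcoset_mult A I" "Gr (dg_quot A I) n = (%x. I +>\<^sub>A x) ` Gr A n"
 "dif (dg_quot A I) X = (\<Union>x \<in> X. I +>\<^sub>A dif A x)"
 by (simp_all add: dg_quot_def quot_def ring.extend_def module.extend_def dg_alg.fields_def module.fields_def FactRing_def)

text \<open>The record carries a grading and a differential, but only the algebra structure is
  assumed: the presenting algebra \<open>pre_coprod\<close> becomes a DG algebra only after passing
  to the quotient.\<close>

locale alg_quot = assoc_algebra K A for K :: "('k, 'c) ring_scheme" and A :: "('k, 'a, 'd) dg_alg_scheme" +
 fixes I assumes ideal_I: "ideal I A"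
begin

lemma I_ideal: "a :. A ==> x \<in> I ==> a \<otimes>\<^sub>A x \<in> I" "a :. A ==> x \<in> I ==> x \<otimes>\<^sub>A a \<in> I"
 using ideal_I by (simp_all add: ideal.I_l_closed ideal.I_r_closed)

lemma submodule_I: "submodule K I A"
proof -
 interpret I: ideal I A by (rule ideal_I)
 show ?thesis unfolding submodule_def
 proof (intro conjI allI impI module_axioms)
  show "I <= carrier A" by (rule I.a_subset)
  show "\<zero>\<^sub>A \<in> I" by simp
  show "x \<oplus>\<^sub>A y \<in> I" if "x \<in> I" "y \<in> I" for x y using that by simp
  show "c \<odot>\<^sub>A x \<in> I" if "c :. K" "x \<in> I" for c x
  proof -
   have "c \<odot>\<^sub>A x = (c \<odot>\<^sub>A \<one>\<^sub>A) \<otimes>\<^sub>A x"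
    using that I.a_subset by (subst smult_mult_left) auto
   then show ?thesis using that I_ideal(1) by simp
  qed
 qed
qed

sublocale Qs: quot_setup K A I
 by (simp add: quot_setup_def quot_setup_axioms_def module_axioms submodule_I)

abbreviation Q where "Q \<equiv> dg_quot A I"
abbreviation cls where "cls x \<equiv> I +>\<^sub>A x"

lemma Q_carrier: "carrier Q = cls ` carrier A"
 by (simp add: dg_quot_simps Qs.quot_carrier)

lemma cls_in: "x :. A ==> cls x :. Q"
 by (simp add: Q_carrier)

lemma Q_rep: "X :. Q ==> \<exists>x \<in> carrier A. X = cls x"
 by (auto simp: Q_carrier)

lemma cls_add: "x :. A ==> y :. A ==> cls x \<oplus>\<^sub>Q cls y = cls (x \<oplus>\<^sub>A y)"
 using Qs.quot_add by (simp add: dg_quot_simps)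

lemma cls_smult: "c :. K ==> x :. A ==> c \<odot>\<^sub>Q cls x = cls (c \<odot>\<^sub>A x)"
 using Qs.quot_smult by (simp add: dg_quot_simps)

lemma cls_mult: "x :. A ==> y :. A ==> cls x \<otimes>\<^sub>Q cls y = cls (x \<otimes>\<^sub>A y)"
 using ideal.rcoset_mult_add[OF ideal_I] by (simp add: dg_quot_simps)

lemma cls_one: "\<one>\<^sub>Q = cls \<one>\<^sub>A" by (simp add: dg_quot_simps)

lemma cls_zero: "\<zero>\<^sub>Q = cls \<zero>\<^sub>A" by (simp add: dg_quot_simps Qs.coset_zero)

lemma cls_zero_iff: "x :. A ==> cls x = \<zero>\<^sub>Q \<longleftrightarrow> x \<in> I"
 by (simp add: dg_quot_simps Qs.quot_zero_eq)

lemma Q_assoc_algebra: "assoc_algebra K Q"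
proof -
 note s = cls_add cls_smult cls_mult cls_one cls_zero
 have ab: "abelian_group Q"
 proof (rule abelian_groupI)
  fix X assume "X :. Q"
  then obtain x where x: "x :. A" "X = cls x" by (auto simp: Q_carrier)
  show "\<exists>Y\<in>carrier Q. Y \<oplus>\<^sub>Q X = \<zero>\<^sub>Q"
   by (rule bexI[of _ "cls (\<ominus>\<^sub>A x)"]) (use x in "auto simp: s l_neg intro: cls_in")
 qed (auto simp: Q_carrier s a_ac)
 have mon: "monoid Q"
  by (rule monoidI) (auto simp: Q_carrier s m_assoc)
 show ?thesis
  by (rule assoc_algebraI[OF field_axioms ab mon])
   (auto simp: Q_carrier s l_distr r_distr smult_l_distr smult_r_distr smult_assoc1 smult_mult_left smult_mult_right)
qed

lemma cls_hom: "(%x. cls x) \<in> alg_hom K A Q"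
 by (rule alg_homI) (auto simp: cls_in cls_add cls_smult cls_mult cls_one)

text \<open>Defined through a chosen representative; the choice disappears in
  \<open>qlift_cls\<close> as soon as \<open>f\<close> kills \<open>I\<close>.\<close>

definition qlift :: "('a => 'b) => 'a set => 'b" where
 "qlift f X = f (SOME x. x :. A & X = cls x)"

lemma qlift_cls:
 assumes "module K N" "f \<in> module_hom K A N" "!!x. x \<in> I ==> f x = \<zero>\<^sub>N" "x :. A"
 shows "qlift f (cls x) = f x"
proof -
 interpret N: module K N by fact
 define y where "y = (SOME y. y :. A & cls x = cls y)"
 have y: "y :. A & cls x = cls y" unfolding y_def by (rule someI[of _ x]) (use assms in auto)
 then have "x \<ominus>\<^sub>A y \<in> I" using assms(4) Qs.quot_eq[of x y] by blast
 then have "f x \<ominus>\<^sub>N f y = \<zero>\<^sub>N"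
  using module_hom_minus[OF module_axioms assms(1,2,4)] y assms(3) by metis
 then have "f x = f y" using N.M.eq_if_minus_zero module_hom_in[OF assms(2)] y assms(4) by metis
 then show ?thesis by (simp add: qlift_def y_def)
qed

lemma qlift_module_hom:
 assumes "module K N" "f \<in> module_hom K A N" "!!x. x \<in> I ==> f x = \<zero>\<^sub>N"
 shows "qlift f \<in> module_hom K Q N"
 by (rule module_homI)
  (auto simp: Q_carrier cls_add cls_smult qlift_cls[OF assms] module_hom_in[OF assms(2)]
   module_hom_add[OF assms(2)] module_hom_smult[OF assms(2)])

lemma qlift_alg_hom:
 assumes "assoc_algebra K N" "f \<in> alg_hom K A N" "!!x. x \<in> I ==> f x = \<zero>\<^sub>N"
 shows "qlift f \<in> alg_hom K Q N"
proof -
 interpret N: assoc_algebra K N by fact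
 note f = alg_homD[OF assms(2)]
 note q = qlift_cls[OF N.module_axioms f(1) assms(3)]
 show ?thesis
  by (rule alg_homI) (auto simp: Q_carrier cls_add cls_smult cls_mult cls_one q f)
qed

lemma dif_cls:
 assumes "dif A \<in> module_hom K A A" "!!x. x \<in> I ==> dif A x \<in> I" "x :. A"
 shows "dif Q (cls x) = cls (dif A x)"
 using Qs.union_map[OF assms] by (simp add: dg_quot_simps)

lemma dif_Q_hom:
 assumes "dif A \<in> module_hom K A A" "!!x. x \<in> I ==> dif A x \<in> I"
 shows "dif Q \<in> module_hom K Q Q"
 by (rule module_homI)
  (auto simp: Q_carrier cls_add cls_smult dif_cls[OF assms] module_hom_in[OF assms(1)]
   module_hom_add[OF assms(1)] module_hom_smult[OF assms(1)])

lemma Gr_Q_subspace: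
 assumes "submodule K (Gr A n) A"
 shows "subspace K (Gr Q n) Q"
proof -
 interpret Q: assoc_algebra K Q by (rule Q_assoc_algebra)
 have g: "x :. A" if "x \<in> Gr A n" for x using that assms by (auto simp: submodule_def)
 show ?thesis unfolding subspace_def submodule_def
 proof (intro conjI allI impI Q.vectorspace_axioms Q.module_axioms)
  show "Gr Q n <= carrier Q" using g by (auto simp: dg_quot_simps(7) cls_in)
  show "\<zero>\<^sub>Q \<in> Gr Q n" using assms unfolding cls_zero dg_quot_simps(7) by (auto simp: submodule_def)
  fix v w assume "v \<in> Gr Q n" "w \<in> Gr Q n"
  then obtain x y where "x \<in> Gr A n" "y \<in> Gr A n" "v = cls x" "w = cls y" by (auto simp: dg_quot_simps(7))
  then show "v \<oplus>\<^sub>Q w \<in> Gr Q n" using g assms by (auto simp: cls_add dg_quot_simps(7) submodule_def)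
 next
  fix c v assume "c :. K" "v \<in> Gr Q n"
  then obtain x where "x \<in> Gr A n" "v = cls x" "c :. K" by (auto simp: dg_quot_simps(7))
  then show "c \<odot>\<^sub>Q v \<in> Gr Q n" using g assms by (auto simp: cls_smult dg_quot_simps(7) submodule_def)
 qed
qed

end

subsection \<open>Dual numbers\<close>

text \<open>A pair \<open>(a, a')\<close> stands for \<open>a + a' x\<close> with \<open>x\<close>
  central and of square zero. An algebra homomorphism into this algebra is a homomorphism to
  \<open>B\<close> together with a derivation along it, so universal properties for homomorphisms
  yield universal properties for derivations.\<close>

definition dual_alg :: "('k, 'b, 'e) module_scheme => ('k, 'b \<times> 'b) module" where
 "dual_alg B = \<lparr>carrier = carrier B \<times> carrier B,
   mult = (%(a, a') (b, b'). (a \<otimes>\<^sub>B b, a' \<otimes>\<^sub>B b \<oplus>\<^sub>B a \<otimes>\<^sub>B b')),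
   one = (\<one>\<^sub>B, \<zero>\<^sub>B), zero = (\<zero>\<^sub>B, \<zero>\<^sub>B),
   add = (%(a, a') (b, b'). (a \<oplus>\<^sub>B b, a' \<oplus>\<^sub>B b')),
   smult = (%c (a, a'). (c \<odot>\<^sub>B a, c \<odot>\<^sub>B a'))\<rparr>"

lemma dual_alg_simps:
 "carrier (dual_alg B) = carrier B \<times> carrier B"
 "(a, a') \<otimes>\<^bsub>dual_alg B\<^esub> (b, b') = (a \<otimes>\<^sub>B b, a' \<otimes>\<^sub>B b \<oplus>\<^sub>B a \<otimes>\<^sub>B b')"
 "\<one>\<^bsub>dual_alg B\<^esub> = (\<one>\<^sub>B, \<zero>\<^sub>B)" "\<zero>\<^bsub>dual_alg B\<^esub> = (\<zero>\<^sub>B, \<zero>\<^sub>B)"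
 "(a, a') \<oplus>\<^bsub>dual_alg B\<^esub> (b, b') = (a \<oplus>\<^sub>B b, a' \<oplus>\<^sub>B b')"
 "c \<odot>\<^bsub>dual_alg B\<^esub> (a, a') = (c \<odot>\<^sub>B a, c \<odot>\<^sub>B a')"
 by (simp_all add: dual_alg_def)

lemma dual_alg_assoc_algebra:
 assumes "assoc_algebra K B" shows "assoc_algebra K (dual_alg B)"
proof -
 interpret B: assoc_algebra K B by fact
 have ab: "abelian_group (dual_alg B)"
  by (rule abelian_groupI) (auto simp: dual_alg_simps B.a_ac intro: B.l_neg)
 have mon: "monoid (dual_alg B)"
  by (rule monoidI) (auto simp: dual_alg_simps B.m_assoc B.l_distr B.r_distr B.a_assoc)
 show ?thesis
  by (rule assoc_algebraI[OF B.field_axioms ab mon])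
   (auto simp: dual_alg_simps B.l_distr B.r_distr B.smult_l_distr B.smult_r_distr B.smult_assoc1
    B.smult_mult_left B.smult_mult_right B.a_ac)
qed

subsection \<open>The coproduct\<close>

locale coprod_setup = R: dg_algebra K R + S: dg_algebra K S
 for K :: "('k, 'c) ring_scheme" and R :: "('k, 'r, 'd) dg_alg_scheme" and S :: "('k, 's, 'e) dg_alg_scheme"
begin

abbreviation X where "X \<equiv> gens R S"
abbreviation P where "P \<equiv> pre_coprod K R S"
abbreviation I where "I \<equiv> coprod_ideal K R S"
abbreviation C where "C \<equiv> dg_quot P I"
abbreviation sg where "sg \<equiv> map_sum (sgn_inv K R) (sgn_inv K S)"
abbreviation df where "df \<equiv> map_sum (dif R) (dif S)"
abbreviation hl where "hl \<equiv> %i. Inl ` Gr R i \<union> Inr ` Gr S i"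

sublocale Fr: free_algebra K "gens R S"
 by (simp add: free_algebra_def R.field_axioms)

lemma P_simps: "carrier P = carrier Fr.F" "mult P = mult Fr.F" "\<one>\<^sub>P = \<one>\<^sub>Fr.F"
 "\<zero>\<^sub>P = \<zero>\<^sub>Fr.F" "add P = add Fr.F" "smult P = smult Fr.F"
 "Gr P n = {f \<in> carrier Fr.F. \<forall>w. f w ~= \<zero>\<^sub>K --> word_deg hl n w}"
 "dif P = lin_ext K Fr.F (word_dif K X df sg)"
 by (simp_all add: pre_coprod_def module.extend_def dg_alg.fields_def)

sublocale P: assoc_algebra K P
 by (rule assoc_algebra_cong[OF Fr.F_assoc_algebra]) (simp_all add: P_simps)

lemma module_hom_P: "module_hom K P B = module_hom K Fr.F B" "module_hom K M P = module_hom K M Fr.F"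
 by (simp_all add: module_hom_def P_simps)

lemma alg_hom_P: "alg_hom K P B = alg_hom K Fr.F B" "alg_hom K B P = alg_hom K B Fr.F"
 by (simp_all add: alg_hom_def module_hom_P ring_hom_def P_simps)

lemma letter_in: "z \<in> X ==> word K [z] :. P"
 using Fr.word_in[of "[z]"] by (simp add: P_simps)

lemma word_P: "w \<in> lists X ==> word K w :. P"
 using Fr.word_in by (simp add: P_simps)

lemma Inl_X: "r :. R ==> Inl r \<in> X" and Inr_X: "s :. S ==> Inr s \<in> X"
 by (auto simp: gens_def)

lemma X_cases: "z \<in> X ==> (!!r. r :. R ==> z = Inl r ==> thesis) ==>
  (!!s. s :. S ==> z = Inr s ==> thesis) ==> thesis"
 by (auto simp: gens_def)

lemma sg_X: "z \<in> X ==> sg z \<in> X" and df_X: "z \<in> X ==> df z \<in> X"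
 by (auto simp: gens_def R.sgn_inv_in S.sgn_inv_in R.dif_in S.dif_in)

lemma hl_X: "z \<in> hl i ==> z \<in> X"
 by (auto simp: gens_def R.Gr_in S.Gr_in)

abbreviation rels where "rels \<equiv> hom_relations K R P (%a. word K [Inl a]) \<union> hom_relations K S P (%a. word K [Inr a])"

lemma hom_relations_in:
 assumes "assoc_algebra K A" "!!a. a :. A ==> g a :. P"
 shows "hom_relations K A P g <= carrier P"
proof -
 interpret A: assoc_algebra K A by fact
 show ?thesis
 proof
  fix x assume "x \<in> hom_relations K A P g"
  then show "x :. P" unfolding hom_relations_def
   by (elim UnE CollectE exE conjE singletonE) (simp_all add: assms(2))
 qed
qed

lemma rels_in: "rels <= carrier P"
 by (intro Un_least hom_relations_in R.assoc_algebra_axioms S.assoc_algebra_axioms letter_in Inl_X Inr_X)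

sublocale Q: alg_quot K P I
 by (intro alg_quot.intro alg_quot_axioms.intro P.assoc_algebra_axioms)
  (simp only: coprod_ideal_def P.genideal_ideal[OF rels_in])

sublocale C: assoc_algebra K C by (rule Q.Q_assoc_algebra)

lemma rels_I: "rels <= I"
 unfolding coprod_ideal_def by (rule P.genideal_self[OF rels_in])

lemma I_least: "ideal J P ==> rels <= J ==> I <= J"
 unfolding coprod_ideal_def by (rule P.genideal_minimal)

text \<open>Each family in \<open>hom_relations\<close> is one of the laws of an algebra
  homomorphism, written as a difference that vanishes modulo \<open>I\<close>.\<close>

lemma hom_relations_hom:
 assumes "assoc_algebra K A" and g: "!!a. a :. A ==> g a :. P" and rel: "hom_relations K A P g <= I"
 shows "(%a. Q.cls (g a)) \<in> alg_hom K A C"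
proof -
 interpret A: assoc_algebra K A by fact
 have e: "Q.cls x = Q.cls y" if "x :. P" "y :. P" "x \<ominus>\<^sub>P y \<in> hom_relations K A P g" for x y
  using that rel Q.Qs.quot_eq by blast
 show ?thesis
 proof (rule alg_homI)
  fix x assume x: "x :. A"
  show "Q.cls (g x) :. C" using g x Q.cls_in by blast
  fix y assume y: "y :. A"
  have "Q.cls (g (x \<oplus>\<^sub>A y)) = Q.cls (g x \<oplus>\<^sub>P g y)"
   by (rule e) (use g x y in "simp_all, unfold hom_relations_def, blast")
  then show "Q.cls (g (x \<oplus>\<^sub>A y)) = Q.cls (g x) \<oplus>\<^sub>C Q.cls (g y)" using g x y by (simp add: Q.cls_add)
  have "Q.cls (g (x \<otimes>\<^sub>A y)) = Q.cls (g x \<otimes>\<^sub>P g y)"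
   by (rule e) (use g x y in "simp_all, unfold hom_relations_def, blast")
  then show "Q.cls (g (x \<otimes>\<^sub>A y)) = Q.cls (g x) \<otimes>\<^sub>C Q.cls (g y)" using g x y by (simp add: Q.cls_mult)
 next
  fix c x assume x: "x :. A" and c: "c :. K"
  have "Q.cls (g (c \<odot>\<^sub>A x)) = Q.cls (c \<odot>\<^sub>P g x)"
   by (rule e) (use g x c in "simp_all, unfold hom_relations_def, blast")
  then show "Q.cls (g (c \<odot>\<^sub>A x)) = c \<odot>\<^sub>C Q.cls (g x)" using g x c by (simp add: Q.cls_smult)
 next
  have "Q.cls (g \<one>\<^sub>A) = Q.cls \<one>\<^sub>P"
   by (rule e) (use g in "simp_all, unfold hom_relations_def, blast")
  then show "Q.cls (g \<one>\<^sub>A) = \<one>\<^sub>C" by (simp add: Q.cls_one)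
 qed
qed

text \<open>The conditions on products and on the unit compare values of \<open>f\<close> and do not
  ask \<open>f\<close> to be multiplicative. The lemma therefore applies both to homomorphisms out
  of the free algebra and to its differential followed by the class map.\<close>

lemma relations_killed:
 assumes "assoc_algebra K A" "module K T" and f: "f \<in> module_hom K P T"
  and g: "!!a. a :. A ==> g a :. P"
  and add: "!!a b. [|a :. A; b :. A|] ==> f (g (a \<oplus>\<^sub>A b)) = f (g a) \<oplus>\<^sub>T f (g b)"
  and smult: "!!c a. [|c :. K; a :. A|] ==> f (g (c \<odot>\<^sub>A a)) = c \<odot>\<^sub>T f (g a)"
  and mult: "!!a b. [|a :. A; b :. A|] ==> f (g (a \<otimes>\<^sub>A b)) = f (g a \<otimes>\<^sub>P g b)"
  and one: "f (g \<one>\<^sub>A) = f \<one>\<^sub>P"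
  and x: "x \<in> hom_relations K A P g"
 shows "f x = \<zero>\<^sub>T"
proof -
 interpret A: assoc_algebra K A by fact
 interpret T: module K T by fact
 note f_minus = module_hom_minus[OF P.module_axioms T.module_axioms f]
 note f_in = module_hom_in[OF f]
 show ?thesis using x unfolding hom_relations_def
  by (elim UnE CollectE exE conjE singletonE)
   (simp_all add: f_minus g add smult mult one module_hom_add[OF f] module_hom_smult[OF f] f_in T.M.minus_self)
qed

definition L where "L z = Q.cls (word K [z])"

lemma incl1_L: "incl1 K R S r = L (Inl r)" and incl2_L: "incl2 K R S s = L (Inr s)"
 by (simp_all add: incl1_def incl2_def L_def)

lemma L1_hom: "(%r. L (Inl r)) \<in> alg_hom K R C"
 unfolding L_def by (rule hom_relations_hom[OF R.assoc_algebra_axioms letter_in[OF Inl_X]]) (use rels_I in auto)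

lemma L2_hom: "(%s. L (Inr s)) \<in> alg_hom K S C"
 unfolding L_def by (rule hom_relations_hom[OF S.assoc_algebra_axioms letter_in[OF Inr_X]]) (use rels_I in auto)

lemma L_in: "z \<in> X ==> L z :. C"
 unfolding L_def by (intro Q.cls_in letter_in)

lemma cls_word_Cons:
 assumes "z \<in> X" "w \<in> lists X"
 shows "Q.cls (word K (z # w)) = L z \<otimes>\<^sub>C Q.cls (word K w)"
 using assms Fr.word_mult[of "[z]" w] by (simp add: L_def Q.cls_mult letter_in word_P) (simp add: P_simps)

lemma cls_word_Nil: "Q.cls (word K []) = \<one>\<^sub>C"
 by (simp add: Q.cls_one P_simps Fr.word_Nil)

text \<open>Elements are linear combinations of words, and words are built by multiplying with
  letters from the left. The letters include inhomogeneous ones.\<close>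

lemma C_induct [consumes 1, case_names zero one letter add smult]:
 assumes x: "x :. C" and zero: "T \<zero>\<^sub>C" and one: "T \<one>\<^sub>C"
  and letter: "!!z y. [|z \<in> X; y :. C; T y|] ==> T (L z \<otimes>\<^sub>C y)"
  and add: "!!x y. [|x :. C; y :. C; T x; T y|] ==> T (x \<oplus>\<^sub>C y)"
  and smult: "!!c x. [|c :. K; x :. C; T x|] ==> T (c \<odot>\<^sub>C x)"
 shows "T x"
proof -
 obtain f where f: "f :. Fr.F" "x = Q.cls f" using Q.Q_rep[OF x] by (auto simp: P_simps)
 have w: "T (Q.cls (word K w))" if "w \<in> lists X" for w
  using that
 proof (induction w)
  case Nil then show ?case using one by (simp add: cls_word_Nil)
 next
  case (Cons z w) then show ?case using letter[of z "Q.cls (word K w)"]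
   by (simp add: cls_word_Cons Q.cls_in word_P)
 qed
 have "T (Q.cls f)" using f(1)
 proof (induction rule: Fr.free_induct)
  case zero then show ?case using \<open>T \<zero>\<^sub>C\<close> by (simp add: Q.cls_zero P_simps)
 next
  case (word c w)
  then show ?case using smult[OF word(1) Q.cls_in[OF word_P] w] word
   by (simp add: Q.cls_smult word_P) (simp add: P_simps)
 next
  case (add f g)
  then have "f :. P" "g :. P" by (simp_all add: P_simps)
  then show ?case using \<open>T (Q.cls f)\<close> \<open>T (Q.cls g)\<close> assms(5)[OF Q.cls_in Q.cls_in, of f g]
   by (simp add: Q.cls_add) (simp add: P_simps)
 qed
 then show ?thesis using f by simp
qed

text \<open>The kernel of the extension to the free algebra is an ideal containing the relations,
  hence it contains the ideal they generate.\<close>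

lemma universal:
 assumes "assoc_algebra K B" and h1: "h1 \<in> alg_hom K R B" and h2: "h2 \<in> alg_hom K S B"
 shows "\<exists>G \<in> alg_hom K C B. (\<forall>r \<in> carrier R. G (L (Inl r)) = h1 r) & (\<forall>s \<in> carrier S. G (L (Inr s)) = h2 s)"
proof -
 interpret B: assoc_algebra K B by fact
 note h1' = alg_homD[OF h1] and h2' = alg_homD[OF h2]
 define f where "f = Fr.extend_hom B (case_sum h1 h2)"
 have l: "case_sum h1 h2 z :. B" if "z \<in> X" for z using that h1' h2' by (auto simp: gens_def)
 have f: "f \<in> alg_hom K P B" unfolding f_def alg_hom_P by (rule Fr.extend_hom_hom[OF assms(1) l])
 have fl: "f (word K [z]) = case_sum h1 h2 z" if "z \<in> X" for z
  unfolding f_def by (rule Fr.extend_hom_letter[OF assms(1) l that])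
 note f' = alg_homD[OF f]
 have k: "I <= {x \<in> carrier P. f x = \<zero>\<^sub>B}"
 proof (rule I_least[OF alg_hom_kernel_ideal[OF P.assoc_algebra_axioms assms(1) f]])
  have "f x = \<zero>\<^sub>B" if "x \<in> hom_relations K R P (%a. word K [Inl a])" for x
   by (rule relations_killed[OF R.assoc_algebra_axioms B.module_axioms f'(1) _ _ _ _ _ that])
    (simp_all add: letter_in Inl_X fl f' h1')
  moreover have "f x = \<zero>\<^sub>B" if "x \<in> hom_relations K S P (%a. word K [Inr a])" for x
   by (rule relations_killed[OF S.assoc_algebra_axioms B.module_axioms f'(1) _ _ _ _ _ that])
    (simp_all add: letter_in Inr_X fl f' h2')
  ultimately show "rels <= {x \<in> carrier P. f x = \<zero>\<^sub>B}" using rels_in by blast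
 qed
 then have k': "f x = \<zero>\<^sub>B" if "x \<in> I" for x using that by blast
 show ?thesis
  by (rule bexI[of _ "Q.qlift f"])
   (auto simp: L_def Q.qlift_cls[OF B.module_axioms f'(1) k'] letter_in Inl_X Inr_X fl
    intro!: Q.qlift_alg_hom[OF assms(1) f k'])
qed

lemma alg_hom_eq:
 assumes "assoc_algebra K B" "G \<in> alg_hom K C B" "H \<in> alg_hom K C B"
  and "!!z. z \<in> X ==> G (L z) = H (L z)" and x: "x :. C"
 shows "G x = H x"
proof -
 interpret B: assoc_algebra K B by fact
 note G = alg_homD[OF assms(2)] and H = alg_homD[OF assms(3)]
 from x show ?thesis
 proof (induction rule: C_induct)
  case zero then show ?case
   using module_hom_zero[OF C.module_axioms B.module_axioms G(1)] module_hom_zero[OF C.module_axioms B.module_axioms H(1)] by simp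
 qed (simp_all add: G H assms(4) L_in)
qed

text \<open>The universal property is applied to the dual numbers over \<open>B\<close>, with
  \<open>\<eta>\<close> as second component on \<open>R\<close> and zero on \<open>S\<close>. The
  first component of the resulting map agrees with \<open>g\<close> on letters, hence everywhere,
  and the second is the derivation.\<close>

lemma universal_derivation:
 assumes "assoc_algebra K B" and g: "g \<in> alg_hom K C B" and \<eta>: "\<eta> \<in> module_hom K R B"
  and \<eta>_mult: "!!x y. [|x :. R; y :. R|] ==>
   \<eta> (x \<otimes>\<^sub>R y) = \<eta> x \<otimes>\<^sub>B g (L (Inl y)) \<oplus>\<^sub>B g (L (Inl x)) \<otimes>\<^sub>B \<eta> y"
 shows "\<exists>D \<in> module_hom K C B. (\<forall>x \<in> carrier C. \<forall>y \<in> carrier C. D (x \<otimes>\<^sub>C y) = D x \<otimes>\<^sub>B g y \<oplus>\<^sub>B g x \<otimes>\<^sub>B D y) &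
  (\<forall>r \<in> carrier R. D (L (Inl r)) = \<eta> r) & (\<forall>s \<in> carrier S. D (L (Inr s)) = \<zero>\<^sub>B)"
proof -
 interpret B: assoc_algebra K B by fact
 interpret D: assoc_algebra K "dual_alg B" by (rule dual_alg_assoc_algebra[OF assms(1)])
 note g' = alg_homD[OF g] and L1' = alg_homD[OF L1_hom] and L2' = alg_homD[OF L2_hom]
 note d = dual_alg_simps
 have \<eta>_in: "\<eta> x :. B" if "x :. R" for x using module_hom_in[OF \<eta> that] .
 have \<eta>_one: "\<eta> \<one>\<^sub>R = \<zero>\<^sub>B"
 proof -
  have "\<eta> \<one>\<^sub>R = \<eta> \<one>\<^sub>R \<oplus>\<^sub>B \<eta> \<one>\<^sub>R"
   using \<eta>_mult[of "\<one>\<^sub>R" "\<one>\<^sub>R"] by (simp add: L1' g' \<eta>_in)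
  then show ?thesis using \<eta>_in[OF R.one_closed] by (metis B.add.l_cancel_one')
 qed
 have h1: "(%r. (g (L (Inl r)), \<eta> r)) \<in> alg_hom K R (dual_alg B)"
  by (rule alg_homI)
   (simp_all add: d L1' g' \<eta>_in \<eta>_mult \<eta>_one module_hom_add[OF \<eta>] module_hom_smult[OF \<eta>])
 have h2: "(%s. (g (L (Inr s)), \<zero>\<^sub>B)) \<in> alg_hom K S (dual_alg B)"
  by (rule alg_homI) (simp_all add: d L2' g')
 obtain G where G: "G \<in> alg_hom K C (dual_alg B)"
  "!!r. r :. R ==> G (L (Inl r)) = (g (L (Inl r)), \<eta> r)"
  "!!s. s :. S ==> G (L (Inr s)) = (g (L (Inr s)), \<zero>\<^sub>B)"
  using universal[OF D.assoc_algebra_axioms h1 h2] by blast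
 note G' = alg_homD[OF G(1)]
 have Gin: "fst (G x) :. B" "snd (G x) :. B" if "x :. C" for x
  using G'(2)[OF that] by (auto simp: d)
 have dd: "p \<oplus>\<^bsub>dual_alg B\<^esub> q = (fst p \<oplus>\<^sub>B fst q, snd p \<oplus>\<^sub>B snd q)"
  "p \<otimes>\<^bsub>dual_alg B\<^esub> q = (fst p \<otimes>\<^sub>B fst q, snd p \<otimes>\<^sub>B fst q \<oplus>\<^sub>B fst p \<otimes>\<^sub>B snd q)"
  "c \<odot>\<^bsub>dual_alg B\<^esub> p = (c \<odot>\<^sub>B fst p, c \<odot>\<^sub>B snd p)" for p q c
  by (cases p; cases q; simp add: d)+
 have fst_hom: "(%x. fst (G x)) \<in> alg_hom K C B"
  by (rule alg_homI) (simp_all add: Gin G' dd d)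
 have fst_G: "fst (G x) = g x" if "x :. C" for x
  by (rule alg_hom_eq[OF assms(1) fst_hom g _ that]) (auto elim!: X_cases simp: G)
 show ?thesis
 proof (intro bexI[of _ "%x. snd (G x)"] conjI ballI)
  show "(%x. snd (G x)) \<in> module_hom K C B"
   by (rule module_homI) (simp_all add: Gin G' dd)
 qed (simp_all add: G G' dd fst_G)
qed

lemma derivation_eq:
 assumes "assoc_algebra K B" and g: "g \<in> alg_hom K C B"
  and D: "D \<in> module_hom K C B" "D' \<in> module_hom K C B"
  and D_mult: "!!x y. [|x :. C; y :. C|] ==> D (x \<otimes>\<^sub>C y) = D x \<otimes>\<^sub>B g y \<oplus>\<^sub>B g x \<otimes>\<^sub>B D y"
   "!!x y. [|x :. C; y :. C|] ==> D' (x \<otimes>\<^sub>C y) = D' x \<otimes>\<^sub>B g y \<oplus>\<^sub>B g x \<otimes>\<^sub>B D' y"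
  and eq: "!!z. z \<in> X ==> D (L z) = D' (L z)" and x: "x :. C"
 shows "D x = D' x"
proof -
 interpret B: assoc_algebra K B by fact
 \<comment> \<open>The unit is the class of a letter, so equality on letters also covers it.\<close>
 have L1: "\<one>\<^sub>C = L (Inl \<one>\<^sub>R)" using alg_homD(6)[OF L1_hom] by simp
 from x show ?thesis
 proof (induction rule: C_induct)
  case zero then show ?case
   using module_hom_zero[OF C.module_axioms B.module_axioms D(1)] module_hom_zero[OF C.module_axioms B.module_axioms D(2)] by simp
 next
  case one then show ?case unfolding L1 by (rule eq) (simp add: Inl_X)
 qed (simp_all add: D_mult eq L_in module_hom_add[OF D(1)] module_hom_add[OF D(2)] module_hom_smult[OF D(1)] module_hom_smult[OF D(2)])
qed

end

subsection \<open>The differential and the grading of the coproduct\<close>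

lemma word_deg_append: "word_deg G m u ==> word_deg G n v ==> word_deg G (m + n) (u @ v)"
proof (induction u arbitrary: m)
 case (Cons x u)
 then obtain i where i: "x \<in> G i" "word_deg G (m - i) u" by auto
 have "word_deg G (m - i + n) (u @ v)" using Cons.IH[OF i(2)] Cons.prems(2) .
 moreover have "m - i + n = m + n - i" by simp
 ultimately show ?case using i(1) by auto
qed simp

context coprod_setup begin

text \<open>The free algebra on inhomogeneous letters has no grading, so the sign twist of its
  differential is an endomorphism instead of a power of -1. On classes of homogeneous elements it
  becomes that power, see \<open>cls_sig\<close>.\<close>

definition sig where "sig = Fr.extend_hom P (%z. word K [sg z])"

lemma sig_hom: "sig \<in> alg_hom K P P"
 unfolding sig_def using Fr.extend_hom_hom[OF P.assoc_algebra_axioms letter_in[OF sg_X]] by (simp add: alg_hom_P)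

lemma sig_letter: "z \<in> X ==> sig (word K [z]) = word K [sg z]"
 unfolding sig_def by (rule Fr.extend_hom_letter[OF P.assoc_algebra_axioms letter_in[OF sg_X]])

lemmas sig = alg_homD[OF sig_hom]

abbreviation wd where "wd \<equiv> word_dif K X df sg"

lemma wd_Cons: "wd (z # w) = word K (df z # w) \<oplus>\<^sub>P word K [sg z] \<otimes>\<^sub>P wd w"
 by (simp add: P_simps)

lemma wd_Nil: "wd [] = \<zero>\<^sub>P"
 by (simp add: P_simps)

declare word_dif.simps [simp del]

lemma wd_in: "w \<in> lists X ==> wd w :. P"
proof (induction w)
 case (Cons z w)
 then have "word K (df z # w) :. P" by (intro word_P) (simp add: df_X)
 then show ?case using Cons by (simp add: wd_Cons letter_in sg_X)
qed (simp add: wd_Nil)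

lemma word_Cons: "word K (z # w) = word K [z] \<otimes>\<^sub>P word K w"
 using Fr.word_mult[of "[z]" w] by (simp add: P_simps)

lemma word_append: "word K (u @ v) = word K u \<otimes>\<^sub>P word K v"
 using Fr.word_mult[of u v] by (simp add: P_simps)

lemma word_Nil_P: "word K [] = \<one>\<^sub>P"
 by (simp add: P_simps Fr.word_Nil)

lemma sig_word_Cons: "z \<in> X ==> w \<in> lists X ==> sig (word K (z # w)) = word K [sg z] \<otimes>\<^sub>P sig (word K w)"
 by (subst word_Cons) (simp add: sig letter_in word_P sig_letter)

text \<open>In every summand of \<open>word_dif\<close> the letters before the differentiated one
  are twisted; when that letter lies in \<open>v\<close>, the whole of \<open>u\<close> is twisted,
  which is \<open>sig\<close>.\<close>

lemma wd_append:
 assumes "u \<in> lists X" "v \<in> lists X"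
 shows "wd (u @ v) = wd u \<otimes>\<^sub>P word K v \<oplus>\<^sub>P sig (word K u) \<otimes>\<^sub>P wd v"
 using assms(1)
proof (induction u)
 case Nil then show ?case using assms(2) by (simp add: wd_Nil word_Nil_P sig word_P wd_in)
next
 case (Cons z u)
 then have z: "z \<in> X" "u \<in> lists X" by auto
 have i: "word K (df z # u) :. P" "word K v :. P" "word K [sg z] :. P" "wd u :. P"
  "wd v :. P" "sig (word K u) :. P"
  using z assms(2) word_P[of "df z # u"] by (simp_all add: df_X word_P letter_in sg_X wd_in sig)
 have "word K (df z # u @ v) = word K (df z # u) \<otimes>\<^sub>P word K v" using word_append[of "df z # u" v] by simp
 then show ?case using Cons.IH i z
  by (simp add: wd_Cons sig_word_Cons P.l_distr P.r_distr P.m_assoc P.a_assoc)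
qed

lemma wd_in_F: "w \<in> lists X ==> wd w :. Fr.F"
 using wd_in by (simp add: P_simps)

lemma dif_P_hom: "dif P \<in> module_hom K P P"
 using Fr.lin_ext_hom[OF Fr.F.module_axioms wd_in_F] by (simp add: module_hom_P P_simps)

lemma dif_P_word: "w \<in> lists X ==> dif P (word K w) = wd w"
 using Fr.lin_ext_word[OF Fr.F.module_axioms wd_in_F] by (simp add: P_simps)

lemma dif_P_in: "f :. P ==> dif P f :. P"
 by (rule module_hom_in[OF dif_P_hom])

lemma P_induct [consumes 1, case_names zero word add]:
 assumes "f :. P" "T \<zero>\<^sub>P"
  and "!!c w. [|c :. K; w \<in> lists X|] ==> T (c \<odot>\<^sub>P word K w)"
  and "!!f g. [|f :. P; g :. P; T f; T g|] ==> T (f \<oplus>\<^sub>P g)"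
 shows "T f"
 using assms(1) unfolding P_simps(1)
 by (rule Fr.free_induct) (use assms(2-4) in "simp_all add: P_simps")

lemma dif_P_mult:
 assumes "f :. P" "g :. P"
 shows "dif P (f \<otimes>\<^sub>P g) = dif P f \<otimes>\<^sub>P g \<oplus>\<^sub>P sig f \<otimes>\<^sub>P dif P g"
proof -
 note z = module_hom_zero[OF P.module_axioms P.module_axioms dif_P_hom]
  module_hom_zero[OF P.module_axioms P.module_axioms sig(1)]
 note d = module_hom_add[OF dif_P_hom] module_hom_smult[OF dif_P_hom]
 have w: "dif P (word K u \<otimes>\<^sub>P g) = dif P (word K u) \<otimes>\<^sub>P g \<oplus>\<^sub>P sig (word K u) \<otimes>\<^sub>P dif P g"
  if u: "u \<in> lists X" for u
  using assms(2)
 proof (induction g rule: P_induct)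
  case zero then show ?case using u by (simp add: z word_P wd_in sig dif_P_word)
 next
  case (word c v)
  have "u @ v \<in> lists X" using u word by simp
  then show ?case using u word
   by (simp add: P.smult_mult_right word_append[symmetric] d word_P wd_in sig dif_P_word wd_append
    P.smult_r_distr)
 next
  case (add g h) then show ?case using u by (simp add: d P.r_distr word_P sig dif_P_in P.a_interchange)
 qed
 show ?thesis
  using assms(1)
 proof (induction f rule: P_induct)
  case zero then show ?case using assms(2) by (simp add: z dif_P_in)
 next
  case (word c u) then show ?case using assms(2)
   by (simp add: P.smult_mult_left d w word_P dif_P_in sig P.smult_r_distr)
 next
  case (add f h) then show ?case using assms(2) by (simp add: d P.l_distr sig dif_P_in P.a_interchange)
 qed
qed

text \<open>Modulo \<open>I\<close> the letters form a homomorphism, and on \<open>A\<close> the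
  involution is multiplicative while the differential satisfies the twisted Leibniz rule. Both sides
  of a relation thus keep equal classes after applying \<open>sig\<close> or the
  differential.\<close>

lemma rels_dif_sig:
 assumes "dg_algebra K A" and g: "!!a. a :. A ==> g a :. P"
  and sg: "!!a. a :. A ==> sig (g a) = g (sgn_inv K A a)"
  and df: "!!a. a :. A ==> dif P (g a) = g (dif A a)"
  and rel: "hom_relations K A P g <= I" and x: "x \<in> hom_relations K A P g"
 shows "sig x \<in> I & dif P x \<in> I"
proof -
 interpret A: dg_algebra K A by fact
 have "(%a. Q.cls (g a)) \<in> alg_hom K A C" by (rule hom_relations_hom[OF A.assoc_algebra_axioms g rel])
 note h = alg_homD[OF this]
 note s = A.sgn_inv_in A.sgn_inv_mult A.sgn_inv_one module_hom_add[OF A.sgn_inv_hom] module_hom_smult[OF A.sgn_inv_hom]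
 note d = A.dif_in A.dif_mult_sgn A.dif_one module_hom_add[OF A.dif_linear] module_hom_smult[OF A.dif_linear]
 note cls = alg_homD[OF Q.cls_hom]
 have "hom_relations K A P g <= carrier P" by (rule hom_relations_in[OF A.assoc_algebra_axioms g])
 then have xP: "x :. P" using x by blast
 have dif_one: "dif P \<one>\<^sub>P = \<zero>\<^sub>P" using dif_P_word[of "[]"] by (simp add: word_Nil_P wd_Nil)
 have cls0: "Q.cls (g \<zero>\<^sub>A) = Q.cls \<zero>\<^sub>P"
  using module_hom_zero[OF A.module_axioms C.module_axioms h(1)] by (simp add: Q.cls_zero)
 have "Q.cls (sig x) = \<zero>\<^sub>C"
  by (rule relations_killed[OF A.assoc_algebra_axioms C.module_axioms module_hom_comp[OF sig(1) cls(1)] _ _ _ _ _ x])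
   (simp_all add: g sg s h sig cls)
 moreover have "Q.cls (dif P x) = \<zero>\<^sub>C"
  by (rule relations_killed[OF A.assoc_algebra_axioms C.module_axioms module_hom_comp[OF dif_P_hom cls(1)] _ _ _ _ _ x])
   (simp_all add: g df s d h cls dif_P_mult sg dif_one cls0)
 ultimately show ?thesis using xP by (simp add: Q.cls_zero_iff sig dif_P_in)
qed

text \<open>The differential of a product involves \<open>sig\<close> of its left factor, so
  stability under both maps has to be proved at once: the elements of \<open>I\<close> that both
  maps send into \<open>I\<close> form an ideal containing the relations.\<close>

lemma I_dif_sig: "x \<in> I ==> sig x \<in> I & dif P x \<in> I"
proof -
 let ?J = "{x \<in> I. sig x \<in> I & dif P x \<in> I}"
 have IP: "x \<in> I ==> x :. P" for x using Q.Qs.I_sub by blast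
 note z = module_hom_zero[OF P.module_axioms P.module_axioms dif_P_hom]
  module_hom_zero[OF P.module_axioms P.module_axioms sig(1)]
 have "ideal ?J P"
 proof (rule idealI'[OF P.assoc_algebra_axioms])
  show "?J <= carrier P" using IP by blast
  show "\<zero>\<^sub>P \<in> ?J" by (simp add: z Q.Qs.I_zero)
  fix x y assume "x \<in> ?J" "y \<in> ?J"
  then show "x \<oplus>\<^sub>P y \<in> ?J" using IP by (auto simp: sig module_hom_add[OF dif_P_hom] Q.Qs.I_add)
 next
  fix a x assume a: "a :. P" and x: "x \<in> ?J"
  then have "x :. P" using IP by blast
  then show "a \<otimes>\<^sub>P x \<in> ?J" using a x by (auto simp: sig dif_P_mult dif_P_in intro!: Q.Qs.I_add Q.I_ideal(1))
  show "x \<otimes>\<^sub>P a \<in> ?J" using \<open>x :. P\<close> a x by (auto simp: sig dif_P_mult dif_P_in intro!: Q.Qs.I_add Q.I_ideal(2))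
 qed
 moreover have "rels <= ?J"
 proof
  fix x assume x: "x \<in> rels"
  have d: "dif P (word K [z]) = word K [df z]" if "z \<in> X" for z
   using that dif_P_word[of "[z]"] word_P[of "[df z]"] df_X by (simp add: wd_Cons wd_Nil letter_in sg_X)
  have "sig x \<in> I & dif P x \<in> I"
   using x
  proof
   assume x: "x \<in> hom_relations K R P (%a. word K [Inl a])"
   show ?thesis
    by (rule rels_dif_sig[OF R.dg_algebra_axioms _ _ _ _ x])
     (use rels_I in "simp_all add: letter_in Inl_X sig_letter d")
  next
   assume x: "x \<in> hom_relations K S P (%a. word K [Inr a])"
   show ?thesis
    by (rule rels_dif_sig[OF S.dg_algebra_axioms _ _ _ _ x])
     (use rels_I in "simp_all add: letter_in Inr_X sig_letter d")
  qed
  then show "x \<in> ?J" using x rels_I by blast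
 qed
 ultimately show "x \<in> I ==> sig x \<in> I & dif P x \<in> I" using I_least by blast
qed

lemma dif_C: "f :. P ==> dif C (Q.cls f) = Q.cls (dif P f)"
 by (rule Q.dif_cls[OF dif_P_hom]) (simp_all add: I_dif_sig)

lemma dif_C_hom: "dif C \<in> module_hom K C C"
 by (rule Q.dif_Q_hom[OF dif_P_hom]) (simp add: I_dif_sig)

lemma dif_C_in: "x :. C ==> dif C x :. C"
 by (rule module_hom_in[OF dif_C_hom])

lemma dif_C_one: "dif C \<one>\<^sub>C = \<zero>\<^sub>C"
 using dif_P_word[of "[]"] by (simp add: Q.cls_one dif_C word_Nil_P wd_Nil Q.cls_zero)

lemma dif_P_letter: "z \<in> X ==> dif P (word K [z]) = word K [df z]"
 using dif_P_word[of "[z]"] word_P[of "[df z]"] df_X by (simp add: wd_Cons wd_Nil letter_in sg_X)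

lemma dif_C_letter: "z \<in> X ==> dif C (L z) = L (df z)"
 by (simp add: L_def dif_C letter_in dif_P_letter)

lemma dif_C_letter_mult:
 assumes "z \<in> X" "y :. C"
 shows "dif C (L z \<otimes>\<^sub>C y) = L (df z) \<otimes>\<^sub>C y \<oplus>\<^sub>C L (sg z) \<otimes>\<^sub>C dif C y"
proof -
 obtain f where f: "f :. P" "y = Q.cls f" using Q.Q_rep assms(2) by blast
 show ?thesis using assms f
  by (simp add: L_def Q.cls_mult letter_in dif_C dif_P_mult dif_P_letter sig_letter df_X sg_X dif_P_in Q.cls_add)
qed

lemma L_zero: "L (Inl \<zero>\<^sub>R) = \<zero>\<^sub>C" "L (Inr \<zero>\<^sub>S) = \<zero>\<^sub>C"
 using module_hom_zero[OF R.module_axioms C.module_axioms alg_homD(1)[OF L1_hom]]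
  module_hom_zero[OF S.module_axioms C.module_axioms alg_homD(1)[OF L2_hom]] by simp_all

lemma L_dif_dif: "z \<in> X ==> L (df (df z)) = \<zero>\<^sub>C"
 by (auto elim!: X_cases simp: R.dif_dif S.dif_dif L_zero)

lemma L_dif_sg: "z \<in> X ==> L (df (sg z)) = \<ominus>\<^sub>C L (sg (df z))"
 using module_hom_neg[OF R.module_axioms C.module_axioms alg_homD(1)[OF L1_hom]]
  module_hom_neg[OF S.module_axioms C.module_axioms alg_homD(1)[OF L2_hom]]
 by (auto elim!: X_cases simp: R.dif_sgn_inv S.dif_sgn_inv R.dif_in S.dif_in R.sgn_inv_in S.sgn_inv_in)

text \<open>The square of a twisted derivation that anticommutes with its twist has no mixed terms,
  so induction on words reduces it to letters. There the square gives the letter of the zero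
  element, which vanishes only modulo the relations.\<close>

lemma dif_C_dif_C:
 assumes "x :. C" shows "dif C (dif C x) = \<zero>\<^sub>C"
 using assms
proof (induction rule: C_induct)
 case zero then show ?case by (simp add: module_hom_zero[OF C.module_axioms C.module_axioms dif_C_hom])
next
 case one then show ?case by (simp add: dif_C_one module_hom_zero[OF C.module_axioms C.module_axioms dif_C_hom])
next
 case (letter z y)
 have i: "L z :. C" "L (df z) :. C" "L (sg z) :. C" "L (sg (df z)) :. C" "L (sg (sg z)) :. C"
  using letter by (auto intro!: L_in sg_X df_X)
 show ?case using letter i
  by (simp add: dif_C_letter_mult module_hom_add[OF dif_C_hom] sg_X df_X dif_C_in L_dif_dif L_dif_sg C.l_minus C.r_neg)
next
 case (add x y) then show ?case by (simp add: module_hom_add[OF dif_C_hom] dif_C_in)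
next
 case (smult c x) then show ?case by (simp add: module_hom_smult[OF dif_C_hom] dif_C_in)
qed

lemma L_sg: "z \<in> hl i ==> L (sg z) = ksign K i \<odot>\<^sub>C L z"
 using alg_homD(5)[OF L1_hom] alg_homD(5)[OF L2_hom]
 by (auto simp: R.sgn_inv_Gr_eq S.sgn_inv_Gr_eq R.R.ksign_in R.Gr_in S.Gr_in)

lemma word_deg_X: "word_deg hl n w ==> w \<in> lists X"
proof (induction w arbitrary: n)
 case (Cons z w)
 then obtain i where "z \<in> hl i" "word_deg hl (n - i) w" by auto
 then show ?case using hl_X Cons.IH by simp
qed simp

text \<open>The sign of a letter of degree \<open>i\<close> can be pulled out as a scalar only in
  the quotient, where letters are linear; the signs then multiply to that of the total
  degree.\<close>

lemma cls_sig_word: "word_deg hl n w ==> Q.cls (sig (word K w)) = ksign K n \<odot>\<^sub>C Q.cls (word K w)"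
proof (induction w arbitrary: n)
 case Nil
 have "\<one>\<^sub>K \<odot>\<^sub>C Q.cls (word K []) = Q.cls (word K [])" by (rule C.smult_one) (simp add: Q.cls_in word_P)
 then show ?case using Nil by (simp add: sig word_Nil_P ksign_def)
next
 case (Cons z w)
 then obtain i where i: "z \<in> hl i" "word_deg hl (n - i) w" by auto
 have z: "z \<in> X" "w \<in> lists X" using hl_X i word_deg_X by auto
 have k: "ksign K n = ksign K i \<otimes>\<^sub>K ksign K (n - i)" using R.R.ksign_add[of i "n - i"] by simp
 have i': "Q.cls (word K w) :. C" "L z :. C" using z by (simp_all add: Q.cls_in word_P L_in)
 have "Q.cls (sig (word K (z # w))) = L (sg z) \<otimes>\<^sub>C Q.cls (sig (word K w))"
  using z by (simp add: sig_word_Cons L_def Q.cls_mult letter_in sg_X sig word_P)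
 also have "\<dots> = (ksign K i \<odot>\<^sub>C L z) \<otimes>\<^sub>C (ksign K (n - i) \<odot>\<^sub>C Q.cls (word K w))"
  unfolding L_sg[OF i(1)] Cons.IH[OF i(2)] ..
 also have "\<dots> = ksign K n \<odot>\<^sub>C Q.cls (word K (z # w))"
  using z i' by (simp add: C.smult_mult_left C.smult_mult_right R.R.ksign_in k C.smult_assoc1[symmetric] R.R.m_comm cls_word_Cons)
 finally show ?case .
qed

lemma Gr_P_induct [consumes 1, case_names zero word add]:
 assumes f: "f \<in> Gr P n" and "T \<zero>\<^sub>P"
  and "!!c w. [|c :. K; word_deg hl n w|] ==> T (c \<odot>\<^sub>P word K w)"
  and "!!f g. [|f :. P; g :. P; T f; T g|] ==> T (f \<oplus>\<^sub>P g)"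
 shows "T f"
proof -
 have "f :. Fr.F" "{w. f w ~= \<zero>\<^sub>K} <= {w. word_deg hl n w}" using f by (auto simp: P_simps)
 then show ?thesis by (rule Fr.free_induct_on) (use assms(2-4) in "simp_all add: P_simps")
qed

lemma Gr_P_submodule: "submodule K (Gr P n) P"
 unfolding submodule_def
proof (intro conjI allI impI P.module_axioms)
 show "Gr P n <= carrier P" by (auto simp: P_simps)
 show "\<zero>\<^sub>P \<in> Gr P n" using Fr.F.zero_closed by (simp add: P_simps) (simp add: free_alg_simps)
 fix f g assume f: "f \<in> Gr P n" and g: "g \<in> Gr P n"
 have "f \<oplus>\<^sub>Fr.F g :. Fr.F" using f g by (simp add: P_simps)
 moreover have "\<forall>w. (f \<oplus>\<^sub>Fr.F g) w ~= \<zero>\<^sub>K --> word_deg hl n w"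
  using f g unfolding P_simps free_alg_simps by (auto simp: Fr.F_carrier) (metis R.R.l_zero R.R.zero_closed)
 ultimately show "f \<oplus>\<^sub>P g \<in> Gr P n" by (simp add: P_simps)
next
 fix c f assume c: "c :. K" and f: "f \<in> Gr P n"
 have "c \<odot>\<^sub>Fr.F f :. Fr.F" using f c by (simp add: P_simps)
 moreover have "\<forall>w. (c \<odot>\<^sub>Fr.F f) w ~= \<zero>\<^sub>K --> word_deg hl n w"
 proof (intro allI impI)
  fix w assume "(c \<odot>\<^sub>Fr.F f) w ~= \<zero>\<^sub>K"
  then have "f w ~= \<zero>\<^sub>K" using c by (cases "f w = \<zero>\<^sub>K") (simp_all add: free_alg_simps)
  then show "word_deg hl n w" using f by (simp add: P_simps)
 qed
 ultimately show "c \<odot>\<^sub>P f \<in> Gr P n" by (simp add: P_simps)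
qed

lemma Gr_P_in: "f \<in> Gr P n ==> f :. P"
 by (simp add: P_simps)

lemma Gr_P_word: "word_deg hl n w ==> word K w \<in> Gr P n"
 using word_P[OF word_deg_X] by (simp add: P_simps) (auto simp: word_def)

lemma Gr_P_mult:
 assumes f: "f \<in> Gr P m" and g: "g \<in> Gr P n" shows "f \<otimes>\<^sub>P g \<in> Gr P (m + n)"
proof -
 have "f \<otimes>\<^sub>Fr.F g :. Fr.F" using f g by (simp add: P_simps)
 moreover have "word_deg hl (m + n) w" if "(f \<otimes>\<^sub>Fr.F g) w ~= \<zero>\<^sub>K" for w
 proof -
  have sc: "\<forall>w. f w :. K" "\<forall>w. g w :. K" using f g by (simp_all add: P_simps Fr.F_carrier)
  have "Fr.conv f g w ~= \<zero>\<^sub>K" using that by (simp add: Fr.F_mult)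
  from Fr.conv_nonzero[OF sc this] obtain u v where "w = u @ v" "f u ~= \<zero>\<^sub>K" "g v ~= \<zero>\<^sub>K"
   by auto
  then show ?thesis using f g by (auto simp: P_simps intro!: word_deg_append)
 qed
 ultimately show ?thesis by (simp add: P_simps)
qed

lemma Gr_C: "x \<in> Gr C n \<longleftrightarrow> (\<exists>f \<in> Gr P n. x = Q.cls f)"
 by (auto simp: dg_quot_simps)

lemma Gr_C_subspace: "subspace K (Gr C n) C"
 by (rule Q.Gr_Q_subspace[OF Gr_P_submodule])

lemma Gr_C_submodule: "submodule K (Gr C n) C"
 using Gr_C_subspace by (simp add: subspace_def)

lemma Gr_C_in: "x \<in> Gr C n ==> x :. C"
 by (auto simp: Gr_C intro: Q.cls_in Gr_P_in)

lemma Gr_C_add: "x \<in> Gr C n ==> y \<in> Gr C n ==> x \<oplus>\<^sub>C y \<in> Gr C n"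
 using Gr_C_submodule[of n] by (simp add: submodule_def)

lemma Gr_C_zero: "\<zero>\<^sub>C \<in> Gr C n"
 using Gr_C_submodule[of n] by (simp add: submodule_def)

lemma Gr_C_smult: "c :. K ==> x \<in> Gr C n ==> c \<odot>\<^sub>C x \<in> Gr C n"
 using Gr_C_submodule[of n] by (simp add: submodule_def)

lemma Gr_C_mult: "x \<in> Gr C m ==> y \<in> Gr C n ==> x \<otimes>\<^sub>C y \<in> Gr C (m + n)"
 using Gr_P_mult by (auto simp: Gr_C Q.cls_mult Gr_P_in intro!: bexI)

lemma L_Gr: "z \<in> hl i ==> L z \<in> Gr C i"
 unfolding L_def Gr_C using Gr_P_word[of i "[z]"] by auto

lemma Gr_C_one: "\<one>\<^sub>C \<in> Gr C 0"
 unfolding Gr_C using Gr_P_word[of 0 "[]"] by (auto simp: Q.cls_one word_Nil_P)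

lemma df_hl: "z \<in> hl i ==> df z \<in> hl (i + 1)"
 using R.dif_degree S.dif_degree by auto

lemma sg_hl: "z \<in> hl i ==> sg z \<in> hl i"
 using R.sgn_inv_Gr S.sgn_inv_Gr by auto

lemma wd_Gr: "word_deg hl n w ==> wd w \<in> Gr P (n + 1)"
proof (induction w arbitrary: n)
 case Nil then show ?case using Gr_P_submodule by (simp add: wd_Nil submodule_def)
next
 case (Cons z w)
 then obtain i where i: "z \<in> hl i" "word_deg hl (n - i) w" by auto
 have "word_deg hl (n + 1) (df z # w)" using df_hl[OF i(1)] i(2) by (auto intro!: exI[of _ "i + 1"])
 then have 1: "word K (df z # w) \<in> Gr P (n + 1)" by (rule Gr_P_word)
 have "word K [sg z] \<in> Gr P i" by (rule Gr_P_word) (use sg_hl[OF i(1)] in auto)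
 then have "word K [sg z] \<otimes>\<^sub>P wd w \<in> Gr P (i + (n - i + 1))" using Cons.IH[OF i(2)] by (rule Gr_P_mult)
 then have 2: "word K [sg z] \<otimes>\<^sub>P wd w \<in> Gr P (n + 1)" by (simp add: algebra_simps)
 show ?case unfolding wd_Cons using 1 2 Gr_P_submodule[of "n + 1"] by (simp add: submodule_def)
qed

lemma dif_P_Gr: "f \<in> Gr P n ==> dif P f \<in> Gr P (n + 1)"
proof (induction f rule: Gr_P_induct)
 case zero then show ?case using Gr_P_submodule[of "n + 1"]
  by (simp add: module_hom_zero[OF P.module_axioms P.module_axioms dif_P_hom] submodule_def)
next
 case (word c w) then show ?case using Gr_P_submodule[of "n + 1"] wd_Gr[OF word(2)]
  by (simp add: module_hom_smult[OF dif_P_hom] word_P word_deg_X dif_P_word submodule_def)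
next
 case (add f g) then show ?case using Gr_P_submodule[of "n + 1"] by (simp add: module_hom_add[OF dif_P_hom] submodule_def)
qed

lemma cls_sig: "f \<in> Gr P n ==> Q.cls (sig f) = ksign K n \<odot>\<^sub>C Q.cls f"
proof (induction f rule: Gr_P_induct)
 case zero then show ?case
  by (simp add: module_hom_zero[OF P.module_axioms P.module_axioms sig(1)] R.R.ksign_in Q.cls_zero[symmetric])
next
 case (word c w)
 have i: "Q.cls (word K w) :. C" "w \<in> lists X" using word_deg_X[OF word(2)] by (simp_all add: Q.cls_in word_P)
 show ?case using i word cls_sig_word[OF word(2)]
  by (simp add: sig Q.cls_smult[symmetric] word_P C.smult_assoc1[symmetric] R.R.ksign_in R.R.m_comm)
next
 case (add f g) then show ?case by (simp add: sig Q.cls_add[symmetric] R.R.ksign_in C.smult_r_distr Q.cls_in)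
qed

subsection \<open>Uniqueness of homogeneous components\<close>

text \<open>The coproduct acts on sequences in itself, an element of degree \<open>n\<close> by multiplication followed
 by a shift by \<open>n\<close>. This separates the degrees.\<close>

definition W where "W = fun_space UNIV C (UNIV \<rightarrow> carrier C)"

lemma W_simps: "carrier W = UNIV \<rightarrow> carrier C" "\<zero>\<^sub>W = (%n. \<zero>\<^sub>C)"
 "f \<oplus>\<^sub>W g = (%x. f x \<oplus>\<^sub>C g x)" "c \<odot>\<^sub>W f = (%x. c \<odot>\<^sub>C f x)"
 by (simp_all add: W_def fun_space_simps restrict_UNIV)

lemma W_vectorspace: "vectorspace K W"
 unfolding W_def by (rule fun_space_vectorspace[OF C.vectorspace_axioms]) (auto simp: PiE_def)

abbreviation EW where "EW \<equiv> End_alg K W"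

lemma EW_assoc: "assoc_algebra K EW"
 by (rule End_alg_assoc_algebra[OF W_vectorspace])

definition shift :: "int => _ => (int => _) => int => _" where
 "shift j a = (\<lambda>f \<in> carrier W. %n. a \<otimes>\<^sub>C f (n - j))"

lemma shift_in: "a :. C ==> shift j a :. EW"
 unfolding End_alg_simps shift_def
 by (intro IntI module_homI) (auto simp: W_simps Pi_iff C.r_distr C.smult_mult_right)

lemma shift_add: "a :. C ==> b :. C ==> shift j (a \<oplus>\<^sub>C b) = shift j a \<oplus>\<^sub>EW shift j b"
 by (auto simp: End_alg_simps shift_def W_simps C.l_distr Pi_iff intro!: restrict_ext)

lemma shift_smult: "a :. C ==> c :. K ==> shift j (c \<odot>\<^sub>C a) = c \<odot>\<^sub>EW shift j a"
 by (auto simp: End_alg_simps shift_def W_simps C.smult_mult_left Pi_iff intro!: restrict_ext)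

lemma shift_mult: "a :. C ==> b :. C ==> shift (i + j) (a \<otimes>\<^sub>C b) = shift i a \<otimes>\<^sub>EW shift j b"
 by (auto simp: End_alg_simps shift_def W_simps C.m_assoc Pi_iff compose_def diff_diff_eq intro!: restrict_ext)

lemma shift_one: "shift 0 \<one>\<^sub>C = \<one>\<^sub>EW"
 by (auto simp: End_alg_simps shift_def W_simps Pi_iff intro!: restrict_ext)

text \<open>The shifted multiplications of degree \<open>m\<close> and \<open>n\<close> compose to
  that of degree \<open>m + n\<close>, so gluing them over the homogeneous parts of \<open>A\<close>
  gives an algebra homomorphism.\<close>

lemma shift_hom:
 assumes "dg_algebra K A" and i: "i \<in> alg_hom K A C"
 shows "\<exists>h \<in> alg_hom K A EW. \<forall>n. \<forall>a \<in> Gr A n. h a = shift n (i a)"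
proof -
 interpret A: dg_algebra K A by fact
 interpret EW: assoc_algebra K EW by (rule EW_assoc)
 note i' = alg_homD[OF i]
 let ?h = "A.glue EW (%n a. shift n (i a))"
 have s: "(%a. shift n (i a)) \<in> module_hom K (A\<lparr>carrier := Gr A n\<rparr>) EW" for n
  by (rule module_homI) (simp_all add: A.Gr_in i' shift_in shift_add shift_smult)
 have hom: "?h \<in> module_hom K A EW" by (rule A.glue_hom[OF EW.module_axioms s])
 have hG: "?h a = shift n (i a)" if "a \<in> Gr A n" for a n by (rule A.glue_Gr[OF EW.module_axioms s that])
 note hin = module_hom_in[OF hom]
 have mult: "?h (x \<otimes>\<^sub>A y) = ?h x \<otimes>\<^sub>EW ?h y" if x: "x :. A" and y: "y :. A" for x y
  using x
 proof (induction x rule: A.homogeneous_induct)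
  case (homogeneous m x)
  show ?case using y
  proof (induction y rule: A.homogeneous_induct)
   case (homogeneous n y)
   show ?case using hG[OF A.Gr_mult[OF \<open>x \<in> Gr A m\<close> homogeneous]] hG[OF homogeneous] hG[OF \<open>x \<in> Gr A m\<close>]
     A.Gr_in[OF homogeneous] A.Gr_in[OF \<open>x \<in> Gr A m\<close>] by (simp add: i' shift_mult)
  next
   case (add y z) then show ?case using A.Gr_in[OF \<open>x \<in> Gr A m\<close>]
    by (simp add: A.r_distr EW.r_distr module_hom_add[OF hom] hin)
  qed
 next
  case (add x z) then show ?case using y by (simp add: A.l_distr EW.l_distr module_hom_add[OF hom] hin)
 qed
 have "?h \<in> alg_hom K A EW"
  by (rule alg_homI) (simp_all add: hin mult module_hom_add[OF hom] module_hom_smult[OF hom] hG[OF A.Gr_one] i' shift_one)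
 then show ?thesis using hG by blast
qed

text \<open>By the universal property it is enough to let \<open>R\<close> and \<open>S\<close> act
  separately. That an element of \<open>Gr C n\<close> acts as a shift by \<open>n\<close> is
  checked on words of degree \<open>n\<close> and extended linearly.\<close>

lemma shift_rep: "\<exists>G \<in> alg_hom K C EW. \<forall>n. \<forall>x \<in> Gr C n. G x = shift n x"
proof -
 interpret EW: assoc_algebra K EW by (rule EW_assoc)
 obtain h1 where h1: "h1 \<in> alg_hom K R EW" "!!n r. r \<in> Gr R n ==> h1 r = shift n (L (Inl r))"
  using shift_hom[OF R.dg_algebra_axioms L1_hom] by blast
 obtain h2 where h2: "h2 \<in> alg_hom K S EW" "!!n r. r \<in> Gr S n ==> h2 r = shift n (L (Inr r))"
  using shift_hom[OF S.dg_algebra_axioms L2_hom] by blast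
 obtain G where G: "G \<in> alg_hom K C EW" "\<forall>r \<in> carrier R. G (L (Inl r)) = h1 r" "\<forall>s \<in> carrier S. G (L (Inr s)) = h2 s"
  using universal[OF EW_assoc h1(1) h2(1)] by blast
 note G' = alg_homD[OF G(1)]
 have GL: "G (L z) = shift i (L z)" if "z \<in> hl i" for z i
  using that G h1 h2 R.Gr_in S.Gr_in by auto
 have Gw: "G (Q.cls (word K w)) = shift n (Q.cls (word K w))" if "word_deg hl n w" for n w
  using that
 proof (induction w arbitrary: n)
  case Nil then show ?case by (simp add: cls_word_Nil shift_one G')
 next
  case (Cons z w)
  then obtain i where i: "z \<in> hl i" "word_deg hl (n - i) w" by auto
  have z: "z \<in> X" "w \<in> lists X" using hl_X i word_deg_X by auto
  then show ?case using GL[OF i(1)] Cons.IH[OF i(2)] shift_mult[OF L_in[OF z(1)] Q.cls_in[OF word_P[OF z(2)]], of i "n - i"]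
   by (simp add: cls_word_Cons G' L_in Q.cls_in word_P)
 qed
 have zero: "shift n \<zero>\<^sub>C = \<zero>\<^sub>EW" for n
  by (auto simp: End_alg_simps shift_def W_simps Pi_iff intro!: restrict_ext)
 have "G (Q.cls f) = shift n (Q.cls f)" if "f \<in> Gr P n" for n f
  using that
 proof (induction f rule: Gr_P_induct)
  case zero then show ?case
   using module_hom_zero[OF C.module_axioms EW.module_axioms G'(1)] by (simp add: Q.cls_zero[symmetric] \<open>shift n \<zero>\<^sub>C = \<zero>\<^sub>EW\<close>)
 next
  case (word c w) then show ?case
   by (simp add: Q.cls_smult[symmetric] word_P word_deg_X G' Gw shift_smult Q.cls_in)
 next
  case (add f g) then show ?case by (simp add: Q.cls_add[symmetric] G' shift_add Q.cls_in)
 qed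
 then have "\<forall>n. \<forall>x \<in> Gr C n. G x = shift n x" by (auto simp: Gr_C)
 then show ?thesis using G(1) by blast
qed

lemma degree_projection:
 "\<exists>\<pi> \<in> module_hom K C C. \<forall>n. \<forall>x \<in> Gr C n. \<pi> x = (if n = m then x else \<zero>\<^sub>C)"
proof -
 obtain G where G: "G \<in> alg_hom K C EW" "!!n x. x \<in> Gr C n ==> G x = shift n x"
  using shift_rep by blast
 note G' = alg_homD[OF G(1)]
 \<comment> \<open>On the sequence with the unit at place 0, an element of degree \<open>n\<close>
   produces the sequence with that element at place \<open>n\<close>; reading place \<open>m\<close>
   is the projection.\<close>
 define e where "e = (%n::int. if n = 0 then \<one>\<^sub>C else \<zero>\<^sub>C)"
 have e: "e :. W" by (simp add: W_simps e_def)
 have Gin: "G x e :. W" if "x :. C" for x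
 proof -
  have "G x \<in> module_hom K W W" using G'(2)[OF that] by (simp add: End_alg_simps)
  then show ?thesis using e by (rule module_hom_in)
 qed
 show ?thesis
 proof (intro bexI[of _ "%x. G x e m"] allI ballI)
  show "(%x. G x e m) \<in> module_hom K C C"
   by (rule module_homI) (use Gin e in "simp_all add: G' End_alg_simps, auto simp: W_simps")
  fix n x assume x: "x \<in> Gr C n"
  then show "G x e m = (if n = m then x else \<zero>\<^sub>C)"
   using e Gr_C_in[OF x] by (simp add: G(2)[OF x] shift_def) (simp add: e_def)
 qed
qed

text \<open>Sums of homogeneous elements as an inductive closure, which makes stability under
  products a double induction instead of a manipulation of finite sums.\<close>

inductive_set hspan where
 homogeneous: "x \<in> Gr C n ==> x \<in> hspan"
| add: "x \<in> hspan ==> y \<in> hspan ==> x \<oplus>\<^sub>C y \<in> hspan"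

lemma hspan_in: "x \<in> hspan ==> x :. C"
 by (induction rule: hspan.induct) (simp_all add: Gr_C_in)

lemma hspan_hdecomp: "x \<in> hspan ==> \<exists>F c. finite F & (\<forall>n. c n \<in> Gr C n) & (\<forall>n. n \<notin> F --> c n = \<zero>\<^sub>C) & x = (\<Oplus>\<^sub>C n\<in>F. c n)"
proof (induction rule: hspan.induct)
 case (homogeneous x n)
 show ?case
  proof (intro exI[of _ "{n}"] exI[of _ "%m. if m = n then x else \<zero>\<^sub>C"] conjI allI impI)
   show "(if k = n then x else \<zero>\<^sub>C) \<in> Gr C k" for k
    using homogeneous by (cases "k = n") (simp_all add: Gr_C_zero)
   have "x :. C" using homogeneous by (rule Gr_C_in)
   then show "x = (\<Oplus>\<^sub>C k\<in>{n}. if k = n then x else \<zero>\<^sub>C)" by simp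
  qed simp_all
next
 case (add x y)
 then obtain F c F' c' where F: "finite F" "!!n. c n \<in> Gr C n" "!!n. n \<notin> F ==> c n = \<zero>\<^sub>C" "x = (\<Oplus>\<^sub>C n\<in>F. c n)"
  and F': "finite F'" "!!n. c' n \<in> Gr C n" "!!n. n \<notin> F' ==> c' n = \<zero>\<^sub>C" "y = (\<Oplus>\<^sub>C n\<in>F'. c' n)"
  by metis
 have 1: "(\<Oplus>\<^sub>C n\<in>F. c n) = (\<Oplus>\<^sub>C n\<in>F \<union> F'. c n)"
  by (rule C.add.finprod_mono_neutral_cong_left) (use F F'(1) Gr_C_in[OF F(2)] in auto)
 have 2: "(\<Oplus>\<^sub>C n\<in>F'. c' n) = (\<Oplus>\<^sub>C n\<in>F \<union> F'. c' n)"
  by (rule C.add.finprod_mono_neutral_cong_left) (use F' F(1) Gr_C_in[OF F'(2)] in auto)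
 have "x \<oplus>\<^sub>C y = (\<Oplus>\<^sub>C n\<in>F \<union> F'. c n \<oplus>\<^sub>C c' n)"
  unfolding F(4) F'(4) 1 2 by (rule C.finsum_addf[symmetric]) (use Gr_C_in[OF F(2)] Gr_C_in[OF F'(2)] in auto)
 then show ?case
  by (intro exI[of _ "F \<union> F'"] exI[of _ "%n. c n \<oplus>\<^sub>C c' n"])
   (use F F' in "auto intro: Gr_C_add")
qed

lemma hspan_smult: "x \<in> hspan ==> c :. K ==> c \<odot>\<^sub>C x \<in> hspan"
 by (induction rule: hspan.induct) (auto intro: hspan.intros Gr_C_smult simp: C.smult_r_distr hspan_in)

lemma hspan_mult: "x \<in> hspan ==> y \<in> hspan ==> x \<otimes>\<^sub>C y \<in> hspan"
proof (induction rule: hspan.induct)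
 case (homogeneous x m)
 from homogeneous(2) show ?case
  using homogeneous(1)
  by (induction rule: hspan.induct) (auto intro: hspan.intros Gr_C_mult simp: C.r_distr hspan_in Gr_C_in)
next
 case (add x y) then show ?case by (auto intro: hspan.intros simp: C.l_distr hspan_in)
qed

lemma L_hspan: "z \<in> X ==> L z \<in> hspan"
proof (erule X_cases)
 fix r assume "r :. R" "z = Inl r"
 then show "L z \<in> hspan"
 proof (induction r arbitrary: z rule: R.homogeneous_induct)
  case (homogeneous n r) then show ?case by (intro hspan.homogeneous[of _ n] L_Gr) auto
 next
  case (add r r') then show ?case by (simp add: alg_homD(3)[OF L1_hom] hspan.add)
 qed
next
 fix r assume "r :. S" "z = Inr r"
 then show "L z \<in> hspan"
 proof (induction r arbitrary: z rule: S.homogeneous_induct)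
  case (homogeneous n r) then show ?case by (intro hspan.homogeneous[of _ n] L_Gr) auto
 next
  case (add r r') then show ?case by (simp add: alg_homD(3)[OF L2_hom] hspan.add)
 qed
qed

lemma hspan_C: "x :. C ==> x \<in> hspan"
 by (induction rule: C_induct)
  (auto intro: hspan.homogeneous[OF Gr_C_zero] hspan.homogeneous[OF Gr_C_one] hspan_mult L_hspan hspan.add hspan_smult)

text \<open>Decompositions exist because letters, hence words, are sums of homogeneous elements.
  They are unique because a linear projection onto each degree recovers the component from the
  element.\<close>

lemma C_direct_sum: "x :. C ==> \<exists>!c. hdecomp C x c"
proof (rule ex_ex1I)
 assume x: "x :. C"
 obtain F c where F: "finite F" "!!n. c n \<in> Gr C n" "!!n. n \<notin> F ==> c n = \<zero>\<^sub>C" "x = (\<Oplus>\<^sub>C n\<in>F. c n)"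
  using hspan_hdecomp[OF hspan_C[OF x]] by blast
 have sub: "{n. c n ~= \<zero>\<^sub>C} <= F" using F(3) by auto
 have "(\<Oplus>\<^sub>C n\<in>{n. c n ~= \<zero>\<^sub>C}. c n) = (\<Oplus>\<^sub>C n\<in>F. c n)"
  by (rule C.add.finprod_mono_neutral_cong_left) (use F(1) sub Gr_C_in[OF F(2)] in auto)
 then show "\<exists>c. hdecomp C x c" using F finite_subset[OF sub F(1)] by (auto simp: hdecomp_def)
next
 have e: "c m = \<pi> x" if "hdecomp C x c" "\<pi> \<in> module_hom K C C"
  "!!n x. x \<in> Gr C n ==> \<pi> x = (if n = m then x else \<zero>\<^sub>C)" for c m \<pi>
 proof -
  have c: "c n \<in> Gr C n" "finite {n. c n ~= \<zero>\<^sub>C}" "x = (\<Oplus>\<^sub>C n\<in>{n. c n ~= \<zero>\<^sub>C}. c n)" for n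
   using that(1) by (auto simp: hdecomp_def)
  let ?F = "insert m {n. c n ~= \<zero>\<^sub>C}"
  have cin: "c n :. C" for n using Gr_C_in[OF c(1)] .
  have "x = (\<Oplus>\<^sub>C n\<in>?F. c n)"
   unfolding c(3) by (rule C.add.finprod_mono_neutral_cong_left) (use c(2) cin in auto)
  then have "\<pi> x = (\<Oplus>\<^sub>C n\<in>?F. \<pi> (c n))"
   using module_hom_finsum[OF C.module_axioms C.module_axioms that(2), of ?F c] c(2) cin by simp
  also have "\<dots> = (\<Oplus>\<^sub>C n\<in>?F. if m = n then c n else \<zero>\<^sub>C)"
   using that(3)[OF c(1)] by (intro C.finsum_cong') (auto simp: cin)
  also have "\<dots> = c m" by (rule C.finsum_singleton) (use c(2) cin in auto)
  finally show ?thesis by simp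
 qed
 fix c c' assume "hdecomp C x c" "hdecomp C x c'"
 have "c m = c' m" for m
 proof -
  obtain \<pi> where "\<pi> \<in> module_hom K C C" "!!n x. x \<in> Gr C n ==> \<pi> x = (if n = m then x else \<zero>\<^sub>C)"
   using degree_projection[of m] by blast
  then show ?thesis using e[OF \<open>hdecomp C x c\<close>, of \<pi> m] e[OF \<open>hdecomp C x c'\<close>, of \<pi> m] by simp
 qed
 then show "c = c'" by (rule ext)
qed

text \<open>The twisted Leibniz rule of the free algebra descends, and \<open>cls_sig\<close> turns
  its twist into the Koszul sign.\<close>

lemma C_dg_algebra: "dg_algebra K C"
proof (intro dg_algebra.intro C.assoc_algebra_axioms dg_algebra_axioms.intro Gr_C_subspace C_direct_sum
  Gr_C_one Gr_C_mult dif_C_hom dif_C_dif_C)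
 fix x n assume "x \<in> Gr C n"
 then show "dif C x \<in> Gr C (n + 1)"
  unfolding Gr_C using dif_P_Gr dif_C Gr_P_in by blast
 fix y assume y: "y :. C"
 obtain f g where "f \<in> Gr P n" "x = Q.cls f" "g :. P" "y = Q.cls g"
  using \<open>x \<in> Gr C n\<close> Q.Q_rep[OF y] by (auto simp: Gr_C)
 moreover from this have "dif C (x \<otimes>\<^sub>C y) = Q.cls (dif P f \<otimes>\<^sub>P g) \<oplus>\<^sub>C Q.cls (sig f) \<otimes>\<^sub>C Q.cls (dif P g)"
  by (simp add: Q.cls_mult Gr_P_in dif_C dif_P_mult Q.cls_add dif_P_in sig)
 ultimately show "dif C (x \<otimes>\<^sub>C y) = dif C x \<otimes>\<^sub>C y \<oplus>\<^sub>C ksign K n \<odot>\<^sub>C (x \<otimes>\<^sub>C dif C y)"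
  by (simp add: cls_sig Q.cls_mult[symmetric] Gr_P_in dif_P_in dif_C C.smult_mult_left R.R.ksign_in Q.cls_in)
qed

end

subsection \<open>Matrix units\<close>

text \<open>Here \<open>e i j\<close> are matrix units and \<open>ent i j m\<close> is the entry of
  \<open>m\<close> in row \<open>i\<close> and column \<open>j\<close>. An empty \<open>B\<close> is
  allowed; then the unit is an empty sum and the algebra is zero.\<close>

locale matrix_units = assoc_algebra K E for K :: "('k, 'c) ring_scheme" and E :: "('k, 'm, 'd) module_scheme" +
 fixes B :: "'i set" and e :: "'i => 'i => 'm" and ent :: "'i => 'i => 'm => 'k"
 assumes finB: "finite B"
  and e_in: "[|i \<in> B; j \<in> B|] ==> e i j :. E"
  and e_mult: "[|i \<in> B; j \<in> B; k \<in> B; l \<in> B|] ==> e i j \<otimes>\<^sub>E e k l = (if j = k then e i l else \<zero>\<^sub>E)"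
  and e_sum: "(\<Oplus>\<^sub>E i\<in>B. e i i) = \<one>\<^sub>E"
  and ent_in: "[|i \<in> B; j \<in> B; m :. E|] ==> ent i j m :. K"
  and e_m_e: "[|i \<in> B; j \<in> B; k \<in> B; l \<in> B; m :. E|] ==> e k i \<otimes>\<^sub>E m \<otimes>\<^sub>E e j l = ent i j m \<odot>\<^sub>E e k l"
  and e_nonzero: "i \<in> B ==> e i i ~= \<zero>\<^sub>E"
begin

text \<open>A nonzero difference of the scalars would be invertible and annihilate the nonzero
  element \<open>e i i\<close>.\<close>

lemma smult_cancel:
 assumes "i \<in> B" "a :. K" "b :. K" "a \<odot>\<^sub>E e i i = b \<odot>\<^sub>E e i i"
 shows "a = b"
proof (rule ccontr)
 assume "a ~= b"
 let ?c = "a \<ominus>\<^sub>K b"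
 have c: "?c :. K" "?c ~= \<zero>\<^sub>K" using R.eq_if_minus_zero[OF assms(2,3)] \<open>a ~= b\<close> assms(2,3) by blast+
 have "?c \<odot>\<^sub>E e i i = \<zero>\<^sub>E"
  using assms e_in by (simp add: R.minus_eq smult_l_distr smult_l_minus r_neg)
 have u: "?c \<in> Units K" using c field_Units by blast
 have i: "inv\<^bsub>K\<^esub> ?c :. K" "inv\<^bsub>K\<^esub> ?c \<otimes>\<^sub>K ?c = \<one>\<^sub>K" using u by simp_all
 have "inv\<^bsub>K\<^esub> ?c \<odot>\<^sub>E (?c \<odot>\<^sub>E e i i) = \<zero>\<^sub>E"
  unfolding \<open>?c \<odot>\<^sub>E e i i = \<zero>\<^sub>E\<close> using i by simp
 moreover have "inv\<^bsub>K\<^esub> ?c \<odot>\<^sub>E (?c \<odot>\<^sub>E e i i) = e i i"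
  using i c(1) e_in assms(1) by (simp add: smult_assoc1[symmetric])
 ultimately show False using e_nonzero assms by simp
qed

lemma ent_smult_one: "i \<in> B ==> a :. K ==> ent i i (a \<odot>\<^sub>E \<one>\<^sub>E) = a"
 using e_m_e[of i i i i "a \<odot>\<^sub>E \<one>\<^sub>E"] e_in[of i i] e_mult[of i i i i]
 by (intro smult_cancel[of i]) (simp_all add: ent_in smult_mult_left smult_mult_right)

lemma ent_hom: "i \<in> B ==> ent i i \<in> module_hom K E (base_alg K)"
proof (rule module_homI, unfold base_alg_simps)
 fix x y assume i: "i \<in> B" and xy: "x :. E" "y :. E"
 show "ent i i (x \<oplus>\<^sub>E y) = ent i i x \<oplus>\<^sub>K ent i i y"
  using i xy e_in[OF i i] e_m_e[OF i i i i, symmetric]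
  by (intro smult_cancel[OF i]) (simp_all add: ent_in smult_l_distr r_distr l_distr)
next
 fix c x assume i: "i \<in> B" and xy: "x :. E" "c :. K"
 show "ent i i (c \<odot>\<^sub>E x) = c \<otimes>\<^sub>K ent i i x"
  using i xy e_in[OF i i] e_m_e[OF i i i i, symmetric]
  by (intro smult_cancel[OF i]) (simp_all add: ent_in smult_assoc1 smult_mult_left smult_mult_right)
qed (simp add: ent_in)

text \<open>Moving \<open>m\<close> to the left through \<open>e k t\<close> in
  \<open>e k t m e t k\<close> shows that \<open>m e k k\<close> is the diagonal entry of
  \<open>m\<close> at \<open>t\<close> times \<open>e k k\<close>; summation over \<open>k\<close>
  gives \<open>m\<close> itself. One diagonal entry suffices, with no division by the
  dimension.\<close>

lemma central_scalar:
 assumes m: "m :. E" and com: "!!x. x :. E ==> m \<otimes>\<^sub>E x = x \<otimes>\<^sub>E m" and t: "t \<in> B"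
 shows "m = ent t t m \<odot>\<^sub>E \<one>\<^sub>E"
proof -
 have k: "m \<otimes>\<^sub>E e k k = ent t t m \<odot>\<^sub>E e k k" if k: "k \<in> B" for k
 proof -
  have "ent t t m \<odot>\<^sub>E e k k = (e k t \<otimes>\<^sub>E m) \<otimes>\<^sub>E e t k" using e_m_e k t m by simp
  also have "\<dots> = m \<otimes>\<^sub>E (e k t \<otimes>\<^sub>E e t k)" using com[OF e_in[OF k t]] e_in k t m by (simp add: m_assoc[symmetric])
  finally show ?thesis using e_mult k t by simp
 qed
 have "m = m \<otimes>\<^sub>E (\<Oplus>\<^sub>E i\<in>B. e i i)" using e_sum m by simp
 also have "\<dots> = (\<Oplus>\<^sub>E i\<in>B. m \<otimes>\<^sub>E e i i)" by (rule finsum_rdistr[OF finB m]) (simp add: e_in)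
 also have "\<dots> = (\<Oplus>\<^sub>E i\<in>B. ent t t m \<odot>\<^sub>E e i i)"
  by (rule finsum_cong') (simp_all add: k e_in ent_in t m Pi_def)
 also have "\<dots> = ent t t m \<odot>\<^sub>E (\<Oplus>\<^sub>E i\<in>B. e i i)"
  by (rule finsum_smult_ldistr[symmetric]) (simp_all add: finB e_in ent_in t m)
 finally show ?thesis using e_sum by simp
qed

end

text \<open>For a finite basis \<open>B\<close>, the map \<open>e i j\<close> sends a vector to its
  \<open>j\<close>-th coordinate times the basis vector \<open>i\<close>, and the entry of
  \<open>m\<close> is the \<open>i\<close>-th coordinate of \<open>m j\<close>. The basis vectors
  themselves serve as indices.\<close>

lemma End_matrix_units:
 fixes V :: "('k, 'v, 'd) module_scheme"
 assumes "vectorspace K V" "vectorspace.fin_dim K V"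
 shows "\<exists>B e ent. matrix_units K (End_alg K V) (B :: 'v set) e ent"
proof -
 interpret V: vectorspace K V by fact
 interpret E: assoc_algebra K "End_alg K V" by (rule End_alg_assoc_algebra[OF assms(1)])
 obtain B where B: "finite B" "V.basis B" using V.finite_basis_exists[OF assms(2)] by blast
 have BV: "B <= carrier V" using B(2) by (simp add: V.basis_def)
 have Bin: "i :. V" if "i \<in> B" for i using BV that by blast
 define lc where "lc a = (\<Oplus>\<^sub>V i\<in>B. a i \<odot>\<^sub>V i)" for a
 have uniq: "\<exists>!a. a \<in> B \<rightarrow>\<^sub>E carrier K & lc a = v" if "v :. V" for v
  using V.basis_criterion[OF B(1) BV] B(2) that by (simp add: V.lincomb_def lc_def)
 define co where "co v = (THE a. a \<in> B \<rightarrow>\<^sub>E carrier K & lc a = v)" for v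
 have co: "co v \<in> B \<rightarrow>\<^sub>E carrier K" "lc (co v) = v" if "v :. V" for v
  using theI'[OF uniq[OF that]] by (simp_all add: co_def)
 have co_in: "co v i :. K" if "v :. V" "i \<in> B" for v i using co(1)[OF that(1)] that(2) by auto
 have co_eq: "co (lc a) i = a i" if "!!i. i \<in> B ==> a i :. K" "i \<in> B" for a i
 proof -
  have lca: "lc (restrict a B) = lc a" unfolding lc_def
   by (rule V.M.finsum_cong') (use that Bin in auto)
  have "lc a :. V" unfolding lc_def by (rule V.M.finsum_closed) (use that Bin in auto)
  then have "co (lc a) = restrict a B"
   using uniq[of "lc a"] co[of "lc a"] lca that(1) by (metis (no_types, lifting) restrict_PiE_iff)
  then show ?thesis using that(2) by simp
 qed
 have co_add: "co (v \<oplus>\<^sub>V w) i = co v i \<oplus>\<^sub>K co w i" if "v :. V" "w :. V" "i \<in> B" for v w i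
 proof -
  have "lc (%i. co v i \<oplus>\<^sub>K co w i) = (\<Oplus>\<^sub>V i\<in>B. co v i \<odot>\<^sub>V i \<oplus>\<^sub>V co w i \<odot>\<^sub>V i)"
   unfolding lc_def by (rule V.M.finsum_cong') (use that co_in Bin in "auto simp: V.smult_l_distr")
  also have "\<dots> = lc (co v) \<oplus>\<^sub>V lc (co w)"
   unfolding lc_def by (rule V.M.finsum_addf) (use that co_in Bin in auto)
  finally have "v \<oplus>\<^sub>V w = lc (%i. co v i \<oplus>\<^sub>K co w i)" using co that by simp
  then show ?thesis using co_eq[of "%i. co v i \<oplus>\<^sub>K co w i" i] that co_in by simp
 qed
 have co_smult: "co (c \<odot>\<^sub>V v) i = c \<otimes>\<^sub>K co v i" if "v :. V" "c :. K" "i \<in> B" for v c i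
 proof -
  have "lc (%i. c \<otimes>\<^sub>K co v i) = (\<Oplus>\<^sub>V i\<in>B. c \<odot>\<^sub>V (co v i \<odot>\<^sub>V i))"
   unfolding lc_def by (rule V.M.finsum_cong') (use that co_in Bin in "auto simp: V.smult_assoc1")
  also have "\<dots> = c \<odot>\<^sub>V lc (co v)"
   unfolding lc_def by (rule V.finsum_smult_ldistr[symmetric]) (use that co_in Bin B in auto)
  finally have "c \<odot>\<^sub>V v = lc (%i. c \<otimes>\<^sub>K co v i)" using co that by simp
  then show ?thesis using co_eq[of "%i. c \<otimes>\<^sub>K co v i" i] that co_in by simp
 qed
 have co_basis: "co j i = (if i = j then \<one>\<^sub>K else \<zero>\<^sub>K)" if ij: "i \<in> B" "j \<in> B" for i j
 proof -
  have "lc (%i. if j = i then \<one>\<^sub>K else \<zero>\<^sub>K) = (\<Oplus>\<^sub>V i\<in>B. if j = i then i else \<zero>\<^sub>V)"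
   unfolding lc_def by (rule V.M.finsum_cong') (use Bin in auto)
  also have "\<dots> = j" by (rule V.M.finsum_singleton) (use ij B Bin in auto)
  finally show ?thesis using co_eq[of "%i. if j = i then \<one>\<^sub>K else \<zero>\<^sub>K" i] ij by auto
 qed
 define e where "e i j = (\<lambda>v \<in> carrier V. co v j \<odot>\<^sub>V i)" for i j
 have e_in: "e i j :. (End_alg K V)" if "i \<in> B" "j \<in> B" for i j
  unfolding End_alg_simps e_def
  by (intro IntI module_homI)
   (simp_all add: that co_in Bin co_add co_smult V.smult_l_distr V.smult_assoc1)
 have mV: "m v :. V" if "m :. (End_alg K V)" "v :. V" for m v
  using that by (auto simp: End_alg_simps intro: module_hom_in)
 have ms: "m (c \<odot>\<^sub>V v) = c \<odot>\<^sub>V m v" if "m :. (End_alg K V)" "v :. V" "c :. K" for m v c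
  using that by (auto simp: End_alg_simps module_hom_smult)
 have ext: "m = m'" if "m :. (End_alg K V)" "m' :. (End_alg K V)" "!!v. v :. V ==> m v = m' v" for m m'
  using that by (auto simp: End_alg_simps intro: extensionalityI)
 have "matrix_units K (End_alg K V) B e (%i j m. co (m j) i)"
 proof (intro matrix_units.intro E.assoc_algebra_axioms matrix_units_axioms.intro B(1) e_in)
  fix i j k l assume a: "i \<in> B" "j \<in> B" "k \<in> B" "l \<in> B"
  show "e i j \<otimes>\<^bsub>End_alg K V\<^esub> e k l = (if j = k then e i l else \<zero>\<^bsub>End_alg K V\<^esub>)"
  proof (rule ext)
   show "e i j \<otimes>\<^bsub>End_alg K V\<^esub> e k l :. (End_alg K V)" using e_in a by simp
   show "(if j = k then e i l else \<zero>\<^bsub>End_alg K V\<^esub>) :. (End_alg K V)" using e_in a by simp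
   fix v assume v: "v :. V"
   then show "(e i j \<otimes>\<^bsub>End_alg K V\<^esub> e k l) v = (if j = k then e i l else \<zero>\<^bsub>End_alg K V\<^esub>) v"
    using a Bin co_in by (simp add: End_alg_simps compose_eq e_def co_smult co_basis)
  qed
  fix m assume m: "m :. (End_alg K V)"
  show "e k i \<otimes>\<^bsub>End_alg K V\<^esub> m \<otimes>\<^bsub>End_alg K V\<^esub> e j l = co (m j) i \<odot>\<^bsub>End_alg K V\<^esub> e k l"
  proof (rule ext)
   show "e k i \<otimes>\<^bsub>End_alg K V\<^esub> m \<otimes>\<^bsub>End_alg K V\<^esub> e j l :. (End_alg K V)" using e_in a m by simp
   show "co (m j) i \<odot>\<^bsub>End_alg K V\<^esub> e k l :. (End_alg K V)" using e_in a m mV Bin co_in by simp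
   fix v assume v: "v :. V"
   then show "(e k i \<otimes>\<^bsub>End_alg K V\<^esub> m \<otimes>\<^bsub>End_alg K V\<^esub> e j l) v = (co (m j) i \<odot>\<^bsub>End_alg K V\<^esub> e k l) v"
    using a Bin co_in mV[OF m] by (simp add: End_alg_simps compose_eq e_def ms[OF m] co_smult V.smult_assoc1[symmetric] V.R.m_comm)
  qed
 next
  fix i j m assume "i \<in> B" "j \<in> B" "m :. (End_alg K V)"
  then show "co (m j) i :. K" using co_in mV Bin by simp
 next
  fix i assume i: "i \<in> B"
  have "i ~= \<zero>\<^sub>V"
  proof
   assume "i = \<zero>\<^sub>V"
   moreover have "co (\<zero>\<^sub>K \<odot>\<^sub>V i) i = \<zero>\<^sub>K" using co_smult[OF Bin[OF i] V.R.zero_closed i] co_in[OF Bin[OF i] i] by simp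
   ultimately show False using co_basis[OF i i] Bin[OF i] by simp
  qed
  moreover have "e i i i = i" using i Bin co_basis[OF i i] by (simp add: e_def)
  ultimately show "e i i ~= \<zero>\<^bsub>End_alg K V\<^esub>" using Bin[OF i] by (auto simp: End_alg_simps)
 next
  show "(\<Oplus>\<^bsub>End_alg K V\<^esub>i\<in>B. e i i) = \<one>\<^bsub>End_alg K V\<^esub>"
  proof (rule ext)
   show "(\<Oplus>\<^bsub>End_alg K V\<^esub>i\<in>B. e i i) :. (End_alg K V)" by (rule E.finsum_closed) (use e_in in auto)
   fix v assume v: "v :. V"
   have ev: "(%m. m v) \<in> module_hom K (End_alg K V) V"
    by (rule module_homI) (use v mV in "simp_all add: End_alg_simps")
   have "(\<Oplus>\<^bsub>End_alg K V\<^esub>i\<in>B. e i i) v = (\<Oplus>\<^sub>V i\<in>B. e i i v)"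
    by (rule module_hom_finsum[OF E.module_axioms V.module_axioms ev B(1)]) (use e_in in auto)
   also have "\<dots> = lc (co v)" unfolding lc_def
    by (rule V.M.finsum_cong') (use v co_in Bin in "auto simp: e_def")
   finally show "(\<Oplus>\<^bsub>End_alg K V\<^esub>i\<in>B. e i i) v = \<one>\<^bsub>End_alg K V\<^esub> v" using v co by (simp add: End_alg_simps)
  qed simp
 qed
 then show ?thesis by blast
qed

subsection \<open>Graded commutators\<close>

context dg_algebra begin

lemma hcomp_zero: "hcomp R \<zero>\<^sub>R n = \<zero>\<^sub>R"
 using hcomp_homogeneous[OF Gr_zero] by simp

text \<open>The graded commutator with the degrees as parameters, since the zero element is
  homogeneous of every degree and does not determine them.\<close>

definition bracket :: "int => int => 'a => 'a => 'a" where
 "bracket i j x y = (x \<otimes>\<^sub>R y) \<ominus>\<^sub>R (ksign K (i * j) \<odot>\<^sub>R (y \<otimes>\<^sub>R x))"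

lemma bracket_in: "x :. R ==> y :. R ==> bracket i j x y :. R"
 by (simp add: bracket_def R.ksign_in)

lemma bracket_zero: "y :. R ==> bracket i j y \<zero>\<^sub>R = \<zero>\<^sub>R" "y :. R ==> bracket i j \<zero>\<^sub>R y = \<zero>\<^sub>R"
 by (simp_all add: bracket_def R.ksign_in minus_self)

text \<open>The support of a homogeneous element is one degree, or empty for zero; the hypothesis on
  \<open>f n\<close> at zero makes both cases agree.\<close>

lemma finsum_hsupp_homogeneous:
 assumes "y \<in> Gr R n" "!!z. z \<in> Gr R n ==> f n z :. R" "f n \<zero>\<^sub>R = \<zero>\<^sub>R"
 shows "(\<Oplus>\<^sub>R j \<in> hsupp R y. f j (hcomp R y j)) = f n y"
proof (cases "y = \<zero>\<^sub>R")
 case True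
 have "hsupp R \<zero>\<^sub>R = {}" by (simp add: hsupp_def hcomp_zero)
 then show ?thesis using True assms(3) by simp
next
 case False
 then have "hsupp R y = {n}" using assms(1) by (auto simp: hsupp_def hcomp_homogeneous)
 then show ?thesis using assms by (simp add: hcomp_homogeneous)
qed

lemma gcomm_eq: "gcomm K R x y = (\<Oplus>\<^sub>R i \<in> hsupp R x. \<Oplus>\<^sub>R j \<in> hsupp R y. bracket i j (hcomp R x i) (hcomp R y j))"
 by (simp add: gcomm_def bracket_def)

lemma gcomm_homogeneous:
 assumes "x \<in> Gr R i" "y \<in> Gr R j"
 shows "gcomm K R x y = bracket i j x y"
proof -
 have "(\<Oplus>\<^sub>R j \<in> hsupp R y. bracket i' j z (hcomp R y j)) = bracket i' j z y" if "z :. R" for i' z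
  by (rule finsum_hsupp_homogeneous[OF assms(2), of "%j. bracket i' j z"]) (simp_all add: bracket_in Gr_in that bracket_zero)
 then have "gcomm K R x y = (\<Oplus>\<^sub>R i' \<in> hsupp R x. bracket i' j (hcomp R x i') y)"
  unfolding gcomm_eq by (intro finsum_cong') (auto simp: hcomp_in Gr_in[OF assms(1)] Gr_in[OF assms(2)] bracket_in)
 also have "\<dots> = bracket i j x y"
  by (rule finsum_hsupp_homogeneous[OF assms(1), of "%i x. bracket i j x y"]) (simp_all add: bracket_in Gr_in[OF assms(2)] Gr_in bracket_zero)
 finally show ?thesis .
qed

text \<open>Against an element of degree 0 all signs are trivial, also for inhomogeneous
  \<open>x\<close>. Hence the graded centralizer of End V in the coproduct is the ordinary
  one.\<close>

lemma gcomm_deg0: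
 assumes "x :. R" "y \<in> Gr R 0"
 shows "gcomm K R x y = (x \<otimes>\<^sub>R y) \<ominus>\<^sub>R (y \<otimes>\<^sub>R x)"
proof -
 have y: "y :. R" using assms Gr_in by blast
 let ?f = "%x. (x \<otimes>\<^sub>R y) \<ominus>\<^sub>R (y \<otimes>\<^sub>R x)"
 have hom: "?f \<in> module_hom K R R"
  by (rule module_homI) (simp_all add: y minus_eq l_distr r_distr minus_add a_interchange smult_mult_left
   smult_mult_right smult_r_distr smult_r_minus)
 have b: "bracket i 0 z y = ?f z" if "z :. R" for i z using that y by (simp add: bracket_def ksign_def)
 have "(\<Oplus>\<^sub>R j \<in> hsupp R y. bracket i j z (hcomp R y j)) = bracket i 0 z y" if "z :. R" for i z
  by (rule finsum_hsupp_homogeneous[OF assms(2), of "%j. bracket i j z"]) (simp_all add: bracket_in Gr_in that bracket_zero)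
 then have "gcomm K R x y = (\<Oplus>\<^sub>R i \<in> hsupp R x. ?f (hcomp R x i))"
  unfolding gcomm_eq using assms y by (intro finsum_cong') (auto simp: hcomp_in b)
 also have "\<dots> = ?f (\<Oplus>\<^sub>R i \<in> hsupp R x. hcomp R x i)"
  using assms by (intro module_hom_finsum[OF module_axioms module_axioms hom, symmetric]) (auto simp: hsupp_finite hcomp_in)
 finally show ?thesis using hcomp_sum[OF assms(1) hsupp_finite[OF assms(1)] order_refl] by simp
qed

lemma gcomm_in: "x :. R ==> y :. R ==> gcomm K R x y :. R"
 unfolding gcomm_eq by (intro finsum_closed) (auto simp: bracket_in hcomp_in)

lemma comm_ideal_ideal: "ideal (comm_ideal K R) R"
 unfolding comm_ideal_def by (rule genideal_ideal) (auto simp: gcomm_in)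

lemma comm_ideal_bracket:
 assumes "x \<in> Gr R i" "y \<in> Gr R j" shows "bracket i j x y \<in> comm_ideal K R"
proof -
 have "gcomm K R x y \<in> {gcomm K R x y | x y. x :. R & y :. R}"
  using Gr_in assms by blast
 moreover have "{gcomm K R x y | x y. x :. R & y :. R} <= comm_ideal K R"
  unfolding comm_ideal_def by (rule genideal_self) (auto simp: gcomm_in)
 ultimately show ?thesis using gcomm_homogeneous[OF assms] by auto
qed

lemma comm_ideal_least:
 assumes J: "ideal J R" and b: "!!i j x y. [|x \<in> Gr R i; y \<in> Gr R j|] ==> bracket i j x y \<in> J"
 shows "comm_ideal K R <= J"
 unfolding comm_ideal_def
proof (rule genideal_minimal[OF J], safe)
 interpret J: ideal J R by fact
 fix x y assume x: "x :. R" and y: "y :. R"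
 have s: "(\<Oplus>\<^sub>R i \<in> S. f i) \<in> J" if "finite S" "!!i. i \<in> S ==> f i \<in> J" for S :: "int set" and f
  using that
 proof induction
  case (insert i S)
  then show ?case using J.a_subset by (subst finsum_insert) (auto intro!: J.a_closed)
 qed simp
 show "gcomm K R x y \<in> J"
  unfolding gcomm_eq using x y by (intro s b hsupp_finite hcomp_Gr)
qed

lemma dif_bracket:
 assumes x: "x \<in> Gr R i" and y: "y \<in> Gr R j"
 shows "dif R (bracket i j x y) = bracket (i + 1) j (dif R x) y \<oplus>\<^sub>R ksign K i \<odot>\<^sub>R bracket i (j + 1) x (dif R y)"
proof -
 have c: "x :. R" "y :. R" using x y Gr_in by auto
 have k1: "ksign K ((i + 1) * j) = ksign K (i * j) \<otimes>\<^sub>K ksign K j"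
  using R.ksign_add[of "i * j" j] by (simp add: algebra_simps)
 have "i + i * (j + 1) = (i * j) + (i + i)" by (simp add: algebra_simps)
 then have k2: "ksign K i \<otimes>\<^sub>K ksign K (i * (j + 1)) = ksign K (i * j)"
  using R.ksign_add[of i "i * (j + 1)"] by (simp add: ksign_def)
 let ?a = "dif R x \<otimes>\<^sub>R y" and ?b = "x \<otimes>\<^sub>R dif R y" and ?c = "dif R y \<otimes>\<^sub>R x" and ?d = "y \<otimes>\<^sub>R dif R x"
 note k = R.ksign_in
 have i: "?a :. R" "?b :. R" "?c :. R" "?d :. R" using c by (simp_all add: dif_in)
 have "dif R (bracket i j x y) = (?a \<oplus>\<^sub>R ksign K i \<odot>\<^sub>R ?b) \<ominus>\<^sub>R (ksign K (i * j) \<odot>\<^sub>R (?c \<oplus>\<^sub>R ksign K j \<odot>\<^sub>R ?d))"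
  unfolding bracket_def using c dif_mult[OF x c(2)] dif_mult[OF y c(1)]
  by (simp add: module_hom_minus[OF module_axioms module_axioms dif_linear] module_hom_smult[OF dif_linear] k)
 moreover have "ksign K i \<odot>\<^sub>R bracket i (j + 1) x (dif R y) = ksign K i \<odot>\<^sub>R ?b \<ominus>\<^sub>R (ksign K (i * j) \<odot>\<^sub>R ?c)"
  unfolding bracket_def using i k by (simp add: minus_eq smult_r_distr smult_r_minus smult_assoc1[symmetric] k2)
 moreover have "bracket (i + 1) j (dif R x) y = ?a \<ominus>\<^sub>R (ksign K (i * j) \<odot>\<^sub>R (ksign K j \<odot>\<^sub>R ?d))"
  unfolding bracket_def using i k by (simp add: k1 smult_assoc1)
 ultimately show ?thesis using i k by (simp add: minus_eq smult_r_distr minus_add a_ac)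
qed

text \<open>The elements of the ideal whose differential stays in it form an ideal containing all
  brackets. Multiplication on the right produces \<open>sgn_inv K R x\<close> times a differential,
  so stability of the ideal under the involution has to come with it.\<close>

lemma comm_ideal_dif:
 assumes "z \<in> comm_ideal K R" shows "dif R z \<in> comm_ideal K R"
proof -
 let ?I = "comm_ideal K R"
 interpret I: alg_quot K R ?I by (intro alg_quot.intro alg_quot_axioms.intro assoc_algebra_axioms comm_ideal_ideal)
 have IP: "x :. R" if "x \<in> ?I" for x using that I.Qs.I_sub by blast
 let ?J = "{z \<in> ?I. dif R z \<in> ?I}"
 have "ideal ?J R"
 proof (rule idealI'[OF assoc_algebra_axioms])
  show "?J <= carrier R" using IP by blast
  show "\<zero>\<^sub>R \<in> ?J" by (simp add: I.Qs.I_zero module_hom_zero[OF module_axioms module_axioms dif_linear])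
  fix x y assume "x \<in> ?J" "y \<in> ?J"
  then show "x \<oplus>\<^sub>R y \<in> ?J" using IP by (auto simp: module_hom_add[OF dif_linear] I.Qs.I_add)
 next
  fix a x assume a: "a :. R" and x: "x \<in> ?J"
  then have "x :. R" using IP by blast
  then show "a \<otimes>\<^sub>R x \<in> ?J" using a x by (auto simp: dif_mult_sgn dif_in sgn_inv_in intro!: I.Qs.I_add I.I_ideal(1))
  have "sgn_inv K R x \<otimes>\<^sub>R dif R a \<in> ?I"
  proof (rule I.I_ideal(2))
   \<comment> \<open>Stability under the involution: a bracket is homogeneous, so the involution
     only rescales it by a sign.\<close>
   have J: "ideal {z \<in> carrier R. sgn_inv K R z \<in> ?I} R"
    by (rule idealI'[OF assoc_algebra_axioms])
     (auto simp: sgn_inv_mult sgn_inv_in module_hom_add[OF sgn_inv_hom] I.Qs.I_zero I.Qs.I_add I.I_ideal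
      module_hom_zero[OF module_axioms module_axioms sgn_inv_hom])
   have "?I <= {z \<in> carrier R. sgn_inv K R z \<in> ?I}"
   proof (rule comm_ideal_least[OF J])
    fix i j x y assume xy: "x \<in> Gr R i" "y \<in> Gr R j"
    have c: "x :. R" "y :. R" using xy Gr_in by auto
    have g: "bracket i j x y \<in> Gr R (i + j)"
     unfolding bracket_def minus_eq using Gr_mult[OF xy] Gr_mult[OF xy(2,1)]
     by (auto intro!: Gr_add Gr_neg Gr_smult R.ksign_in simp: add.commute)
    show "bracket i j x y \<in> {z \<in> carrier R. sgn_inv K R z \<in> ?I}"
     using comm_ideal_bracket[OF xy] by (simp add: sgn_inv_Gr_eq[OF g] bracket_in c I.Qs.I_smult R.ksign_in)
   qed
   then show "sgn_inv K R x \<in> ?I" using x by blast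
  qed (simp add: a dif_in)
  then show "x \<otimes>\<^sub>R a \<in> ?J" using \<open>x :. R\<close> a x
   by (auto simp: dif_mult_sgn dif_in sgn_inv_in intro!: I.Qs.I_add I.I_ideal(2))
 qed
 moreover have "bracket i j x y \<in> ?J" if xy: "x \<in> Gr R i" "y \<in> Gr R j" for i j x y
  using comm_ideal_bracket[OF xy] comm_ideal_bracket[OF dif_degree[OF xy(1)] xy(2)]
   comm_ideal_bracket[OF xy(1) dif_degree[OF xy(2)]]
  by (simp add: dif_bracket[OF xy] I.Qs.I_add I.Qs.I_smult R.ksign_in)
 ultimately have "?I <= ?J" by (rule comm_ideal_least)
 then show ?thesis using assms by blast
qed

text \<open>Factors of degree 0 do not move degrees. Hence the components of an element commuting
  with End V commute with End V, and the centralizer is a graded subalgebra.\<close>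

lemma hcomp_mult_deg0:
 assumes x: "x :. R" and y: "y \<in> Gr R 0"
 shows "hcomp R (x \<otimes>\<^sub>R y) n = hcomp R x n \<otimes>\<^sub>R y" "hcomp R (y \<otimes>\<^sub>R x) n = y \<otimes>\<^sub>R hcomp R x n"
proof -
 have yc: "y :. R" using y Gr_in by blast
 have "hcomp R (x \<otimes>\<^sub>R y) n = hcomp R x n \<otimes>\<^sub>R y & hcomp R (y \<otimes>\<^sub>R x) n = y \<otimes>\<^sub>R hcomp R x n"
  using x
 proof (induction x rule: homogeneous_induct)
  case (homogeneous m x)
  then show ?case using Gr_mult[OF homogeneous y] Gr_mult[OF y homogeneous] yc by (simp add: hcomp_homogeneous)
 next
  case (add x z) then show ?case using yc by (simp add: l_distr r_distr hcomp_add hcomp_in)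
 qed
 then show "hcomp R (x \<otimes>\<^sub>R y) n = hcomp R x n \<otimes>\<^sub>R y" "hcomp R (y \<otimes>\<^sub>R x) n = y \<otimes>\<^sub>R hcomp R x n" by auto
qed

end

subsection \<open>Sub-DG-algebras\<close>

text \<open>Closure under homogeneous components is what lets the decomposition in \<open>A\<close>
  serve as a decomposition inside \<open>H\<close>.\<close>

locale dg_sub = dg_algebra K A for K :: "('k, 'c) ring_scheme" and A :: "('k, 'a, 'd) dg_alg_scheme" +
 fixes H
 assumes H_sub: "H <= carrier A" and H_one: "\<one>\<^sub>A \<in> H"
  and H_add: "[|x \<in> H; y \<in> H|] ==> x \<oplus>\<^sub>A y \<in> H"
  and H_mult: "[|x \<in> H; y \<in> H|] ==> x \<otimes>\<^sub>A y \<in> H"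
  and H_smult: "[|c :. K; x \<in> H|] ==> c \<odot>\<^sub>A x \<in> H"
  and H_hcomp: "x \<in> H ==> hcomp A x n \<in> H"
  and H_dif: "x \<in> H ==> dif A x \<in> H"
begin

abbreviation Asub where "Asub \<equiv> A\<lparr>carrier := H, Gr := %n. Gr A n \<inter> H\<rparr>"

lemma H_in: "x \<in> H ==> x :. A" using H_sub by blast

lemma H_zero: "\<zero>\<^sub>A \<in> H" using H_smult[OF R.zero_closed H_one] by simp

lemma Asub_assoc: "assoc_algebra K Asub"
proof -
 have neg: "\<ominus>\<^sub>A x \<in> H" if "x \<in> H" for x
  using H_smult[of "\<ominus>\<^sub>K \<one>\<^sub>K" x] H_in that by (simp add: neg_eq_smult)
 have ab: "abelian_group Asub"
 proof (rule abelian_groupI)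
  fix x assume "x :. Asub"
  then show "\<exists>y\<in>carrier Asub. y \<oplus>\<^sub>Asub x = \<zero>\<^sub>Asub"
   by (intro bexI[of _ "\<ominus>\<^sub>A x"]) (simp_all add: l_neg neg H_in)
 qed (simp_all add: H_add H_zero H_in a_ac)
 have mon: "monoid Asub" by (rule monoidI) (auto simp: H_mult H_one H_in m_assoc)
 show ?thesis
  by (rule assoc_algebraI[OF field_axioms ab mon])
   (auto simp: H_in H_smult l_distr r_distr smult_l_distr smult_r_distr smult_assoc1 smult_mult_left smult_mult_right)
qed

sublocale As: assoc_algebra K Asub by (rule Asub_assoc)

lemma finsum_Asub: "finite F ==> (!!i. i \<in> F ==> f i \<in> H) ==> (\<Oplus>\<^sub>Asub i\<in>F. f i) = (\<Oplus>\<^sub>A i\<in>F. f i)"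
proof (induction F rule: finite_induct)
 case empty then show ?case by (simp add: As.finsum_empty)
next
 case (insert i F)
 have "(\<Oplus>\<^sub>Asub i\<in>insert i F. f i) = f i \<oplus>\<^sub>Asub (\<Oplus>\<^sub>Asub i\<in>F. f i)"
  by (rule As.finsum_insert) (use insert in auto)
 then show ?case using insert H_in by (subst finsum_insert) auto
qed

lemma hdecomp_Asub: "hdecomp Asub x c \<longleftrightarrow> hdecomp A x c & (\<forall>n. c n \<in> H)"
 using finsum_Asub[of "{n. c n ~= \<zero>\<^sub>A}" c] by (auto simp: hdecomp_def)

lemma Asub_dg_algebra: "dg_algebra K Asub"
proof (intro dg_algebra.intro Asub_assoc dg_algebra_axioms.intro)
 show "subspace K (Gr Asub n) Asub" for n
  unfolding subspace_def submodule_def using As.vectorspace_axioms As.module_axioms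
  by (auto simp: Gr_add H_add Gr_zero H_zero Gr_smult H_smult)
 fix x assume x: "x :. Asub"
 show "\<exists>!c. hdecomp Asub x c"
 proof (rule ex1I[of _ "hcomp A x"])
  show "hdecomp Asub x (hcomp A x)" using x by (simp add: hdecomp_Asub hdecomp_hcomp H_in H_hcomp)
  show "c = hcomp A x" if "hdecomp Asub x c" for c using that x hdecomp_unique[of x c] by (simp add: hdecomp_Asub H_in)
 qed
 show "dif Asub (dif Asub x) = \<zero>\<^sub>Asub" using x by (simp add: dif_dif H_in)
next
 show "dif Asub \<in> module_hom K Asub Asub"
  by (rule module_homI) (auto simp: H_dif H_in module_hom_add[OF dif_linear] module_hom_smult[OF dif_linear])
next
 fix x y n assume "x \<in> Gr Asub n" "y :. Asub"
 then show "dif Asub (x \<otimes>\<^sub>Asub y) = dif Asub x \<otimes>\<^sub>Asub y \<oplus>\<^sub>Asub ksign K n \<odot>\<^sub>Asub (x \<otimes>\<^sub>Asub dif Asub y)"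
  by (simp add: dif_mult H_in)
qed (simp_all add: Gr_one H_one Gr_mult H_mult dif_degree H_dif)

end

subsection \<open>Derivations into a bimodule concentrated in degree zero\<close>

lemma bimod_via_simps:
 "carrier (bimod_via f (deg0 B)) = carrier B" "mult (bimod_via f (deg0 B)) = mult B"
 "\<one>\<^bsub>bimod_via f (deg0 B)\<^esub> = \<one>\<^sub>B" "\<zero>\<^bsub>bimod_via f (deg0 B)\<^esub> = \<zero>\<^sub>B"
 "add (bimod_via f (deg0 B)) = add B" "smult (bimod_via f (deg0 B)) = smult B"
 "Gr (bimod_via f (deg0 B)) n = (if n = 0 then carrier B else {\<zero>\<^sub>B})" "dif (bimod_via f (deg0 B)) x = \<zero>\<^sub>B"
 "lact (bimod_via f (deg0 B)) s m = f s \<otimes>\<^sub>B m" "ract (bimod_via f (deg0 B)) m s = m \<otimes>\<^sub>B f s"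
 "a_inv (bimod_via f (deg0 B)) = a_inv B" "a_minus (bimod_via f (deg0 B)) = a_minus B"
 by (simp_all add: bimod_via_def deg0_def dg_alg.extend_def module.extend_def dg_alg.fields_def
  dg_bimod.fields_def a_inv_def a_minus_def fun_eq_iff m_inv_def)

lemma finsum_bimod_via: "finsum (bimod_via f (deg0 B)) = finsum B"
 by (simp add: finsum_def finprod_def bimod_via_simps fun_eq_iff)

lemma module_hom_bimod_via: "module_hom K S (bimod_via f (deg0 B)) = module_hom K S B"
 by (simp add: module_hom_def bimod_via_simps)

lemma fun_space_bimod_via: "fun_space X (bimod_via f (deg0 B)) C = fun_space X B C"
 by (simp add: fun_space_def bimod_via_simps)

text \<open>Derivations along a DG homomorphism into an algebra in degree 0. The grading of
  \<open>S\<close> enters through the induction principle \<open>S_span\<close>, so that the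
  quotient \<open>rep_alg\<close> qualifies as soon as its homogeneous parts span.\<close>

locale der_setup = S: assoc_algebra K S + B: assoc_algebra K B
 for K :: "('k, 'c) ring_scheme" and S :: "('k, 's, 'd) dg_alg_scheme" and B :: "('k, 'b) module" (structure) +
 fixes f :: "'s => 'b"
 assumes f_hom: "f \<in> alg_hom K S B"
  and f_Gr: "[|x \<in> Gr S n; n ~= 0|] ==> f x = \<zero>"
  and f_dif: "x :. S ==> f (dif S x) = \<zero>"
  and S_Gr_in: "x \<in> Gr S n ==> x :. S"
  and S_span: "!!T x. [|x :. S; !!n y. y \<in> Gr S n ==> T y;
   !!y z. [|y :. S; z :. S; T y; T z|] ==> T (y \<oplus>\<^sub>S z)|] ==> T x"
  and S_dif_hom: "dif S \<in> module_hom K S S"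
  and S_dif_degree: "x \<in> Gr S n ==> dif S x \<in> Gr S (n + 1)"
  and S_dif_dif: "x :. S ==> dif S (dif S x) = \<zero>\<^sub>S"
  and S_dif_mult: "[|x \<in> Gr S n; y :. S|] ==>
   dif S (x \<otimes>\<^sub>S y) = dif S x \<otimes>\<^sub>S y \<oplus>\<^sub>S ksign K n \<odot>\<^sub>S (x \<otimes>\<^sub>S dif S y)"
begin

abbreviation N where "N \<equiv> bimod_via f (deg0 B)"

lemmas f = alg_homD[OF f_hom]

text \<open>A map of degree \<open>i\<close> into degree 0 can be nonzero only on degree
  \<open>- i\<close>. The Koszul sign in the Leibniz rule multiplies \<open>f x\<close>, which
  vanishes unless \<open>x\<close> has degree 0, where the sign is 1.\<close>

definition der :: "int => ('s => 'b) => bool" where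
 "der i \<delta> \<longleftrightarrow> \<delta> \<in> module_hom K S B & (\<forall>n. \<forall>x \<in> Gr S n. n ~= - i --> \<delta> x = \<zero>) &
   (\<forall>x \<in> carrier S. \<forall>y \<in> carrier S. \<delta> (x \<otimes>\<^sub>S y) = \<delta> x \<otimes> f y \<oplus> f x \<otimes> \<delta> y)"

lemma derD:
 assumes "der i \<delta>"
 shows "\<delta> \<in> module_hom K S B" "x \<in> Gr S n ==> n ~= - i ==> \<delta> x = \<zero>"
  "x :. S ==> y :. S ==> \<delta> (x \<otimes>\<^sub>S y) = \<delta> x \<otimes> f y \<oplus> f x \<otimes> \<delta> y"
  "x :. S ==> \<delta> x :. B"
 using assms module_hom_in by (auto simp: der_def)

lemma der_homogeneousI:
 assumes h: "\<delta> \<in> module_hom K S B" and d: "!!n x. x \<in> Gr S n ==> n ~= - i ==> \<delta> x = \<zero>"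
  and m: "!!n x y. [|x \<in> Gr S n; y :. S|] ==> \<delta> (x \<otimes>\<^sub>S y) = \<delta> x \<otimes> f y \<oplus> f x \<otimes> \<delta> y"
 shows "der i \<delta>"
 unfolding der_def
proof (intro conjI h allI ballI impI)
 fix x y assume x: "x :. S" and y: "y :. S"
 note i = module_hom_in[OF h]
 show "\<delta> (x \<otimes>\<^sub>S y) = \<delta> x \<otimes> f y \<oplus> f x \<otimes> \<delta> y"
 proof (rule S_span[OF x])
  fix x z assume "x :. S" "z :. S" "\<delta> (x \<otimes>\<^sub>S y) = \<delta> x \<otimes> f y \<oplus> f x \<otimes> \<delta> y"
   "\<delta> (z \<otimes>\<^sub>S y) = \<delta> z \<otimes> f y \<oplus> f z \<otimes> \<delta> y"
  then show "\<delta> ((x \<oplus>\<^sub>S z) \<otimes>\<^sub>S y) = \<delta> (x \<oplus>\<^sub>S z) \<otimes> f y \<oplus> f (x \<oplus>\<^sub>S z) \<otimes> \<delta> y"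
   using y by (simp add: S.l_distr B.l_distr module_hom_add[OF h] i f B.a_interchange)
 qed (rule m[OF _ y])
qed (rule d)

text \<open>Either the degree of \<open>x\<close> is 0 and the sign is 1, or \<open>f x\<close> is
  0.\<close>

lemma f_sign:
 assumes "x \<in> Gr S n" "b :. B"
 shows "ksign K (i * n) \<odot> (f x \<otimes> b) = f x \<otimes> b"
proof (cases "n = 0")
 case True
 then show ?thesis using assms S_Gr_in[OF assms(1)] by (simp add: ksign_def f)
next
 case False
 then show ?thesis using assms by (simp add: f_Gr S.R.ksign_in)
qed

lemma der_iff: "\<delta> \<in> dg_der K S N i \<longleftrightarrow> der i \<delta> & \<delta> \<in> extensional (carrier S)"
proof
 assume d: "\<delta> \<in> dg_der K S N i"
 then have h: "\<delta> \<in> module_hom K S B" "\<delta> \<in> extensional (carrier S)" by (simp_all add: dg_der_def module_hom_bimod_via)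
 note di = module_hom_in[OF h(1)]
 have "der i \<delta>"
 proof (rule der_homogeneousI[OF h(1)])
  fix n x assume x: "x \<in> Gr S n" "n ~= - i"
  then have "\<delta> x \<in> Gr N (n + i)" using d by (auto simp: dg_der_def)
  then show "\<delta> x = \<zero>" using x(2) by (simp add: bimod_via_simps split: if_splits)
 next
  fix n x y assume x: "x \<in> Gr S n" and y: "y :. S"
  then have "\<delta> (x \<otimes>\<^sub>S y) = ract N (\<delta> x) y \<oplus>\<^sub>N ksign K (i * n) \<odot>\<^sub>N lact N x (\<delta> y)"
   using d unfolding dg_der_def by blast
  then show "\<delta> (x \<otimes>\<^sub>S y) = \<delta> x \<otimes> f y \<oplus> f x \<otimes> \<delta> y"
   using f_sign[OF x di[OF y]] by (simp add: bimod_via_simps)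
 qed
 then show "der i \<delta> & \<delta> \<in> extensional (carrier S)" using h by simp
next
 assume d: "der i \<delta> & \<delta> \<in> extensional (carrier S)"
 then have d': "der i \<delta>" by simp
 note dd = derD[OF d']
 show "\<delta> \<in> dg_der K S N i"
  unfolding dg_der_def
 proof (intro CollectI conjI allI ballI IntI)
  show "\<delta> \<in> module_hom K S N" using dd(1) by (simp add: module_hom_bimod_via)
  show "\<delta> \<in> extensional (carrier S)" using d by simp
  show "\<delta> ` Gr S n <= Gr N (n + i)" for n
   using dd(2)[of _ n] dd(4)[OF S_Gr_in[of _ n]] by (auto simp: bimod_via_simps)
  fix n x y assume x: "x \<in> Gr S n" and y: "y :. S"
  show "\<delta> (x \<otimes>\<^sub>S y) = ract N (\<delta> x) y \<oplus>\<^sub>N ksign K (i * n) \<odot>\<^sub>N lact N x (\<delta> y)"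
   using f_sign[OF x dd(4)[OF y]] dd(3)[OF S_Gr_in[OF x] y] by (simp add: bimod_via_simps)
 qed
qed

lemma der_dif_eq:
 assumes "der i \<delta>"
 shows "dg_der_dif K S N i \<delta> = (\<lambda>x \<in> carrier S. \<ominus> (ksign K i \<odot> \<delta> (dif S x)))"
 unfolding dg_der_dif_def
 by (rule restrict_ext)
  (simp add: bimod_via_simps B.minus_eq S.R.ksign_in derD(4)[OF assms] module_hom_in[OF S_dif_hom])

lemma der_cong: "der i \<delta> ==> (!!x. x :. S ==> \<delta>' x = \<delta> x) ==> der i \<delta>'"
 by (auto simp: der_def S_Gr_in module_hom_def)

lemma der_zero: "der i (%x. \<zero>)"
 by (auto simp: der_def f intro!: module_homI)

lemma der_add:
 assumes "der i \<delta>" "der i \<delta>'" shows "der i (%x. \<delta> x \<oplus> \<delta>' x)"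
proof (rule der_homogeneousI)
 note d = derD[OF assms(1)] derD[OF assms(2)]
 show "(%x. \<delta> x \<oplus> \<delta>' x) \<in> module_hom K S B"
  by (rule module_homI) (simp_all add: d module_hom_add[OF d(1)] module_hom_add[OF d(5)]
   module_hom_smult[OF d(1)] module_hom_smult[OF d(5)] B.a_interchange B.smult_r_distr)
 show "\<delta> x \<oplus> \<delta>' x = \<zero>" if "x \<in> Gr S n" "n ~= - i" for n x
  using d(2)[OF that] d(6)[OF that] by simp
 show "\<delta> (x \<otimes>\<^sub>S y) \<oplus> \<delta>' (x \<otimes>\<^sub>S y) = (\<delta> x \<oplus> \<delta>' x) \<otimes> f y \<oplus> f x \<otimes> (\<delta> y \<oplus> \<delta>' y)"
  if "x \<in> Gr S n" "y :. S" for x y n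
  using that S_Gr_in[OF that(1)] by (simp add: d f B.l_distr B.r_distr B.a_interchange)
qed

lemma der_smult:
 assumes "der i \<delta>" "c :. K" shows "der i (%x. c \<odot> \<delta> x)"
proof (rule der_homogeneousI)
 note d = derD[OF assms(1)]
 show "(%x. c \<odot> \<delta> x) \<in> module_hom K S B"
  by (rule module_homI) (simp_all add: d assms(2) module_hom_add[OF d(1)]
   module_hom_smult[OF d(1)] B.smult_r_distr B.smult_assoc1[symmetric] S.R.m_comm)
 show "c \<odot> \<delta> x = \<zero>" if "x \<in> Gr S n" "n ~= - i" for n x
  using d(2)[OF that] assms(2) by simp
 show "c \<odot> \<delta> (x \<otimes>\<^sub>S y) = (c \<odot> \<delta> x) \<otimes> f y \<oplus> f x \<otimes> (c \<odot> \<delta> y)"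
  if "x \<in> Gr S n" "y :. S" for x y n
  using that S_Gr_in[OF that(1)] assms(2) by (simp add: d f B.smult_r_distr B.smult_mult_left B.smult_mult_right)
qed

text \<open>Of the four terms produced by the two Leibniz rules, two contain \<open>f\<close> of a
  boundary and vanish; the sign of the last one is harmless by \<open>f_sign\<close>.\<close>

lemma der_comp_dif:
 assumes "der i \<delta>" shows "der (i + 1) (%x. \<delta> (dif S x))"
proof (rule der_homogeneousI)
 note d = derD[OF assms]
 note di = module_hom_in[OF S_dif_hom]
 show "(%x. \<delta> (dif S x)) \<in> module_hom K S B" by (rule module_hom_comp[OF S_dif_hom d(1)])
 show "\<delta> (dif S x) = \<zero>" if "x \<in> Gr S n" "n ~= - (i + 1)" for n x
  using d(2)[OF S_dif_degree[OF that(1)]] that(2) by simp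
 fix n x y assume x: "x \<in> Gr S n" and y: "y :. S"
 have xc: "x :. S" using S_Gr_in[OF x] .
 have "ksign K n \<odot> (f x \<otimes> \<delta> (dif S y)) = f x \<otimes> \<delta> (dif S y)"
  using f_sign[OF x d(4)[OF di[OF y]], of 1] by simp
 then show "\<delta> (dif S (x \<otimes>\<^sub>S y)) = \<delta> (dif S x) \<otimes> f y \<oplus> f x \<otimes> \<delta> (dif S y)"
  using xc y S.R.ksign_in[of n]
  by (simp add: S_dif_mult[OF x y] module_hom_add[OF d(1)] module_hom_smult[OF d(1)] di d f_dif f)
qed

lemma der_dif_zero_iff:
 assumes "der i \<delta>"
 shows "dg_der_dif K S N i \<delta> = (\<lambda>x \<in> carrier S. \<zero>) \<longleftrightarrow> (\<forall>x \<in> carrier S. \<delta> (dif S x) = \<zero>)"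
proof
 assume h: "dg_der_dif K S N i \<delta> = (\<lambda>x \<in> carrier S. \<zero>)"
 show "\<forall>x \<in> carrier S. \<delta> (dif S x) = \<zero>"
 proof
  fix x assume x: "x :. S"
  have c: "\<delta> (dif S x) :. B" using x derD(4)[OF assms] module_hom_in[OF S_dif_hom] by blast
  have "\<ominus> (ksign K i \<odot> \<delta> (dif S x)) = \<zero>"
   using fun_cong[OF h, of x] x by (simp add: der_dif_eq[OF assms])
  then have "\<ominus> (\<ominus> (ksign K i \<odot> \<delta> (dif S x))) = \<zero>" by simp
  then have "ksign K i \<odot> (ksign K i \<odot> \<delta> (dif S x)) = \<zero>" using c S.R.ksign_in[of i] by simp
  then show "\<delta> (dif S x) = \<zero>" using c S.R.ksign_in[of i] by (simp add: B.smult_assoc1[symmetric] S.R.ksign_self)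
 qed
next
 assume "\<forall>x \<in> carrier S. \<delta> (dif S x) = \<zero>"
 then show "dg_der_dif K S N i \<delta> = (\<lambda>x \<in> carrier S. \<zero>)"
  unfolding der_dif_eq[OF assms] using S.R.ksign_in[of i] by (intro restrict_ext) simp
qed

definition Zc where "Zc i = {\<delta>. der i \<delta> & \<delta> \<in> extensional (carrier S) & (\<forall>x \<in> carrier S. \<delta> (dif S x) = \<zero>)}"
definition Bc where "Bc i = dg_der_dif K S N (i - 1) ` dg_der K S N (i - 1)"

lemma cohomology_eq: "dg_der_cohomology K S N i = quot (fun_space (carrier S) B (Zc i)) (Bc i)"
proof -
 have "{\<delta> \<in> dg_der K S N i. dg_der_dif K S N i \<delta> = (\<lambda>x \<in> carrier S. \<zero>\<^sub>N)} = Zc i"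
  using der_dif_zero_iff by (auto simp: Zc_def der_iff bimod_via_simps)
 then show ?thesis by (simp add: dg_der_cohomology_def Bc_def fun_space_bimod_via)
qed

lemma Zc_module: "module K (fun_space (carrier S) B (Zc i))"
proof (rule fun_space_module[OF B.module_axioms])
 have di: "dif S x :. S" if "x :. S" for x using module_hom_in[OF S_dif_hom that] .
 show "Zc i <= carrier S \<rightarrow>\<^sub>E carrier B"
  by (auto simp: Zc_def PiE_def derD(4))
 show "(\<lambda>x \<in> carrier S. \<zero>) \<in> Zc i"
  using der_cong[OF der_zero, of "\<lambda>x \<in> carrier S. \<zero>" i] di by (simp add: Zc_def)
 show "(\<lambda>x \<in> carrier S. \<delta> x \<oplus> \<delta>' x) \<in> Zc i" if "\<delta> \<in> Zc i" "\<delta>' \<in> Zc i" for \<delta> \<delta>'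
  using that der_cong[OF der_add, of i \<delta> \<delta>' "\<lambda>x \<in> carrier S. \<delta> x \<oplus> \<delta>' x"] di by (simp add: Zc_def)
 show "(\<lambda>x \<in> carrier S. c \<odot> \<delta> x) \<in> Zc i" if "c :. K" "\<delta> \<in> Zc i" for \<delta> c
  using that der_cong[OF der_smult, of i \<delta> c "\<lambda>x \<in> carrier S. c \<odot> \<delta> x"] di by (simp add: Zc_def)
qed

text \<open>The differential of \<open>N\<close> is zero, so the differential of a derivation is
  composition with \<open>dif S\<close> up to the sign \<open>- (-1)^(i-1)\<close>. Rescaling the
  derivation by that sign removes it in either direction.\<close>

lemma Bc_iff: "\<beta> \<in> Bc i \<longleftrightarrow> (\<exists>\<delta>. der (i - 1) \<delta> & \<delta> \<in> extensional (carrier S) & \<beta> = (\<lambda>x \<in> carrier S. \<delta> (dif S x)))"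
proof
 have di: "dif S x :. S" if "x :. S" for x using module_hom_in[OF S_dif_hom that] .
 let ?s = "ksign K (i - 1)"
 have k: "?s :. K" by (rule S.R.ksign_in)
 {
  assume "\<beta> \<in> Bc i"
  then obtain \<delta> where \<delta>: "der (i - 1) \<delta>" "\<beta> = dg_der_dif K S N (i - 1) \<delta>" by (auto simp: Bc_def der_iff)
  let ?d = "\<lambda>x \<in> carrier S. (\<ominus>\<^sub>K \<one>\<^sub>K) \<odot> (?s \<odot> \<delta> x)"
  have "der (i - 1) (%x. (\<ominus>\<^sub>K \<one>\<^sub>K) \<odot> (?s \<odot> \<delta> x))" by (intro der_smult \<delta>(1) k) simp
  then have "der (i - 1) ?d" by (rule der_cong) simp
  moreover have "\<beta> = (\<lambda>x \<in> carrier S. ?d (dif S x))"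
   unfolding \<delta>(2) der_dif_eq[OF \<delta>(1)]
   by (rule restrict_ext) (simp add: di B.neg_eq_smult derD(4)[OF \<delta>(1)] k)
  ultimately show "\<exists>\<delta>. der (i - 1) \<delta> & \<delta> \<in> extensional (carrier S) & \<beta> = (\<lambda>x \<in> carrier S. \<delta> (dif S x))"
   by (intro exI[of _ ?d]) simp
 next
  assume "\<exists>\<delta>. der (i - 1) \<delta> & \<delta> \<in> extensional (carrier S) & \<beta> = (\<lambda>x \<in> carrier S. \<delta> (dif S x))"
  then obtain \<delta> where \<delta>: "der (i - 1) \<delta>" "\<beta> = (\<lambda>x \<in> carrier S. \<delta> (dif S x))" by blast
  let ?d = "\<lambda>x \<in> carrier S. (\<ominus>\<^sub>K \<one>\<^sub>K) \<odot> (?s \<odot> \<delta> x)"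
  have "der (i - 1) (%x. (\<ominus>\<^sub>K \<one>\<^sub>K) \<odot> (?s \<odot> \<delta> x))" by (intro der_smult \<delta>(1) k) simp
  then have d: "der (i - 1) ?d" by (rule der_cong) simp
  have "\<ominus> (?s \<odot> ((\<ominus>\<^sub>K \<one>\<^sub>K) \<odot> (?s \<odot> b))) = b" if "b :. B" for b
   using that k by (simp add: B.smult_l_minus B.smult_r_minus B.smult_assoc1[symmetric] S.R.ksign_self S.R.l_minus S.R.r_minus)
  then have "\<beta> = dg_der_dif K S N (i - 1) ?d"
   unfolding \<delta>(2) der_dif_eq[OF d] by (intro restrict_ext) (simp add: di derD(4)[OF \<delta>(1)])
  then show "\<beta> \<in> Bc i" using d by (auto simp: Bc_def der_iff)
 }
qed

lemma cohomology_quot_setup: "quot_setup K (fun_space (carrier S) B (Zc i)) (Bc i)"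
proof -
 have di: "dif S x :. S" if "x :. S" for x using module_hom_in[OF S_dif_hom that] .
 have z0: "\<delta> \<zero>\<^sub>S = \<zero>" if "der j \<delta>" for \<delta> j
  using module_hom_zero[OF S.module_axioms B.module_axioms derD(1)[OF that]] .
 have "submodule K (Bc i) (fun_space (carrier S) B (Zc i))"
  unfolding submodule_def fun_space_simps
 proof (intro conjI allI impI Zc_module)
  show "Bc i <= Zc i"
  proof
   fix \<beta> assume "\<beta> \<in> Bc i"
   then obtain \<delta> where \<delta>: "der (i - 1) \<delta>" "\<beta> = (\<lambda>x \<in> carrier S. \<delta> (dif S x))" by (auto simp: Bc_iff)
   have "der i (%x. \<delta> (dif S x))" using der_comp_dif[OF \<delta>(1)] by simp
   then have "der i \<beta>" by (rule der_cong) (simp add: \<delta>(2))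
   then show "\<beta> \<in> Zc i" using di z0[OF \<delta>(1)] by (simp add: Zc_def \<delta>(2) S_dif_dif)
  qed
  show "(\<lambda>x \<in> carrier S. \<zero>) \<in> Bc i"
  proof (unfold Bc_iff, rule exI[of _ "\<lambda>x \<in> carrier S. \<zero>"], intro conjI)
   show "der (i - 1) (\<lambda>x \<in> carrier S. \<zero>)" by (rule der_cong[OF der_zero]) simp
   show "(\<lambda>x \<in> carrier S. \<zero>) \<in> extensional (carrier S)" by simp
   show "(\<lambda>x \<in> carrier S. \<zero>) = (\<lambda>x \<in> carrier S. (\<lambda>x \<in> carrier S. \<zero>) (dif S x))"
    by (rule restrict_ext) (simp add: di)
  qed
  fix \<beta> \<beta>' assume "\<beta> \<in> Bc i" "\<beta>' \<in> Bc i"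
  then obtain \<delta> \<delta>' where \<delta>: "der (i - 1) \<delta>" "\<beta> = (\<lambda>x \<in> carrier S. \<delta> (dif S x))"
   "der (i - 1) \<delta>'" "\<beta>' = (\<lambda>x \<in> carrier S. \<delta>' (dif S x))" by (auto simp: Bc_iff)
  show "(\<lambda>x \<in> carrier S. \<beta> x \<oplus> \<beta>' x) \<in> Bc i"
  proof (unfold Bc_iff, rule exI[of _ "\<lambda>x \<in> carrier S. \<delta> x \<oplus> \<delta>' x"], intro conjI)
   show "der (i - 1) (\<lambda>x \<in> carrier S. \<delta> x \<oplus> \<delta>' x)" by (rule der_cong[OF der_add[OF \<delta>(1,3)]]) simp
   show "(\<lambda>x \<in> carrier S. \<delta> x \<oplus> \<delta>' x) \<in> extensional (carrier S)" by simp
   show "(\<lambda>x \<in> carrier S. \<beta> x \<oplus> \<beta>' x) = (\<lambda>x \<in> carrier S. (\<lambda>x \<in> carrier S. \<delta> x \<oplus> \<delta>' x) (dif S x))"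
    unfolding \<delta>(2,4) by (rule restrict_ext) (simp add: di)
  qed
 next
  fix c \<beta> assume c: "c :. K" and "\<beta> \<in> Bc i"
  then obtain \<delta> where \<delta>: "der (i - 1) \<delta>" "\<beta> = (\<lambda>x \<in> carrier S. \<delta> (dif S x))" by (auto simp: Bc_iff)
  show "(\<lambda>x \<in> carrier S. c \<odot> \<beta> x) \<in> Bc i"
  proof (unfold Bc_iff, rule exI[of _ "\<lambda>x \<in> carrier S. c \<odot> \<delta> x"], intro conjI)
   show "der (i - 1) (\<lambda>x \<in> carrier S. c \<odot> \<delta> x)" by (rule der_cong[OF der_smult[OF \<delta>(1) c]]) simp
   show "(\<lambda>x \<in> carrier S. c \<odot> \<delta> x) \<in> extensional (carrier S)" by simp
   show "(\<lambda>x \<in> carrier S. c \<odot> \<beta> x) = (\<lambda>x \<in> carrier S. (\<lambda>x \<in> carrier S. c \<odot> \<delta> x) (dif S x))"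
    unfolding \<delta>(2) by (rule restrict_ext) (simp add: di)
  qed
 qed
 then show ?thesis using Zc_module by (simp add: quot_setup_def quot_setup_axioms_def)
qed

end

lemma (in dg_algebra) der_setupI:
 fixes B :: "('k, 'b) module"
 assumes "assoc_algebra K B" "f \<in> alg_hom K R B" "!!n x. [|x \<in> Gr R n; n ~= 0|] ==> f x = \<zero>\<^sub>B"
  "!!x. x :. R ==> f (dif R x) = \<zero>\<^sub>B"
 shows "der_setup K R B f"
proof (intro der_setup.intro der_setup_axioms.intro assms(1,2) assoc_algebra_axioms dif_linear)
 show "T x" if "x :. R" "!!n y. y \<in> Gr R n ==> T y"
  "!!y z. [|y :. R; z :. R; T y; T z|] ==> T (y \<oplus>\<^sub>R z)" for T x
  by (rule homogeneous_induct[where P = T, OF that])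
qed (simp_all add: assms(3,4) Gr_in dif_degree dif_dif dif_mult)

subsection \<open>Matrix coefficients with respect to a matrix subalgebra\<close>

lemma (in abelian_monoid) finsum_induct:
 assumes "finite F" "!!i. i \<in> F ==> f i :. G & T (f i)" "T \<zero>"
  "!!x y. [|x :. G; y :. G; T x; T y|] ==> T (x \<oplus> y)"
 shows "T (finsum G f F)"
 using assms(1,2)
proof induction
 case empty then show ?case using assms(3) by simp
next
 case (insert i F)
 have "finsum G f F :. G" by (rule finsum_closed) (use insert in auto)
 then show ?case using insert assms(4) by (subst finsum_insert) auto
qed

text \<open>An algebra receiving a unital map from a matrix algebra is the tensor product of the
  matrix algebra with the centralizer \<open>H\<close> of the image. The lemmas below make this
  explicit through coefficients in \<open>H\<close>.\<close>

locale matrix_coeffs = mu: matrix_units K E B e ent + C: assoc_algebra K C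
 for K :: "('k, 'c) ring_scheme" and E :: "('k, 'm, 'd) module_scheme" and B :: "'i set" and e ent
  and C :: "('k, 'x, 'f) module_scheme" +
 fixes J assumes J_hom: "J \<in> alg_hom K E C"
begin

lemmas J = alg_homD[OF J_hom]

lemma J_zero: "J \<zero>\<^sub>E = \<zero>\<^sub>C"
 by (rule module_hom_zero[OF mu.module_axioms C.module_axioms J(1)])

definition H where "H = {w \<in> carrier C. \<forall>m \<in> carrier E. w \<otimes>\<^sub>C J m = J m \<otimes>\<^sub>C w}"

lemma H_in: "w \<in> H ==> w :. C" by (simp add: H_def)

lemma H_comm: "w \<in> H ==> m :. E ==> w \<otimes>\<^sub>C J m = J m \<otimes>\<^sub>C w" by (simp add: H_def)

text \<open>The coefficient of \<open>w\<close> at the matrix unit \<open>e i j\<close>: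
  \<open>w\<close> is compressed to the position \<open>i\<close>, \<open>j\<close>, moved to every
  diagonal place \<open>k\<close> and summed, which puts it in the centralizer.\<close>

definition cf where "cf i j w = (\<Oplus>\<^sub>C k\<in>B. J (e k i) \<otimes>\<^sub>C w \<otimes>\<^sub>C J (e j k))"

lemma Je_in: "i \<in> B ==> j \<in> B ==> J (e i j) :. C" by (simp add: J mu.e_in)

lemma Je_mult: "[|i \<in> B; j \<in> B; k \<in> B; l \<in> B|] ==> J (e i j) \<otimes>\<^sub>C J (e k l) = (if j = k then J (e i l) else \<zero>\<^sub>C)"
 using mu.e_mult[of i j k l] by (simp add: J(4)[symmetric] mu.e_in J_zero)

lemma cf_in: "[|i \<in> B; j \<in> B; w :. C|] ==> cf i j w :. C"
 unfolding cf_def by (rule C.finsum_closed) (auto simp: Je_in)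

lemma cf_hom:
 assumes "i \<in> B" "j \<in> B" shows "cf i j \<in> module_hom K C C"
proof (rule module_homI)
 fix x y assume xy: "x :. C" "y :. C"
 have "cf i j (x \<oplus>\<^sub>C y) = (\<Oplus>\<^sub>C k\<in>B. J (e k i) \<otimes>\<^sub>C x \<otimes>\<^sub>C J (e j k) \<oplus>\<^sub>C J (e k i) \<otimes>\<^sub>C y \<otimes>\<^sub>C J (e j k))"
  unfolding cf_def by (rule C.finsum_cong') (use assms xy in "auto simp: Je_in C.l_distr C.r_distr")
 also have "\<dots> = cf i j x \<oplus>\<^sub>C cf i j y"
  unfolding cf_def by (rule C.finsum_addf) (use assms xy in "auto simp: Je_in")
 finally show "cf i j (x \<oplus>\<^sub>C y) = cf i j x \<oplus>\<^sub>C cf i j y" .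
next
 fix a x assume ax: "a :. K" "x :. C"
 have "cf i j (a \<odot>\<^sub>C x) = (\<Oplus>\<^sub>C k\<in>B. a \<odot>\<^sub>C (J (e k i) \<otimes>\<^sub>C x \<otimes>\<^sub>C J (e j k)))"
  unfolding cf_def by (rule C.finsum_cong') (use assms ax in "auto simp: Je_in C.smult_mult_left C.smult_mult_right")
 also have "\<dots> = a \<odot>\<^sub>C cf i j x"
  unfolding cf_def by (rule C.finsum_smult_ldistr[symmetric]) (use assms ax mu.finB in "auto simp: Je_in")
 finally show "cf i j (a \<odot>\<^sub>C x) = a \<odot>\<^sub>C cf i j x" .
qed (simp add: cf_in assms)

lemma E_expand:
 assumes m: "m :. E" shows "m = (\<Oplus>\<^sub>E a\<in>B. \<Oplus>\<^sub>E b\<in>B. ent a b m \<odot>\<^sub>E e a b)"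
proof -
 have e: "e a a \<otimes>\<^sub>E m = (\<Oplus>\<^sub>E b\<in>B. ent a b m \<odot>\<^sub>E e a b)" if a: "a \<in> B" for a
 proof -
  have "e a a \<otimes>\<^sub>E m = (e a a \<otimes>\<^sub>E m) \<otimes>\<^sub>E (\<Oplus>\<^sub>E b\<in>B. e b b)" using m a by (simp add: mu.e_sum mu.e_in)
  also have "\<dots> = (\<Oplus>\<^sub>E b\<in>B. e a a \<otimes>\<^sub>E m \<otimes>\<^sub>E e b b)"
   by (rule mu.finsum_rdistr[OF mu.finB]) (use m a in "auto simp: mu.e_in")
  also have "\<dots> = (\<Oplus>\<^sub>E b\<in>B. ent a b m \<odot>\<^sub>E e a b)"
   by (rule mu.finsum_cong') (use m a in "auto simp: mu.e_in mu.e_m_e mu.ent_in")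
  finally show ?thesis .
 qed
 have "m = (\<Oplus>\<^sub>E a\<in>B. e a a) \<otimes>\<^sub>E m" using m by (simp add: mu.e_sum)
 also have "\<dots> = (\<Oplus>\<^sub>E a\<in>B. e a a \<otimes>\<^sub>E m)"
  by (rule mu.finsum_ldistr[OF mu.finB m]) (auto simp: mu.e_in)
 also have "\<dots> = (\<Oplus>\<^sub>E a\<in>B. \<Oplus>\<^sub>E b\<in>B. ent a b m \<odot>\<^sub>E e a b)"
  by (rule mu.finsum_cong') (use m e in "auto simp: mu.e_in mu.ent_in intro!: mu.finsum_closed")
 finally show ?thesis .
qed

lemma E_induct:
 assumes m: "m :. E" and e: "!!a b c. [|a \<in> B; b \<in> B; c :. K|] ==> T (c \<odot>\<^sub>E e a b)"
  and zero: "T \<zero>\<^sub>E" and add: "!!x y. [|x :. E; y :. E; T x; T y|] ==> T (x \<oplus>\<^sub>E y)"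
 shows "T m"
proof -
 have "T (\<Oplus>\<^sub>E a\<in>B. \<Oplus>\<^sub>E b\<in>B. ent a b m \<odot>\<^sub>E e a b)"
 proof (rule mu.finsum_induct[OF mu.finB _ zero add], rule conjI)
  fix a assume a: "a \<in> B"
  show "(\<Oplus>\<^sub>E b\<in>B. ent a b m \<odot>\<^sub>E e a b) :. E"
   by (rule mu.finsum_closed) (use a m in "auto simp: mu.e_in mu.ent_in")
  show "T (\<Oplus>\<^sub>E b\<in>B. ent a b m \<odot>\<^sub>E e a b)"
   by (rule mu.finsum_induct[OF mu.finB _ zero add]) (use a m e in "auto simp: mu.e_in mu.ent_in")
 qed
 then show ?thesis using E_expand[OF m] by simp
qed

text \<open>Multiplication by a matrix unit selects one summand, \<open>k = a\<close> from the right
  and \<open>k = b\<close> from the left, with the same outcome. So coefficients commute with matrix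
  units, and with the right choice of indices they recover the blocks of \<open>w\<close>.\<close>

lemma cf_Je:
 assumes "i \<in> B" "j \<in> B" "a \<in> B" "b \<in> B" "w :. C"
 shows "cf i j w \<otimes>\<^sub>C J (e a b) = J (e a i) \<otimes>\<^sub>C w \<otimes>\<^sub>C J (e j b)"
  and "J (e a b) \<otimes>\<^sub>C cf i j w = J (e a i) \<otimes>\<^sub>C w \<otimes>\<^sub>C J (e j b)"
proof -
 have "cf i j w \<otimes>\<^sub>C J (e a b) = (\<Oplus>\<^sub>C k\<in>B. J (e k i) \<otimes>\<^sub>C w \<otimes>\<^sub>C J (e j k) \<otimes>\<^sub>C J (e a b))"
  unfolding cf_def by (rule C.finsum_ldistr[OF mu.finB]) (use assms in "auto simp: Je_in")
 also have "\<dots> = (\<Oplus>\<^sub>C k\<in>B. if a = k then J (e k i) \<otimes>\<^sub>C w \<otimes>\<^sub>C J (e j b) else \<zero>\<^sub>C)"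
  by (rule C.finsum_cong') (use assms in "auto simp: Je_in C.m_assoc Je_mult")
 also have "\<dots> = J (e a i) \<otimes>\<^sub>C w \<otimes>\<^sub>C J (e j b)"
  by (rule C.finsum_singleton) (use assms mu.finB in "auto simp: Je_in")
 finally show "cf i j w \<otimes>\<^sub>C J (e a b) = J (e a i) \<otimes>\<^sub>C w \<otimes>\<^sub>C J (e j b)" .
 have "J (e a b) \<otimes>\<^sub>C cf i j w = (\<Oplus>\<^sub>C k\<in>B. J (e a b) \<otimes>\<^sub>C (J (e k i) \<otimes>\<^sub>C w \<otimes>\<^sub>C J (e j k)))"
  unfolding cf_def by (rule C.finsum_rdistr[OF mu.finB]) (use assms in "auto simp: Je_in")
 also have "\<dots> = (\<Oplus>\<^sub>C k\<in>B. if b = k then J (e a i) \<otimes>\<^sub>C w \<otimes>\<^sub>C J (e j k) else \<zero>\<^sub>C)"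
  by (rule C.finsum_cong') (use assms in "auto simp: Je_in C.m_assoc[symmetric] Je_mult")
 also have "\<dots> = J (e a i) \<otimes>\<^sub>C w \<otimes>\<^sub>C J (e j b)"
  by (rule C.finsum_singleton) (use assms mu.finB in "auto simp: Je_in")
 finally show "J (e a b) \<otimes>\<^sub>C cf i j w = J (e a i) \<otimes>\<^sub>C w \<otimes>\<^sub>C J (e j b)" .
qed

lemma cf_H:
 assumes "i \<in> B" "j \<in> B" "w :. C" shows "cf i j w \<in> H"
proof -
 have c: "cf i j w :. C" by (rule cf_in[OF assms])
 have "cf i j w \<otimes>\<^sub>C J m = J m \<otimes>\<^sub>C cf i j w" if "m :. E" for m
 proof (rule E_induct[OF that])
  fix a b x assume "a \<in> B" "b \<in> B" "x :. K"
  then show "cf i j w \<otimes>\<^sub>C J (x \<odot>\<^sub>E e a b) = J (x \<odot>\<^sub>E e a b) \<otimes>\<^sub>C cf i j w"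
   using assms c by (simp add: J mu.e_in C.smult_mult_left C.smult_mult_right cf_Je)
 qed (use c in "simp_all add: J_zero J C.l_distr C.r_distr")
 then show ?thesis using c by (simp add: H_def)
qed

text \<open>The unit is inserted on both sides of \<open>w\<close> as the sum of the diagonal units;
  each block is then a coefficient times a matrix unit by \<open>cf_Je\<close>.\<close>

lemma HJ_decomp:
 assumes w: "w :. C" shows "w = (\<Oplus>\<^sub>C i\<in>B. \<Oplus>\<^sub>C j\<in>B. cf i j w \<otimes>\<^sub>C J (e i j))"
proof -
 have one: "(\<Oplus>\<^sub>C i\<in>B. J (e i i)) = \<one>\<^sub>C"
  using module_hom_finsum[OF mu.module_axioms C.module_axioms J(1) mu.finB, of "%i. e i i"] J(6)
  by (simp add: mu.e_sum mu.e_in)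
 have e: "J (e a a) \<otimes>\<^sub>C w = (\<Oplus>\<^sub>C b\<in>B. cf a b w \<otimes>\<^sub>C J (e a b))" if a: "a \<in> B" for a
 proof -
  have "J (e a a) \<otimes>\<^sub>C w = (J (e a a) \<otimes>\<^sub>C w) \<otimes>\<^sub>C (\<Oplus>\<^sub>C b\<in>B. J (e b b))" using w a by (simp add: one Je_in)
  also have "\<dots> = (\<Oplus>\<^sub>C b\<in>B. J (e a a) \<otimes>\<^sub>C w \<otimes>\<^sub>C J (e b b))"
   by (rule C.finsum_rdistr[OF mu.finB]) (use w a in "auto simp: Je_in")
  also have "\<dots> = (\<Oplus>\<^sub>C b\<in>B. cf a b w \<otimes>\<^sub>C J (e a b))"
   by (rule C.finsum_cong') (use w a in "auto simp: Je_in cf_Je cf_in")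
  finally show ?thesis .
 qed
 have "w = (\<Oplus>\<^sub>C a\<in>B. J (e a a)) \<otimes>\<^sub>C w" using w by (simp add: one)
 also have "\<dots> = (\<Oplus>\<^sub>C a\<in>B. J (e a a) \<otimes>\<^sub>C w)"
  by (rule C.finsum_ldistr[OF mu.finB w]) (auto simp: Je_in)
 also have "\<dots> = (\<Oplus>\<^sub>C a\<in>B. \<Oplus>\<^sub>C b\<in>B. cf a b w \<otimes>\<^sub>C J (e a b))"
  by (rule C.finsum_cong') (use w e in "auto simp: Je_in cf_in intro!: C.finsum_closed")
 finally show ?thesis .
qed

lemma H_zero: "\<zero>\<^sub>C \<in> H" by (simp add: H_def J)
lemma H_one: "\<one>\<^sub>C \<in> H" by (simp add: H_def J)

lemma HJ_induct:
 assumes w: "w :. C" and HJ: "!!h m. [|h \<in> H; m :. E|] ==> T (h \<otimes>\<^sub>C J m)"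
  and add: "!!x y. [|x :. C; y :. C; T x; T y|] ==> T (x \<oplus>\<^sub>C y)"
 shows "T w"
proof -
 have zero: "T \<zero>\<^sub>C" using HJ[OF H_zero mu.one_closed] by (simp add: J)
 have "T (\<Oplus>\<^sub>C i\<in>B. \<Oplus>\<^sub>C j\<in>B. cf i j w \<otimes>\<^sub>C J (e i j))"
 proof (rule C.finsum_induct[OF mu.finB _ zero add], rule conjI)
  fix a assume a: "a \<in> B"
  show "(\<Oplus>\<^sub>C j\<in>B. cf a j w \<otimes>\<^sub>C J (e a j)) :. C"
   by (rule C.finsum_closed) (use a w in "auto simp: Je_in cf_in")
  show "T (\<Oplus>\<^sub>C j\<in>B. cf a j w \<otimes>\<^sub>C J (e a j))"
   by (rule C.finsum_induct[OF mu.finB _ zero add]) (use a w HJ in "auto simp: Je_in cf_in cf_H mu.e_in")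
 qed
 then show ?thesis using HJ_decomp[OF w] by simp
qed

lemma HJ_mult:
 assumes "h \<in> H" "h' \<in> H" "m :. E" "m' :. E"
 shows "(h \<otimes>\<^sub>C J m) \<otimes>\<^sub>C (h' \<otimes>\<^sub>C J m') = (h \<otimes>\<^sub>C h') \<otimes>\<^sub>C J (m \<otimes>\<^sub>E m')"
proof -
 have "(h \<otimes>\<^sub>C J m) \<otimes>\<^sub>C (h' \<otimes>\<^sub>C J m') = h \<otimes>\<^sub>C (J m \<otimes>\<^sub>C h') \<otimes>\<^sub>C J m'"
  using assms by (simp add: C.m_assoc H_in J)
 also have "J m \<otimes>\<^sub>C h' = h' \<otimes>\<^sub>C J m" using H_comm[OF assms(2,3)] by simp
 finally show ?thesis using assms by (simp add: C.m_assoc H_in J)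
qed

lemma H_mult: "h \<in> H ==> h' \<in> H ==> h \<otimes>\<^sub>C h' \<in> H"
 unfolding H_def by (auto simp: J C.m_assoc) (metis C.m_assoc J(2))

lemma H_add: "h \<in> H ==> h' \<in> H ==> h \<oplus>\<^sub>C h' \<in> H"
 unfolding H_def by (auto simp: J C.l_distr C.r_distr)

lemma H_smult: "c :. K ==> h \<in> H ==> c \<odot>\<^sub>C h \<in> H"
 unfolding H_def by (auto simp: J C.smult_mult_left C.smult_mult_right)

text \<open>This shows that the decomposition of \<open>HJ_decomp\<close> is the inverse of the
  multiplication map: a pure tensor has the entries of \<open>m\<close> times \<open>h\<close> as
  its coefficients.\<close>

lemma cf_HJ:
 assumes "i \<in> B" "j \<in> B" "h \<in> H" "m :. E"
 shows "cf i j (h \<otimes>\<^sub>C J m) = ent i j m \<odot>\<^sub>C h"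
proof -
 have x: "ent i j m :. K" using assms mu.ent_in by blast
 have t: "J (e k i) \<otimes>\<^sub>C (h \<otimes>\<^sub>C J m) \<otimes>\<^sub>C J (e j k) = ent i j m \<odot>\<^sub>C (h \<otimes>\<^sub>C J (e k k))" if k: "k \<in> B" for k
 proof -
  have "J (e k i) \<otimes>\<^sub>C (h \<otimes>\<^sub>C J m) \<otimes>\<^sub>C J (e j k) = (J (e k i) \<otimes>\<^sub>C h) \<otimes>\<^sub>C (J m \<otimes>\<^sub>C J (e j k))"
   using k assms by (simp add: C.m_assoc Je_in H_in J mu.e_in)
  also have "J (e k i) \<otimes>\<^sub>C h = h \<otimes>\<^sub>C J (e k i)" using H_comm[OF assms(3) mu.e_in[OF k assms(1)]] by simp
  also have "h \<otimes>\<^sub>C J (e k i) \<otimes>\<^sub>C (J m \<otimes>\<^sub>C J (e j k)) = h \<otimes>\<^sub>C J (e k i \<otimes>\<^sub>E m \<otimes>\<^sub>E e j k)"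
   using k assms by (simp add: C.m_assoc Je_in H_in J mu.e_in)
  also have "\<dots> = ent i j m \<odot>\<^sub>C (h \<otimes>\<^sub>C J (e k k))"
   using k assms x by (simp add: mu.e_m_e J mu.e_in C.smult_mult_right H_in)
  finally show ?thesis .
 qed
 have one: "(\<Oplus>\<^sub>C i\<in>B. J (e i i)) = \<one>\<^sub>C"
  using module_hom_finsum[OF mu.module_axioms C.module_axioms J(1) mu.finB, of "%i. e i i"] J(6)
  by (simp add: mu.e_sum mu.e_in)
 have "cf i j (h \<otimes>\<^sub>C J m) = (\<Oplus>\<^sub>C k\<in>B. ent i j m \<odot>\<^sub>C (h \<otimes>\<^sub>C J (e k k)))"
  unfolding cf_def by (rule C.finsum_cong') (use assms x t in "auto simp: Je_in H_in")
 also have "\<dots> = ent i j m \<odot>\<^sub>C (\<Oplus>\<^sub>C k\<in>B. h \<otimes>\<^sub>C J (e k k))"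
  by (rule C.finsum_smult_ldistr[symmetric]) (use assms x mu.finB in "auto simp: Je_in H_in")
 also have "(\<Oplus>\<^sub>C k\<in>B. h \<otimes>\<^sub>C J (e k k)) = h \<otimes>\<^sub>C (\<Oplus>\<^sub>C k\<in>B. J (e k k))"
  by (rule C.finsum_rdistr[OF mu.finB, symmetric]) (use assms in "auto simp: Je_in H_in")
 finally show ?thesis using assms by (simp add: one H_in)
qed

text \<open>The tensor product of a functional on \<open>H\<close> with the identity of the matrix
  algebra.\<close>

definition ext where "ext lam w = (\<Oplus>\<^sub>E i\<in>B. \<Oplus>\<^sub>E j\<in>B. lam (cf i j w) \<odot>\<^sub>E e i j)"

definition lin where "lin lam \<longleftrightarrow> (\<forall>h \<in> H. lam h :. K) &
 (\<forall>h \<in> H. \<forall>h' \<in> H. lam (h \<oplus>\<^sub>C h') = lam h \<oplus>\<^sub>K lam h') & (\<forall>a \<in> carrier K. \<forall>h \<in> H. lam (a \<odot>\<^sub>C h) = a \<otimes>\<^sub>K lam h)"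

lemma linD: "lin lam ==> h \<in> H ==> lam h :. K"
 "lin lam ==> h \<in> H ==> h' \<in> H ==> lam (h \<oplus>\<^sub>C h') = lam h \<oplus>\<^sub>K lam h'"
 "lin lam ==> a :. K ==> h \<in> H ==> lam (a \<odot>\<^sub>C h) = a \<otimes>\<^sub>K lam h"
 by (simp_all add: lin_def)

lemma finsum2_in: "(!!i j. i \<in> B ==> j \<in> B ==> f i j :. E) ==> (\<Oplus>\<^sub>E i\<in>B. \<Oplus>\<^sub>E j\<in>B. f i j) :. E"
 by (intro mu.finsum_closed Pi_I) auto

lemma finsum2_add:
 assumes "!!i j. i \<in> B ==> j \<in> B ==> f i j :. E" "!!i j. i \<in> B ==> j \<in> B ==> g i j :. E"
 shows "(\<Oplus>\<^sub>E i\<in>B. \<Oplus>\<^sub>E j\<in>B. f i j \<oplus>\<^sub>E g i j) = (\<Oplus>\<^sub>E i\<in>B. \<Oplus>\<^sub>E j\<in>B. f i j) \<oplus>\<^sub>E (\<Oplus>\<^sub>E i\<in>B. \<Oplus>\<^sub>E j\<in>B. g i j)"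
proof -
 have "(\<Oplus>\<^sub>E i\<in>B. \<Oplus>\<^sub>E j\<in>B. f i j \<oplus>\<^sub>E g i j) = (\<Oplus>\<^sub>E i\<in>B. (\<Oplus>\<^sub>E j\<in>B. f i j) \<oplus>\<^sub>E (\<Oplus>\<^sub>E j\<in>B. g i j))"
  by (rule mu.finsum_cong') (use assms in "auto intro!: mu.finsum_closed mu.finsum_addf")
 also have "\<dots> = (\<Oplus>\<^sub>E i\<in>B. \<Oplus>\<^sub>E j\<in>B. f i j) \<oplus>\<^sub>E (\<Oplus>\<^sub>E i\<in>B. \<Oplus>\<^sub>E j\<in>B. g i j)"
  by (rule mu.finsum_addf) (use assms in "auto intro!: mu.finsum_closed")
 finally show ?thesis .
qed

lemma finsum2_smult:
 assumes "!!i j. i \<in> B ==> j \<in> B ==> f i j :. E" "a :. K"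
 shows "(\<Oplus>\<^sub>E i\<in>B. \<Oplus>\<^sub>E j\<in>B. a \<odot>\<^sub>E f i j) = a \<odot>\<^sub>E (\<Oplus>\<^sub>E i\<in>B. \<Oplus>\<^sub>E j\<in>B. f i j)"
proof -
 have "(\<Oplus>\<^sub>E i\<in>B. \<Oplus>\<^sub>E j\<in>B. a \<odot>\<^sub>E f i j) = (\<Oplus>\<^sub>E i\<in>B. a \<odot>\<^sub>E (\<Oplus>\<^sub>E j\<in>B. f i j))"
  by (rule mu.finsum_cong') (use assms mu.finB in "auto intro!: mu.finsum_closed mu.smult_closed mu.finsum_smult_ldistr[symmetric]")
 also have "\<dots> = a \<odot>\<^sub>E (\<Oplus>\<^sub>E i\<in>B. \<Oplus>\<^sub>E j\<in>B. f i j)"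
  by (rule mu.finsum_smult_ldistr[symmetric]) (use assms mu.finB in "auto intro!: mu.finsum_closed")
 finally show ?thesis .
qed

lemma finsum2_cong:
 assumes "!!i j. i \<in> B ==> j \<in> B ==> f i j = g i j" "!!i j. i \<in> B ==> j \<in> B ==> g i j :. E"
 shows "(\<Oplus>\<^sub>E i\<in>B. \<Oplus>\<^sub>E j\<in>B. f i j) = (\<Oplus>\<^sub>E i\<in>B. \<Oplus>\<^sub>E j\<in>B. g i j)"
proof (rule mu.finsum_cong'[OF refl])
 show "(%i. \<Oplus>\<^sub>E j\<in>B. g i j) \<in> B \<rightarrow> carrier E" by (intro Pi_I mu.finsum_closed) (auto simp: assms)
 show "(\<Oplus>\<^sub>E j\<in>B. f i j) = (\<Oplus>\<^sub>E j\<in>B. g i j)" if "i \<in> B" for i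
  by (rule mu.finsum_cong'[OF refl]) (use assms that in auto)
qed

lemma ext_term_in: "lin lam ==> w :. C ==> i \<in> B ==> j \<in> B ==> lam (cf i j w) \<odot>\<^sub>E e i j :. E"
 by (simp add: linD cf_H mu.e_in)

lemma ext_hom:
 assumes l: "lin lam" shows "ext lam \<in> module_hom K C E"
proof (rule module_homI)
 fix x assume x: "x :. C"
 show "ext lam x :. E" unfolding ext_def by (rule finsum2_in) (rule ext_term_in[OF l x])
 fix y assume y: "y :. C"
 have "ext lam (x \<oplus>\<^sub>C y) = (\<Oplus>\<^sub>E i\<in>B. \<Oplus>\<^sub>E j\<in>B. lam (cf i j x) \<odot>\<^sub>E e i j \<oplus>\<^sub>E lam (cf i j y) \<odot>\<^sub>E e i j)"
  unfolding ext_def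
  by (rule finsum2_cong) (use x y l in "simp_all add: module_hom_add[OF cf_hom] linD cf_H mu.e_in mu.smult_l_distr")
 also have "\<dots> = ext lam x \<oplus>\<^sub>E ext lam y"
  unfolding ext_def by (rule finsum2_add; rule ext_term_in[OF l]) (use x y in auto)
 finally show "ext lam (x \<oplus>\<^sub>C y) = ext lam x \<oplus>\<^sub>E ext lam y" .
next
 fix a x assume x: "x :. C" and a: "a :. K"
 have "ext lam (a \<odot>\<^sub>C x) = (\<Oplus>\<^sub>E i\<in>B. \<Oplus>\<^sub>E j\<in>B. a \<odot>\<^sub>E (lam (cf i j x) \<odot>\<^sub>E e i j))"
  unfolding ext_def
  by (rule finsum2_cong) (use x a l in "simp_all add: module_hom_smult[OF cf_hom] linD cf_H mu.e_in mu.smult_assoc1")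
 also have "\<dots> = a \<odot>\<^sub>E ext lam x"
  unfolding ext_def by (rule finsum2_smult[OF ext_term_in[OF l x] a])
 finally show "ext lam (a \<odot>\<^sub>C x) = a \<odot>\<^sub>E ext lam x" .
qed

lemma ext_HJ:
 assumes "lin lam" "h \<in> H" "m :. E"
 shows "ext lam (h \<otimes>\<^sub>C J m) = lam h \<odot>\<^sub>E m"
proof -
 have "ext lam (h \<otimes>\<^sub>C J m) = (\<Oplus>\<^sub>E i\<in>B. \<Oplus>\<^sub>E j\<in>B. lam h \<odot>\<^sub>E (ent i j m \<odot>\<^sub>E e i j))"
  unfolding ext_def
  by (rule finsum2_cong)
   (use assms in "simp_all add: cf_HJ linD mu.ent_in mu.e_in mu.smult_assoc1[symmetric] mu.R.m_comm")
 also have "\<dots> = lam h \<odot>\<^sub>E (\<Oplus>\<^sub>E i\<in>B. \<Oplus>\<^sub>E j\<in>B. ent i j m \<odot>\<^sub>E e i j)"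
  by (rule finsum2_smult) (use assms in "simp_all add: linD mu.ent_in mu.e_in")
 finally show ?thesis using E_expand[OF assms(3)] by simp
qed

lemma ext_add:
 assumes "lin lam" "lin lam'" "w :. C"
 shows "ext (%h. lam h \<oplus>\<^sub>K lam' h) w = ext lam w \<oplus>\<^sub>E ext lam' w"
proof -
 have "ext (%h. lam h \<oplus>\<^sub>K lam' h) w = (\<Oplus>\<^sub>E i\<in>B. \<Oplus>\<^sub>E j\<in>B. lam (cf i j w) \<odot>\<^sub>E e i j \<oplus>\<^sub>E lam' (cf i j w) \<odot>\<^sub>E e i j)"
  unfolding ext_def by (rule finsum2_cong) (use assms in "simp_all add: linD cf_H mu.e_in mu.smult_l_distr")
 also have "\<dots> = ext lam w \<oplus>\<^sub>E ext lam' w"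
  unfolding ext_def by (rule finsum2_add) (use assms in "simp_all add: ext_term_in")
 finally show ?thesis .
qed

lemma ext_smult:
 assumes "lin lam" "a :. K" "w :. C"
 shows "ext (%h. a \<otimes>\<^sub>K lam h) w = a \<odot>\<^sub>E ext lam w"
proof -
 have "ext (%h. a \<otimes>\<^sub>K lam h) w = (\<Oplus>\<^sub>E i\<in>B. \<Oplus>\<^sub>E j\<in>B. a \<odot>\<^sub>E (lam (cf i j w) \<odot>\<^sub>E e i j))"
  unfolding ext_def by (rule finsum2_cong) (use assms in "simp_all add: linD cf_H mu.e_in mu.smult_assoc1")
 also have "\<dots> = a \<odot>\<^sub>E ext lam w"
  unfolding ext_def by (rule finsum2_smult) (use assms in "simp_all add: ext_term_in")
 finally show ?thesis .
qed

end

subsection \<open>The representation algebra\<close>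

lemma alg_hom_cong:
 assumes "assoc_algebra K A" "f \<in> alg_hom K A B" "!!x. x :. A ==> g x = f x"
 shows "g \<in> alg_hom K A B"
proof -
 interpret A: assoc_algebra K A by fact
 note f = alg_homD[OF assms(2)]
 show ?thesis by (rule alg_homI) (simp_all add: assms(3) f)
qed

lemma alg_hom_deg0: "alg_hom K (deg0 A) B = alg_hom K A B" "alg_hom K B (deg0 A) = alg_hom K B A"
 by (simp_all add: alg_hom_def module_hom_def ring_hom_def deg0_simps)

text \<open>The three hypotheses on \<open>\<phi>\<close> say that it is a DG algebra map to End V
  placed in degree 0.\<close>

locale rep_setup = R: dg_algebra K R + mu: matrix_units K "End_alg K V" B e ent
 for K :: "('k, 'c) ring_scheme" and R :: "('k, 'r, 'd) dg_alg_scheme" and V :: "('k, 'v, 'f) module_scheme"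
  and B :: "'i set" and e ent +
 fixes \<phi> :: "'r => 'v => 'v"
 assumes \<phi>_hom: "\<phi> \<in> alg_hom K R (End_alg K V)"
  and \<phi>_Gr: "!!n x. [|x \<in> Gr R n; n ~= 0|] ==> \<phi> x = \<zero>\<^bsub>End_alg K V\<^esub>"
  and \<phi>_dif: "!!x. x :. R ==> \<phi> (dif R x) = \<zero>\<^bsub>End_alg K V\<^esub>"
begin

abbreviation E where "E \<equiv> End_alg K V"

sublocale Cp: coprod_setup K R "deg0 (End_alg K V)"
 by (intro coprod_setup.intro R.dg_algebra_axioms deg0_dg_algebra mu.assoc_algebra_axioms)

abbreviation C where "C \<equiv> Cp.C"
abbreviation L where "L \<equiv> Cp.L"
abbreviation J where "J \<equiv> %m. Cp.L (Inr m)"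

sublocale CD: dg_algebra K Cp.C by (rule Cp.C_dg_algebra)

lemma J_hom: "J \<in> alg_hom K E C"
 using Cp.L2_hom by (simp add: alg_hom_deg0)

sublocale mc: matrix_coeffs K "End_alg K V" B e ent Cp.C "%m. Cp.L (Inr m)"
 by (intro matrix_coeffs.intro matrix_coeffs_axioms.intro mu.matrix_units_axioms Cp.C.assoc_algebra_axioms J_hom)

abbreviation H where "H \<equiv> mc.H"

lemma J_Gr: "m :. E ==> J m \<in> Gr C 0"
 by (rule Cp.L_Gr) (simp add: deg0_simps)

lemma J_X: "m :. E ==> Inr m \<in> Cp.X"
 by (rule Cp.Inr_X) (simp add: deg0_simps)

lemma dif_J: "m :. E ==> dif C (J m) = \<zero>\<^sub>C"
 using Cp.L_zero(2) by (simp add: Cp.dif_C_letter J_X) (simp add: deg0_simps)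

lemma sgn_J: "m :. E ==> sgn_inv K C (J m) = J m"
 using CD.sgn_inv_Gr_eq[OF J_Gr, of m] by (simp add: ksign_def mc.J)

text \<open>Images of End V are cocycles of degree 0, so the differential is linear over End V on
  both sides and preserves its centralizer.\<close>

lemma dif_mult_J:
 assumes "w :. C" "m :. E"
 shows "dif C (w \<otimes>\<^sub>C J m) = dif C w \<otimes>\<^sub>C J m" "dif C (J m \<otimes>\<^sub>C w) = J m \<otimes>\<^sub>C dif C w"
 using assms by (simp_all add: CD.dif_mult_sgn mc.J dif_J sgn_J CD.sgn_inv_in CD.dif_in)

lemma End_coprod_eq: "End_coprod K R V = C"
 by (simp add: End_coprod_def coprod_def)

lemma root_carrier_eq: "root_carrier K R V = H"
proof -
 have "gcomm K C w (J m) = \<zero>\<^sub>C \<longleftrightarrow> w \<otimes>\<^sub>C J m = J m \<otimes>\<^sub>C w" if "w :. C" "m :. E" for w m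
  using CD.gcomm_deg0[OF that(1) J_Gr[OF that(2)]] Cp.C.eq_if_minus_zero[of "w \<otimes>\<^sub>C J m" "J m \<otimes>\<^sub>C w"]
   Cp.C.minus_self[of "J m \<otimes>\<^sub>C w"] that mc.J(2) by auto
 then show ?thesis unfolding root_carrier_def mc.H_def End_coprod_eq Cp.incl2_L by blast
qed

lemma H_dif: "w \<in> H ==> dif C w \<in> H"
proof -
 assume w: "w \<in> H"
 have "dif C w \<otimes>\<^sub>C J m = J m \<otimes>\<^sub>C dif C w" if "m :. E" for m
  using dif_mult_J[OF mc.H_in[OF w] that] mc.H_comm[OF w that] by simp
 then show ?thesis using CD.dif_in[OF mc.H_in[OF w]] by (simp add: mc.H_def)
qed

lemma H_hcomp: "w \<in> H ==> hcomp C w n \<in> H"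
proof -
 assume w: "w \<in> H"
 have "hcomp C w n \<otimes>\<^sub>C J m = J m \<otimes>\<^sub>C hcomp C w n" if "m :. E" for m
  using CD.hcomp_mult_deg0[OF mc.H_in[OF w] J_Gr[OF that], of n] mc.H_comm[OF w that] by simp
 then show ?thesis using CD.hcomp_in[OF mc.H_in[OF w]] by (simp add: mc.H_def)
qed

sublocale Rt: dg_sub K Cp.C mc.H
 by (intro dg_sub.intro dg_sub_axioms.intro CD.dg_algebra_axioms)
  (auto intro: mc.H_in mc.H_one mc.H_add mc.H_mult mc.H_smult H_hcomp H_dif)

abbreviation Rt where "Rt \<equiv> C\<lparr>carrier := H, Gr := %n. Gr C n \<inter> H\<rparr>"

sublocale RD: dg_algebra K "Cp.C\<lparr>carrier := mc.H, Gr := %n. Gr Cp.C n \<inter> mc.H\<rparr>" by (rule Rt.Asub_dg_algebra)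

lemma root_alg_eq: "root_alg K R V = Rt"
 by (simp add: root_alg_def root_carrier_eq End_coprod_eq)

sublocale Qr: alg_quot K "Cp.C\<lparr>carrier := mc.H, Gr := %n. Gr Cp.C n \<inter> mc.H\<rparr>"
  "comm_ideal K (Cp.C\<lparr>carrier := mc.H, Gr := %n. Gr Cp.C n \<inter> mc.H\<rparr>)"
 by (intro alg_quot.intro alg_quot_axioms.intro Rt.As.assoc_algebra_axioms RD.comm_ideal_ideal)

abbreviation CI where "CI \<equiv> comm_ideal K Rt"
abbreviation rep where "rep \<equiv> dg_quot Rt CI"
abbreviation rc where "rc h \<equiv> CI +>\<^sub>Rt h"

lemma rep_alg_eq: "rep_alg K R V = rep"
 by (simp add: rep_alg_def root_alg_eq abelianization_def)

sublocale rep: assoc_algebra K "dg_quot (Cp.C\<lparr>carrier := mc.H, Gr := %n. Gr Cp.C n \<inter> mc.H\<rparr>)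
  (comm_ideal K (Cp.C\<lparr>carrier := mc.H, Gr := %n. Gr Cp.C n \<inter> mc.H\<rparr>))"
 by (rule Qr.Q_assoc_algebra)

lemma rc_in: "h \<in> H ==> rc h :. rep"
 by (rule Qr.cls_in) simp

lemma rc_rep: "x :. rep ==> \<exists>h \<in> H. x = rc h"
 using Qr.Q_rep[of x] by simp

lemma rc_add: "h \<in> H ==> h' \<in> H ==> rc (h \<oplus>\<^sub>C h') = rc h \<oplus>\<^sub>rep rc h'"
 using Qr.cls_add[of h h'] by simp

lemma rc_mult: "h \<in> H ==> h' \<in> H ==> rc (h \<otimes>\<^sub>C h') = rc h \<otimes>\<^sub>rep rc h'"
 using Qr.cls_mult[of h h'] by simp

lemma rc_smult: "c :. K ==> h \<in> H ==> rc (c \<odot>\<^sub>C h) = c \<odot>\<^sub>rep rc h"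
 using Qr.cls_smult[of c h] by simp

lemma rc_one: "rc \<one>\<^sub>C = \<one>\<^sub>rep"
 using Qr.cls_one by simp

lemma rc_dif: "h \<in> H ==> dif rep (rc h) = rc (dif C h)"
 using Qr.dif_cls[OF RD.dif_linear RD.comm_ideal_dif, of h] by simp

lemma rep_Gr: "x \<in> Gr rep n \<longleftrightarrow> (\<exists>h \<in> H. h \<in> Gr C n & x = rc h)"
 by (auto simp: dg_quot_simps)

text \<open>The extension of \<open>\<phi>\<close> by the identity of End V to the coproduct. It is
  determined by its values on letters, so the choice is immaterial.\<close>

definition g where "g = (SOME g. g \<in> alg_hom K C E & (\<forall>r \<in> carrier R. g (L (Inl r)) = \<phi> r) & (\<forall>m \<in> carrier E. g (J m) = m))"

lemma g_props: "g \<in> alg_hom K C E & (\<forall>r \<in> carrier R. g (L (Inl r)) = \<phi> r) & (\<forall>m \<in> carrier E. g (J m) = m)"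
proof -
 have "(%m. m) \<in> alg_hom K (deg0 E) E" unfolding alg_hom_deg0 by (rule alg_homI) simp_all
 then have "\<exists>g. g \<in> alg_hom K C E & (\<forall>r \<in> carrier R. g (L (Inl r)) = \<phi> r) & (\<forall>m \<in> carrier E. g (J m) = m)"
  using Cp.universal[OF mu.assoc_algebra_axioms \<phi>_hom, of "%m. m"] unfolding deg0_simps(1) by blast
 then show ?thesis unfolding g_def by (rule someI_ex)
qed

lemma g_hom: "g \<in> alg_hom K C E" and g_L: "r :. R ==> g (L (Inl r)) = \<phi> r" and g_J: "m :. E ==> g (J m) = m"
 using g_props by simp_all

lemmas g = alg_homD[OF g_hom]

lemma g_zero: "g \<zero>\<^sub>C = \<zero>\<^sub>E"
 by (rule module_hom_zero[OF Cp.C.module_axioms mu.module_axioms g(1)])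

text \<open>The third case occurs because \<open>deg0\<close> has the zero space in every nonzero
  degree, so the letter of zero counts as homogeneous of any degree.\<close>

lemma hl_cases:
 assumes "z \<in> Cp.hl i"
 obtains r where "z = Inl r" "r \<in> Gr R i" | m where "z = Inr m" "m :. E" "i = 0" | "z = Inr \<zero>\<^sub>E"
 using assms by (auto simp: deg0_simps split: if_splits)

lemma g_hl: "z \<in> Cp.hl i ==> i ~= 0 ==> g (L z) = \<zero>\<^sub>E"
 by (erule hl_cases) (auto simp: g_L R.Gr_in \<phi>_Gr g_J)

lemma words_vanish:
 assumes T: "T \<in> module_hom K C E" and w: "!!w. word_deg Cp.hl n w ==> T (Cp.Q.cls (word K w)) = \<zero>\<^sub>E"
  and x: "x \<in> Gr C n"
 shows "T x = \<zero>\<^sub>E"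
proof -
 have "T (Cp.Q.cls f) = \<zero>\<^sub>E" if "f \<in> Gr Cp.P n" for f
  using that
 proof (induction f rule: Cp.Gr_P_induct)
  case zero then show ?case using module_hom_zero[OF Cp.C.module_axioms mu.module_axioms T] by (simp add: Cp.Q.cls_zero)
 next
  case (word c w)
  then show ?case using w[OF word(2)] Cp.word_P[OF Cp.word_deg_X[OF word(2)]]
   by (simp add: Cp.Q.cls_smult[symmetric] module_hom_smult[OF T] Cp.Q.cls_in)
 next
  case (add f h) then show ?case by (simp add: Cp.Q.cls_add[symmetric] module_hom_add[OF T] Cp.Q.cls_in)
 qed
 then show ?thesis using x by (auto simp: Cp.Gr_C)
qed

text \<open>A word of nonzero total degree contains a letter of nonzero degree, which
  \<open>g\<close> kills.\<close>

lemma g_word: "word_deg Cp.hl n w ==> n ~= 0 ==> g (Cp.Q.cls (word K w)) = \<zero>\<^sub>E"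
proof (induction w arbitrary: n)
 case (Cons z w)
 then obtain i where i: "z \<in> Cp.hl i" "word_deg Cp.hl (n - i) w" by auto
 have z: "z \<in> Cp.X" "w \<in> lists Cp.X" using Cp.hl_X i Cp.word_deg_X by auto
 have c: "Cp.Q.cls (word K w) :. C" "L z :. C" using z by (simp_all add: Cp.Q.cls_in Cp.word_P Cp.L_in)
 have "g (Cp.Q.cls (word K (z # w))) = g (L z) \<otimes>\<^sub>E g (Cp.Q.cls (word K w))"
  using z c by (simp add: Cp.cls_word_Cons g)
 then show ?case using g_hl[OF i(1)] Cons.IH[OF i(2)] Cons.prems(2) g(2)[OF c(1)] g(2)[OF c(2)] by (cases "i = 0") simp_all
qed simp

lemma g_Gr: "x \<in> Gr C n ==> n ~= 0 ==> g x = \<zero>\<^sub>E"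
 using words_vanish[OF g(1)] g_word by blast

lemma g_dif_letter: "z \<in> Cp.X ==> g (L (Cp.df z)) = \<zero>\<^sub>E"
 by (erule Cp.X_cases) (simp_all add: g_L R.dif_in \<phi>_dif deg0_simps g_J)

text \<open>The twisted Leibniz rule reduces the claim to letters, where it is the hypothesis on
  \<open>\<phi>\<close> or the vanishing differential of End V.\<close>

lemma g_dif: "x :. C ==> g (dif C x) = \<zero>\<^sub>E"
proof (induction rule: Cp.C_induct)
 case zero then show ?case by (simp add: module_hom_zero[OF Cp.C.module_axioms Cp.C.module_axioms CD.dif_linear] g_zero)
next
 case one then show ?case by (simp add: CD.dif_one g_zero)
next
 case (letter z y)
 then show ?case by (simp add: Cp.dif_C_letter_mult Cp.L_in Cp.df_X Cp.sg_X CD.dif_in g g_dif_letter)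
next
 case (add x y) then show ?case by (simp add: module_hom_add[OF CD.dif_linear] g CD.dif_in)
next
 case (smult c x) then show ?case by (simp add: module_hom_smult[OF CD.dif_linear] g CD.dif_in)
qed

sublocale DR: der_setup K R "End_alg K V" \<phi>
 by (rule R.der_setupI[OF mu.assoc_algebra_axioms \<phi>_hom \<phi>_Gr \<phi>_dif])

end

subsection \<open>The point of the representation scheme\<close>

locale rep_point_setup = rep_setup + fixes t assumes t: "t \<in> B"
begin

text \<open>An index \<open>t\<close> exists exactly when End V is nonzero. The entry at
  \<open>t\<close> reads the scalar off a scalar matrix.\<close>

abbreviation eps where "eps \<equiv> ent t t"

lemma eps_in: "m :. E ==> eps m :. K" by (rule mu.ent_in[OF t t])
lemma eps_add: "m :. E ==> m' :. E ==> eps (m \<oplus>\<^sub>E m') = eps m \<oplus>\<^sub>K eps m'"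
 using module_hom_add[OF mu.ent_hom[OF t]] by (simp add: base_alg_simps)
lemma eps_smult: "c :. K ==> m :. E ==> eps (c \<odot>\<^sub>E m) = c \<otimes>\<^sub>K eps m"
 using module_hom_smult[OF mu.ent_hom[OF t]] by (simp add: base_alg_simps)
lemma eps_one: "c :. K ==> eps (c \<odot>\<^sub>E \<one>\<^sub>E) = c" by (rule mu.ent_smult_one[OF t])
lemma eps_1: "eps \<one>\<^sub>E = \<one>\<^sub>K" using eps_one[OF R.R.one_closed] by simp
lemma eps_0: "eps \<zero>\<^sub>E = \<zero>\<^sub>K" using eps_smult[OF R.R.zero_closed mu.one_closed] by (simp add: eps_1)

text \<open>Since \<open>g\<close> is the identity on End V, it carries the centralizer of End V
  into the centre of End V, which consists of scalars.\<close>

lemma g_H: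
 assumes "h \<in> H" shows "g h = eps (g h) \<odot>\<^sub>E \<one>\<^sub>E"
proof (rule mu.central_scalar[OF _ _ t])
 show "g h :. E" using g(2) mc.H_in[OF assms] by blast
 fix m assume m: "m :. E"
 have "g (h \<otimes>\<^sub>C J m) = g (J m \<otimes>\<^sub>C h)" using mc.H_comm[OF assms m] by simp
 then show "g h \<otimes>\<^sub>E m = m \<otimes>\<^sub>E g h" using m mc.H_in[OF assms] by (simp add: g mc.J g_J)
qed

definition h0 where "h0 h = eps (g h)"

lemma h0_in: "h \<in> H ==> h0 h :. K"
 by (simp add: h0_def eps_in g mc.H_in)

lemma h0_mult: "h \<in> H ==> h' \<in> H ==> h0 (h \<otimes>\<^sub>C h') = h0 h \<otimes>\<^sub>K h0 h'"
proof -
 assume h: "h \<in> H" "h' \<in> H"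
 have "g (h \<otimes>\<^sub>C h') = (h0 h \<odot>\<^sub>E \<one>\<^sub>E) \<otimes>\<^sub>E (h0 h' \<odot>\<^sub>E \<one>\<^sub>E)"
  using g_H h by (simp add: g mc.H_in h0_def)
 also have "\<dots> = (h0 h \<otimes>\<^sub>K h0 h') \<odot>\<^sub>E \<one>\<^sub>E"
  using h0_in h by (simp add: mu.smult_mult_left mu.smult_mult_right mu.smult_assoc1[symmetric] R.R.m_comm)
 finally show ?thesis using h0_in h by (simp add: h0_def[of "h \<otimes>\<^sub>C h'"] eps_one)
qed

lemma h0_hom: "h0 \<in> alg_hom K Rt (base_alg K)"
 by (rule alg_homI) (simp_all add: base_alg_simps h0_in h0_mult, simp_all add: h0_def g mc.H_in eps_add eps_smult eps_1)

lemma h0_Gr: "h \<in> H ==> h \<in> Gr C n ==> n ~= 0 ==> h0 h = \<zero>\<^sub>K"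
 by (simp add: h0_def g_Gr eps_0)

lemma base_assoc: "assoc_algebra K (base_alg K)" by (rule base_alg_assoc_algebra[OF R.field_axioms])

text \<open>If both degrees are nonzero, both sides are 0; otherwise the sign is 1 and commutativity
  of the field applies.\<close>

lemma sign_vanish:
 assumes "i ~= 0 ==> a = \<zero>\<^sub>K" "j ~= 0 ==> b = \<zero>\<^sub>K" "a :. K" "b :. K"
 shows "ksign K (i * j) \<otimes>\<^sub>K (b \<otimes>\<^sub>K a) = a \<otimes>\<^sub>K b"
 using assms R.R.ksign_in[of "i * j"]
 by (cases "i = 0"; cases "j = 0") (simp_all add: ksign_def R.R.m_comm)

text \<open>The kernel of \<open>h0\<close> is an ideal, and \<open>h0\<close> sends brackets to
  zero because the field is commutative and \<open>h0\<close> vanishes outside degree 0.\<close>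

lemma h0_kills: "x \<in> CI ==> h0 x = \<zero>\<^bsub>base_alg K\<^esub>"
proof -
 note h = alg_homD[OF h0_hom]
 interpret b: assoc_algebra K "base_alg K" by (rule base_assoc)
 have "CI <= {x \<in> carrier Rt. h0 x = \<zero>\<^bsub>base_alg K\<^esub>}"
 proof (rule RD.comm_ideal_least[OF alg_hom_kernel_ideal[OF Rt.As.assoc_algebra_axioms base_assoc h0_hom]])
  fix i j x y assume x: "x \<in> Gr Rt i" and y: "y \<in> Gr Rt j"
  then have xy: "x :. Rt" "y :. Rt" by simp_all
  have "h0 (RD.bracket i j x y) = (h0 x \<otimes>\<^sub>K h0 y) \<ominus>\<^bsub>base_alg K\<^esub> (ksign K (i * j) \<otimes>\<^sub>K (h0 y \<otimes>\<^sub>K h0 x))"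
   using xy module_hom_minus[OF Rt.As.module_axioms b.module_axioms h(1)] h(4,5)[of _ _] R.R.ksign_in
   by (simp add: RD.bracket_def base_alg_simps mc.H_mult mc.H_smult)
  also have "ksign K (i * j) \<otimes>\<^sub>K (h0 y \<otimes>\<^sub>K h0 x) = h0 x \<otimes>\<^sub>K h0 y"
   by (rule sign_vanish) (use x y in "auto simp: h0_Gr h0_in")
  also have "(h0 x \<otimes>\<^sub>K h0 y) \<ominus>\<^bsub>base_alg K\<^esub> (h0 x \<otimes>\<^sub>K h0 y) = \<zero>\<^bsub>base_alg K\<^esub>"
   by (rule b.minus_self) (use xy in "simp add: base_alg_simps h0_in")
  finally show "RD.bracket i j x y \<in> {x \<in> carrier Rt. h0 x = \<zero>\<^bsub>base_alg K\<^esub>}"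
   using RD.bracket_in[OF xy] by simp
 qed
 then show "x \<in> CI ==> h0 x = \<zero>\<^bsub>base_alg K\<^esub>" by blast
qed

text \<open>The point of the representation scheme given by \<open>\<phi>\<close>. It is restricted
  to the carrier because \<open>point_of\<close> asks for an extensional function, which makes the
  point unique.\<close>

definition f1 where "f1 = restrict (Qr.qlift h0) (carrier rep)"

lemma f1_rc: "h \<in> H ==> f1 (rc h) = h0 h"
proof -
 assume h: "h \<in> H"
 interpret b: assoc_algebra K "base_alg K" by (rule base_assoc)
 show ?thesis using Qr.qlift_cls[OF b.module_axioms alg_homD(1)[OF h0_hom] h0_kills, of h] h rc_in[OF h]
  by (simp add: f1_def)
qed

lemma f1_hom: "f1 \<in> alg_hom K rep (base_alg K)"
 by (rule alg_hom_cong[OF rep.assoc_algebra_axioms Qr.qlift_alg_hom[OF base_assoc h0_hom h0_kills]])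
  (simp_all add: f1_def)

lemma f1_Gr: "x \<in> Gr rep n ==> n ~= 0 ==> f1 x = \<zero>\<^bsub>base_alg K\<^esub>"
 by (auto simp: rep_Gr f1_rc h0_Gr base_alg_simps)

lemma f1_dif: "x :. rep ==> f1 (dif rep x) = \<zero>\<^bsub>base_alg K\<^esub>"
 using rc_rep[of x] by (auto simp: rc_dif f1_rc H_dif h0_def g_dif mc.H_in eps_0 base_alg_simps)

lemma point_f1: "point_of K R V \<phi> f1"
proof -
 interpret b: assoc_algebra K "base_alg K" by (rule base_assoc)
 have Gr_rep: "x :. rep" if "x \<in> Gr rep n" for x n using that rc_in by (auto simp: rep_Gr)
 have "f1 \<in> dg_hom K rep (deg0 (base_alg K))"
  unfolding dg_hom_def alg_hom_deg0
 proof (intro CollectI conjI allI ballI f1_hom)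
  show "f1 ` Gr rep n <= Gr (deg0 (base_alg K)) n" for n
   using f1_Gr[of _ n] alg_homD(2)[OF f1_hom] Gr_rep by (auto simp: deg0_simps)
 qed (simp add: f1_dif deg0_simps)
 moreover have "f1 \<in> extensional (carrier rep)" by (simp add: f1_def)
 moreover have "corresponds K R V f1 \<phi>"
  unfolding corresponds_def root_alg_eq End_coprod_eq Cp.incl1_L Cp.incl2_L
 proof (intro bexI[of _ g] conjI ballI)
  show "g \<in> dg_hom K C (deg0 E)"
   unfolding dg_hom_def alg_hom_deg0
  proof (intro CollectI conjI allI ballI g_hom)
   show "g ` Gr C n <= Gr (deg0 E) n" for n
    using g_Gr[of _ n] g(2) CD.Gr_in by (auto simp: deg0_simps)
  qed (simp add: g_dif deg0_simps)
  show "g w = f1 (rc w) \<odot>\<^sub>E \<one>\<^sub>E" if "w :. Rt" for w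
   using that g_H[of w] by (simp add: f1_rc h0_def)
 qed (simp_all add: g_J g_L)
 ultimately show ?thesis by (simp add: point_of_def rep_alg_eq)
qed

text \<open>The map \<open>g'\<close> witnessing the correspondence agrees with \<open>g\<close> on
  all letters, hence everywhere. On the centralizer it is \<open>f\<close> times the unit, so
  \<open>eps\<close> recovers \<open>f\<close>.\<close>

lemma point_unique: "point_of K R V \<phi> f ==> f = f1"
proof -
 assume f: "point_of K R V \<phi> f"
 obtain g' where g': "g' \<in> dg_hom K C (deg0 E)" "!!w. w :. Rt ==> g' w = f (rc w) \<odot>\<^sub>E \<one>\<^sub>E"
  "!!m. m :. E ==> g' (J m) = m" "!!r. r :. R ==> \<phi> r = g' (L (Inl r))"
  using f unfolding point_of_def corresponds_def root_alg_eq End_coprod_eq Cp.incl1_L Cp.incl2_L by blast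
 have gh: "g' \<in> alg_hom K C E" using g'(1) by (simp add: dg_hom_def alg_hom_deg0)
 have eq: "g' x = g x" if "x :. C" for x
  by (rule Cp.alg_hom_eq[OF mu.assoc_algebra_axioms gh g_hom _ that])
   (auto elim!: Cp.X_cases simp: g'(3) g'(4)[symmetric] g_J g_L deg0_simps)
 have fin: "f \<in> alg_hom K rep (base_alg K)" "f \<in> extensional (carrier rep)"
  using f by (simp_all add: point_of_def dg_hom_def rep_alg_eq alg_hom_deg0)
 have "f x = f1 x" if x: "x :. rep" for x
 proof -
  obtain h where h: "h \<in> H" "x = rc h" using rc_rep[OF x] by blast
  have "f x :. K" using alg_homD(2)[OF fin(1) x] by (simp add: base_alg_simps)
  moreover have "f x \<odot>\<^sub>E \<one>\<^sub>E = g h" using g'(2)[of h] h eq[OF mc.H_in[OF h(1)]] by simp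
  ultimately have "f x = eps (g h)" using eps_one[of "f x"] by simp
  then show ?thesis using h by (simp add: f1_rc h0_def)
 qed
 then show "f = f1" using fin(2) by (intro extensionalityI[of f "carrier rep"]) (simp_all add: f1_def)
qed

lemma rep_point_eq: "rep_point K R V \<phi> = f1"
proof -
 have "(THE f. point_of K R V \<phi> f) = f1" by (rule the_equality[where P = "point_of K R V \<phi>", OF point_f1 point_unique])
 moreover have "\<exists>f. point_of K R V \<phi> f" by (rule exI[of _ f1], rule point_f1)
 ultimately show ?thesis by (simp add: rep_point_def)
qed

sublocale DS: der_setup K "dg_quot (Cp.C\<lparr>carrier := mc.H, Gr := %n. Gr Cp.C n \<inter> mc.H\<rparr>)
  (comm_ideal K (Cp.C\<lparr>carrier := mc.H, Gr := %n. Gr Cp.C n \<inter> mc.H\<rparr>))" "base_alg K" f1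
proof (intro der_setup.intro der_setup_axioms.intro rep.assoc_algebra_axioms base_assoc f1_hom)
 show "f1 x = \<zero>\<^bsub>base_alg K\<^esub>" if "x \<in> Gr rep n" "n ~= 0" for x n by (rule f1_Gr[OF that])
 show "f1 (dif rep x) = \<zero>\<^bsub>base_alg K\<^esub>" if "x :. rep" for x by (rule f1_dif[OF that])
 show "dif rep \<in> module_hom K rep rep" by (rule Qr.dif_Q_hom[OF RD.dif_linear RD.comm_ideal_dif])
 fix x n assume x: "x \<in> Gr rep n"
 then obtain h where h: "h \<in> H" "h \<in> Gr C n" "x = rc h" by (auto simp: rep_Gr)
 show "x :. rep" using h rc_in by simp
 show "dif rep x \<in> Gr rep (n + 1)" using h H_dif CD.dif_degree by (auto simp: rc_dif rep_Gr)
 fix y assume "y :. rep"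
 then obtain h' where h': "h' \<in> H" "y = rc h'" using rc_rep by blast
 have "rc (dif C (h \<otimes>\<^sub>C h')) = rc (dif C h \<otimes>\<^sub>C h' \<oplus>\<^sub>C ksign K n \<odot>\<^sub>C (h \<otimes>\<^sub>C dif C h'))"
  using CD.dif_mult[OF h(2) mc.H_in[OF h'(1)]] by simp
 then show "dif rep (x \<otimes>\<^sub>rep y) = dif rep x \<otimes>\<^sub>rep y \<oplus>\<^sub>rep ksign K n \<odot>\<^sub>rep (x \<otimes>\<^sub>rep dif rep y)"
  using h h' by (simp add: rc_mult[symmetric] rc_dif mc.H_mult H_dif rc_add[symmetric] rc_smult[symmetric] mc.H_smult R.R.ksign_in)
next
 fix x assume "x :. rep"
 then obtain h where h: "h \<in> H" "x = rc h" using rc_rep by blast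
 show "dif rep (dif rep x) = \<zero>\<^sub>rep"
  using h Qr.cls_zero by (simp add: rc_dif H_dif CD.dif_dif mc.H_in)
next
 fix T x assume x: "x :. rep" and hom: "!!n y. y \<in> Gr rep n ==> T y"
  and add: "!!y z. [|y :. rep; z :. rep; T y; T z|] ==> T (y \<oplus>\<^sub>rep z)"
 obtain h where h: "h \<in> H" "x = rc h" using rc_rep[OF x] by blast
 have "h :. Rt" using h by simp
 then have "T (rc h)"
 proof (induction h rule: RD.homogeneous_induct)
  case (homogeneous n y) then show ?case using hom[of "rc y" n] by (auto simp: rep_Gr)
 next
  case (add y z) then show ?case using rc_in rc_add \<open>!!y z. [|y :. rep; z :. rep; T y; T z|] ==> T (y \<oplus>\<^sub>rep z)\<close>[of "rc y" "rc z"] by simp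
 qed
 then show "T x" using h by simp
qed

end

subsection \<open>Derivations of the representation algebra\<close>

context rep_point_setup begin

lemma lin_der: "DS.der i \<delta> ==> mc.lin (%h. \<delta> (rc h))"
proof -
 assume d: "DS.der i \<delta>"
 note d' = DS.derD[OF d]
 show ?thesis unfolding mc.lin_def
  using d'(4)[OF rc_in] module_hom_add[OF d'(1) rc_in rc_in] module_hom_smult[OF d'(1) _ rc_in]
  by (simp add: rc_add rc_smult base_alg_simps)
qed

text \<open>The derivation of the coproduct into End V that is \<open>\<delta>\<close> on the
  centralizer and zero on End V.\<close>

definition D where "D \<delta> = mc.ext (%h. \<delta> (rc h))"

lemma D_hom: "DS.der i \<delta> ==> D \<delta> \<in> module_hom K C E"
 unfolding D_def by (rule mc.ext_hom[OF lin_der])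

lemma D_HJ: "DS.der i \<delta> ==> h \<in> H ==> m :. E ==> D \<delta> (h \<otimes>\<^sub>C J m) = \<delta> (rc h) \<odot>\<^sub>E m"
 unfolding D_def by (rule mc.ext_HJ[OF lin_der])

lemma g_HJ: "h \<in> H ==> m :. E ==> g (h \<otimes>\<^sub>C J m) = h0 h \<odot>\<^sub>E m"
proof -
 assume h: "h \<in> H" and m: "m :. E"
 have "g (h \<otimes>\<^sub>C J m) = (h0 h \<odot>\<^sub>E \<one>\<^sub>E) \<otimes>\<^sub>E m"
  using g_H[OF h] h m by (simp add: g mc.H_in mc.J g_J h0_def)
 then show ?thesis using h0_in[OF h] m by (simp add: mu.smult_mult_left)
qed

text \<open>Additivity in both factors reduces the Leibniz rule to pure tensors, where the
  centralizer commutes with End V and the rule becomes that of \<open>\<delta>\<close> along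
  \<open>h0\<close>.\<close>

lemma D_mult:
 assumes d: "DS.der i \<delta>" and x: "x :. C" and y: "y :. C"
 shows "D \<delta> (x \<otimes>\<^sub>C y) = D \<delta> x \<otimes>\<^sub>E g y \<oplus>\<^sub>E g x \<otimes>\<^sub>E D \<delta> y"
proof -
 note hom = D_hom[OF d]
 note Din = module_hom_in[OF hom]
 note d' = DS.derD[OF d]
 show ?thesis
 proof (rule mc.HJ_induct[OF x])
  fix h m assume h: "h \<in> H" and m: "m :. E"
  have hm: "h \<otimes>\<^sub>C J m :. C" using h m by (simp add: mc.H_in mc.J)
  show "D \<delta> ((h \<otimes>\<^sub>C J m) \<otimes>\<^sub>C y) = D \<delta> (h \<otimes>\<^sub>C J m) \<otimes>\<^sub>E g y \<oplus>\<^sub>E g (h \<otimes>\<^sub>C J m) \<otimes>\<^sub>E D \<delta> y"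
  proof (rule mc.HJ_induct[OF y])
   fix h' m' assume h': "h' \<in> H" and m': "m' :. E"
   have k: "\<delta> (rc h) :. K" "\<delta> (rc h') :. K" "h0 h :. K" "h0 h' :. K"
    using d'(4)[OF rc_in] h h' h0_in by (simp_all add: base_alg_simps)
   have "\<delta> (rc (h \<otimes>\<^sub>C h')) = \<delta> (rc h) \<otimes>\<^sub>K h0 h' \<oplus>\<^sub>K h0 h \<otimes>\<^sub>K \<delta> (rc h')"
    using d'(3)[OF rc_in[OF h] rc_in[OF h']] h h' by (simp add: rc_mult f1_rc base_alg_simps)
   then show "D \<delta> ((h \<otimes>\<^sub>C J m) \<otimes>\<^sub>C (h' \<otimes>\<^sub>C J m')) =
     D \<delta> (h \<otimes>\<^sub>C J m) \<otimes>\<^sub>E g (h' \<otimes>\<^sub>C J m') \<oplus>\<^sub>E g (h \<otimes>\<^sub>C J m) \<otimes>\<^sub>E D \<delta> (h' \<otimes>\<^sub>C J m')"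
    using h h' m m' k
    by (simp add: mc.HJ_mult D_HJ[OF d] mc.H_mult g_HJ mu.smult_l_distr mu.smult_assoc1[symmetric] R.R.m_comm mu.smult_mult_left mu.smult_mult_right)
  next
   fix y z assume "y :. C" "z :. C"
    "D \<delta> ((h \<otimes>\<^sub>C J m) \<otimes>\<^sub>C y) = D \<delta> (h \<otimes>\<^sub>C J m) \<otimes>\<^sub>E g y \<oplus>\<^sub>E g (h \<otimes>\<^sub>C J m) \<otimes>\<^sub>E D \<delta> y"
    "D \<delta> ((h \<otimes>\<^sub>C J m) \<otimes>\<^sub>C z) = D \<delta> (h \<otimes>\<^sub>C J m) \<otimes>\<^sub>E g z \<oplus>\<^sub>E g (h \<otimes>\<^sub>C J m) \<otimes>\<^sub>E D \<delta> z"
   then show "D \<delta> ((h \<otimes>\<^sub>C J m) \<otimes>\<^sub>C (y \<oplus>\<^sub>C z)) =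
     D \<delta> (h \<otimes>\<^sub>C J m) \<otimes>\<^sub>E g (y \<oplus>\<^sub>C z) \<oplus>\<^sub>E g (h \<otimes>\<^sub>C J m) \<otimes>\<^sub>E D \<delta> (y \<oplus>\<^sub>C z)"
    using hm Din[OF hm] g(2)[OF hm]
    by (simp add: Cp.C.r_distr module_hom_add[OF hom] g(3) g(2) mu.r_distr Din mu.a_interchange)
  qed
 next
  fix x z assume "x :. C" "z :. C"
   "D \<delta> (x \<otimes>\<^sub>C y) = D \<delta> x \<otimes>\<^sub>E g y \<oplus>\<^sub>E g x \<otimes>\<^sub>E D \<delta> y"
   "D \<delta> (z \<otimes>\<^sub>C y) = D \<delta> z \<otimes>\<^sub>E g y \<oplus>\<^sub>E g z \<otimes>\<^sub>E D \<delta> y"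
  then show "D \<delta> ((x \<oplus>\<^sub>C z) \<otimes>\<^sub>C y) = D \<delta> (x \<oplus>\<^sub>C z) \<otimes>\<^sub>E g y \<oplus>\<^sub>E g (x \<oplus>\<^sub>C z) \<otimes>\<^sub>E D \<delta> y"
   using y by (simp add: Cp.C.l_distr module_hom_add[OF hom] g(3) g(2) mu.l_distr Din mu.a_interchange)
 qed
qed

lemma cf_Gr: "i \<in> B ==> j \<in> B ==> w \<in> Gr C n ==> mc.cf i j w \<in> Gr C n"
 unfolding mc.cf_def
proof (rule Cp.C.finsum_induct[OF mu.finB])
 fix k assume a: "i \<in> B" "j \<in> B" "w \<in> Gr C n" "k \<in> B"
 have "J (e k i) \<otimes>\<^sub>C w \<otimes>\<^sub>C J (e j k) \<in> Gr C (0 + n + 0)"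
  by (intro Cp.Gr_C_mult J_Gr mu.e_in a)
 then show "J (e k i) \<otimes>\<^sub>C w \<otimes>\<^sub>C J (e j k) :. C & J (e k i) \<otimes>\<^sub>C w \<otimes>\<^sub>C J (e j k) \<in> Gr C n"
  using Cp.Gr_C_in by simp
qed (simp_all add: Cp.Gr_C_zero Cp.Gr_C_add)

lemma D_Gr:
 assumes d: "DS.der i \<delta>" and x: "x \<in> Gr C n" "n ~= - i"
 shows "D \<delta> x = \<zero>\<^sub>E"
proof -
 have "\<delta> (rc (mc.cf a b x)) = \<zero>\<^sub>K" if "a \<in> B" "b \<in> B" for a b
  using DS.derD(2)[OF d _ x(2), of "rc (mc.cf a b x)"] cf_Gr[OF that x(1)] mc.cf_H[OF that Cp.Gr_C_in[OF x(1)]]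
  by (auto simp: rep_Gr base_alg_simps)
 then have "D \<delta> x = (\<Oplus>\<^sub>E a\<in>B. \<Oplus>\<^sub>E b\<in>B. \<zero>\<^sub>E)"
  unfolding D_def mc.ext_def by (intro mc.finsum2_cong) (simp_all add: mu.e_in)
 then show ?thesis by simp
qed

text \<open>Matrix units are cocycles of degree 0, so taking coefficients is a chain map. This is
  what makes the extension \<open>D\<close> compatible with the differentials.\<close>

lemma cf_dif: "i \<in> B ==> j \<in> B ==> w :. C ==> mc.cf i j (dif C w) = dif C (mc.cf i j w)"
proof -
 assume a: "i \<in> B" "j \<in> B" "w :. C"
 have t: "dif C (J (e k i) \<otimes>\<^sub>C w \<otimes>\<^sub>C J (e j k)) = J (e k i) \<otimes>\<^sub>C dif C w \<otimes>\<^sub>C J (e j k)" if "k \<in> B" for k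
  using a that by (simp add: dif_mult_J mu.e_in mc.J)
 have "dif C (mc.cf i j w) = (\<Oplus>\<^sub>C k\<in>B. dif C (J (e k i) \<otimes>\<^sub>C w \<otimes>\<^sub>C J (e j k)))"
  unfolding mc.cf_def
  by (rule module_hom_finsum[OF Cp.C.module_axioms Cp.C.module_axioms CD.dif_linear mu.finB]) (use a in "auto simp: mu.e_in mc.J")
 also have "\<dots> = mc.cf i j (dif C w)"
  unfolding mc.cf_def by (rule Cp.C.finsum_cong') (use a t in "auto simp: mu.e_in mc.J CD.dif_in")
 finally show ?thesis by simp
qed

lemma D_dif:
 assumes d: "DS.der i \<delta>" and w: "w :. C"
 shows "D (%x. \<delta> (dif rep x)) w = D \<delta> (dif C w)"
 unfolding D_def mc.ext_def
proof (rule mc.finsum2_cong)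
 fix a b assume ab: "a \<in> B" "b \<in> B"
 have h: "mc.cf a b w \<in> H" by (rule mc.cf_H[OF ab w])
 show "\<delta> (dif rep (rc (mc.cf a b w))) \<odot>\<^sub>E e a b = \<delta> (rc (mc.cf a b (dif C w))) \<odot>\<^sub>E e a b"
  using rc_dif[OF h] cf_dif[OF ab w] by simp
 show "\<delta> (rc (mc.cf a b (dif C w))) \<odot>\<^sub>E e a b :. E"
  using mc.ext_term_in[OF lin_der[OF d] CD.dif_in[OF w] ab] .
qed

text \<open>The adjunction between derivations of \<open>rep_alg\<close> into the field and
  derivations of \<open>R\<close> into End V, stated as a relation for use in
  \<open>vs_iso_quotI\<close>.\<close>

definition corr where "corr \<delta> \<eta> \<longleftrightarrow> (\<forall>r \<in> carrier R. \<eta> r = D \<delta> (L (Inl r)))"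

lemma Inl_L_in: "r :. R ==> L (Inl r) :. C"
 by (rule Cp.L_in[OF Cp.Inl_X])

lemmas L1 = alg_homD[OF Cp.L1_hom]

lemma dif_L: "r :. R ==> dif C (L (Inl r)) = L (Inl (dif R r))"
 by (simp add: Cp.dif_C_letter Cp.Inl_X)

lemma corr_der:
 assumes d: "DS.der i \<delta>" and c: "corr \<delta> \<eta>" shows "DR.der i \<eta>"
proof -
 have "DR.der i (%r. D \<delta> (L (Inl r)))"
 proof (rule DR.der_homogeneousI)
  show "(%r. D \<delta> (L (Inl r))) \<in> module_hom K R E" by (rule module_hom_comp[OF L1(1) D_hom[OF d]])
  show "D \<delta> (L (Inl x)) = \<zero>\<^sub>E" if "x \<in> Gr R n" "n ~= - i" for x n
   by (rule D_Gr[OF d Cp.L_Gr that(2)]) (use that(1) in simp)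
  show "D \<delta> (L (Inl (x \<otimes>\<^sub>R y))) = D \<delta> (L (Inl x)) \<otimes>\<^sub>E \<phi> y \<oplus>\<^sub>E \<phi> x \<otimes>\<^sub>E D \<delta> (L (Inl y))"
   if "x \<in> Gr R n" "y :. R" for x y n
   using D_mult[OF d Inl_L_in[OF R.Gr_in[OF that(1)]] Inl_L_in[OF that(2)]] that(2) R.Gr_in[OF that(1)]
   by (simp add: L1 g_L)
 qed
 then show ?thesis by (rule DR.der_cong) (use c in "simp add: corr_def")
qed

lemma corr_dif:
 assumes d: "DS.der i \<delta>" and c: "corr \<delta> \<eta>"
 shows "corr (%x. \<delta> (dif rep x)) (%r. \<eta> (dif R r))"
 using c unfolding corr_def by (simp add: D_dif[OF d] Inl_L_in dif_L R.dif_in)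

text \<open>A derivation kills the unit, so \<open>D \<delta>\<close> vanishes on End V; by
  hypothesis it vanishes on \<open>R\<close>, hence on the coproduct. Its value at \<open>h\<close>
  times the unit returns \<open>\<delta>\<close> at the class of \<open>h\<close>.\<close>

lemma corr_inj:
 assumes d: "DS.der i \<delta>" and c: "corr \<delta> (%r. \<zero>\<^sub>E)" and x: "x :. rep"
 shows "\<delta> x = \<zero>\<^sub>K"
proof -
 note d' = DS.derD[OF d]
 have "\<delta> \<one>\<^sub>rep = \<delta> \<one>\<^sub>rep \<oplus>\<^bsub>base_alg K\<^esub> \<delta> \<one>\<^sub>rep"
  using d'(3)[OF rep.one_closed rep.one_closed] d'(4)[OF rep.one_closed] by (simp add: DS.f)
 then have one: "\<delta> \<one>\<^sub>rep = \<zero>\<^sub>K" using d'(4)[OF rep.one_closed] by (metis DS.B.add.l_cancel_one' base_alg_simps(4))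
 have J0: "D \<delta> (J m) = \<zero>\<^sub>E" if "m :. E" for m
  using D_HJ[OF d mc.H_one that] that by (simp add: mc.J rc_one one)
 have z: "D \<delta> w = \<zero>\<^sub>E" if "w :. C" for w
 proof (rule Cp.derivation_eq[OF mu.assoc_algebra_axioms g_hom D_hom[OF d] _ _ _ _ that])
  show "(%x. \<zero>\<^sub>E) \<in> module_hom K C E" by (rule module_homI) simp_all
  show "D \<delta> (L z) = \<zero>\<^sub>E" if "z \<in> Cp.X" for z
   using that by (rule Cp.X_cases) (use c J0 in "simp_all add: corr_def deg0_simps")
 qed (simp_all add: D_mult[OF d] g)
 obtain h where h: "h \<in> H" "x = rc h" using rc_rep[OF x] by blast
 have k: "\<delta> (rc h) :. K" using d'(4)[OF rc_in[OF h(1)]] by (simp add: base_alg_simps)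
 have "\<delta> (rc h) \<odot>\<^sub>E \<one>\<^sub>E = \<zero>\<^sub>E"
  using D_HJ[OF d h(1) mu.one_closed] z[of "h \<otimes>\<^sub>C J \<one>\<^sub>E"] h by (simp add: mc.H_in mc.J)
 then show ?thesis using eps_one[OF k] eps_0 h by simp
qed

text \<open>The derivation \<open>\<eta>\<close> is extended by zero on End V to a derivation
  \<open>T\<close> of the coproduct. The restriction of \<open>T\<close> to the centralizer is
  scalar, and its scalar \<open>d0\<close> descends to the abelianization.\<close>

lemma corr_surj:
 assumes d: "DR.der i \<eta>"
 shows "\<exists>\<delta>. DS.der i \<delta> & \<delta> \<in> extensional (carrier rep) & corr \<delta> \<eta>"
proof -
 note d' = DR.derD[OF d]
 obtain T where T: "T \<in> module_hom K C E"
  "!!x y. [|x :. C; y :. C|] ==> T (x \<otimes>\<^sub>C y) = T x \<otimes>\<^sub>E g y \<oplus>\<^sub>E g x \<otimes>\<^sub>E T y"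
  "!!r. r :. R ==> T (L (Inl r)) = \<eta> r" "!!m. m :. E ==> T (J m) = \<zero>\<^sub>E"
  using Cp.universal_derivation[OF mu.assoc_algebra_axioms g_hom d'(1)] d'(3) g_L unfolding deg0_simps(1) by auto
 note Tin = module_hom_in[OF T(1)]
 have TJ: "T (w \<otimes>\<^sub>C J m) = T w \<otimes>\<^sub>E m" "T (J m \<otimes>\<^sub>C w) = m \<otimes>\<^sub>E T w" if "w :. C" "m :. E" for w m
  using that by (simp_all add: T mc.J g_J g Tin)
 define d0 where "d0 h = eps (T h)" for h
 have d0_in: "d0 h :. K" if "h \<in> H" for h using that by (simp add: d0_def eps_in Tin mc.H_in)
 \<comment> \<open>As \<open>T\<close> vanishes on End V, it is linear over End V on both sides. It
   therefore sends elements commuting with End V to central elements, which are scalars.\<close>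
 have TH: "T h = d0 h \<odot>\<^sub>E \<one>\<^sub>E" if h: "h \<in> H" for h
  unfolding d0_def
 proof (rule mu.central_scalar[OF _ _ t])
  show "T h :. E" using Tin mc.H_in[OF h] by blast
  show "T h \<otimes>\<^sub>E m = m \<otimes>\<^sub>E T h" if "m :. E" for m
   using TJ[OF mc.H_in[OF h] that] mc.H_comm[OF h that] by simp
 qed
 have d0_mult: "d0 (h \<otimes>\<^sub>C h') = d0 h \<otimes>\<^sub>K h0 h' \<oplus>\<^sub>K h0 h \<otimes>\<^sub>K d0 h'" if h: "h \<in> H" "h' \<in> H" for h h'
 proof -
  have k: "d0 h :. K" "d0 h' :. K" "h0 h :. K" "h0 h' :. K" using h d0_in h0_in by auto
  have e: "(a \<odot>\<^sub>E \<one>\<^sub>E) \<otimes>\<^sub>E (c \<odot>\<^sub>E \<one>\<^sub>E) = (a \<otimes>\<^sub>K c) \<odot>\<^sub>E \<one>\<^sub>E" if "a :. K" "c :. K" for a c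
   using that by (simp add: mu.smult_mult_left mu.smult_mult_right mu.smult_assoc1[symmetric] R.R.m_comm)
  have "T (h \<otimes>\<^sub>C h') = (d0 h \<odot>\<^sub>E \<one>\<^sub>E) \<otimes>\<^sub>E (h0 h' \<odot>\<^sub>E \<one>\<^sub>E) \<oplus>\<^sub>E (h0 h \<odot>\<^sub>E \<one>\<^sub>E) \<otimes>\<^sub>E (d0 h' \<odot>\<^sub>E \<one>\<^sub>E)"
   using T(2)[OF mc.H_in[OF h(1)] mc.H_in[OF h(2)]] TH[OF h(1)] TH[OF h(2)] g_H[OF h(1)] g_H[OF h(2)] by (simp add: h0_def)
  also have "\<dots> = (d0 h \<otimes>\<^sub>K h0 h' \<oplus>\<^sub>K h0 h \<otimes>\<^sub>K d0 h') \<odot>\<^sub>E \<one>\<^sub>E"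
   using k by (simp only: e) (simp add: mu.smult_l_distr)
  finally show ?thesis using eps_one[of "d0 h \<otimes>\<^sub>K h0 h' \<oplus>\<^sub>K h0 h \<otimes>\<^sub>K d0 h'"] k by (simp add: d0_def[of "h \<otimes>\<^sub>C h'"])
 qed
 have d0_hom: "d0 \<in> module_hom K Rt (base_alg K)"
  by (rule module_homI)
   (simp_all add: base_alg_simps d0_in, simp_all add: d0_def module_hom_add[OF T(1)] module_hom_smult[OF T(1)] mc.H_in eps_add eps_smult Tin)
 note d0_add = module_hom_add[OF d0_hom] and d0_smult = module_hom_smult[OF d0_hom]
 have h0z: "h0 x = \<zero>\<^sub>K" if "x \<in> CI" for x using h0_kills[OF that] by (simp add: base_alg_simps)
 have CIH: "x \<in> H" if "x \<in> CI" for x using that Qr.Qs.I_sub by auto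
 \<comment> \<open>Because \<open>d0\<close> is a derivation along \<open>h0\<close> and
   \<open>h0\<close> kills the commutator ideal, the elements of that ideal killed by
   \<open>d0\<close> form an ideal again. It remains to test brackets.\<close>
 have kills: "d0 x = \<zero>\<^bsub>base_alg K\<^esub>" if "x \<in> CI" for x
 proof -
  let ?Jd = "{x \<in> CI. d0 x = \<zero>\<^sub>K}"
  have "ideal ?Jd Rt"
  proof (rule idealI'[OF Rt.As.assoc_algebra_axioms])
   show "?Jd <= carrier Rt" using CIH by auto
   show "\<zero>\<^sub>Rt \<in> ?Jd"
    using Qr.Qs.I_zero module_hom_zero[OF Rt.As.module_axioms DS.B.module_axioms d0_hom] by (simp add: base_alg_simps)
   show "x \<oplus>\<^sub>Rt y \<in> ?Jd" if "x \<in> ?Jd" "y \<in> ?Jd" for x y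
    using that d0_add[of x y] CIH Qr.Qs.I_add[of x y] by (simp add: base_alg_simps)
   show "a \<otimes>\<^sub>Rt x \<in> ?Jd" if "a :. Rt" "x \<in> ?Jd" for a x
    using that Qr.I_ideal(1)[of a x] CIH by (simp add: d0_mult h0z d0_in h0_in)
   show "x \<otimes>\<^sub>Rt a \<in> ?Jd" if "a :. Rt" "x \<in> ?Jd" for a x
    using that Qr.I_ideal(2)[of a x] CIH by (simp add: d0_mult h0z d0_in h0_in)
  qed
  moreover have "RD.bracket i j x y \<in> ?Jd" if x: "x \<in> Gr Rt i" and y: "y \<in> Gr Rt j" for i j x y
  proof -
   have xy: "x \<in> H" "y \<in> H" using x y by simp_all
   have k: "d0 x :. K" "d0 y :. K" "h0 x :. K" "h0 y :. K" using xy d0_in h0_in by auto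
   \<comment> \<open>If one degree is 0 the sign is 1 and both products have the same image by
     commutativity of the field. If both are nonzero, \<open>h0\<close> kills both factors and each
     product is sent to 0.\<close>
   have s: "d0 (x \<otimes>\<^sub>C y) = ksign K (i * j) \<otimes>\<^sub>K d0 (y \<otimes>\<^sub>C x)"
   proof (cases "i = 0 \<or> j = 0")
    case True
    then have "ksign K (i * j) = \<one>\<^sub>K" by (auto simp: ksign_def)
    then show ?thesis using k xy by (simp add: d0_mult R.R.m_comm R.R.a_comm)
   next
    case False
    then have "h0 x = \<zero>\<^sub>K" "h0 y = \<zero>\<^sub>K" using x y h0_Gr[OF xy(1)] h0_Gr[OF xy(2)] by auto
    then show ?thesis using k xy R.R.ksign_in by (simp add: d0_mult)
   qed
   have "d0 (RD.bracket i j x y) = d0 (x \<otimes>\<^sub>C y) \<ominus>\<^bsub>base_alg K\<^esub> ksign K (i * j) \<otimes>\<^sub>K d0 (y \<otimes>\<^sub>C x)"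
    using xy module_hom_minus[OF Rt.As.module_axioms DS.B.module_axioms d0_hom] d0_smult[of "ksign K (i * j)" "y \<otimes>\<^sub>C x"] R.R.ksign_in
    by (simp add: RD.bracket_def base_alg_simps mc.H_mult mc.H_smult)
   also have "\<dots> = \<zero>\<^sub>K"
    unfolding s[symmetric] using DS.B.minus_self[of "d0 (x \<otimes>\<^sub>C y)"] d0_in[OF mc.H_mult[OF xy]] by (simp add: base_alg_simps)
   finally show ?thesis using RD.comm_ideal_bracket[OF x y] by simp
  qed
  ultimately have "CI <= ?Jd" by (rule RD.comm_ideal_least)
  then show ?thesis using that by (auto simp: base_alg_simps)
 qed
 define \<delta> where "\<delta> = restrict (Qr.qlift d0) (carrier rep)"
 have \<delta>_rc: "\<delta> (rc h) = d0 h" if "h \<in> H" for h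
  using Qr.qlift_cls[OF DS.B.module_axioms d0_hom kills, of h] that rc_in[OF that] by (simp add: \<delta>_def)
 have T_hl: "T (L z) = \<zero>\<^sub>E" if "z \<in> Cp.hl a" "a ~= - i" for z a
  using that(1) by (rule hl_cases) (use that(2) R.Gr_in d'(2) in "auto simp: T")
 \<comment> \<open>One factor is always hit by \<open>g\<close>, which kills nonzero degrees, and
   the other by \<open>T\<close>, which is inductively supported in degree \<open>- i\<close>; a
   surviving term has total degree \<open>- i\<close>.\<close>
 have T_word: "T (Cp.Q.cls (word K w)) = \<zero>\<^sub>E" if "word_deg Cp.hl n w" "n ~= - i" for n w
  using that
 proof (induction w arbitrary: n)
  case Nil
  then show ?case using T(4)[OF mu.one_closed] by (simp add: Cp.cls_word_Nil mc.J)
 next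
  case (Cons z w)
  then obtain a where a: "z \<in> Cp.hl a" "word_deg Cp.hl (n - a) w" by auto
  have z: "z \<in> Cp.X" "w \<in> lists Cp.X" using Cp.hl_X a Cp.word_deg_X by auto
  have c: "Cp.Q.cls (word K w) :. C" "L z :. C" using z by (simp_all add: Cp.Q.cls_in Cp.word_P Cp.L_in)
  have "T (Cp.Q.cls (word K (z # w))) = T (L z) \<otimes>\<^sub>E g (Cp.Q.cls (word K w)) \<oplus>\<^sub>E g (L z) \<otimes>\<^sub>E T (Cp.Q.cls (word K w))"
   using z c by (simp add: Cp.cls_word_Cons T)
  moreover have "T (L z) \<otimes>\<^sub>E g (Cp.Q.cls (word K w)) = \<zero>\<^sub>E"
   using T_hl[OF a(1)] g_word[OF a(2)] Cons.prems(2) Tin[OF c(2)] g(2)[OF c(1)] by (cases "a = - i") auto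
  moreover have "g (L z) \<otimes>\<^sub>E T (Cp.Q.cls (word K w)) = \<zero>\<^sub>E"
   using g_hl[OF a(1)] Cons.IH[OF a(2)] Cons.prems(2) Tin[OF c(1)] g(2)[OF c(2)] by (cases "a = 0") auto
  ultimately show ?case by simp
 qed
 have T_Gr: "T x = \<zero>\<^sub>E" if "x \<in> Gr C n" "n ~= - i" for x n
  using words_vanish[OF T(1) _ that(1)] T_word[OF _ that(2)] by blast
 have der: "DS.der i \<delta>"
  unfolding DS.der_def
 proof (intro conjI allI ballI impI)
  have q: "Qr.qlift d0 \<in> module_hom K rep (base_alg K)"
   by (rule Qr.qlift_module_hom[OF DS.B.module_axioms d0_hom kills])
  show "\<delta> \<in> module_hom K rep (base_alg K)"
   by (rule module_homI)
    (simp_all add: \<delta>_def module_hom_in[OF q] module_hom_add[OF q] module_hom_smult[OF q])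
  show "\<delta> x = \<zero>\<^bsub>base_alg K\<^esub>" if "x \<in> Gr rep n" "n ~= - i" for n x
   using that by (auto simp: rep_Gr \<delta>_rc d0_def T_Gr eps_0 base_alg_simps)
  fix x y assume "x :. rep" "y :. rep"
  then obtain h h' where "h \<in> H" "h' \<in> H" "x = rc h" "y = rc h'" using rc_rep by metis
  then show "\<delta> (x \<otimes>\<^sub>rep y) = \<delta> x \<otimes>\<^bsub>base_alg K\<^esub> f1 y \<oplus>\<^bsub>base_alg K\<^esub> f1 x \<otimes>\<^bsub>base_alg K\<^esub> \<delta> y"
   by (simp add: rc_mult[symmetric] \<delta>_rc mc.H_mult f1_rc d0_mult base_alg_simps)
 qed
 have "D \<delta> w = T w" if "w :. C" for w
 proof (rule mc.HJ_induct[OF that])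
  show "D \<delta> (h \<otimes>\<^sub>C J m) = T (h \<otimes>\<^sub>C J m)" if "h \<in> H" "m :. E" for h m
   using that D_HJ[OF der that] TH[OF that(1)] d0_in[OF that(1)] by (simp add: TJ mc.H_in \<delta>_rc mu.smult_mult_left)
  show "D \<delta> (x \<oplus>\<^sub>C y) = T (x \<oplus>\<^sub>C y)"
   if "x :. C" "y :. C" "D \<delta> x = T x" "D \<delta> y = T y" for x y
   using that by (simp add: module_hom_add[OF T(1)] module_hom_add[OF D_hom[OF der]])
 qed
 then have "corr \<delta> \<eta>" by (simp add: corr_def Inl_L_in T)
 moreover have "\<delta> \<in> extensional (carrier rep)" by (simp add: \<delta>_def)
 ultimately show ?thesis using der by blast
qed

lemma corr_add:
 assumes "DS.der i \<delta>" "DS.der i \<delta>'" "corr \<delta> \<eta>" "corr \<delta>' \<eta>'"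
 shows "corr (\<lambda>x \<in> carrier rep. \<delta> x \<oplus>\<^sub>K \<delta>' x) (\<lambda>r \<in> carrier R. \<eta> r \<oplus>\<^sub>E \<eta>' r)"
 unfolding corr_def
proof
 fix r assume r: "r :. R"
 have "D (\<lambda>x \<in> carrier rep. \<delta> x \<oplus>\<^sub>K \<delta>' x) (L (Inl r)) = mc.ext (%h. \<delta> (rc h) \<oplus>\<^sub>K \<delta>' (rc h)) (L (Inl r))"
  unfolding D_def mc.ext_def
  by (rule mc.finsum2_cong)
   (use lin_der[OF assms(1)] lin_der[OF assms(2)] r in \<open>simp_all add: rc_in mc.cf_H Inl_L_in mu.e_in mc.linD(1)[of "%h. \<delta> (rc h)"] mc.linD(1)[of "%h. \<delta>' (rc h)"]\<close>)
 also have "\<dots> = D \<delta> (L (Inl r)) \<oplus>\<^sub>E D \<delta>' (L (Inl r))"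
  unfolding D_def by (rule mc.ext_add[OF lin_der[OF assms(1)] lin_der[OF assms(2)] Inl_L_in[OF r]])
 finally show "(\<lambda>r \<in> carrier R. \<eta> r \<oplus>\<^sub>E \<eta>' r) r = D (\<lambda>x \<in> carrier rep. \<delta> x \<oplus>\<^sub>K \<delta>' x) (L (Inl r))"
  using r assms(3,4) by (simp add: corr_def)
qed

lemma corr_smult:
 assumes "DS.der i \<delta>" "corr \<delta> \<eta>" "a :. K"
 shows "corr (\<lambda>x \<in> carrier rep. a \<otimes>\<^sub>K \<delta> x) (\<lambda>r \<in> carrier R. a \<odot>\<^sub>E \<eta> r)"
 unfolding corr_def
proof
 fix r assume r: "r :. R"
 have "D (\<lambda>x \<in> carrier rep. a \<otimes>\<^sub>K \<delta> x) (L (Inl r)) = mc.ext (%h. a \<otimes>\<^sub>K \<delta> (rc h)) (L (Inl r))"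
  unfolding D_def mc.ext_def
  by (rule mc.finsum2_cong)
   (use lin_der[OF assms(1)] assms(3) r in \<open>simp_all add: rc_in mc.cf_H Inl_L_in mu.e_in mc.linD(1)[of "%h. \<delta> (rc h)"]\<close>)
 also have "\<dots> = a \<odot>\<^sub>E D \<delta> (L (Inl r))"
  unfolding D_def by (rule mc.ext_smult[OF lin_der[OF assms(1)] assms(3) Inl_L_in[OF r]])
 finally show "(\<lambda>r \<in> carrier R. a \<odot>\<^sub>E \<eta> r) r = D (\<lambda>x \<in> carrier rep. a \<otimes>\<^sub>K \<delta> x) (L (Inl r))"
  using r assms(2) by (simp add: corr_def)
qed

text \<open>The difference of the two derivations corresponds to zero, so \<open>corr_inj\<close>
  applies.\<close>

lemma corr_eq:
 assumes "DS.der i \<delta>" "DS.der i \<delta>'" "corr \<delta> \<eta>" "corr \<delta>' \<eta>" "x :. rep"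
 shows "\<delta> x = \<delta>' x"
proof -
 let ?m = "\<ominus>\<^sub>K \<one>\<^sub>K"
 let ?n = "\<lambda>x \<in> carrier rep. ?m \<otimes>\<^sub>K \<delta>' x" and ?d = "\<lambda>x \<in> carrier rep. \<delta> x \<oplus>\<^sub>K (\<lambda>x \<in> carrier rep. ?m \<otimes>\<^sub>K \<delta>' x) x"
 have m: "?m :. K" by simp
 have n: "DS.der i ?n" by (rule DS.der_cong[OF DS.der_smult[OF assms(2) m]]) (simp add: base_alg_simps)
 have d: "DS.der i ?d" by (rule DS.der_cong[OF DS.der_add[OF assms(1) n]]) (simp add: base_alg_simps)
 have "corr ?d (\<lambda>r \<in> carrier R. \<eta> r \<oplus>\<^sub>E (\<lambda>r \<in> carrier R. ?m \<odot>\<^sub>E \<eta> r) r)"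
  by (rule corr_add[OF assms(1) n assms(3) corr_smult[OF assms(2,4) m]])
 moreover have "\<eta> r \<oplus>\<^sub>E ?m \<odot>\<^sub>E \<eta> r = \<zero>\<^sub>E" if "r :. R" for r
  using DR.derD(4)[OF corr_der[OF assms(1,3)] that] by (simp add: mu.neg_eq_smult[symmetric] mu.r_neg)
 ultimately have "corr ?d (%r. \<zero>\<^sub>E)" by (simp add: corr_def)
 then have "?d x = \<zero>\<^sub>K" by (rule corr_inj[OF d _ assms(5)])
 then have "\<delta> x \<oplus>\<^sub>K ?m \<otimes>\<^sub>K \<delta>' x = \<zero>\<^sub>K" using assms(5) by simp
 moreover have k: "\<delta> x :. K" "\<delta>' x :. K"
  using DS.derD(4)[OF assms(1,5)] DS.derD(4)[OF assms(2,5)] by (simp_all add: base_alg_simps)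
 ultimately have "\<delta> x \<ominus>\<^sub>K \<delta>' x = \<zero>\<^sub>K" by (simp add: R.R.minus_eq R.R.l_minus)
 then show ?thesis by (rule R.R.eq_if_minus_zero[OF k])
qed

text \<open>The relation \<open>corr\<close> is linear, one-to-one and onto on derivations, and
  compatible with composition with the differentials, so it matches cocycles with cocycles and
  coboundaries with coboundaries.\<close>

lemma derived_tangent_iso:
 "vs_iso K (derived_tangent K R V \<phi> i) (dg_der_cohomology K R (bimod_via \<phi> (deg0 E)) i)"
 unfolding derived_tangent_def rep_point_eq rep_alg_eq DS.cohomology_eq DR.cohomology_eq
proof (rule vs_iso_quotI[OF DS.cohomology_quot_setup DR.cohomology_quot_setup, where Z = corr])
 note s = fun_space_simps
 have dR: "dif R r :. R" if "r :. R" for r using R.dif_in that .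
 have dS: "dif rep x :. rep" if "x :. rep" for x using module_hom_in[OF DS.S_dif_hom that] .
 show "\<exists>\<eta> \<in> carrier (fun_space (carrier R) E (DR.Zc i)). corr \<delta> \<eta>"
  if \<delta>: "\<delta> :. (fun_space (carrier rep) (base_alg K) (DS.Zc i))" for \<delta>
 proof -
  have d: "DS.der i \<delta>" "!!x. x :. rep ==> \<delta> (dif rep x) = \<zero>\<^sub>K"
   using \<delta> by (simp_all add: s DS.Zc_def base_alg_simps)
  let ?\<eta> = "\<lambda>r \<in> carrier R. D \<delta> (L (Inl r))"
  have c: "corr \<delta> ?\<eta>" by (simp add: corr_def)
  have "?\<eta> (dif R r) = \<zero>\<^sub>E" if r: "r :. R" for r
  proof -
   have "?\<eta> (dif R r) = D (%x. \<delta> (dif rep x)) (L (Inl r))"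
    using r by (simp add: dR D_dif[OF d(1)] Inl_L_in dif_L)
   also have "\<dots> = (\<Oplus>\<^sub>E a\<in>B. \<Oplus>\<^sub>E b\<in>B. \<zero>\<^sub>E)"
    unfolding D_def mc.ext_def
    by (rule mc.finsum2_cong) (simp_all add: d(2) rc_in mc.cf_H Inl_L_in r mu.e_in)
   finally show ?thesis by simp
  qed
  then show ?thesis using c corr_der[OF d(1) c] by (intro bexI[of _ ?\<eta>]) (simp_all add: s DR.Zc_def)
 qed
 \<comment> \<open>Composed with the differentials, \<open>\<delta>\<close> corresponds to
   \<open>\<eta>\<close> composed with the differential of \<open>R\<close>, which is zero;
   injectivity of \<open>corr\<close> gives the claim.\<close>
 have cocycle: "\<delta> (dif rep x) = \<zero>\<^sub>K"
  if "DS.der i \<delta>" "corr \<delta> \<eta>" "!!r. r :. R ==> \<eta> (dif R r) = \<zero>\<^sub>E" "x :. rep" for \<delta> \<eta> x i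
 proof (rule corr_inj[OF DS.der_comp_dif[OF that(1)] _ that(4)])
  show "corr (%x. \<delta> (dif rep x)) (%r. \<zero>\<^sub>E)"
   using corr_dif[OF that(1,2)] that(3) by (simp add: corr_def)
 qed
 show "\<exists>\<delta> \<in> carrier (fun_space (carrier rep) (base_alg K) (DS.Zc i)). corr \<delta> \<eta>"
  if \<eta>: "\<eta> :. (fun_space (carrier R) E (DR.Zc i))" for \<eta>
 proof -
  have d: "DR.der i \<eta>" "!!x. x :. R ==> \<eta> (dif R x) = \<zero>\<^sub>E"
   using \<eta> by (simp_all add: s DR.Zc_def)
  obtain \<delta> where \<delta>: "DS.der i \<delta>" "\<delta> \<in> extensional (carrier rep)" "corr \<delta> \<eta>" using corr_surj[OF d(1)] by blast
  then show ?thesis using cocycle[OF \<delta>(1,3) d(2)] by (intro bexI[of _ \<delta>]) (simp_all add: s DS.Zc_def base_alg_simps)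
 qed
 show "corr (\<delta> \<oplus>\<^bsub>fun_space (carrier rep) (base_alg K) (DS.Zc i)\<^esub> \<delta>') (\<eta> \<oplus>\<^bsub>fun_space (carrier R) E (DR.Zc i)\<^esub> \<eta>')"
  if "corr \<delta> \<eta>" "corr \<delta>' \<eta>'" "\<delta> :. (fun_space (carrier rep) (base_alg K) (DS.Zc i))"
   "\<delta>' :. (fun_space (carrier rep) (base_alg K) (DS.Zc i))" for \<delta> \<delta>' \<eta> \<eta>'
  using corr_add[of i \<delta> \<delta>' \<eta> \<eta>'] that by (simp add: s DS.Zc_def base_alg_simps)
 show "corr (c \<odot>\<^bsub>fun_space (carrier rep) (base_alg K) (DS.Zc i)\<^esub> \<delta>) (c \<odot>\<^bsub>fun_space (carrier R) E (DR.Zc i)\<^esub> \<eta>)"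
  if "corr \<delta> \<eta>" "c :. K" "\<delta> :. (fun_space (carrier rep) (base_alg K) (DS.Zc i))" for c \<delta> \<eta>
  using corr_smult[of i \<delta> \<eta> c] that by (simp add: s DS.Zc_def base_alg_simps)
 show "\<delta> \<in> DS.Bc i \<longleftrightarrow> \<eta> \<in> DR.Bc i"
  if c: "corr \<delta> \<eta>" and \<delta>: "\<delta> :. (fun_space (carrier rep) (base_alg K) (DS.Zc i))"
   and \<eta>: "\<eta> :. (fun_space (carrier R) E (DR.Zc i))" for \<delta> \<eta>
 proof
  assume "\<delta> \<in> DS.Bc i"
  then obtain \<beta> where \<beta>: "DS.der (i - 1) \<beta>" "\<delta> = (\<lambda>x \<in> carrier rep. \<beta> (dif rep x))" by (auto simp: DS.Bc_iff)
  let ?\<theta> = "\<lambda>r \<in> carrier R. D \<beta> (L (Inl r))"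
  have \<theta>: "corr \<beta> ?\<theta>" by (simp add: corr_def)
  have "\<eta> r = ?\<theta> (dif R r)" if r: "r :. R" for r
  proof -
   have "\<eta> r = D (%x. \<beta> (dif rep x)) (L (Inl r))"
    using c r unfolding corr_def \<beta>(2) D_def mc.ext_def
    by (simp, intro mc.finsum2_cong)
     (use mc.linD(1)[OF lin_der[OF DS.der_comp_dif[OF \<beta>(1)]]] in "simp_all add: rc_in mc.cf_H Inl_L_in mu.e_in")
   then show ?thesis using corr_dif[OF \<beta>(1) \<theta>] r by (simp add: corr_def)
  qed
  then have "\<eta> = (\<lambda>r \<in> carrier R. ?\<theta> (dif R r))"
   using \<eta> by (intro extensionalityI[of \<eta> "carrier R"]) (simp_all add: s DR.Zc_def)
  then show "\<eta> \<in> DR.Bc i"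
   unfolding DR.Bc_iff using corr_der[OF \<beta>(1) \<theta>] by (intro exI[of _ ?\<theta>]) simp
 next
  assume "\<eta> \<in> DR.Bc i"
  then obtain \<theta> where \<theta>: "DR.der (i - 1) \<theta>" "\<eta> = (\<lambda>r \<in> carrier R. \<theta> (dif R r))" by (auto simp: DR.Bc_iff)
  obtain \<beta> where \<beta>: "DS.der (i - 1) \<beta>" "\<beta> \<in> extensional (carrier rep)" "corr \<beta> \<theta>" using corr_surj[OF \<theta>(1)] by blast
  have d: "DS.der i (%x. \<beta> (dif rep x))" using DS.der_comp_dif[OF \<beta>(1)] by simp
  have cc: "corr (%x. \<beta> (dif rep x)) \<eta>" using corr_dif[OF \<beta>(1,3)] by (simp add: corr_def \<theta>(2))
  have \<delta>': "DS.der i \<delta>" "\<delta> \<in> extensional (carrier rep)" using \<delta> by (simp_all add: s DS.Zc_def)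
  have "\<delta> = (\<lambda>x \<in> carrier rep. \<beta> (dif rep x))"
   using corr_eq[OF \<delta>'(1) d c cc] \<delta>'(2) by (intro extensionalityI[of \<delta> "carrier rep"]) simp_all
  then show "\<delta> \<in> DS.Bc i" unfolding DS.Bc_iff using \<beta> by blast
 qed
qed

end

section \<open>The zero vector space\<close>

context rep_setup begin

text \<open>With an empty basis the unit of End V is an empty sum. The map from End V transports the
  equation between unit and zero to the coproduct and to \<open>rep_alg\<close>, so the cohomology
  spaces on both sides are zero.\<close>

lemma derived_tangent_iso_trivial:
 assumes "B = {}"
 shows "vs_iso K (derived_tangent K R V \<phi> i) (dg_der_cohomology K R (bimod_via \<phi> (deg0 E)) i)"
proof -
 have one0: "\<one>\<^sub>E = \<zero>\<^sub>E" using mu.e_sum unfolding assms by simp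
 have E0: "m = \<zero>\<^sub>E" if m: "m :. E" for m
 proof -
  have "m = \<one>\<^sub>E \<otimes>\<^sub>E m" by (rule mu.l_one[OF m, symmetric])
  also have "\<dots> = \<zero>\<^sub>E \<otimes>\<^sub>E m" by (simp only: one0)
  also have "\<dots> = \<zero>\<^sub>E" by (rule mu.l_null[OF m])
  finally show ?thesis .
 qed
 note Jp = alg_homD[OF J_hom]
 have e: "\<zero>\<^sub>K \<odot>\<^sub>E \<one>\<^sub>E = \<one>\<^sub>E" by (rule trans[OF E0 one0[symmetric]]) simp
 have "\<one>\<^sub>C = J \<one>\<^sub>E" by (rule Jp(6)[symmetric])
 also have "\<dots> = J (\<zero>\<^sub>K \<odot>\<^sub>E \<one>\<^sub>E)" by (simp only: e)
 also have "\<dots> = \<zero>\<^sub>K \<odot>\<^sub>C J \<one>\<^sub>E" by (rule Jp(5)) simp_all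
 also have "\<dots> = \<zero>\<^sub>K \<odot>\<^sub>C \<one>\<^sub>C" by (simp only: Jp(6))
 finally have c1: "\<one>\<^sub>C = \<zero>\<^sub>K \<odot>\<^sub>C \<one>\<^sub>C" .
 have "rc \<one>\<^sub>C = \<zero>\<^sub>K \<odot>\<^sub>rep rc \<one>\<^sub>C"
  by (rule trans[OF arg_cong[where f = "%h. rc h", OF c1] rc_smult[OF R.R.zero_closed mc.H_one]])
 then have one: "\<one>\<^sub>rep = \<zero>\<^sub>rep" unfolding rc_one by simp
 have rep0: "x = \<zero>\<^sub>rep" if x: "x :. rep" for x
 proof -
  have "x = \<one>\<^sub>rep \<otimes>\<^sub>rep x" by (rule rep.l_one[OF x, symmetric])
  also have "\<dots> = \<zero>\<^sub>rep \<otimes>\<^sub>rep x" by (simp only: one)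
  also have "\<dots> = \<zero>\<^sub>rep" by (rule rep.l_null[OF x])
  finally show ?thesis .
 qed
 interpret k: assoc_algebra K "base_alg K" by (rule base_alg_assoc_algebra) (rule R.field_axioms)
 \<comment> \<open>The zero algebra has no unital map to a field, so \<open>rep_point\<close> takes
   its default value.\<close>
 have "\<not> point_of K R V \<phi> f" for f
 proof
  assume "point_of K R V \<phi> f"
  then have f: "f \<in> alg_hom K rep (base_alg K)"
   by (simp add: point_of_def dg_hom_def rep_alg_eq alg_hom_deg0)
  have "f \<zero>\<^sub>rep = \<zero>\<^bsub>base_alg K\<^esub>"
   by (rule module_hom_zero[OF rep.module_axioms k.module_axioms alg_homD(1)[OF f]])
  then show False using alg_homD(6)[OF f] one by (simp add: base_alg_simps)
 qed
 then have pt: "rep_point K R V \<phi> = (%w. \<zero>\<^sub>K)" by (simp add: rep_point_def)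
 let ?N = "bimod_via (%w. \<zero>\<^sub>K) (deg0 (base_alg K)) :: ('k, _, 'k) dg_bimod" and ?z = "\<lambda>x \<in> carrier rep. \<zero>\<^sub>K"
 note s = bimod_via_simps base_alg_simps
 have dS: "dif rep x :. rep" if x: "x :. rep" for x
 proof -
  obtain h where "h \<in> H" "x = rc h" using rc_rep[OF x] by blast
  then show ?thesis using rc_dif rc_in H_dif by simp
 qed
 have GrS: "x :. rep" if "x \<in> Gr rep n" for x n using that rep_Gr rc_in by auto
 have der: "dg_der K rep ?N j = {?z}" for j
 proof (intro equalityI subsetI)
  fix \<delta> assume "\<delta> \<in> dg_der K rep ?N j"
  then have d: "\<delta> \<in> module_hom K rep (base_alg K)" "\<delta> \<in> extensional (carrier rep)"
   by (simp_all add: dg_der_def module_hom_bimod_via)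
  have "\<delta> x = \<zero>\<^sub>K" if "x :. rep" for x
   using module_hom_zero[OF rep.module_axioms k.module_axioms d(1)] rep0[OF that] by (simp add: base_alg_simps)
  then show "\<delta> \<in> {?z}" using d(2) by (auto intro!: extensionalityI[of \<delta> "carrier rep"])
 next
  fix \<delta> assume "\<delta> \<in> {?z}"
  moreover have "?z \<in> module_hom K rep (base_alg K)"
   by (rule module_homI) (simp_all add: base_alg_simps)
  ultimately show "\<delta> \<in> dg_der K rep ?N j"
   by (auto simp: dg_der_def module_hom_bimod_via s GrS R.R.ksign_in)
 qed
 have kz: "\<zero>\<^sub>K \<ominus>\<^bsub>base_alg K\<^esub> \<zero>\<^sub>K = \<zero>\<^sub>K"
  using k.minus_self[OF k.zero_closed] by (simp only: base_alg_simps)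
 have dif: "dg_der_dif K rep ?N j ?z = ?z" for j
  unfolding dg_der_dif_def by (rule restrict_ext) (simp add: s dS R.R.ksign_in kz)
 have st: "{\<delta> \<in> {?z}. dg_der_dif K rep ?N i \<delta> = ?z} = {?z}" using dif[of i] by blast
 have e: "derived_tangent K R V \<phi> i = quot (fun_space (carrier rep) (base_alg K) {?z}) {?z}"
  unfolding derived_tangent_def pt rep_alg_eq dg_der_cohomology_def der fun_space_bimod_via bimod_via_simps base_alg_simps
  by ((simp only: st image_insert image_empty dif) | (simp add: dif cong: conj_cong))
 have m: "module K (fun_space (carrier rep) (base_alg K) {?z})"
 proof (rule fun_space_module[OF k.module_axioms])
  show "{?z} <= carrier rep \<rightarrow>\<^sub>E carrier (base_alg K)" by (auto simp: base_alg_simps)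
 qed (auto simp: base_alg_simps intro!: restrict_ext)
 have "submodule K {?z} (fun_space (carrier rep) (base_alg K) {?z})"
  unfolding submodule_def fun_space_simps
 proof (intro conjI allI impI m)
  show "(\<lambda>x \<in> carrier rep. f x \<oplus>\<^bsub>base_alg K\<^esub> g x) \<in> {?z}" if "f \<in> {?z}" "g \<in> {?z}" for f g
   using that by (auto simp: base_alg_simps intro!: restrict_ext)
  show "(\<lambda>x \<in> carrier rep. c \<odot>\<^bsub>base_alg K\<^esub> f x) \<in> {?z}" if "c :. K" "f \<in> {?z}" for c f
   using that by (auto simp: base_alg_simps intro!: restrict_ext)
 qed (simp_all add: base_alg_simps)
 then have q: "quot_setup K (fun_space (carrier rep) (base_alg K) {?z}) {?z}"
  using m by (simp add: quot_setup_def quot_setup_axioms_def)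
 interpret Q: quot_setup K "fun_space (carrier R) E (DR.Zc i)" "DR.Bc i" by (rule DR.cohomology_quot_setup)
 have Z0: "\<eta> = \<zero>\<^bsub>fun_space (carrier R) E (DR.Zc i)\<^esub>" if "\<eta> \<in> DR.Zc i" for \<eta>
  unfolding fun_space_simps
 proof (rule extensionalityI[of _ "carrier R"])
  show "\<eta> x = (\<lambda>x \<in> carrier R. \<zero>\<^sub>E) x" if x: "x :. R" for x
   using \<open>\<eta> \<in> DR.Zc i\<close> E0[of "\<eta> x"] DR.derD(4)[of i \<eta> x] x by (simp add: DR.Zc_def)
 qed (use that in "simp_all add: DR.Zc_def")
 show ?thesis unfolding e DR.cohomology_eq
 \<comment> \<open>Both spaces of cocycles consist of zero alone, so the relation that always holds
   is an isomorphism.\<close>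
 proof (rule vs_iso_quotI[OF q DR.cohomology_quot_setup, where Z = "%_ _. True"])
  show "\<exists>y \<in> carrier (fun_space (carrier R) E (DR.Zc i)). True" using Q.M.zero_closed by blast
  show "\<exists>x \<in> carrier (fun_space (carrier rep) (base_alg K) {?z}). True" by (simp add: fun_space_simps)
  show "x \<in> {?z} \<longleftrightarrow> y \<in> DR.Bc i" if "x :. (fun_space (carrier rep) (base_alg K) {?z})"
   "y :. (fun_space (carrier R) E (DR.Zc i))" for x y
   using that Z0[of y] Q.I_zero by (simp add: fun_space_simps(1))
 qed simp_all
qed

end

subsection \<open>Multilinear cochains\<close>

context abelian_group begin

lemma minus_interchange:
 assumes "a :. G" "b :. G" "c :. G" "d :. G"
 shows "(a \<oplus> b) \<ominus> (c \<oplus> d) = (a \<ominus> c) \<oplus> (b \<ominus> d)"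
 using assms by (simp add: minus_eq minus_add a_ac)

end

lemma tuples_0: "tuples A 0 = {[]}"
 by (auto simp: tuples_def)

lemma tuples_Cons: "a # w \<in> tuples A (Suc n) \<longleftrightarrow> a :. A & w \<in> tuples A n"
 by (auto simp: tuples_def)

lemma tuples_SucE:
 assumes "w \<in> tuples A (Suc n)" obtains a u where "w = a # u" "a :. A" "u \<in> tuples A n"
 using assms by (cases w) (auto simp: tuples_def)

text \<open>The target \<open>B\<close> is a bimodule through \<open>f\<close>. The locale is used
  twice: for the resolution \<open>R\<close> with the composite map, and for \<open>A\<close> with
  the representation.\<close>

locale bar_setup = A: assoc_algebra K A + B: assoc_algebra K B
 for K :: "('k, 'c) ring_scheme" and A :: "('k, 'a, 'd) module_scheme" and B :: "('k, 'b) module" (structure) +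
 fixes f :: "'a => 'b"
 assumes f_hom: "f \<in> alg_hom K A B"
begin

lemmas f = alg_homD[OF f_hom]

text \<open>Multilinearity by recursion on the first argument, so that every statement about
  cochains can be proved by slicing off that argument. Agreement with linearity in each position is
  \<open>mlin_iff\<close>.\<close>

primrec mlin :: "nat => ('a list => 'b) => bool" where
 "mlin 0 F \<longleftrightarrow> F [] :. B"
| "mlin (Suc n) F \<longleftrightarrow> (\<forall>a \<in> carrier A. mlin n (%u. F (a # u))) & (\<forall>u \<in> tuples A n. (%a. F (a # u)) \<in> module_hom K A B)"

lemma mlin_slice: "mlin (Suc n) F ==> a :. A ==> mlin n (%u. F (a # u))"
 by simp

lemma mlin_hom: "mlin (Suc n) F ==> u \<in> tuples A n ==> (%a. F (a # u)) \<in> module_hom K A B"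
 by simp

lemma mlin_val: "mlin n F ==> w \<in> tuples A n ==> F w :. B"
proof (induction n arbitrary: F w)
 case (Suc n)
 then obtain a u where w: "w = a # u" "a :. A" "u \<in> tuples A n" by (elim tuples_SucE)
 show ?case using Suc.IH[OF mlin_slice[OF Suc.prems(1) w(2)] w(3)] w(1) by simp
qed (simp add: tuples_0)

lemma mlin_first_add: "mlin (Suc n) F ==> u \<in> tuples A n ==> a :. A ==> b :. A ==>
  F ((a \<oplus>\<^sub>A b) # u) = F (a # u) \<oplus> F (b # u)"
 by (rule module_hom_add[OF mlin_hom])

lemma mlin_first_smult: "mlin (Suc n) F ==> u \<in> tuples A n ==> c :. K ==> a :. A ==>
  F ((c \<odot>\<^sub>A a) # u) = c \<odot> F (a # u)"
 by (rule module_hom_smult[OF mlin_hom])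

lemma mlin_first_zero: "mlin (Suc n) F ==> u \<in> tuples A n ==> F (\<zero>\<^sub>A # u) = \<zero>"
 by (rule module_hom_zero[OF A.module_axioms B.module_axioms mlin_hom])

lemma mlin_cong: "mlin n F ==> (!!w. w \<in> tuples A n ==> G w = F w) ==> mlin n G"
proof (induction n arbitrary: F G)
 case (Suc n)
 show ?case unfolding mlin.simps
 proof (intro conjI ballI)
  show "mlin n (%u. G (a # u))" if a: "a :. A" for a
   by (rule Suc.IH[OF mlin_slice[OF Suc.prems(1) a]]) (use Suc.prems(2) a in "simp add: tuples_Cons")
  show "(%a. G (a # u)) \<in> module_hom K A B" if u: "u \<in> tuples A n" for u
   using mlin_hom[OF Suc.prems(1) u] Suc.prems(2) u by (simp add: module_hom_def tuples_Cons Pi_iff)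
 qed
qed (simp add: tuples_0)

lemma mlinI: 
 assumes "!!a. a :. A ==> mlin n (%u. F (a # u))"
  and "!!u a b. [|u \<in> tuples A n; a :. A; b :. A|] ==> F ((a \<oplus>\<^sub>A b) # u) = F (a # u) \<oplus> F (b # u)"
  and "!!u c a. [|u \<in> tuples A n; c :. K; a :. A|] ==> F ((c \<odot>\<^sub>A a) # u) = c \<odot> F (a # u)"
 shows "mlin (Suc n) F"
 unfolding mlin.simps
proof (intro conjI ballI assms(1))
 fix u assume u: "u \<in> tuples A n"
 show "(%a. F (a # u)) \<in> module_hom K A B"
  by (rule module_homI) (use assms(2,3) mlin_val[OF assms(1) u] u in simp_all)
qed

lemma mlin_zero: "mlin n (%u. \<zero>)"
 by (induction n) (simp_all add: module_hom_def)

lemma mlin_add: "mlin n F ==> mlin n G ==> mlin n (%u. F u \<oplus> G u)"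
proof (induction n arbitrary: F G)
 case (Suc n)
 note m = Suc.prems
 note v = mlin_val[OF m(1)] mlin_val[OF m(2)]
 show ?case
 proof (rule mlinI)
  show "mlin n (%u. F (a # u) \<oplus> G (a # u))" if "a :. A" for a
   by (rule Suc.IH[OF mlin_slice[OF m(1) that] mlin_slice[OF m(2) that]])
 qed (simp_all add: mlin_first_add[OF m(1)] mlin_first_add[OF m(2)] mlin_first_smult[OF m(1)] mlin_first_smult[OF m(2)]
   v tuples_Cons B.a_interchange B.smult_r_distr)
qed simp

lemma mlin_smult: "mlin n F ==> c :. K ==> mlin n (%u. c \<odot> F u)"
proof (induction n arbitrary: F)
 case (Suc n)
 note m = Suc.prems(1)
 show ?case
 proof (rule mlinI)
  show "mlin n (%u. c \<odot> F (a # u))" if "a :. A" for a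
   by (rule Suc.IH[OF mlin_slice[OF m that] Suc.prems(2)])
 qed (simp_all add: mlin_first_add[OF m] mlin_first_smult[OF m] mlin_val[OF m] Suc.prems(2)
   tuples_Cons B.smult_r_distr B.smult_assoc1[symmetric] A.R.m_comm)
qed simp

lemma mlin_lmult: "mlin n F ==> x :. B ==> mlin n (%u. x \<otimes> F u)"
proof (induction n arbitrary: F)
 case (Suc n)
 note m = Suc.prems(1)
 show ?case
 proof (rule mlinI)
  show "mlin n (%u. x \<otimes> F (a # u))" if "a :. A" for a
   by (rule Suc.IH[OF mlin_slice[OF m that] Suc.prems(2)])
 qed (simp_all add: mlin_first_add[OF m] mlin_first_smult[OF m] mlin_val[OF m] Suc.prems(2)
   tuples_Cons B.r_distr B.smult_mult_right)
qed simp

lemma mlin_neg: "mlin n F ==> mlin n (%u. \<ominus> F u)"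
 by (rule mlin_cong[OF mlin_smult[of n F "\<ominus>\<^sub>K \<one>\<^sub>K"]]) (simp_all add: B.neg_eq_smult mlin_val)

lemma mlin_minus: "mlin n F ==> mlin n G ==> mlin n (%u. F u \<ominus> G u)"
 unfolding B.minus_eq by (intro mlin_add mlin_neg)

subsection \<open>The Hochschild differential\<close>

text \<open>All terms of the Hochschild differential except the left action, with the sign reversed.
  Passing to the slice at \<open>a\<close> shifts the positions by one and so alternates the
  signs.\<close>

fun bar :: "('a list => 'b) => 'a list => 'b" where
 "bar F [] = \<zero>"
| "bar F [a] = F [] \<otimes> f a"
| "bar F (a # b # w) = F ((a \<otimes>\<^sub>A b) # w) \<ominus> bar (%u. F (a # u)) (b # w)"

lemma tuples_Suc2E:
 assumes "w \<in> tuples A (Suc (Suc n))"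
 obtains a b u where "w = a # b # u" "a :. A" "b :. A" "u \<in> tuples A n" "b # u \<in> tuples A (Suc n)"
 using assms by (elim tuples_SucE) (auto simp: tuples_Cons)

lemma tuples_1E:
 assumes "w \<in> tuples A (Suc 0)" obtains a where "w = [a]" "a :. A"
 using assms by (elim tuples_SucE) (auto simp: tuples_0)

lemma bar_cong: "w \<in> tuples A (Suc n) ==> (!!u. u \<in> tuples A n ==> F u = G u) ==> bar F w = bar G w"
proof (induction n arbitrary: F G w)
 case 0 then show ?case by (elim tuples_1E) (simp add: tuples_0)
next
 case (Suc n)
 obtain a b u where w: "w = a # b # u" "a :. A" "b :. A" "u \<in> tuples A n" "b # u \<in> tuples A (Suc n)"
  using Suc.prems(1) by (rule tuples_Suc2E)
 have "bar (%v. F (a # v)) (b # u) = bar (%v. G (a # v)) (b # u)"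
  by (rule Suc.IH[OF w(5)]) (simp add: Suc.prems(2) tuples_Cons w(2))
 then show ?case using w Suc.prems(2) by (simp add: tuples_Cons)
qed

lemma bar_val: "mlin n F ==> w \<in> tuples A (Suc n) ==> bar F w :. B"
proof (induction n arbitrary: F w)
 case 0 then show ?case by (elim tuples_1E) (simp add: f)
next
 case (Suc n)
 obtain a b u where w: "w = a # b # u" "a :. A" "b :. A" "u \<in> tuples A n" "b # u \<in> tuples A (Suc n)"
  using Suc.prems(2) by (rule tuples_Suc2E)
 show ?case using w Suc.IH[OF mlin_slice[OF Suc.prems(1) w(2)] w(5)] mlin_val[OF Suc.prems(1), of "(a \<otimes>\<^sub>A b) # u"]
  by (simp add: tuples_Cons)
qed

lemma bar_add: "mlin n F ==> mlin n G ==> w \<in> tuples A (Suc n) ==>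
  bar (%u. F u \<oplus> G u) w = bar F w \<oplus> bar G w"
proof (induction n arbitrary: F G w)
 case 0 then show ?case by (elim tuples_1E) (simp add: f B.l_distr)
next
 case (Suc n)
 obtain a b u where w: "w = a # b # u" "a :. A" "b :. A" "u \<in> tuples A n" "b # u \<in> tuples A (Suc n)"
  using Suc.prems(3) by (rule tuples_Suc2E)
 note s = mlin_slice[OF Suc.prems(1) w(2)] mlin_slice[OF Suc.prems(2) w(2)]
 show ?case using w Suc.IH[OF s w(5)] bar_val[OF s(1) w(5)] bar_val[OF s(2) w(5)]
   mlin_val[OF Suc.prems(1), of "(a \<otimes>\<^sub>A b) # u"] mlin_val[OF Suc.prems(2), of "(a \<otimes>\<^sub>A b) # u"]
  by (simp add: tuples_Cons B.minus_interchange)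
qed

lemma bar_smult: "mlin n F ==> c :. K ==> w \<in> tuples A (Suc n) ==>
  bar (%u. c \<odot> F u) w = c \<odot> bar F w"
proof (induction n arbitrary: F w)
 case 0 then show ?case by (elim tuples_1E) (simp add: f B.smult_mult_left)
next
 case (Suc n)
 obtain a b u where w: "w = a # b # u" "a :. A" "b :. A" "u \<in> tuples A n" "b # u \<in> tuples A (Suc n)"
  using Suc.prems(3) by (rule tuples_Suc2E)
 note s = mlin_slice[OF Suc.prems(1) w(2)]
 show ?case using w Suc.IH[OF s Suc.prems(2) w(5)] bar_val[OF s w(5)] Suc.prems(2)
   mlin_val[OF Suc.prems(1), of "(a \<otimes>\<^sub>A b) # u"]
  by (simp add: tuples_Cons B.minus_eq B.smult_r_distr B.smult_r_minus)
qed

lemma bar_lmult: "mlin n F ==> x :. B ==> w \<in> tuples A (Suc n) ==>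
  bar (%u. x \<otimes> F u) w = x \<otimes> bar F w"
proof (induction n arbitrary: F w)
 case 0 then show ?case by (elim tuples_1E) (simp add: f B.m_assoc)
next
 case (Suc n)
 obtain a b u where w: "w = a # b # u" "a :. A" "b :. A" "u \<in> tuples A n" "b # u \<in> tuples A (Suc n)"
  using Suc.prems(3) by (rule tuples_Suc2E)
 note s = mlin_slice[OF Suc.prems(1) w(2)]
 show ?case using w Suc.IH[OF s Suc.prems(2) w(5)] bar_val[OF s w(5)] Suc.prems(2)
   mlin_val[OF Suc.prems(1), of "(a \<otimes>\<^sub>A b) # u"]
  by (simp add: tuples_Cons B.minus_eq B.r_distr B.r_minus)
qed

lemma bar_minus:
 assumes "mlin n F" "mlin n G" "w \<in> tuples A (Suc n)"
 shows "bar (%u. F u \<ominus> G u) w = bar F w \<ominus> bar G w"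
proof -
 let ?m = "\<ominus>\<^sub>K \<one>\<^sub>K"
 have "bar (%u. F u \<ominus> G u) w = bar (%u. F u \<oplus> ?m \<odot> G u) w"
  by (rule bar_cong[OF assms(3)]) (simp add: B.minus_eq B.neg_eq_smult mlin_val[OF assms(2)])
 also have "\<dots> = bar F w \<oplus> ?m \<odot> bar G w"
  using assms by (simp add: bar_add[OF assms(1) mlin_smult] bar_smult)
 finally show ?thesis using bar_val[OF assms(2,3)] by (simp add: B.minus_eq B.neg_eq_smult)
qed

lemma bar_zero: "w \<in> tuples A (Suc n) ==> (!!u. u \<in> tuples A n ==> F u = \<zero>) ==> bar F w = \<zero>"
proof -
 assume w: "w \<in> tuples A (Suc n)" and F: "!!u. u \<in> tuples A n ==> F u = \<zero>"
 have "bar F w = bar (%u. \<zero> \<otimes> \<zero>) w" by (rule bar_cong[OF w]) (simp add: F)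
 also have "\<dots> = \<zero>" using bar_lmult[OF mlin_zero B.zero_closed w] bar_val[OF mlin_zero w] by simp
 finally show ?thesis .
qed

lemma mlin_bar: "mlin n F ==> mlin (Suc n) (bar F)"
proof (induction n arbitrary: F)
 case 0
 show ?case by (rule mlinI) (use 0 in "simp_all add: tuples_0 f B.r_distr B.smult_mult_right")
next
 case (Suc n)
 note m = Suc.prems
 have sl: "mlin (Suc n) (bar (%u. F (a # u)))" if "a :. A" for a by (rule Suc.IH[OF mlin_slice[OF m that]])
 show ?case
 proof (rule mlinI)
  fix a assume a: "a :. A"
  \<comment> \<open>The contracted argument is written through \<open>hd\<close> and
    \<open>tl\<close>, so that this term is a cochain of the whole remaining list.\<close>
  let ?G = "%u. F ((a \<otimes>\<^sub>A hd u) # tl u)"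
  have "mlin (Suc n) ?G"
  proof (rule mlinI)
   show "mlin n (%u. F ((a \<otimes>\<^sub>A hd (b # u)) # tl (b # u)))" if "b :. A" for b
    using mlin_slice[OF m, of "a \<otimes>\<^sub>A b"] a that by simp
  qed (simp_all add: a A.r_distr A.smult_mult_right mlin_first_add[OF m] mlin_first_smult[OF m])
  then have "mlin (Suc n) (%u. ?G u \<ominus> bar (%u. F (a # u)) u)" using sl[OF a] by (rule mlin_minus)
  then show "mlin (Suc n) (%u. bar F (a # u))"
   by (rule mlin_cong) (elim tuples_SucE, simp)
 next
  fix u a b assume u: "u \<in> tuples A (Suc n)" and a: "a :. A" "b :. A"
  obtain c v where c: "u = c # v" "c :. A" "v \<in> tuples A n" using u by (rule tuples_SucE)
  have "bar (%x. F ((a \<oplus>\<^sub>A b) # x)) u = bar (%x. F (a # x) \<oplus> F (b # x)) u"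
   by (rule bar_cong[OF u]) (simp add: mlin_first_add[OF m] a)
  also have "\<dots> = bar (%x. F (a # x)) u \<oplus> bar (%x. F (b # x)) u"
   by (rule bar_add[OF mlin_slice[OF m a(1)] mlin_slice[OF m a(2)] u])
  finally show "bar F ((a \<oplus>\<^sub>A b) # u) = bar F (a # u) \<oplus> bar F (b # u)"
   using c a u bar_val[OF mlin_slice[OF m a(1)] u] bar_val[OF mlin_slice[OF m a(2)] u]
    mlin_val[OF m, of "(a \<otimes>\<^sub>A c) # v"] mlin_val[OF m, of "(b \<otimes>\<^sub>A c) # v"]
   by (simp add: A.l_distr mlin_first_add[OF m] B.minus_interchange tuples_Cons)
 next
  fix u c a assume u: "u \<in> tuples A (Suc n)" and a: "c :. K" "a :. A"
  obtain b v where b: "u = b # v" "b :. A" "v \<in> tuples A n" using u by (rule tuples_SucE)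
  have "bar (%x. F ((c \<odot>\<^sub>A a) # x)) u = bar (%x. c \<odot> F (a # x)) u"
   by (rule bar_cong[OF u]) (simp add: mlin_first_smult[OF m] a)
  also have "\<dots> = c \<odot> bar (%x. F (a # x)) u"
   by (rule bar_smult[OF mlin_slice[OF m a(2)] a(1) u])
  finally show "bar F ((c \<odot>\<^sub>A a) # u) = c \<odot> bar F (a # u)"
   using b a u bar_val[OF mlin_slice[OF m a(2)] u] mlin_val[OF m, of "(a \<otimes>\<^sub>A b) # v"]
   by (simp add: A.smult_mult_left mlin_first_smult[OF m] B.minus_eq B.smult_r_distr B.smult_r_minus tuples_Cons)
 qed
qed

text \<open>The identity for the slice at \<open>a\<close>, evaluated at \<open>b # c # u\<close>,
  identifies two of the terms. The rest cancel in pairs by associativity of the product.\<close>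

lemma bar_bar: "mlin n F ==> w \<in> tuples A (Suc (Suc n)) ==> bar (bar F) w = \<zero>"
proof (induction n arbitrary: F w)
 case 0
 then obtain a b where "w = [a, b]" "a :. A" "b :. A" by (elim tuples_Suc2E) (simp add: tuples_0)
 then show ?case using 0 by (simp add: f B.m_assoc B.minus_self)
next
 case (Suc n)
 note m = Suc.prems(1)
 obtain a b u' where w': "w = a # b # u'" "a :. A" "b :. A" "u' \<in> tuples A (Suc n)" "b # u' \<in> tuples A (Suc (Suc n))"
  using Suc.prems(2) by (rule tuples_Suc2E)
 obtain c u where c: "u' = c # u" "c :. A" "u \<in> tuples A n" using w'(4) by (rule tuples_SucE)
 have t: "c # u \<in> tuples A (Suc n)" "(b \<otimes>\<^sub>A c) # u \<in> tuples A (Suc n)" "(a \<otimes>\<^sub>A b \<otimes>\<^sub>A c) # u \<in> tuples A (Suc n)"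
  using c w' by (simp_all add: tuples_Cons)
 note ma = mlin_slice[OF m w'(2)] and mab = mlin_slice[OF m A.m_closed[OF w'(2,3)]]
 note mba = mlin_slice[OF mlin_bar[OF ma] w'(3)]
 let ?X = "F ((a \<otimes>\<^sub>A b \<otimes>\<^sub>A c) # u)" and ?z = "bar (%v. F ((a \<otimes>\<^sub>A b) # v)) (c # u)"
  and ?y = "bar (%v. F (a # v)) ((b \<otimes>\<^sub>A c) # u)" and ?y' = "bar (%v. bar (%v. F (a # v)) (b # v)) (c # u)"
 have i: "?X :. B" "?z :. B" "?y :. B" "?y' :. B"
  using mlin_val[OF m t(3)] bar_val[OF mab t(1)] bar_val[OF ma t(2)] bar_val[OF mba t(1)] by simp_all
 have "bar (bar (%v. F (a # v))) (b # c # u) = \<zero>" using Suc.IH[OF ma, of "b # c # u"] w'(5) c by simp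
 then have "?y \<ominus> ?y' = \<zero>" by simp
 then have y: "?y' = ?y" using B.eq_if_minus_zero[OF i(3,4)] by simp
 have "bar (%v. bar F (a # b # v)) (c # u) = bar (%v. F ((a \<otimes>\<^sub>A b) # v) \<ominus> bar (%v. F (a # v)) (b # v)) (c # u)"
  by simp
 also have "\<dots> = ?z \<ominus> ?y'" by (rule bar_minus[OF mab mba t(1)])
 finally have "bar (%v. bar F (a # v)) (b # c # u) = (?X \<ominus> ?y) \<ominus> (?z \<ominus> ?y)"
  using w' c by (simp add: y A.m_assoc)
 also have "\<dots> = ?X \<ominus> ?z" by (rule B.minus_minus_cancel[OF i(2,3,1)])
 finally show ?case using w' c i by (simp add: B.minus_self)
qed

text \<open>The Hochschild differential: left action minus \<open>bar\<close>. The value on the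
  empty list is a default and never enters.\<close>

definition hoch :: "('a list => 'b) => 'a list => 'b" where
 "hoch F w = (case w of [] => \<zero> | a # u => (f a \<otimes> F u) \<ominus> bar F (a # u))"

lemma hoch_Cons: "hoch F (a # u) = (f a \<otimes> F u) \<ominus> bar F (a # u)"
 by (simp add: hoch_def)

lemma hoch_cong: "w \<in> tuples A (Suc n) ==> (!!u. u \<in> tuples A n ==> F u = G u) ==> hoch F w = hoch G w"
 using bar_cong[of w n F G] by (elim tuples_SucE) (simp add: tuples_Cons f hoch_Cons)

lemma hoch_val: "mlin n F ==> w \<in> tuples A (Suc n) ==> hoch F w :. B"
 using bar_val[of n F w] mlin_val[of n F "tl w"] by (elim tuples_SucE) (simp add: tuples_Cons f hoch_Cons f)

lemma mlin_hoch:
 assumes m: "mlin n F" shows "mlin (Suc n) (hoch F)"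
proof (rule mlinI)
 note mb = mlin_bar[OF m]
 show "mlin n (%u. hoch F (a # u))" if "a :. A" for a
  unfolding hoch_Cons by (intro mlin_minus mlin_lmult m mlin_slice[OF mb] f that)
 fix u assume u: "u \<in> tuples A n"
 show "hoch F ((a \<oplus>\<^sub>A b) # u) = hoch F (a # u) \<oplus> hoch F (b # u)" if "a :. A" "b :. A" for a b
  using that u mlin_val[OF m u] mlin_val[OF mb, of "a # u"] mlin_val[OF mb, of "b # u"]
  by (simp add: hoch_Cons f mlin_first_add[OF mb] B.l_distr B.minus_interchange tuples_Cons)
 show "hoch F ((c \<odot>\<^sub>A a) # u) = c \<odot> hoch F (a # u)" if "c :. K" "a :. A" for a c
  using that u mlin_val[OF m u] mlin_val[OF mb, of "a # u"]
  by (simp add: hoch_Cons f mlin_first_smult[OF mb] B.smult_mult_left B.minus_eq B.smult_r_distr B.smult_r_minus tuples_Cons)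
qed

lemma hoch_add:
 assumes "mlin n F" "mlin n G" "w \<in> tuples A (Suc n)"
 shows "hoch (%u. F u \<oplus> G u) w = hoch F w \<oplus> hoch G w"
proof -
 obtain a u where w: "w = a # u" "a :. A" "u \<in> tuples A n" using assms(3) by (rule tuples_SucE)
 show ?thesis using w assms bar_val[OF assms(1,3)] bar_val[OF assms(2,3)] mlin_val[OF assms(1) w(3)] mlin_val[OF assms(2) w(3)]
  bar_add[OF assms] by (simp add: hoch_Cons f B.r_distr B.minus_interchange)
qed

lemma hoch_smult:
 assumes "mlin n F" "c :. K" "w \<in> tuples A (Suc n)"
 shows "hoch (%u. c \<odot> F u) w = c \<odot> hoch F w"
proof -
 obtain a u where w: "w = a # u" "a :. A" "u \<in> tuples A n" using assms(3) by (rule tuples_SucE)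
 show ?thesis using w assms bar_val[OF assms(1,3)] mlin_val[OF assms(1) w(3)] bar_smult[OF assms]
  by (simp add: hoch_Cons f B.smult_mult_right B.minus_eq B.smult_r_distr B.smult_r_minus)
qed

text \<open>Besides \<open>bar_bar\<close>, the point is that \<open>bar\<close> commutes with left
  multiplication by elements of \<open>B\<close>, which cancels the terms containing one left
  action.\<close>

lemma hoch_hoch:
 assumes m: "mlin n F" and w: "w \<in> tuples A (Suc (Suc n))" shows "hoch (hoch F) w = \<zero>"
proof -
 obtain a b u where w': "w = a # b # u" "a :. A" "b :. A" "u \<in> tuples A n" "b # u \<in> tuples A (Suc n)"
  using w by (rule tuples_Suc2E)
 note mb = mlin_bar[OF m]
 have t: "(a \<otimes>\<^sub>A b) # u \<in> tuples A (Suc n)" using w' by (simp add: tuples_Cons)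
 let ?p = "f a \<otimes> f b \<otimes> F u" and ?q = "bar F ((a \<otimes>\<^sub>A b) # u)" and ?r = "f a \<otimes> bar F (b # u)"
  and ?s = "bar (%v. bar F (a # v)) (b # u)"
 have i: "?p :. B" "?q :. B" "?r :. B" "?s :. B"
  using w' f mlin_val[OF m w'(4)] bar_val[OF m t] bar_val[OF m w'(5)] bar_val[OF mlin_slice[OF mb w'(2)] w'(5)] by simp_all
 have "?q \<ominus> ?s = \<zero>" using bar_bar[OF m w] w' by simp
 then have s: "?s = ?q" using B.eq_if_minus_zero[OF i(2,4)] by simp
 have "bar (%v. hoch F (a # v)) (b # u) = bar (%v. f a \<otimes> F v) (b # u) \<ominus> ?s"
  unfolding hoch_Cons by (rule bar_minus[OF mlin_lmult[OF m f(2)] mlin_slice[OF mb] w'(5)]) (rule w'(2))+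
 also have "bar (%v. f a \<otimes> F v) (b # u) = ?r" by (rule bar_lmult[OF m f(2) w'(5)]) (rule w'(2))
 finally have 1: "bar (%v. hoch F (a # v)) (b # u) = ?r \<ominus> ?q" by (simp only: s)
 have "bar (hoch F) w = (?p \<ominus> ?q) \<ominus> (?r \<ominus> ?q)" using w' 1 by (simp add: hoch_Cons f)
 also have "\<dots> = ?p \<ominus> ?r" by (rule B.minus_minus_cancel[OF i(3,2,1)])
 finally have 2: "bar (hoch F) w = ?p \<ominus> ?r" .
 have "f a \<otimes> hoch F (b # u) = ?p \<ominus> ?r"
  using w' f mlin_val[OF m w'(4)] bar_val[OF m w'(5)] by (simp add: hoch_Cons B.minus_eq B.r_distr B.r_minus B.m_assoc)
 then show ?thesis using 2 i w' by (simp add: hoch_Cons[of _ a] B.minus_self)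
qed

subsection \<open>Operators acting on one argument at a time\<close>

text \<open>The sum over all positions of \<open>F\<close> with \<open>x\<close> in that position,
  \<open>y\<close> in every earlier one and the identity after it. For a differential and the sign
  involution this is the differential on tensor powers; for a contraction \<open>h\<close> and its
  projection \<open>P\<close> it is the usual homotopy on tensor powers.\<close>

fun slotop :: "('a => 'a) => ('a => 'a) => ('a list => 'b) => 'a list => 'b" where
 "slotop x y F [] = \<zero>"
| "slotop x y F (a # w) = F (x a # w) \<oplus> slotop x y (%u. F (y a # u)) w"

context
 fixes x y assumes x: "x \<in> module_hom K A A" and y: "y \<in> module_hom K A A"
begin

lemma x_in: "a :. A ==> x a :. A" by (rule module_hom_in[OF x])
lemma y_in: "a :. A ==> y a :. A" by (rule module_hom_in[OF y])

lemma slotop_cong: "w \<in> tuples A n ==> (!!u. u \<in> tuples A n ==> F u = G u) ==> slotop x y F w = slotop x y G w"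
proof (induction n arbitrary: F G w)
 case (Suc n)
 obtain a u where w: "w = a # u" "a :. A" "u \<in> tuples A n" using Suc.prems(1) by (rule tuples_SucE)
 have "slotop x y (%v. F (y a # v)) u = slotop x y (%v. G (y a # v)) u"
  by (rule Suc.IH[OF w(3)]) (simp add: Suc.prems(2) tuples_Cons y_in w(2))
 then show ?case using w by (simp add: Suc.prems(2) tuples_Cons x_in)
qed (simp add: tuples_0)

lemma slotop_val: "mlin n F ==> w \<in> tuples A n ==> slotop x y F w :. B"
proof (induction n arbitrary: F w)
 case (Suc n)
 obtain a u where w: "w = a # u" "a :. A" "u \<in> tuples A n" using Suc.prems(2) by (rule tuples_SucE)
 show ?case using w Suc.IH[OF mlin_slice[OF Suc.prems(1) y_in[OF w(2)]] w(3)] mlin_val[OF Suc.prems(1), of "x a # u"]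
  by (simp add: tuples_Cons x_in)
qed (simp add: tuples_0)

lemma slotop_add: "mlin n F ==> mlin n G ==> w \<in> tuples A n ==>
  slotop x y (%u. F u \<oplus> G u) w = slotop x y F w \<oplus> slotop x y G w"
proof (induction n arbitrary: F G w)
 case (Suc n)
 obtain a u where w: "w = a # u" "a :. A" "u \<in> tuples A n" using Suc.prems(3) by (rule tuples_SucE)
 note s = mlin_slice[OF Suc.prems(1) y_in[OF w(2)]] mlin_slice[OF Suc.prems(2) y_in[OF w(2)]]
 show ?case using w Suc.IH[OF s w(3)] slotop_val[OF s(1) w(3)] slotop_val[OF s(2) w(3)]
   mlin_val[OF Suc.prems(1), of "x a # u"] mlin_val[OF Suc.prems(2), of "x a # u"]
  by (simp add: tuples_Cons x_in B.a_interchange)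
qed (simp add: tuples_0)

lemma slotop_smult: "mlin n F ==> c :. K ==> w \<in> tuples A n ==>
  slotop x y (%u. c \<odot> F u) w = c \<odot> slotop x y F w"
proof (induction n arbitrary: F w)
 case (Suc n)
 obtain a u where w: "w = a # u" "a :. A" "u \<in> tuples A n" using Suc.prems(3) by (rule tuples_SucE)
 note s = mlin_slice[OF Suc.prems(1) y_in[OF w(2)]]
 show ?case using w Suc.IH[OF s Suc.prems(2) w(3)] slotop_val[OF s w(3)] Suc.prems(2) mlin_val[OF Suc.prems(1), of "x a # u"]
  by (simp add: tuples_Cons x_in B.smult_r_distr)
qed (simp add: tuples_0)

lemma slotop_lmult: "mlin n F ==> b :. B ==> w \<in> tuples A n ==>
  slotop x y (%u. b \<otimes> F u) w = b \<otimes> slotop x y F w"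
proof (induction n arbitrary: F w)
 case (Suc n)
 obtain a u where w: "w = a # u" "a :. A" "u \<in> tuples A n" using Suc.prems(3) by (rule tuples_SucE)
 note s = mlin_slice[OF Suc.prems(1) y_in[OF w(2)]]
 show ?case using w Suc.IH[OF s Suc.prems(2) w(3)] slotop_val[OF s w(3)] Suc.prems(2) mlin_val[OF Suc.prems(1), of "x a # u"]
  by (simp add: tuples_Cons x_in B.r_distr)
qed (simp add: tuples_0)

lemma slotop_minus:
 assumes "mlin n F" "mlin n G" "w \<in> tuples A n"
 shows "slotop x y (%u. F u \<ominus> G u) w = slotop x y F w \<ominus> slotop x y G w"
proof -
 let ?m = "\<ominus>\<^sub>K \<one>\<^sub>K"
 have "slotop x y (%u. F u \<ominus> G u) w = slotop x y (%u. F u \<oplus> ?m \<odot> G u) w"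
  by (rule slotop_cong[OF assms(3)]) (simp add: B.minus_eq B.neg_eq_smult mlin_val[OF assms(2)])
 also have "\<dots> = slotop x y F w \<oplus> ?m \<odot> slotop x y G w"
  using assms by (simp add: slotop_add[OF assms(1) mlin_smult] slotop_smult)
 finally show ?thesis using slotop_val[OF assms(2,3)] by (simp add: B.minus_eq B.neg_eq_smult)
qed

lemma slotop_zero: "w \<in> tuples A n ==> (!!u. u \<in> tuples A n ==> F u = \<zero>) ==> slotop x y F w = \<zero>"
proof -
 assume w: "w \<in> tuples A n" and F: "!!u. u \<in> tuples A n ==> F u = \<zero>"
 have "slotop x y F w = slotop x y (%u. \<zero> \<otimes> \<zero>) w" by (rule slotop_cong[OF w]) (simp add: F)
 also have "\<dots> = \<zero>" using slotop_lmult[OF mlin_zero B.zero_closed w] slotop_val[OF mlin_zero w] by simp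
 finally show ?thesis .
qed

lemma mlin_slotop: "mlin n F ==> mlin n (slotop x y F)"
proof (induction n arbitrary: F)
 case (Suc n)
 note m = Suc.prems
 note xa = module_hom_add[OF x] module_hom_smult[OF x] and ya = module_hom_add[OF y] module_hom_smult[OF y]
 show ?case
 proof (rule mlinI)
  show "mlin n (%u. slotop x y F (a # u))" if "a :. A" for a
   using mlin_add[OF mlin_slice[OF m x_in[OF that]] Suc.IH[OF mlin_slice[OF m y_in[OF that]]]] by simp
 next
  fix u a b assume u: "u \<in> tuples A n" and a: "a :. A" "b :. A"
  have "slotop x y (%v. F (y (a \<oplus>\<^sub>A b) # v)) u = slotop x y (%v. F (y a # v) \<oplus> F (y b # v)) u"
   by (rule slotop_cong[OF u]) (simp add: ya a y_in mlin_first_add[OF m])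
  also have "\<dots> = slotop x y (%v. F (y a # v)) u \<oplus> slotop x y (%v. F (y b # v)) u"
   by (rule slotop_add[OF mlin_slice[OF m y_in[OF a(1)]] mlin_slice[OF m y_in[OF a(2)]] u])
  finally show "slotop x y F ((a \<oplus>\<^sub>A b) # u) = slotop x y F (a # u) \<oplus> slotop x y F (b # u)"
   using u a slotop_val[OF mlin_slice[OF m y_in[OF a(1)]] u] slotop_val[OF mlin_slice[OF m y_in[OF a(2)]] u]
    mlin_val[OF m, of "x a # u"] mlin_val[OF m, of "x b # u"]
   by (simp add: xa x_in mlin_first_add[OF m] B.a_interchange tuples_Cons)
 next
  fix u c a assume u: "u \<in> tuples A n" and a: "c :. K" "a :. A"
  have "slotop x y (%v. F (y (c \<odot>\<^sub>A a) # v)) u = slotop x y (%v. c \<odot> F (y a # v)) u"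
   by (rule slotop_cong[OF u]) (simp add: ya a y_in mlin_first_smult[OF m])
  also have "\<dots> = c \<odot> slotop x y (%v. F (y a # v)) u"
   by (rule slotop_smult[OF mlin_slice[OF m y_in[OF a(2)]] a(1) u])
  finally show "slotop x y F ((c \<odot>\<^sub>A a) # u) = c \<odot> slotop x y F (a # u)"
   using u a slotop_val[OF mlin_slice[OF m y_in[OF a(2)]] u] mlin_val[OF m, of "x a # u"]
   by (simp add: xa x_in mlin_first_smult[OF m] B.smult_r_distr tuples_Cons)
 qed
qed simp

text \<open>A derivation twisted by a multiplicative \<open>y\<close> distributes over a merged
  argument exactly as over the two separate ones. The closing right action is not differentiated,
  because \<open>f\<close> kills the image of \<open>x\<close>.\<close>

lemma slotop_bar:
 assumes mult: "!!a b. [|a :. A; b :. A|] ==> x (a \<otimes>\<^sub>A b) = x a \<otimes>\<^sub>A b \<oplus>\<^sub>A y a \<otimes>\<^sub>A x b"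
  "!!a b. [|a :. A; b :. A|] ==> y (a \<otimes>\<^sub>A b) = y a \<otimes>\<^sub>A y b"
  and fx: "!!a. a :. A ==> f (x a) = \<zero>"
 shows "mlin n F ==> w \<in> tuples A (Suc n) ==> slotop x y (bar F) w = bar (slotop x y F) w"
proof (induction n arbitrary: F w)
 case 0 then show ?case by (elim tuples_1E) (simp add: fx f)
next
 case (Suc n)
 note m = Suc.prems(1)
 obtain a b u where w: "w = a # b # u" "a :. A" "b :. A" "u \<in> tuples A n" "b # u \<in> tuples A (Suc n)"
  using Suc.prems(2) by (rule tuples_Suc2E)
 have c: "x a :. A" "y a :. A" "x b :. A" "y b :. A" using w x_in y_in by auto
 note mx = mlin_slice[OF m c(1)] and my = mlin_slice[OF m c(2)]
 note myy = mlin_slice[OF m A.m_closed[OF c(2,4)]] and mby = mlin_slice[OF mlin_bar[OF my] c(4)]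
 let ?p = "F ((x a \<otimes>\<^sub>A b) # u)" and ?q = "F ((y a \<otimes>\<^sub>A x b) # u)" and ?r = "slotop x y (%v. F ((y a \<otimes>\<^sub>A y b) # v)) u"
  and ?s = "bar (%v. F (x a # v)) (b # u)" and ?t = "bar (%v. F (y a # v)) (x b # u)"
  and ?t' = "slotop x y (%v. bar (%v. F (y a # v)) (y b # v)) u" and ?z = "bar (slotop x y (%v. F (y a # v))) (b # u)"
 have xb: "x b # u \<in> tuples A (Suc n)" using w c by (simp add: tuples_Cons)
 have i: "?p :. B" "?q :. B" "?r :. B" "?s :. B" "?t :. B" "?t' :. B" "?z :. B"
  using mlin_val[OF m, of "(x a \<otimes>\<^sub>A b) # u"] mlin_val[OF m, of "(y a \<otimes>\<^sub>A x b) # u"] w c slotop_val[OF myy w(4)]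
   bar_val[OF mx w(5)] bar_val[OF my xb] slotop_val[OF mby w(4)] bar_val[OF mlin_slotop[OF my] w(5)]
  by (simp_all add: tuples_Cons)
 have IH: "?t \<oplus> ?t' = ?z" using Suc.IH[OF my w(5)] by simp
 have "slotop x y (%v. bar F (y a # y b # v)) u = ?r \<ominus> ?t'"
  using slotop_minus[OF myy mby w(4)] by simp
 then have "slotop x y (bar F) w = (?p \<ominus> ?s) \<oplus> ((?q \<ominus> ?t) \<oplus> (?r \<ominus> ?t'))"
  using w by simp
 also have "\<dots> = (?p \<oplus> (?q \<oplus> ?r)) \<ominus> (?s \<oplus> (?t \<oplus> ?t'))"
  using i by (simp add: B.minus_interchange)
 finally have L: "slotop x y (bar F) w = (?p \<oplus> (?q \<oplus> ?r)) \<ominus> (?s \<oplus> ?z)" unfolding IH .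
 have "slotop x y F ((a \<otimes>\<^sub>A b) # u) = (?p \<oplus> ?q) \<oplus> ?r"
  using w c by (simp add: mult mlin_first_add[OF m])
 moreover have "bar (%v. slotop x y F (a # v)) (b # u) = ?s \<oplus> ?z"
  using bar_add[OF mx mlin_slotop[OF my] w(5)] by simp
 ultimately show ?case using L w i by (simp add: B.a_assoc)
qed

text \<open>In addition to \<open>slotop_bar\<close>, the left action meets the first argument after
  \<open>y\<close> has been applied, so \<open>f\<close> must be invariant under
  \<open>y\<close>.\<close>

lemma slotop_hoch:
 assumes mult: "!!a b. [|a :. A; b :. A|] ==> x (a \<otimes>\<^sub>A b) = x a \<otimes>\<^sub>A b \<oplus>\<^sub>A y a \<otimes>\<^sub>A x b"
  "!!a b. [|a :. A; b :. A|] ==> y (a \<otimes>\<^sub>A b) = y a \<otimes>\<^sub>A y b"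
  and fx: "!!a. a :. A ==> f (x a) = \<zero>" and fy: "!!a. a :. A ==> f (y a) = f a"
  and m: "mlin n F" and w: "w \<in> tuples A (Suc n)"
 shows "slotop x y (hoch F) w = hoch (slotop x y F) w"
proof -
 obtain a u where w': "w = a # u" "a :. A" "u \<in> tuples A n" using w by (rule tuples_SucE)
 have c: "x a :. A" "y a :. A" "f a :. B" using w' x_in y_in f by auto
 note mb = mlin_bar[OF m]
 let ?p = "f a \<otimes> slotop x y F u" and ?q = "bar F (x a # u)" and ?r = "slotop x y (%v. bar F (y a # v)) u"
 have i: "?p :. B" "?q :. B" "?r :. B"
  using c slotop_val[OF m w'(3)] mlin_val[OF mb, of "x a # u"] slotop_val[OF mlin_slice[OF mb c(2)] w'(3)] w' by (simp_all add: tuples_Cons)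
 have "slotop x y (%v. hoch F (y a # v)) u = slotop x y (%v. f a \<otimes> F v) u \<ominus> ?r"
  unfolding hoch_Cons fy[OF w'(2)] by (rule slotop_minus[OF mlin_lmult[OF m c(3)] mlin_slice[OF mb c(2)] w'(3)])
 also have "slotop x y (%v. f a \<otimes> F v) u = ?p" by (rule slotop_lmult[OF m c(3) w'(3)])
 finally have "slotop x y (hoch F) w = (\<zero> \<ominus> ?q) \<oplus> (?p \<ominus> ?r)"
  using w' mlin_val[OF m w'(3)] by (simp add: hoch_Cons[of _ "x a"] fx)
 also have "\<dots> = ?p \<ominus> (?q \<oplus> ?r)"
  using i B.minus_interchange[of "\<zero>" ?p ?q ?r] by simp
 also have "?q \<oplus> ?r = bar (slotop x y F) w" using slotop_bar[OF mult fx m w] w' by simp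
 finally show ?thesis using w' by (simp add: hoch_Cons)
qed

end

end

section \<open>Squares and homotopies of operators on tensor powers\<close>

context bar_setup begin

lemma slotop_slotop_Cons:
 assumes x: "x \<in> module_hom K A A" and y: "y \<in> module_hom K A A"
  and x': "x' \<in> module_hom K A A" and y': "y' \<in> module_hom K A A"
  and m: "mlin (Suc n) F" and a: "a :. A" and u: "u \<in> tuples A n"
 shows "slotop x y (slotop x' y' F) (a # u) =
  (F (x' (x a) # u) \<oplus> slotop x' y' (%v. F (y' (x a) # v)) u) \<oplus>
  (slotop x y (%v. F (x' (y a) # v)) u \<oplus> slotop x y (slotop x' y' (%v. F (y' (y a) # v))) u)"
proof -
 have i: "x' (y a) :. A" "y' (y a) :. A"
  using a module_hom_in[OF y] module_hom_in[OF x'] module_hom_in[OF y'] by auto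
 have "slotop x y (%v. F (x' (y a) # v) \<oplus> slotop x' y' (%v. F (y' (y a) # v)) v) u =
   slotop x y (%v. F (x' (y a) # v)) u \<oplus> slotop x y (slotop x' y' (%v. F (y' (y a) # v))) u"
  by (rule slotop_add[OF x y mlin_slice[OF m i(1)] mlin_slotop[OF x' y' mlin_slice[OF m i(2)]] u])
 then show ?thesis by simp
qed

text \<open>Mixed terms in a composite of two slot operators come in pairs whose first arguments add
  up to zero.\<close>

lemma slotop_cancel:
 assumes x: "x \<in> module_hom K A A" and y: "y \<in> module_hom K A A" and m: "mlin (Suc n) F"
  and c: "c :. A" "c' :. A" "c \<oplus>\<^sub>A c' = \<zero>\<^sub>A" and u: "u \<in> tuples A n"
 shows "slotop x y (%v. F (c # v)) u \<oplus> slotop x y (%v. F (c' # v)) u = \<zero>"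
proof -
 have "slotop x y (%v. F (c # v)) u \<oplus> slotop x y (%v. F (c' # v)) u =
   slotop x y (%v. F (c # v) \<oplus> F (c' # v)) u"
  by (rule slotop_add[OF x y mlin_slice[OF m c(1)] mlin_slice[OF m c(2)] u, symmetric])
 also have "\<dots> = \<zero>"
 proof (rule slotop_zero[OF x y u])
  fix v assume v: "v \<in> tuples A n"
  show "F (c # v) \<oplus> F (c' # v) = \<zero>"
   using mlin_first_add[OF m v c(1,2)] mlin_first_zero[OF m v] c(3) by simp
 qed
 finally show ?thesis .
qed

text \<open>Both operators in the same position give \<open>x x = 0\<close>; in different positions
  the two orders cancel by anticommutation of \<open>x\<close> and \<open>y\<close>.\<close>

lemma slotop_square:
 assumes x: "x \<in> module_hom K A A" and y: "y \<in> module_hom K A A"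
  and xx: "!!a. a :. A ==> x (x a) = \<zero>\<^sub>A"
  and xy: "!!a. a :. A ==> y (x a) \<oplus>\<^sub>A x (y a) = \<zero>\<^sub>A"
 shows "mlin n F ==> w \<in> tuples A n ==> slotop x y (slotop x y F) w = \<zero>"
proof (induction n arbitrary: F w)
 case (Suc n)
 note m = Suc.prems(1)
 obtain a u where w: "w = a # u" "a :. A" "u \<in> tuples A n" using Suc.prems(2) by (rule tuples_SucE)
 have i: "x a :. A" "y a :. A" "y (x a) :. A" "x (y a) :. A" "y (y a) :. A"
  using w(2) module_hom_in[OF x] module_hom_in[OF y] by auto
 have "slotop x y (slotop x y (%v. F (y (y a) # v))) u = \<zero>" by (rule Suc.IH[OF mlin_slice[OF m i(5)] w(3)])
 moreover have "F (x (x a) # u) = \<zero>" using mlin_first_zero[OF m w(3)] xx[OF w(2)] by simp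
 moreover have "slotop x y (%v. F (y (x a) # v)) u \<oplus> slotop x y (%v. F (x (y a) # v)) u = \<zero>"
  by (rule slotop_cancel[OF x y m i(3,4) xy[OF w(2)] w(3)])
 moreover note slotop_val[OF x y mlin_slice[OF m i(3)] w(3)] slotop_val[OF x y mlin_slice[OF m i(4)] w(3)]
 ultimately show ?case unfolding w(1) slotop_slotop_Cons[OF x y x y m w(2,3)] by simp
qed (simp add: tuples_0)

text \<open>The homotopy for tensor powers. In the first position \<open>h\<close> and
  \<open>x\<close> contribute \<open>F (a # u) - F (P a # u)\<close>, mixed positions cancel by
  anticommutation of \<open>h\<close> and \<open>y\<close>, and the induction hypothesis continues
  with \<open>P a\<close> in front, so the differences telescope.\<close>

lemma slotop_homotopy:
 assumes x: "x \<in> module_hom K A A" and y: "y \<in> module_hom K A A"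
  and h: "h \<in> module_hom K A A" and P: "P \<in> module_hom K A A"
  and xh: "!!a. a :. A ==> h (x a) \<oplus>\<^sub>A x (h a) = a \<ominus>\<^sub>A P a"
  and yh: "!!a. a :. A ==> h (y a) \<oplus>\<^sub>A y (h a) = \<zero>\<^sub>A"
  and yP: "!!a. a :. A ==> P (y a) = P a" "!!a. a :. A ==> y (P a) = P a"
  and xP: "!!a. a :. A ==> P (x a) = \<zero>\<^sub>A" "!!a. a :. A ==> x (P a) = \<zero>\<^sub>A"
 shows "mlin n F ==> w \<in> tuples A n ==>
  slotop x y (slotop h P F) w \<oplus> slotop h P (slotop x y F) w = F w \<ominus> F (map P w)"
proof (induction n arbitrary: F w)
 case 0 then show ?case by (simp add: tuples_0 B.minus_self)
next
 case (Suc n)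
 note m = Suc.prems(1)
 obtain a u where w: "w = a # u" "a :. A" "u \<in> tuples A n" using Suc.prems(2) by (rule tuples_SucE)
 have i: "h (x a) :. A" "x (h a) :. A" "h (y a) :. A" "y (h a) :. A" "P a :. A"
  using w(2) module_hom_in[OF x] module_hom_in[OF y] module_hom_in[OF h] module_hom_in[OF P] by auto
 have z: "slotop h P (%v. F (\<zero>\<^sub>A # v)) u = \<zero>"
  by (rule slotop_zero[OF h P w(3)]) (rule mlin_first_zero[OF m])
 note mP = mlin_slice[OF m i(5)]
 let ?p = "F (h (x a) # u)" and ?q = "slotop x y (%v. F (h (y a) # v)) u" and ?r = "slotop x y (slotop h P (%v. F (P a # v))) u"
  and ?p' = "F (x (h a) # u)" and ?q' = "slotop x y (%v. F (y (h a) # v)) u" and ?r' = "slotop h P (slotop x y (%v. F (P a # v))) u"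
 have mapP: "map P u \<in> tuples A n" using w(3) module_hom_in[OF P] by (auto simp: tuples_def)
 have c: "?p :. B" "?q :. B" "?r :. B" "?p' :. B" "?q' :. B" "?r' :. B"
  "F (a # u) :. B" "F (P a # u) :. B" "F (P a # map P u) :. B"
  using mlin_val[OF m] i w mapP slotop_val[OF x y mlin_slice[OF m i(3)] w(3)] slotop_val[OF x y mlin_slice[OF m i(4)] w(3)]
   slotop_val[OF x y mlin_slotop[OF h P mP] w(3)] slotop_val[OF h P mlin_slotop[OF x y mP] w(3)]
  by (simp_all add: tuples_Cons)
 have 1: "slotop x y (slotop h P F) w = ?p \<oplus> (?q \<oplus> ?r)"
  unfolding w(1) slotop_slotop_Cons[OF x y h P m w(2,3)] using c z by (simp add: xP yP w(2))
 have 2: "slotop h P (slotop x y F) w = ?p' \<oplus> (?q' \<oplus> ?r')"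
  unfolding w(1) slotop_slotop_Cons[OF h P x y m w(2,3)] using c z by (simp add: xP yP w(2) B.a_assoc)
 have 3: "?p \<oplus> ?p' = F (a # u) \<ominus> F (P a # u)"
  using mlin_first_add[OF m w(3) i(1,2)] module_hom_minus[OF A.module_axioms B.module_axioms mlin_hom[OF m w(3)] w(2) i(5)]
  by (simp add: xh w(2))
 have 4: "?q \<oplus> ?q' = \<zero>" by (rule slotop_cancel[OF x y m i(3,4) yh[OF w(2)] w(3)])
 have 5: "?r \<oplus> ?r' = F (P a # u) \<ominus> F (P a # map P u)" by (rule Suc.IH[OF mP w(3)])
 have "(?p \<oplus> (?q \<oplus> ?r)) \<oplus> (?p' \<oplus> (?q' \<oplus> ?r')) = (?p \<oplus> ?p') \<oplus> ((?q \<oplus> ?q') \<oplus> (?r \<oplus> ?r'))"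
  using c by (simp add: B.a_interchange)
 also have "\<dots> = F (a # u) \<ominus> F (P a # map P u)" unfolding 3 4 5 using c by (simp add: B.minus_telescope)
 finally show ?case unfolding 1 2 using w(1) by simp
qed

end

subsection \<open>Cochains of given degree on a DG algebra\<close>

text \<open>Again \<open>\<phi>\<close> is a DG homomorphism to an algebra in degree 0.
  Nonpositivity of \<open>R\<close> forces cochains of negative internal degree to vanish, which is
  the boundary of the double complex.\<close>

locale dg_bar_setup = bar_setup K R B \<phi> + R: dg_algebra K R
 for K :: "('k, 'c) ring_scheme" and R :: "('k, 'r, 'd) dg_alg_scheme" and B :: "('k, 'b) module" (structure) and \<phi> +
 assumes \<phi>_Gr: "[|a \<in> Gr R n; n ~= 0|] ==> \<phi> a = \<zero>"
  and \<phi>_dif: "a :. R ==> \<phi> (dif R a) = \<zero>"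
  and nonpos: "n > 0 ==> Gr R n = {\<zero>\<^sub>R}"
begin

text \<open>\<open>vdeg n q F\<close>: \<open>F\<close> vanishes on \<open>n\<close>-tuples of homogeneous elements whose degrees do not add up
 to \<open>-q\<close>.\<close>

primrec vdeg :: "nat => int => ('r list => 'b) => bool" where
 "vdeg 0 q F \<longleftrightarrow> (q ~= 0 --> F [] = \<zero>)"
| "vdeg (Suc n) q F \<longleftrightarrow> (\<forall>i. \<forall>a \<in> Gr R i. vdeg n (q + i) (%u. F (a # u)))"

lemma vdeg_slice: "vdeg (Suc n) q F ==> a \<in> Gr R i ==> vdeg n (q + i) (%u. F (a # u))"
 by simp

lemma vdeg_cong: "vdeg n q F ==> (!!w. w \<in> tuples R n ==> G w = F w) ==> vdeg n q G"
proof (induction n arbitrary: q F G)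
 case (Suc n)
 show ?case unfolding vdeg.simps
 proof (intro allI ballI)
  fix i a assume a: "a \<in> Gr R i"
  show "vdeg n (q + i) (%u. G (a # u))"
   by (rule Suc.IH[OF vdeg_slice[OF Suc.prems(1) a]]) (rule Suc.prems(2), simp add: tuples_Cons R.Gr_in[OF a])
 qed
qed (simp add: tuples_0)

lemma vdeg_zero: "vdeg n q (%u. \<zero>)"
 by (induction n arbitrary: q) simp_all

lemma vdeg_add: "vdeg n q F ==> vdeg n q G ==> vdeg n q (%u. F u \<oplus> G u)"
 by (induction n arbitrary: q F G) simp_all

lemma vdeg_minus: "vdeg n q F ==> vdeg n q G ==> vdeg n q (%u. F u \<ominus> G u)"
 by (induction n arbitrary: q F G) (simp_all add: B.minus_self)

lemma vdeg_smult: "vdeg n q F ==> c :. K ==> vdeg n q (%u. c \<odot> F u)"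
 by (induction n arbitrary: q F) simp_all

lemma vdeg_lmult: "vdeg n q F ==> c :. B ==> vdeg n q (%u. c \<otimes> F u)"
 by (induction n arbitrary: q F) simp_all

text \<open>A nonzero value would need arguments of total degree \<open>- q > 0\<close>, and
  \<open>R\<close> has no positive degrees.\<close>

lemma vdeg_neg_zero: "mlin n F ==> vdeg n q F ==> q < 0 ==> w \<in> tuples R n ==> F w = \<zero>"
proof (induction n arbitrary: q F w)
 case (Suc n)
 note m = Suc.prems(1)
 obtain a u where w: "w = a # u" "a :. R" "u \<in> tuples R n" using Suc.prems(4) by (rule tuples_SucE)
 from w(2) have "F (a # u) = \<zero>"
 proof (induction rule: R.homogeneous_induct)
  case (homogeneous i a)
  show ?case
  proof (cases "i > 0")
   case True
   then show ?thesis using homogeneous nonpos[of i] mlin_first_zero[OF m w(3)] by simp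
  next
   case False
   then show ?thesis
    using Suc.IH[OF mlin_slice[OF m R.Gr_in[OF homogeneous]] vdeg_slice[OF Suc.prems(2) homogeneous] _ w(3)] Suc.prems(3) by simp
  qed
 next
  case (add a b) then show ?case using mlin_first_add[OF m w(3)] by simp
 qed
 then show ?case by (simp add: w(1))
qed (simp add: tuples_0)

text \<open>Arguments of degree 0 have total degree 0, which differs from
  \<open>- q\<close>.\<close>

lemma vdeg_Gr_zero: "vdeg n q F ==> q ~= 0 ==> length w = n ==> set w <= Gr R 0 ==> F w = \<zero>"
proof (induction n arbitrary: F w)
 case (Suc n)
 then obtain a u where w: "w = a # u" by (cases w) auto
 show ?case using Suc.IH[of "%u. F (a # u)" u] vdeg_slice[OF Suc.prems(1), of a 0] Suc.prems(2-4) w by simp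
qed simp

text \<open>Exactly one argument is moved, by \<open>e\<close>; since internal degree is minus the
  total degree of the arguments, the cochain degree grows by \<open>e\<close>. The differential has
  \<open>e = 1\<close>, the homotopy \<open>e = - 1\<close>.\<close>

lemma vdeg_slotop:
 assumes x: "!!i a. a \<in> Gr R i ==> x a \<in> Gr R (i + e)" and y: "!!i a. a \<in> Gr R i ==> y a \<in> Gr R i"
 shows "vdeg n q F ==> vdeg n (q + e) (slotop x y F)"
proof (induction n arbitrary: q F)
 case (Suc n)
 show ?case unfolding vdeg.simps
 proof (intro allI ballI)
  fix i a assume a: "a \<in> Gr R i"
  have "vdeg n (q + e + i) (%u. F (x a # u))" using vdeg_slice[OF Suc.prems x[OF a]] by (simp add: algebra_simps)
  moreover have "vdeg n (q + e + i) (slotop x y (%u. F (y a # u)))"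
   using Suc.IH[OF vdeg_slice[OF Suc.prems y[OF a]]] by (simp add: algebra_simps)
  ultimately show "vdeg n (q + e + i) (%u. slotop x y F (a # u))" by (simp add: vdeg_add)
 qed
qed simp

text \<open>The closing right action is by \<open>\<phi>\<close> of the last argument, which is zero
  unless that argument has degree 0; merging arguments preserves total degree.\<close>

lemma vdeg_bar: "mlin n F ==> vdeg n q F ==> vdeg (Suc n) q (bar F)"
proof (induction n arbitrary: q F)
 case 0
 have "bar F [a] = \<zero>" if "a \<in> Gr R i" "q + i ~= 0" for i a
 proof (cases "i = 0")
  case True then show ?thesis using 0 that R.Gr_in[OF that(1)] by (simp add: f)
 next
  case False then show ?thesis using 0 \<phi>_Gr[OF that(1)] by simp
 qed
 then show ?case by simp
next
 case (Suc n)
 show ?case unfolding vdeg.simps(2)[of "Suc n"]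
 proof (intro allI ballI)
  fix i a assume a: "a \<in> Gr R i"
  let ?G = "%u. F ((a \<otimes>\<^sub>R hd u) # tl u)"
  have "vdeg (Suc n) (q + i) ?G" unfolding vdeg.simps
  proof (intro allI ballI)
   fix j b assume b: "b \<in> Gr R j"
   show "vdeg n (q + i + j) (%u. F ((a \<otimes>\<^sub>R hd (b # u)) # tl (b # u)))"
    using vdeg_slice[OF Suc.prems(2) R.Gr_mult[OF a b]] by (simp add: algebra_simps)
  qed
  moreover have "vdeg (Suc n) (q + i) (bar (%u. F (a # u)))"
   by (rule Suc.IH[OF mlin_slice[OF Suc.prems(1) R.Gr_in[OF a]] vdeg_slice[OF Suc.prems(2) a]])
  ultimately have "vdeg (Suc n) (q + i) (%u. ?G u \<ominus> bar (%u. F (a # u)) u)" by (rule vdeg_minus)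
  then show "vdeg (Suc n) (q + i) (%u. bar F (a # u))" by (rule vdeg_cong) (elim tuples_SucE, simp)
 qed
qed

lemma vdeg_hoch:
 assumes m: "mlin n F" and v: "vdeg n q F" shows "vdeg (Suc n) q (hoch F)"
 unfolding vdeg.simps
proof (intro allI ballI)
 fix i a assume a: "a \<in> Gr R i"
 have "vdeg n (q + i) (%u. \<phi> a \<otimes> F u)"
 proof (cases "i = 0")
  case True then show ?thesis using vdeg_lmult[OF v] f(2)[OF R.Gr_in[OF a]] by simp
 next
  case False show ?thesis by (rule vdeg_cong[OF vdeg_zero]) (simp add: \<phi>_Gr[OF a False] mlin_val[OF m])
 qed
 then show "vdeg n (q + i) (%u. hoch F (a # u))"
  unfolding hoch_Cons by (rule vdeg_minus[OF _ vdeg_slice[OF vdeg_bar[OF m v] a]])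
qed

abbreviation dv where "dv \<equiv> slotop (dif R) (sgn_inv K R)"

lemma mlin_dv: "mlin n F ==> mlin n (dv F)"
 by (rule mlin_slotop[OF R.dif_linear R.sgn_inv_hom])

lemma vdeg_dv: "vdeg n q F ==> vdeg n (q + 1) (dv F)"
 by (rule vdeg_slotop[OF R.dif_degree R.sgn_inv_Gr])

lemma dv_dv: "mlin n F ==> w \<in> tuples R n ==> dv (dv F) w = \<zero>"
proof (rule slotop_square[OF R.dif_linear R.sgn_inv_hom R.dif_dif])
 fix a assume a: "a :. R"
 show "sgn_inv K R (dif R a) \<oplus>\<^sub>R dif R (sgn_inv K R a) = \<zero>\<^sub>R"
  unfolding R.dif_sgn_inv[OF a] by (rule A.r_neg[OF R.sgn_inv_in[OF R.dif_in[OF a]]])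
qed

lemma \<phi>_sgn_inv: "a :. R ==> \<phi> (sgn_inv K R a) = \<phi> a"
proof (induction rule: R.homogeneous_induct)
 case (homogeneous n a)
 note a = R.Gr_in[OF homogeneous]
 show ?case
 proof (cases "n = 0")
  case True then show ?thesis using homogeneous a by (simp add: R.sgn_inv_Gr_eq ksign_def)
 next
  case False then show ?thesis using \<phi>_Gr[OF homogeneous] \<phi>_Gr[OF R.sgn_inv_Gr[OF homogeneous]] by simp
 qed
next
 case (add a b) then show ?case by (simp add: module_hom_add[OF R.sgn_inv_hom] R.sgn_inv_in f)
qed

lemma dv_hoch: "mlin n F ==> w \<in> tuples R (Suc n) ==> dv (hoch F) w = hoch (dv F) w"
 by (rule slotop_hoch[OF R.dif_linear R.sgn_inv_hom R.dif_mult_sgn R.sgn_inv_mult \<phi>_dif \<phi>_sgn_inv])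

end

subsection \<open>Contractions of resolutions\<close>

lemma carrier_quot: "carrier (quot M I) = (%x. I +>\<^sub>M x) ` carrier M"
 by (auto simp: quot_def ring.extend_def FactRing_def A_RCOSETS_def RCOSETS_def a_r_coset_def)

locale resolution_setup = A: assoc_algebra K A + R: dg_algebra K R
 for K :: "('k, 'c) ring_scheme" and A :: "('k, 'a) module" and R :: "('k, 'r, 'd) dg_alg_scheme" +
 fixes p
 assumes qi: "quasi_iso K R (deg0 A) p" and nonpos: "n > 0 ==> Gr R n = {\<zero>\<^sub>R}"
begin

lemma p_hom: "p \<in> alg_hom K R A"
 using qi by (simp add: quasi_iso_def dg_hom_def alg_hom_def module_hom_def ring_hom_def deg0_simps)

lemmas p = alg_homD[OF p_hom]

lemma p_Gr: "x \<in> Gr R n ==> n ~= 0 ==> p x = \<zero>\<^sub>A"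
 using qi by (force simp: quasi_iso_def dg_hom_def deg0_simps)

lemma p_dif: "x :. R ==> p (dif R x) = \<zero>\<^sub>A"
 using qi by (simp add: quasi_iso_def dg_hom_def deg0_simps)

lemma p_zero: "p \<zero>\<^sub>R = \<zero>\<^sub>A"
 by (rule module_hom_zero[OF R.module_axioms A.module_axioms p(1)])

lemma dif_zero: "dif R \<zero>\<^sub>R = \<zero>\<^sub>R"
 by (rule module_hom_zero[OF R.module_axioms R.module_axioms R.dif_linear])

lemma coboundaries_zero: "\<zero>\<^sub>R \<in> coboundaries R n"
 unfolding coboundaries_def using R.Gr_zero dif_zero by force

lemma coset_eq: "(coboundaries R n +>\<^bsub>R\<lparr>carrier := Z\<rparr>\<^esub> z) = (%b. b \<oplus>\<^sub>R z) ` coboundaries R n"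
 by (auto simp: a_r_coset_def')

text \<open>The target has no nonzero coboundaries, so its cosets are singletons and the map on
  cohomology is evaluation of \<open>p\<close>.\<close>

lemma p_class:
 assumes "z \<in> Gr R n"
 shows "cohomology_map (deg0 A) p n ((%b. b \<oplus>\<^sub>R z) ` coboundaries R n) = {p z}"
proof -
 have "coboundaries (deg0 A) n = {\<zero>\<^sub>A}" by (auto simp: coboundaries_def deg0_simps)
 then have s: "coboundaries (deg0 A) n +>\<^bsub>deg0 A\<^esub> a = {a}" if "a :. A" for a
  using that by (auto simp: a_r_coset_def' deg0_simps)
 have b: "p (b \<oplus>\<^sub>R z) = p z" "b \<oplus>\<^sub>R z :. R" if "b \<in> coboundaries R n" for b
  using that R.Gr_in R.Gr_in[OF assms] by (auto simp: coboundaries_def p p_dif R.dif_in)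
 show ?thesis unfolding cohomology_map_def using b s[OF p(2)] coboundaries_zero[of n] R.Gr_in[OF assms] p(2)
  by auto
qed

text \<open>Injectivity on cohomology, applied to the classes of \<open>z\<close> and of
  zero.\<close>

lemma cocycle_boundary:
 assumes z: "z \<in> Gr R n" "dif R z = \<zero>\<^sub>R" "p z = \<zero>\<^sub>A"
 shows "z \<in> coboundaries R n"
proof -
 let ?c = "%z. (%b. b \<oplus>\<^sub>R z) ` coboundaries R n"
 have "inj_on (cohomology_map (deg0 A) p n) (carrier (cohomology R n))"
  using qi by (simp add: quasi_iso_def bij_betw_def)
 moreover have "?c z :. (cohomology R n)" "?c \<zero>\<^sub>R :. (cohomology R n)"
  unfolding cohomology_def carrier_quot coset_eq using z R.Gr_zero dif_zero by (auto simp: cocycles_def)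
 moreover have "cohomology_map (deg0 A) p n (?c z) = cohomology_map (deg0 A) p n (?c \<zero>\<^sub>R)"
  unfolding p_class[OF z(1)] p_class[OF R.Gr_zero] by (simp add: z p_zero)
 ultimately have "?c z = ?c \<zero>\<^sub>R" unfolding inj_on_def by blast
 moreover have "z \<in> ?c z" using coboundaries_zero[of n] R.Gr_in[OF z(1)] by force
 moreover have "b \<oplus>\<^sub>R \<zero>\<^sub>R = b" if "b \<in> coboundaries R n" for b
  using that R.Gr_in R.dif_in by (auto simp: coboundaries_def)
 ultimately show ?thesis by auto
qed

text \<open>Surjectivity on cohomology in degree 0, where every element of \<open>A\<close> is its
  own class.\<close>

lemma p_surj:
 assumes a: "a :. A" shows "\<exists>z \<in> Gr R 0. p z = a"
proof -
 let ?c = "%z. (%b. b \<oplus>\<^sub>R z) ` coboundaries R 0"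
 have "coboundaries (deg0 A) 0 = {\<zero>\<^sub>A}" by (auto simp: coboundaries_def deg0_simps)
 then have "coboundaries (deg0 A) 0 +>\<^bsub>(deg0 A)\<lparr>carrier := cocycles (deg0 A) 0\<rparr>\<^esub> a = {a}"
  using a by (auto simp: a_r_coset_def' deg0_simps)
 moreover have "a \<in> cocycles (deg0 A) 0" using a by (simp add: cocycles_def deg0_simps)
 ultimately have "{a} \<in> carrier (cohomology (deg0 A) 0)" unfolding cohomology_def carrier_quot by force
 then have "{a} \<in> cohomology_map (deg0 A) p 0 ` carrier (cohomology R 0)"
  using qi by (simp add: quasi_iso_def bij_betw_def)
 then obtain z where "z \<in> Gr R 0" "cohomology_map (deg0 A) p 0 (?c z) = {a}"
  unfolding cohomology_def carrier_quot coset_eq by (auto simp: cocycles_def)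
 then show ?thesis using p_class[of z 0] by auto
qed

lemma sub_vectorspace: "vectorspace K (R\<lparr>carrier := Gr R n\<rparr>)"
 by (rule R.subspace_is_vs[OF R.Gr_subspace])

text \<open>Over a field the resolution contracts linearly onto \<open>A\<close>. The map
  \<open>i\<close> splits \<open>p\<close> and \<open>s\<close> splits the differential onto
  boundaries. What remains of \<open>x\<close> after removing \<open>s (dif R x)\<close> and
  \<open>i (p x)\<close> is a cocycle killed by \<open>p\<close>, hence a boundary, and
  \<open>h\<close> applies \<open>s\<close> to it. Neither \<open>i\<close> nor \<open>h\<close>
  respects products.\<close>

lemma contraction:
 obtains i h where "i \<in> module_hom K A R" "!!a. a :. A ==> i a \<in> Gr R 0" "!!a. a :. A ==> p (i a) = a"
  "h \<in> module_hom K R R" "!!n x. x \<in> Gr R n ==> h x \<in> Gr R (n - 1)"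
  "!!x. x :. R ==> h (dif R x) \<oplus>\<^sub>R dif R (h x) = x \<ominus>\<^sub>R i (p x)"
proof -
 let ?R = "%n. R\<lparr>carrier := Gr R n\<rparr>"
 have vs: "vectorspace K (?R n)" for n by (rule sub_vectorspace)
 have "p \<in> module_hom K (?R 0) A"
  by (rule module_homI) (auto intro: p dest: R.Gr_in)
 moreover have "p ` carrier (?R 0) = carrier A" using p_surj p(2)[OF R.Gr_in] by force
 ultimately have "\<exists>g \<in> module_hom K A (?R 0). \<forall>y \<in> carrier A. p (g y) = y"
  by (rule linear_section[OF vs A.module_axioms])
 then obtain i where i: "i \<in> module_hom K A (?R 0)" "!!a. a :. A ==> p (i a) = a" by blast
 have iG: "i a \<in> Gr R 0" if "a :. A" for a using module_hom_in[OF i(1) that] by simp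
 have iR: "i \<in> module_hom K A R"
  using i(1) iG R.Gr_in by (auto simp: module_hom_def)
 \<comment> \<open>For each degree, a linear section of the differential from degree
   \<open>n - 1\<close> onto its image in degree \<open>n\<close>.\<close>
 have "\<exists>s. s \<in> module_hom K (R\<lparr>carrier := coboundaries R n\<rparr>) (?R (n - 1)) & (\<forall>y \<in> coboundaries R n. dif R (s y) = y)" for n
 proof -
  interpret N: vectorspace K "?R (n - 1)" by (rule vs)
  have d: "dif R \<in> module_hom K (?R (n - 1)) R" using R.dif_linear R.Gr_in by (auto simp: module_hom_def)
  interpret d: mod_hom K "?R (n - 1)" R "dif R" by (unfold_locales) (use d in "simp add: module_hom_def")
  have e: "d.im = coboundaries R n" by (simp add: d.im_def coboundaries_def)
  have "submodule K (coboundaries R n) R" using d.im_is_submodule unfolding e .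
  then have md: "module K (R\<lparr>carrier := coboundaries R n\<rparr>)"
   by (rule R.submodule_is_module)
  have "dif R \<in> module_hom K (?R (n - 1)) (R\<lparr>carrier := coboundaries R n\<rparr>)"
   using d by (auto simp: module_hom_def coboundaries_def)
  moreover have "dif R ` carrier (?R (n - 1)) = carrier (R\<lparr>carrier := coboundaries R n\<rparr>)" by (simp add: coboundaries_def)
  ultimately have "\<exists>g \<in> module_hom K (R\<lparr>carrier := coboundaries R n\<rparr>) (?R (n - 1)).
    \<forall>y \<in> carrier (R\<lparr>carrier := coboundaries R n\<rparr>). dif R (g y) = y"
   by (rule linear_section[OF vs md])
  then show ?thesis by auto
 qed
 then obtain s where s: "!!n. s n \<in> module_hom K (R\<lparr>carrier := coboundaries R n\<rparr>) (?R (n - 1))"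
  "!!n y. y \<in> coboundaries R n ==> dif R (s n y) = y" by metis
 have sG: "s n y \<in> Gr R (n - 1)" if "y \<in> coboundaries R n" for n y
  using module_hom_in[OF s(1), of y n] that by simp
 have s_add: "s n (y \<oplus>\<^sub>R z) = s n y \<oplus>\<^sub>R s n z" if "y \<in> coboundaries R n" "z \<in> coboundaries R n" for n y z
  using module_hom_add[OF s(1), of y n z] that by simp
 have s_smult: "s n (c \<odot>\<^sub>R y) = c \<odot>\<^sub>R s n y" if "c :. K" "y \<in> coboundaries R n" for n y c
  using module_hom_smult[OF s(1), of c y n] that by simp
 have s0: "s n \<zero>\<^sub>R = \<zero>\<^sub>R" for n
  using s_smult[of "\<zero>\<^sub>K" "\<zero>\<^sub>R" n] coboundaries_zero[of n] R.Gr_in[OF sG[OF coboundaries_zero]] by simp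
 have dB: "dif R x \<in> coboundaries R (n + 1)" if "x \<in> Gr R n" for n x using that by (auto simp: coboundaries_def)
 have uG: "s (n + 1) (dif R x) \<in> Gr R n" if "x \<in> Gr R n" for n x using sG[OF dB[OF that]] by simp
 have pu: "p (s (n + 1) (dif R x)) = \<zero>\<^sub>A" if "x \<in> Gr R n" for n x
 proof (cases "n = 0")
  case True
  then have "dif R x = \<zero>\<^sub>R" using R.dif_degree[OF that] nonpos[of 1] by simp
  then show ?thesis by (simp add: s0 p_zero)
 qed (rule p_Gr[OF uG[OF that]])
 \<comment> \<open>The part of \<open>x\<close> that has to be a boundary: subtracting
   \<open>s (dif R x)\<close> makes it closed, subtracting \<open>i (p x)\<close> puts it in the
   kernel of \<open>p\<close>.\<close>
 define g where "g n x = (x \<ominus>\<^sub>R s (n + 1) (dif R x)) \<ominus>\<^sub>R i (p x)" for n x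
 have ipG: "i (p x) \<in> Gr R n" if "x \<in> Gr R n" for n x
 proof (cases "n = 0")
  case False
  then have "i (p x) = \<zero>\<^sub>R" using p_Gr[OF that] module_hom_zero[OF A.module_axioms R.module_axioms iR] by simp
  then show ?thesis by (simp add: R.Gr_zero)
 qed (use that in "auto intro!: iG p R.Gr_in")
 have dip: "dif R (i a) = \<zero>\<^sub>R" if "a :. A" for a
  using R.dif_degree[OF iG[OF that]] nonpos[of 1] by simp
 have gB: "g n x \<in> coboundaries R n" if x: "x \<in> Gr R n" for n x
 proof (rule cocycle_boundary)
  note c = R.Gr_in[OF x] R.Gr_in[OF uG[OF x]] R.Gr_in[OF ipG[OF x]]
  show "g n x \<in> Gr R n" unfolding g_def R.minus_eq by (intro R.Gr_add R.Gr_neg x uG ipG)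
  show "dif R (g n x) = \<zero>\<^sub>R"
   unfolding g_def using c dip[OF p(2)[OF c(1)]]
   by (simp add: module_hom_minus[OF R.module_axioms R.module_axioms R.dif_linear] s(2)[OF dB[OF x]] R.minus_self R.dif_in)
  show "p (g n x) = \<zero>\<^sub>A"
   unfolding g_def using c pu[OF x] i(2)[OF p(2)[OF c(1)]] p(2)
   by (simp add: module_hom_minus[OF R.module_axioms A.module_axioms p(1)] A.minus_self A.minus_zero_right)
 qed
 have g_add: "g n (x \<oplus>\<^sub>R y) = g n x \<oplus>\<^sub>R g n y" if "x \<in> Gr R n" "y \<in> Gr R n" for n x y
  unfolding g_def using that R.Gr_in[OF uG[OF that(1)]] R.Gr_in[OF uG[OF that(2)]] R.Gr_in[OF ipG[OF that(1)]] R.Gr_in[OF ipG[OF that(2)]] R.Gr_in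
  by (simp add: module_hom_add[OF R.dif_linear] s_add dB p module_hom_add[OF iR] R.minus_interchange)
 have g_smult: "g n (c \<odot>\<^sub>R x) = c \<odot>\<^sub>R g n x" if "c :. K" "x \<in> Gr R n" for n x c
  unfolding g_def using that R.Gr_in[OF uG[OF that(2)]] R.Gr_in[OF ipG[OF that(2)]] R.Gr_in
  by (simp add: module_hom_smult[OF R.dif_linear] s_smult dB p module_hom_smult[OF iR] R.minus_eq R.smult_r_distr R.smult_r_minus)
 define h where "h = R.glue R (%n x. s n (g n x))"
 have hom: "(%x. s n (g n x)) \<in> module_hom K (?R n) R" for n
  by (rule module_homI) (simp_all add: g_add g_smult s_add s_smult gB R.Gr_in[OF sG])
 have hG: "h x = s n (g n x)" if "x \<in> Gr R n" for n x
  unfolding h_def by (rule R.glue_Gr[OF R.module_axioms hom that])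
 have hh: "h \<in> module_hom K R R" unfolding h_def by (rule R.glue_hom[OF R.module_axioms hom])
 have hGr: "h x \<in> Gr R (n - 1)" if "x \<in> Gr R n" for n x using hG[OF that] sG[OF gB[OF that]] by simp
 have "h (dif R x) \<oplus>\<^sub>R dif R (h x) = x \<ominus>\<^sub>R i (p x)" if "x :. R" for x
  using that
 proof (induction rule: R.homogeneous_induct)
  case (homogeneous n x)
  note c = R.Gr_in[OF homogeneous] R.Gr_in[OF uG[OF homogeneous]] R.Gr_in[OF ipG[OF homogeneous]]
  let ?u = "s (n + 1) (dif R x)"
  \<comment> \<open>On a boundary both corrections vanish, by \<open>d d = 0\<close> and
    \<open>p d = 0\<close>. So \<open>h\<close> of \<open>dif R x\<close> is \<open>?u\<close>, and
    \<open>dif R (h x)\<close> is the rest of the identity.\<close>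
  have "g (n + 1) (dif R x) = dif R x"
   unfolding g_def using c module_hom_zero[OF A.module_axioms R.module_axioms iR]
   by (simp add: R.dif_dif s0 p_dif R.dif_in R.minus_zero_right)
  then have 1: "h (dif R x) = ?u" using hG[OF R.dif_degree[OF homogeneous]] by simp
  have 2: "dif R (h x) = (x \<ominus>\<^sub>R ?u) \<ominus>\<^sub>R i (p x)"
   using hG[OF homogeneous] s(2)[OF gB[OF homogeneous]] by (simp add: g_def)
  have "?u \<oplus>\<^sub>R ((x \<ominus>\<^sub>R ?u) \<ominus>\<^sub>R i (p x)) = (?u \<oplus>\<^sub>R (x \<ominus>\<^sub>R ?u)) \<ominus>\<^sub>R i (p x)"
   using c by (simp add: R.minus_eq R.a_assoc)
  also have "?u \<oplus>\<^sub>R (x \<ominus>\<^sub>R ?u) = x" using c by (simp add: R.minus_eq R.a_lcomm R.r_neg)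
  finally show ?case unfolding 1 2 .
 next
  case (add x y)
  have e: "h (dif R (x \<oplus>\<^sub>R y)) \<oplus>\<^sub>R dif R (h (x \<oplus>\<^sub>R y)) = (h (dif R x) \<oplus>\<^sub>R dif R (h x)) \<oplus>\<^sub>R (h (dif R y) \<oplus>\<^sub>R dif R (h y))"
   using add(1,2) module_hom_in[OF hh] R.dif_in
   by (simp add: module_hom_add[OF R.dif_linear] module_hom_add[OF hh] R.a_interchange)
  show ?case unfolding e add(3,4) using add(1,2) module_hom_in[OF iR] p
   by (simp add: module_hom_add[OF iR] R.minus_interchange)
 qed
 then show thesis using iR iG i(2) hh hGr by (rule_tac that)
qed

end

section \<open>The recursive differential as an alternating sum\<close>

lemma (in abelian_monoid) finsum_lessThan_Suc_shift:
 "f \<in> {..<Suc n} \<rightarrow> carrier G ==> finsum G f {..<Suc n} = f 0 \<oplus> finsum G (%i. f (Suc i)) {..<n}"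
proof (induction n)
 case 0 then show ?case by (simp add: lessThan_Suc)
next
 case (Suc n)
 have f: "f \<in> {..<Suc n} \<rightarrow> carrier G" "(%i. f (Suc i)) \<in> {..<n} \<rightarrow> carrier G" "f 0 :. G" "f (Suc n) :. G"
  using Suc.prems by (auto simp: Pi_def)
 have "finsum G f {..<Suc (Suc n)} = f (Suc n) \<oplus> finsum G f {..<Suc n}"
  unfolding lessThan_Suc[of "Suc n"] by (rule finsum_insert) (use f in "auto simp: Pi_def")
 also have "\<dots> = f 0 \<oplus> (f (Suc n) \<oplus> finsum G (%i. f (Suc i)) {..<n})"
  unfolding Suc.IH[OF f(1)] using f finsum_closed[OF f(2)] by (simp add: a_lcomm)
 also have "f (Suc n) \<oplus> finsum G (%i. f (Suc i)) {..<n} = finsum G (%i. f (Suc i)) {..<Suc n}"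
  unfolding lessThan_Suc[of n] by (rule finsum_insert[symmetric]) (use f in "auto simp: Pi_def")
 finally show ?case .
qed

context bar_setup begin

text \<open>Slicing along the prefix \<open>u\<close> brings any position to the front, so linearity
  in the first argument of all slices is linearity in every position.\<close>

lemma mlin_iff:
 "mlin n F \<longleftrightarrow> (\<forall>w \<in> tuples A n. F w :. B) &
   (\<forall>u \<in> lists (carrier A). \<forall>v \<in> lists (carrier A). length u + length v + 1 = n -->
    (%a. F (u @ a # v)) \<in> module_hom K A B)"
proof (induction n arbitrary: F)
 case 0 then show ?case by (simp add: tuples_0)
next
 case (Suc n)
 show ?case
 proof (intro iffI conjI ballI impI)
  assume m: "mlin (Suc n) F"
  show "F w :. B" if "w \<in> tuples A (Suc n)" for w by (rule mlin_val[OF m that])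
  fix u v assume u: "u \<in> lists (carrier A)" and v: "v \<in> lists (carrier A)" and l: "length u + length v + 1 = Suc n"
  show "(%a. F (u @ a # v)) \<in> module_hom K A B"
  proof (cases u)
   case Nil then show ?thesis using mlin_hom[OF m, of v] v l by (simp add: tuples_def)
  next
   case (Cons b u')
   then have "mlin n (%w. F (b # w))" using mlin_slice[OF m, of b] u by simp
   then have "\<forall>u\<in>lists (carrier A). \<forall>v\<in>lists (carrier A). length u + length v + 1 = n -->
     (%a. F (b # u @ a # v)) \<in> module_hom K A B" by (simp add: Suc.IH)
   then show ?thesis using Cons u v l by simp
  qed
 next
  assume r: "(\<forall>w \<in> tuples A (Suc n). F w :. B) &
   (\<forall>u \<in> lists (carrier A). \<forall>v \<in> lists (carrier A). length u + length v + 1 = Suc n -->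
    (%a. F (u @ a # v)) \<in> module_hom K A B)"
  then have rv: "!!w. w \<in> tuples A (Suc n) ==> F w :. B"
   and rh: "!!u v. [|u \<in> lists (carrier A); v \<in> lists (carrier A); length u + length v + 1 = Suc n|] ==>
    (%a. F (u @ a # v)) \<in> module_hom K A B" by blast+
  show "mlin (Suc n) F" unfolding mlin.simps
  proof (intro conjI ballI)
   fix a assume a: "a :. A"
   show "mlin n (%u. F (a # u))" unfolding Suc.IH
   proof (intro conjI ballI impI)
    show "F (a # w) :. B" if "w \<in> tuples A n" for w using that a by (intro rv) (simp add: tuples_Cons)
    show "(%b. F (a # u @ b # v)) \<in> module_hom K A B"
     if "u \<in> lists (carrier A)" "v \<in> lists (carrier A)" "length u + length v + 1 = n" for u v
     using rh[of "a # u" v] that a by simp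
   qed
  next
   fix u assume "u \<in> tuples A n"
   then show "(%a. F (a # u)) \<in> module_hom K A B" using rh[of "[]" u] by (simp add: tuples_def)
  qed
 qed
qed

lemma hochschild_cochains_eq:
 "hochschild_cochains K A (bimod_via f (deg0 B)) n = {F \<in> extensional (tuples A n). mlin n F}"
 unfolding hochschild_cochains_def mlin_iff module_hom_bimod_via bimod_via_simps
 by (auto simp: PiE_def Pi_def)

text \<open>The alternating sum of \<open>hochschild_dif\<close> without its first summand, the left
  action.\<close>

definition bar_sum where
 "bar_sum n F w = (\<Oplus>i \<in> {..<n}. ksign K (int i + 1) \<odot>
    F (take i w @ [w ! i \<otimes>\<^sub>A w ! (i + 1)] @ drop (i + 2) w)) \<oplus>
   ksign K (int n + 1) \<odot> (F (take n w) \<otimes> f (w ! n))"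

lemma ksign_Suc: "ksign K (1 + n) = \<ominus>\<^sub>K \<one>\<^sub>K \<otimes>\<^sub>K ksign K n"
 using A.R.ksign_add[of 1 n] by (simp add: ksign_def)

text \<open>Splitting off the summand \<open>i = 0\<close> leaves the same sum for the slice at
  \<open>a\<close> on the shorter list with all signs reversed, which is the recursion of
  \<open>bar\<close>.\<close>

lemma bar_sum_eq: "mlin n F ==> w \<in> tuples A (Suc n) ==> bar_sum n F w = \<ominus> bar F w"
proof (induction n arbitrary: F w)
 case 0
 then obtain a where "w = [a]" "a :. A" by (elim tuples_1E)
 then show ?case using 0 f by (simp add: bar_sum_def B.neg_eq_smult) (simp add: ksign_def)
next
 case (Suc n)
 note m = Suc.prems(1)
 obtain a b u where w: "w = a # b # u" "a :. A" "b :. A" "u \<in> tuples A n" "b # u \<in> tuples A (Suc n)"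
  using Suc.prems(2) by (rule tuples_Suc2E)
 note sl = mlin_slice[OF m w(2)]
 let ?m = "\<ominus>\<^sub>K \<one>\<^sub>K"
 let ?t = "%F w i. F (take i w @ [w ! i \<otimes>\<^sub>A w ! (i + 1)] @ drop (i + 2) w)"
 let ?H = "%v. F (a # v)"
 have u: "set u <= carrier A" "length u = n" using w(4) by (auto simp: tuples_def)
 have nth: "(b # u) ! i :. A" if "i < Suc n" for i
  using that u w(3) by (cases i) (auto simp: subset_iff)
 have sub: "take i (b # u) @ [(b # u) ! i \<otimes>\<^sub>A (b # u) ! (i + 1)] @ drop (i + 2) (b # u) \<in> tuples A n" if "i < n" for i
  unfolding tuples_def using that u w(3) nth[of i] nth[of "Suc i"] set_take_subset[of i "b # u"] set_drop_subset[of "i + 2" "b # u"]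
  by (auto simp: subset_iff lists_eq_set)
 have Ht: "?t ?H (b # u) i :. B" if "i < n" for i by (rule mlin_val[OF sl sub[OF that]])
 have F0: "F ((a \<otimes>\<^sub>A b) # u) :. B" using mlin_val[OF m, of "(a \<otimes>\<^sub>A b) # u"] w by (simp add: tuples_Cons)
 have tk: "take n (b # u) \<in> tuples A n" unfolding tuples_def using u w(3) set_take_subset[of n "b # u"]
  by (auto simp: subset_iff lists_eq_set)
 have L: "?H (take n (b # u)) \<otimes> f ((b # u) ! n) :. B"
  using mlin_val[OF sl tk] f(2)[OF nth[of n]] by simp
 have shift: "?t F w (Suc i) = ?t ?H (b # u) i" if "i < n" for i using w(1) by simp
 have c: "(%i. ksign K (int i + 1) \<odot> ?t ?H (b # u) i) \<in> {..<n} \<rightarrow> carrier B"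
  using Ht A.R.ksign_in by simp
 have t0: "?t F w 0 = F ((a \<otimes>\<^sub>A b) # u)" using w(1) by simp
 have "(\<Oplus>i \<in> {..<Suc n}. ksign K (int i + 1) \<odot> ?t F w i) =
   ksign K (int 0 + 1) \<odot> ?t F w 0 \<oplus> (\<Oplus>i \<in> {..<n}. ksign K (int (Suc i) + 1) \<odot> ?t F w (Suc i))"
 proof (rule B.finsum_lessThan_Suc_shift, rule Pi_I)
  fix i assume i: "i \<in> {..<Suc n}"
  have "?t F w i :. B"
  proof (cases i)
   case 0 show ?thesis unfolding 0 t0 by (rule F0)
  next
   case (Suc j)
   then show ?thesis using Ht[of j] shift[of j] i by (simp only: lessThan_iff Suc_less_eq)
  qed
  then show "ksign K (int i + 1) \<odot> ?t F w i :. B" by (rule B.smult_closed[OF A.R.ksign_in])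
 qed
 also have "(\<Oplus>i \<in> {..<n}. ksign K (int (Suc i) + 1) \<odot> ?t F w (Suc i)) =
   (\<Oplus>i \<in> {..<n}. ?m \<odot> (ksign K (int i + 1) \<odot> ?t ?H (b # u) i))"
 proof (rule B.finsum_cong')
  fix i assume i: "i \<in> {..<n}"
  have k: "ksign K (int (Suc i) + 1) = ?m \<otimes>\<^sub>K ksign K (int i + 1)" using ksign_Suc[of "int i + 1"] by (simp add: algebra_simps)
  show "ksign K (int (Suc i) + 1) \<odot> ?t F w (Suc i) = ?m \<odot> (ksign K (int i + 1) \<odot> ?t ?H (b # u) i)"
   unfolding k shift[OF i[unfolded lessThan_iff]] by (rule B.smult_assoc1) (use i Ht A.R.ksign_in in simp_all)
 qed (use Ht A.R.ksign_in in simp_all)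
 also have "\<dots> = ?m \<odot> (\<Oplus>i \<in> {..<n}. ksign K (int i + 1) \<odot> ?t ?H (b # u) i)"
  by (rule B.finsum_smult_ldistr[symmetric]) (use c in simp_all)
 finally have S: "(\<Oplus>i \<in> {..<Suc n}. ksign K (int i + 1) \<odot> ?t F w i) =
   ?m \<odot> F ((a \<otimes>\<^sub>A b) # u) \<oplus> ?m \<odot> (\<Oplus>i \<in> {..<n}. ksign K (int i + 1) \<odot> ?t ?H (b # u) i)"
  unfolding t0 by (simp add: ksign_def)
 have k: "ksign K (int (Suc n) + 1) = ?m \<otimes>\<^sub>K ksign K (int n + 1)" using ksign_Suc[of "int n + 1"] by (simp add: algebra_simps)
 have T: "ksign K (int (Suc n) + 1) \<odot> (F (take (Suc n) w) \<otimes> f (w ! Suc n)) =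
   ?m \<odot> (ksign K (int n + 1) \<odot> (?H (take n (b # u)) \<otimes> f ((b # u) ! n)))"
  unfolding k using B.smult_assoc1[OF _ A.R.ksign_in L] w(1) by simp
 have fs: "(\<Oplus>i \<in> {..<n}. ksign K (int i + 1) \<odot> ?t ?H (b # u) i) :. B" by (rule B.finsum_closed[OF c])
 have "bar_sum (Suc n) F w = ?m \<odot> F ((a \<otimes>\<^sub>A b) # u) \<oplus> ?m \<odot> bar_sum n ?H (b # u)"
  unfolding bar_sum_def S T using F0 fs L A.R.ksign_in by (simp add: B.smult_r_distr B.a_assoc)
 also have "\<dots> = ?m \<odot> (F ((a \<otimes>\<^sub>A b) # u) \<ominus> bar ?H (b # u))"
  unfolding Suc.IH[OF sl w(5)] using F0 bar_val[OF sl w(5)] by (simp add: B.minus_eq B.smult_r_distr)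
 finally show ?case using w F0 bar_val[OF sl w(5)] by (simp add: B.neg_eq_smult)
qed

lemma hochschild_dif_eq:
 assumes m: "mlin n F"
 shows "hochschild_dif K A (bimod_via f (deg0 B)) n F = restrict (hoch F) (tuples A (Suc n))"
proof (rule extensionalityI[of _ "tuples A (Suc n)"])
 fix w assume w: "w \<in> tuples A (Suc n)"
 then obtain a u where u: "w = a # u" "a :. A" "u \<in> tuples A n" by (rule tuples_SucE)
 let ?S = "\<Oplus>i \<in> {..<n}. ksign K (int i + 1) \<odot>
    F (take i w @ [w ! i \<otimes>\<^sub>A w ! (i + 1)] @ drop (i + 2) w)"
  and ?T = "ksign K (int n + 1) \<odot> (F (take n w) \<otimes> f (w ! n))"
 have l: "length w = Suc n" "set w <= carrier A" using w by (auto simp: tuples_def)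
 then have nth: "w ! i :. A" if "i < Suc n" for i using that by (auto simp: subset_iff)
 have "take i w @ [w ! i \<otimes>\<^sub>A w ! (i + 1)] @ drop (i + 2) w \<in> tuples A n" if "i < n" for i
  unfolding tuples_def using that l nth[of i] nth[of "Suc i"] set_take_subset[of i w] set_drop_subset[of "i + 2" w]
  by (auto simp: subset_iff lists_eq_set)
 then have S: "?S :. B" using mlin_val[OF m] A.R.ksign_in by (intro B.finsum_closed) simp
 have "take n w \<in> tuples A n" unfolding tuples_def using l set_take_subset[of n w] by (auto simp: subset_iff lists_eq_set)
 then have T: "?T :. B" using mlin_val[OF m] f(2)[OF nth[of n]] A.R.ksign_in by simp
 have p: "f a \<otimes> F u :. B" using f(2)[OF u(2)] mlin_val[OF m u(3)] by simp
 have w1: "w \<in> tuples A (n + 1)" using w by simp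
 have "hochschild_dif K A (bimod_via f (deg0 B)) n F w = (f a \<otimes> F u \<oplus> ?S) \<oplus> ?T"
  unfolding hochschild_dif_def restrict_apply if_P[OF w1] bimod_via_simps finsum_bimod_via using u(1) by simp
 also have "\<dots> = f a \<otimes> F u \<oplus> bar_sum n F w" unfolding bar_sum_def by (rule B.a_assoc[OF p S T])
 also have "\<dots> = hoch F w" unfolding bar_sum_eq[OF m w] using u(1) by (simp add: hoch_Cons B.minus_eq)
 finally show "hochschild_dif K A (bimod_via f (deg0 B)) n F w = restrict (hoch F) (tuples A (Suc n)) w" using w by simp
qed (auto simp: hochschild_dif_def)

lemma hoch_minus:
 assumes "mlin n F" "mlin n G" "w \<in> tuples A (Suc n)"
 shows "hoch (%u. F u \<ominus> G u) w = hoch F w \<ominus> hoch G w"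
proof -
 let ?m = "\<ominus>\<^sub>K \<one>\<^sub>K"
 have "hoch (%u. F u \<ominus> G u) w = hoch (%u. F u \<oplus> ?m \<odot> G u) w"
  by (rule hoch_cong[OF assms(3)]) (simp add: B.minus_eq B.neg_eq_smult mlin_val[OF assms(2)])
 also have "\<dots> = hoch F w \<oplus> ?m \<odot> hoch G w"
  using assms by (simp add: hoch_add[OF assms(1) mlin_smult] hoch_smult)
 finally show ?thesis using hoch_val[OF assms(2,3)] by (simp add: B.minus_eq B.neg_eq_smult)
qed

end

subsection \<open>Exactness of the Hochschild complex of a free algebra\<close>

text \<open>A set \<open>X\<close> of homogeneous generators is fixed; the bijection says that the
  words in \<open>X\<close> form a basis of \<open>R\<close>.\<close>

locale free_bar_setup = dg_bar_setup K R B \<phi> + FA: free_algebra K X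
 for K :: "('k, 'c) ring_scheme" and R :: "('k, 'r, 'd) dg_alg_scheme" and B :: "('k, 'b) module" (structure) and \<phi>
  and X :: "'r set" +
 assumes X_Gr: "X <= (\<Union>n. Gr R n)"
  and bij: "bij_betw (lin_ext K R (%w. foldr (mult R) w \<one>\<^sub>R)) (carrier (free_alg K X)) (carrier R)"
begin

abbreviation ev where "ev w \<equiv> foldr (mult R) w \<one>\<^sub>R"
abbreviation lx where "lx \<equiv> lin_ext K R (%w. foldr (mult R) w \<one>\<^sub>R)"

text \<open>Coordinates in the basis of words.\<close>

definition expand where "expand = inv_into (carrier FA.F) lx"

lemma X_in: "x \<in> X ==> x :. R"
 using X_Gr R.Gr_in by auto

lemma ev_in: "w \<in> lists X ==> ev w :. R"
 by (induction w) (auto simp: X_in)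

lemma lx_hom: "lx \<in> module_hom K FA.F R"
 by (rule FA.lin_ext_hom[OF A.module_axioms ev_in])

lemma lx_word: "w \<in> lists X ==> lx (word K w) = ev w"
 by (rule FA.lin_ext_word[OF A.module_axioms ev_in])

lemma lx_inj: "g :. FA.F ==> g' :. FA.F ==> lx g = lx g' ==> g = g'"
 using bij by (auto simp: bij_betw_def dest: inj_onD)

lemma expand_in: "r :. R ==> expand r :. FA.F"
 unfolding expand_def by (rule inv_into_into) (use bij in "simp add: bij_betw_def")

lemma lx_expand: "r :. R ==> lx (expand r) = r"
 using bij f_inv_into_f[of r lx "carrier FA.F"] by (simp add: bij_betw_def expand_def)

lemma expand_lx: "g :. FA.F ==> expand (lx g) = g"
 using expand_in[OF module_hom_in[OF lx_hom]] lx_expand[OF module_hom_in[OF lx_hom]] lx_inj by blast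

lemma expand_hom: "expand \<in> module_hom K R FA.F"
proof (rule module_homI)
 note l = expand_in lx_expand
 show "expand (x \<oplus>\<^sub>R y) = expand x \<oplus>\<^sub>FA.F expand y" if "x :. R" "y :. R" for x y
  by (rule lx_inj) (use that in "simp_all add: l module_hom_add[OF lx_hom]")
 show "expand (c \<odot>\<^sub>R x) = c \<odot>\<^sub>FA.F expand x" if "c :. K" "x :. R" for c x
  by (rule lx_inj) (use that in "simp_all add: l module_hom_smult[OF lx_hom]")
qed (rule expand_in)

lemma word_induct [consumes 1, case_names word add smult]:
 assumes r: "r :. R" and word: "!!w. w \<in> lists X ==> P (ev w)"
  and add: "!!r s. [|r :. R; s :. R; P r; P s|] ==> P (r \<oplus>\<^sub>R s)"
  and smult: "!!c r. [|c :. K; r :. R; P r|] ==> P (c \<odot>\<^sub>R r)"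
 shows "P r"
proof -
 have "P (lx g)" if "g :. FA.F" for g
  using that
 proof (induction rule: FA.free_induct)
  case (word c w)
  then show ?case using smult[OF word(1) ev_in assms(2)] by (simp add: lx_word module_hom_smult[OF lx_hom] FA.word_in)
 next
  case zero
  show ?case using smult[of "\<zero>\<^sub>K" "ev []"] assms(2)[of "[]"]
   by (simp add: module_hom_zero[OF FA.F.module_axioms A.module_axioms lx_hom])
 next
  case (add f g) then show ?case using assms(3) module_hom_in[OF lx_hom] by (simp add: module_hom_add[OF lx_hom])
 qed
 from this[OF expand_in[OF r]] show ?thesis by (simp add: lx_expand r)
qed

lemma word_deg_ev: "w \<in> lists X ==> word_deg (Gr R) i w ==> ev w \<in> Gr R i"
proof (induction w arbitrary: i)
 case Nil then show ?case by (simp add: R.Gr_one)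
next
 case (Cons x w)
 then obtain j where "x \<in> Gr R j" "word_deg (Gr R) (i - j) w" by auto
 then show ?case using Cons R.Gr_mult[of x j "ev w" "i - j"] by simp
qed

lemma ex_word_deg: "w \<in> lists X ==> \<exists>i. word_deg (Gr R) i w"
proof (induction w)
 case (Cons x w)
 then obtain i j where "x \<in> Gr R j" "word_deg (Gr R) i w" using X_Gr by auto
 then show ?case by (intro exI[of _ "i + j"]) auto
qed simp

text \<open>Dropping all words of other degrees from an expansion realizes the projection to degree
  \<open>i\<close>, because the generators are homogeneous. For homogeneous \<open>r\<close> this
  does not change the element, so by uniqueness of coordinates nothing was dropped.\<close>

lemma expand_Gr:
 assumes r: "r \<in> Gr R i"
 shows "{w. expand r w ~= \<zero>\<^sub>K} <= {w. word_deg (Gr R) i w}"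
proof -
 let ?T = "{w. word_deg (Gr R) i w}"
 have lx0: "lx \<zero>\<^sub>FA.F = \<zero>\<^sub>R" by (rule module_hom_zero[OF FA.F.module_axioms A.module_axioms lx_hom])
 have supp0: "{w. \<zero>\<^sub>FA.F w ~= \<zero>\<^sub>K} <= ?T" by (simp add: free_alg_simps(2))
 have "\<exists>g' \<in> carrier FA.F. {w. g' w ~= \<zero>\<^sub>K} <= ?T & lx g' = hcomp R (lx g) i" if "g :. FA.F" for g
  using that
 proof (induction rule: FA.free_induct)
  case zero
  show ?case
   by (rule bexI[of _ "\<zero>\<^sub>FA.F"]) (use lx0 supp0 R.hcomp_homogeneous[OF R.Gr_zero] in simp_all)
 next
  case (word c w)
  have e: "hcomp R (lx (c \<odot>\<^sub>FA.F word K w)) i = c \<odot>\<^sub>R hcomp R (ev w) i"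
   using word by (simp add: module_hom_smult[OF lx_hom] FA.word_in lx_word R.hcomp_smult ev_in)
  obtain j where j: "word_deg (Gr R) j w" using ex_word_deg[OF word(2)] by blast
  show ?case
  proof (cases "word_deg (Gr R) i w")
   case True
   have "{v. (c \<odot>\<^sub>FA.F word K w) v ~= \<zero>\<^sub>K} <= {w}" using word(1) by (auto simp: free_alg_simps word_def)
   then show ?thesis using True word e R.hcomp_homogeneous[OF word_deg_ev[OF word(2) True]]
    by (intro bexI[of _ "c \<odot>\<^sub>FA.F word K w"]) (auto simp: module_hom_smult[OF lx_hom] FA.word_in lx_word)
  next
   case False
   then have "hcomp R (ev w) i = \<zero>\<^sub>R" using R.hcomp_homogeneous[OF word_deg_ev[OF word(2) j]] j by auto
   then show ?thesis using e word(1)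
    by (intro bexI[of _ "\<zero>\<^sub>FA.F"]) (use lx0 supp0 in simp_all)
  qed
 next
  case (add f g)
  then obtain f' g' where g: "f' :. FA.F" "{w. f' w ~= \<zero>\<^sub>K} <= ?T" "lx f' = hcomp R (lx f) i"
   "g' :. FA.F" "{w. g' w ~= \<zero>\<^sub>K} <= ?T" "lx g' = hcomp R (lx g) i" by blast
  have "{w. (f' \<oplus>\<^sub>FA.F g') w ~= \<zero>\<^sub>K} <= ?T"
  proof (rule subsetI, rule ccontr)
   fix w assume w: "w \<in> {w. (f' \<oplus>\<^sub>FA.F g') w ~= \<zero>\<^sub>K}" "w \<notin> ?T"
   then have "f' w = \<zero>\<^sub>K" "g' w = \<zero>\<^sub>K" using g(2,5) by blast+
   then show False using w(1) by (simp add: free_alg_simps)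
  qed
  then show ?case using g add(1,2) module_hom_in[OF lx_hom]
   by (intro bexI[of _ "f' \<oplus>\<^sub>FA.F g'"]) (simp_all add: module_hom_add[OF lx_hom] R.hcomp_add)
 qed
 then obtain g' where g': "g' :. FA.F" "{w. g' w ~= \<zero>\<^sub>K} <= ?T" "lx g' = hcomp R (lx (expand r)) i"
  using expand_in[OF R.Gr_in[OF r]] by blast
 then have "lx g' = r" using R.hcomp_homogeneous[OF r] by (simp add: lx_expand R.Gr_in[OF r])
 then have "g' = expand r" using expand_lx[OF g'(1)] by simp
 then show ?thesis using g'(2) by simp
qed

text \<open>Found by solving \<open>F = hoch G\<close> for \<open>G\<close> on words: if
  \<open>bar\<close> of the slice of \<open>G\<close> at a letter \<open>x\<close> vanishes, the
  equation at \<open>x # r # u\<close> reads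
  \<open>G (x r # u) = \<phi> x G (r # u) - F (x # r # u)\<close>, which is this recursion.\<close>

primrec primitive_word :: "('r list => 'b) => 'r list => 'r list => 'b" where
 "primitive_word F u [] = \<zero>"
| "primitive_word F u (x # w) = \<phi> x \<otimes> primitive_word F u w \<ominus> F (x # ev w # u)"

definition primitive0 where
 "primitive0 F u r = lin_ext K B (primitive_word F u) (expand r)"

text \<open>Cochains are not normalized, so the value of the primitive at \<open>1 # u\<close> has
  to be \<open>F (1 # 1 # u)\<close> and not 0. The added term supplies this value and satisfies the
  recursion of \<open>primitive_word\<close> without its \<open>F\<close> term.\<close>

definition primitive where
 "primitive F v = primitive0 F (tl v) (hd v) \<oplus> \<phi> (hd v) \<otimes> F (\<one>\<^sub>R # \<one>\<^sub>R # tl v)"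

lemma primitive_Cons: "primitive F (r # u) = primitive0 F u r \<oplus> \<phi> r \<otimes> F (\<one>\<^sub>R # \<one>\<^sub>R # u)"
 by (simp add: primitive_def)

context
 fixes m F assumes m: "mlin (Suc (Suc m)) F"
begin

lemma mlin_primitive_word: "w \<in> lists X ==> mlin m (%u. primitive_word F u w)"
proof (induction w)
 case (Cons x w)
 then have c: "x :. R" "ev w :. R" "w \<in> lists X" using X_in ev_in by auto
 show ?case using mlin_minus[OF mlin_lmult[OF Cons.IH[OF c(3)] f(2)[OF c(1)]] mlin_slice[OF mlin_slice[OF m c(1)] c(2)]] by simp
qed (simp add: mlin_zero)

lemma primitive_word_in: "u \<in> tuples R m ==> w \<in> lists X ==> primitive_word F u w :. B"
 by (rule mlin_val[OF mlin_primitive_word])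

lemma primitive_lin_ext_hom: "u \<in> tuples R m ==> lin_ext K B (primitive_word F u) \<in> module_hom K FA.F B"
 by (rule FA.lin_ext_hom[OF B.module_axioms primitive_word_in])

lemma primitive0_hom: "u \<in> tuples R m ==> primitive0 F u \<in> module_hom K R B"
 unfolding primitive0_def by (rule module_hom_comp[OF expand_hom primitive_lin_ext_hom])

lemma primitive0_word: "u \<in> tuples R m ==> w \<in> lists X ==> primitive0 F u (ev w) = primitive_word F u w"
 using expand_lx[OF FA.word_in] FA.lin_ext_word[OF B.module_axioms primitive_word_in]
 by (simp add: primitive0_def lx_word)

text \<open>The defining recursion, extended linearly from words to all elements
  \<open>r\<close>.\<close>

lemma primitive0_letter_mult:
 assumes u: "u \<in> tuples R m" and x: "x \<in> X" and r: "r :. R"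
 shows "primitive0 F u (x \<otimes>\<^sub>R r) = \<phi> x \<otimes> primitive0 F u r \<ominus> F (x # r # u)"
 using r
proof (induction rule: word_induct)
 case (word w)
 then show ?case using primitive0_word[OF u, of "x # w"] primitive0_word[OF u, of w] x by simp
next
 note h = primitive0_hom[OF u] and xr = X_in[OF x]
 note ms = mlin_slice[OF m xr]
 note v = module_hom_in[OF h] mlin_val[OF m] f(2)[OF xr]
 {
  case (add r s)
  have "\<phi> x \<otimes> primitive0 F u r :. B" "\<phi> x \<otimes> primitive0 F u s :. B" "F (x # r # u) :. B" "F (x # s # u) :. B"
   using v add xr u by (simp_all add: tuples_Cons)
  then show ?case using add xr u v
   by (simp add: A.r_distr module_hom_add[OF h] mlin_first_add[OF ms] B.r_distr B.minus_interchange)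
 next
  case (smult c r)
  have "\<phi> x \<otimes> primitive0 F u r :. B" "F (x # r # u) :. B"
   using v smult xr u by (simp_all add: tuples_Cons)
  then show ?case using smult xr u v
   by (simp add: A.smult_mult_right module_hom_smult[OF h] mlin_first_smult[OF ms] B.smult_mult_right B.minus_eq B.smult_r_distr B.smult_r_minus)
 }
qed

lemma mlin_primitive: "mlin (Suc m) (primitive F)"
proof (rule mlinI)
 note one = A.one_closed
 note m1 = mlin_slice[OF mlin_slice[OF m one] one]
 fix a assume a: "a :. R"
 have "mlin m (%u. lin_ext K B (primitive_word F u) g)" if "g :. FA.F" for g
  using that
 proof (induction rule: FA.free_induct)
  case zero
  show ?case by (rule mlin_cong[OF mlin_zero])
    (rule module_hom_zero[OF FA.F.module_axioms B.module_axioms primitive_lin_ext_hom])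
 next
  case (word c w)
  show ?case
  proof (rule mlin_cong[OF mlin_smult[OF mlin_primitive_word[OF word(2)] word(1)]])
   show "lin_ext K B (primitive_word F u) (c \<odot>\<^sub>FA.F word K w) = c \<odot> primitive_word F u w" if "u \<in> tuples R m" for u
    using module_hom_smult[OF primitive_lin_ext_hom[OF that] word(1) FA.word_in[OF word(2)]]
     FA.lin_ext_word[OF B.module_axioms primitive_word_in[OF that] word(2)] by simp
  qed
 next
  case (add g g')
  show ?case by (rule mlin_cong[OF mlin_add[OF add(3,4)]]) (rule module_hom_add[OF primitive_lin_ext_hom add(1,2)])
 qed
 then have "mlin m (%u. primitive0 F u a)" unfolding primitive0_def using expand_in[OF a] by blast
 then show "mlin m (%u. primitive F (a # u))" unfolding primitive_Cons by (rule mlin_add[OF _ mlin_lmult[OF m1 f(2)[OF a]]])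
next
 note one = A.one_closed
 fix u a b assume u: "u \<in> tuples R m" and a: "a :. R" "b :. R"
 note v = module_hom_in[OF primitive0_hom[OF u]] mlin_val[OF mlin_slice[OF mlin_slice[OF m one] one] u]
 show "primitive F ((a \<oplus>\<^sub>R b) # u) = primitive F (a # u) \<oplus> primitive F (b # u)"
  using a v f by (simp add: primitive_Cons module_hom_add[OF primitive0_hom[OF u]] B.l_distr B.a_interchange)
next
 note one = A.one_closed
 fix u c a assume u: "u \<in> tuples R m" and a: "c :. K" "a :. R"
 note v = module_hom_in[OF primitive0_hom[OF u]] mlin_val[OF mlin_slice[OF mlin_slice[OF m one] one] u]
 show "primitive F ((c \<odot>\<^sub>R a) # u) = c \<odot> primitive F (a # u)"
  using a v f by (simp add: primitive_Cons module_hom_smult[OF primitive0_hom[OF u]] B.smult_mult_left B.smult_r_distr)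
qed

lemma vdeg_primitive_word:
 assumes v: "vdeg (Suc (Suc m)) q F"
 shows "w \<in> lists X ==> word_deg (Gr R) i w ==> vdeg m (q + i) (%u. primitive_word F u w)"
proof (induction w arbitrary: i)
 case Nil then show ?case by (simp add: vdeg_zero)
next
 case (Cons x w)
 then obtain j where j: "x \<in> Gr R j" "word_deg (Gr R) (i - j) w" and w: "w \<in> lists X" by auto
 have "vdeg m (q + i) (%u. \<phi> x \<otimes> primitive_word F u w)"
 proof (cases "j = 0")
  case True then show ?thesis using vdeg_lmult[OF Cons.IH[OF w j(2)] f(2)[OF R.Gr_in[OF j(1)]]] by simp
 next
  case False show ?thesis by (rule vdeg_cong[OF vdeg_zero]) (simp add: \<phi>_Gr[OF j(1) False] primitive_word_in w)
 qed
 moreover have "vdeg m (q + i) (%u. F (x # ev w # u))"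
  using vdeg_slice[OF vdeg_slice[OF v j(1)] word_deg_ev[OF w j(2)]] by simp
 ultimately show ?case by (simp add: vdeg_minus)
qed

text \<open>The primitive keeps the internal degree, because a homogeneous element expands into
  words of its own degree and \<open>\<phi>\<close> kills letters of nonzero degree. Hence the rows
  are exact in each internal degree separately.\<close>

lemma vdeg_primitive:
 assumes v: "vdeg (Suc (Suc m)) q F" shows "vdeg (Suc m) q (primitive F)"
 unfolding vdeg.simps(2)[of m]
proof (intro allI ballI)
 fix i a assume a: "a \<in> Gr R i"
 have "vdeg m (q + i) (%u. lin_ext K B (primitive_word F u) g)"
  if "g :. FA.F" "{w. g w ~= \<zero>\<^sub>K} <= {w. word_deg (Gr R) i w}" for g
  using that
 proof (induction rule: FA.free_induct_on)
  case zero
  show ?case by (rule vdeg_cong[OF vdeg_zero])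
    (rule module_hom_zero[OF FA.F.module_axioms B.module_axioms primitive_lin_ext_hom])
 next
  case (word c w)
  then have d: "word_deg (Gr R) i w" by simp
  show ?case
  proof (rule vdeg_cong[OF vdeg_smult[OF vdeg_primitive_word[OF v word(2) d] word(1)]])
   show "lin_ext K B (primitive_word F u) (c \<odot>\<^sub>FA.F word K w) = c \<odot> primitive_word F u w" if "u \<in> tuples R m" for u
    using module_hom_smult[OF primitive_lin_ext_hom[OF that] word(1) FA.word_in[OF word(2)]]
     FA.lin_ext_word[OF B.module_axioms primitive_word_in[OF that] word(2)] by simp
  qed
 next
  case (add g g')
  show ?case by (rule vdeg_cong[OF vdeg_add[OF add(3,4)]]) (rule module_hom_add[OF primitive_lin_ext_hom add(1,2)])
 qed
 then have 1: "vdeg m (q + i) (%u. primitive0 F u a)"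
  unfolding primitive0_def using expand_in[OF R.Gr_in[OF a]] expand_Gr[OF a] by blast
 note one = A.one_closed
 have "vdeg m (q + i) (%u. \<phi> a \<otimes> F (\<one>\<^sub>R # \<one>\<^sub>R # u))"
 proof (cases "i = 0")
  case True
  then show ?thesis using vdeg_lmult[OF vdeg_slice[OF vdeg_slice[OF v R.Gr_one] R.Gr_one] f(2)[OF R.Gr_in[OF a]]] by simp
 next
  case False
  show ?thesis by (rule vdeg_cong[OF vdeg_zero])
    (simp add: \<phi>_Gr[OF a False] mlin_val[OF mlin_slice[OF mlin_slice[OF m one] one]])
 qed
 then show "vdeg m (q + i) (%u. primitive F (a # u))" unfolding primitive_Cons by (rule vdeg_add[OF 1])
qed

context
 assumes cocycle: "!!w. w \<in> tuples R (Suc (Suc (Suc m))) ==> hoch F w = \<zero>"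
begin

text \<open>The cocycle condition at \<open>1 # 1 # u\<close>: of the three copies of
  \<open>F (1 # u)\<close> two cancel.\<close>

lemma cocycle_one:
 assumes u: "u \<in> tuples R (Suc m)"
 shows "F (\<one>\<^sub>R # u) = bar (%v. F (\<one>\<^sub>R # \<one>\<^sub>R # v)) u"
proof -
 note one = A.one_closed
 obtain s v where s: "u = s # v" "s :. R" "v \<in> tuples R m" using u by (rule tuples_SucE)
 note m1 = mlin_slice[OF m one]
 let ?F = "F (\<one>\<^sub>R # u)" and ?b = "bar (%v. F (\<one>\<^sub>R # \<one>\<^sub>R # v)) u"
 have i: "?F :. B" "?b :. B"
  using mlin_val[OF m1 u] bar_val[OF mlin_slice[OF m1 one] u] by auto
 have "hoch F (\<one>\<^sub>R # \<one>\<^sub>R # u) = ?F \<ominus> (?F \<ominus> (?F \<ominus> ?b))"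
  using s i by (simp add: hoch_Cons f)
 then have "?F \<ominus> (?F \<ominus> (?F \<ominus> ?b)) = \<zero>"
  using cocycle[of "\<one>\<^sub>R # \<one>\<^sub>R # u"] u by (simp add: tuples_Cons)
 moreover have "?F \<ominus> (?F \<ominus> (?F \<ominus> ?b)) = ?F \<ominus> ?b"
  using i B.minus_minus_cancel[of "\<zero>" "?F \<ominus> ?b" ?F] B.minus_minus_cancel[of "?F \<ominus> ?b" ?F ?F]
  by (simp add: B.minus_eq B.minus_add B.a_ac B.r_neg B.r_neg1 B.r_neg2)
 ultimately show ?thesis using B.eq_if_minus_zero[OF i] by simp
qed

lemma primitive_one: "u \<in> tuples R m ==> primitive F (\<one>\<^sub>R # u) = F (\<one>\<^sub>R # \<one>\<^sub>R # u)"
 using primitive0_word[of u "[]"] mlin_val[OF m, of "\<one>\<^sub>R # \<one>\<^sub>R # u"] by (simp add: primitive_Cons f tuples_Cons)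

text \<open>This justifies the assumption behind \<open>primitive_word\<close>. At a letter the
  primitive is \<open>\<phi> x F (1 # 1 # v) - F (x # 1 # v)\<close>. For \<open>m = 0\<close> the
  cocycle condition at \<open>[x, 1, 1]\<close> makes it zero. Otherwise the condition at
  \<open>x # 1 # 1 # v\<close> makes it minus \<open>bar\<close> of the slice of \<open>F\<close> at
  \<open>x\<close>, \<open>1\<close>, \<open>1\<close>, and \<open>bar\<close> squares to
  zero.\<close>

lemma bar_primitive_letter:
 assumes x: "x \<in> X" and u: "u \<in> tuples R (Suc m)"
 shows "bar (%v. primitive F (x # v)) u = \<zero>"
proof -
 note one = A.one_closed and xr = X_in[OF x]
 note mx = mlin_slice[OF m xr]
 have mn: "F (x # \<one>\<^sub>R # v) :. B" "\<phi> x \<otimes> F (\<one>\<^sub>R # \<one>\<^sub>R # v) :. B" if "v \<in> tuples R m" for v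
  using mlin_val[OF m] that xr f by (simp_all add: tuples_Cons)
 have p: "primitive F (x # v) = (\<phi> x \<otimes> F (\<one>\<^sub>R # \<one>\<^sub>R # v)) \<ominus> F (x # \<one>\<^sub>R # v)" if v: "v \<in> tuples R m" for v
  using primitive0_word[OF v, of "[x]"] mn[OF v] x xr f by (simp add: primitive_Cons B.minus_eq B.a_comm)
 show ?thesis
 proof (cases m)
  case 0
  have "primitive F (x # v) = \<zero>" if v: "v \<in> tuples R m" for v
  proof -
   have "v = []" using v 0 by (simp add: tuples_0)
   let ?p = "\<phi> x \<otimes> F [\<one>\<^sub>R, \<one>\<^sub>R]" and ?q = "F [x, \<one>\<^sub>R]"
   have i: "?p :. B" "?q :. B" using mn[OF v] \<open>v = []\<close> by auto
   have "hoch F [x, \<one>\<^sub>R, \<one>\<^sub>R] = \<zero>" by (rule cocycle) (use 0 xr in "simp add: tuples_def")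
   then have "?p \<ominus> (?q \<ominus> (?q \<ominus> ?q)) = \<zero>" using xr i f by (simp add: hoch_Cons)
   then show ?thesis using p[OF v] \<open>v = []\<close> i by (simp add: B.minus_self B.minus_zero_right)
  qed
  then show ?thesis by (rule bar_zero[OF u])
 next
  case (Suc k)
  let ?H = "%v. F (x # \<one>\<^sub>R # \<one>\<^sub>R # v)"
  have "mlin (Suc (Suc k)) (%u. F (x # u))" using mx Suc by simp
  then have mH: "mlin k ?H" using one by simp
  note mbH = mlin_bar[OF mH]
  have e: "primitive F (x # v) = \<ominus> bar ?H v" if v: "v \<in> tuples R m" for v
  proof -
   obtain s v' where s: "v = s # v'" "s :. R" "v' \<in> tuples R k" using v unfolding Suc by (rule tuples_SucE)
   let ?p = "\<phi> x \<otimes> F (\<one>\<^sub>R # \<one>\<^sub>R # v)" and ?q = "F (x # \<one>\<^sub>R # v)" and ?r = "F (x # s # v')" and ?b = "bar ?H v"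
   have rr: "?r = F (x # v)" using s by simp
   have i: "?p :. B" "?q :. B" "?b :. B" using mn[OF v] mlin_val[OF mbH] v Suc by auto
   have "hoch F (x # \<one>\<^sub>R # \<one>\<^sub>R # v) = \<zero>"
    by (rule cocycle) (use v xr in "simp add: tuples_Cons")
   then have "?p \<ominus> (?q \<ominus> (?q \<ominus> (?q \<ominus> ?b))) = \<zero>" using xr s by (simp add: hoch_Cons)
   moreover have "?p \<ominus> (?q \<ominus> (?q \<ominus> (?q \<ominus> ?b))) = (?p \<ominus> ?q) \<ominus> (\<ominus> ?b)"
    using i by (simp add: B.minus_eq B.minus_add B.a_ac B.r_neg B.r_neg1 B.r_neg2)
   ultimately show ?thesis using p[OF v] B.eq_if_minus_zero[of "?p \<ominus> ?q" "\<ominus> ?b"] i by simp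
  qed
  let ?m = "\<ominus>\<^sub>K \<one>\<^sub>K"
  have "bar (%v. primitive F (x # v)) u = bar (%v. ?m \<odot> bar ?H v) u"
   by (rule bar_cong[OF u]) (use Suc in "simp add: e B.neg_eq_smult mlin_val[OF mbH]")
  also have "\<dots> = ?m \<odot> bar (bar ?H) u" using bar_smult[OF mbH, of ?m u] u Suc by simp
  also have "bar (bar ?H) u = \<zero>" by (rule bar_bar[OF mH]) (use u Suc in simp)
  finally show ?thesis by simp
 qed
qed

text \<open>The defect \<open>D\<close> of the primitive is a cocycle that vanishes when its first
  argument is a letter or the unit. The cocycle condition at \<open>x # ev c # v\<close> then
  propagates the vanishing from \<open>ev c\<close> to \<open>x\<close> times \<open>ev c\<close>,
  hence to all words, and linearity does the rest.\<close>

lemma hoch_primitive: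
 assumes w: "w \<in> tuples R (Suc (Suc m))"
 shows "F w = hoch (primitive F) w"
proof -
 note mp = mlin_primitive and one = A.one_closed
 define D where "D = (%v. F v \<ominus> hoch (primitive F) v)"
 have mD: "mlin (Suc (Suc m)) D" unfolding D_def by (rule mlin_minus[OF m mlin_hoch[OF mp]])
 have hD: "hoch D v = \<zero>" if v: "v \<in> tuples R (Suc (Suc (Suc m)))" for v
  unfolding D_def using hoch_minus[OF m mlin_hoch[OF mp] v] cocycle[OF v] hoch_hoch[OF mp v] by (simp add: B.minus_self)
 have Dx: "D (x # v) = \<zero>" if x: "x \<in> X" and v: "v \<in> tuples R (Suc m)" for x v
 proof -
  note xr = X_in[OF x]
  obtain s u where s: "v = s # u" "s :. R" "u \<in> tuples R m" using v by (rule tuples_SucE)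
  let ?g = "\<phi> x \<otimes> primitive0 F u s" and ?e = "\<phi> x \<otimes> (\<phi> s \<otimes> F (\<one>\<^sub>R # \<one>\<^sub>R # u))" and ?F = "F (x # v)"
  have i: "primitive0 F u s :. B" "F (\<one>\<^sub>R # \<one>\<^sub>R # u) :. B" "?F :. B" "\<phi> x :. B" "\<phi> s :. B"
   using module_hom_in[OF primitive0_hom[OF s(3)] s(2)] mlin_val[OF m] xr s f v by (simp_all add: tuples_Cons)
  then have i': "?g :. B" "?e :. B" by simp_all
  have 1: "\<phi> x \<otimes> primitive F v = ?g \<oplus> ?e" using i s by (simp add: primitive_Cons B.r_distr)
  have 2: "primitive F ((x \<otimes>\<^sub>R s) # u) = (?g \<ominus> ?F) \<oplus> ?e"
   using primitive0_letter_mult[OF s(3) x s(2)] i s xr by (simp add: primitive_Cons f B.m_assoc)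
  have "hoch (primitive F) (x # v) = (?g \<oplus> ?e) \<ominus> ((?g \<ominus> ?F) \<oplus> ?e)"
   using bar_primitive_letter[OF x v] 1 2 i' i s by (simp add: hoch_Cons B.minus_zero_right)
  also have "\<dots> = (?g \<ominus> (?g \<ominus> ?F)) \<oplus> (?e \<ominus> ?e)" using i i' by (simp add: B.minus_interchange)
  also have "\<dots> = ?F"
   unfolding B.minus_self[OF i'(2)] using i i' by (simp add: B.minus_eq B.minus_add B.r_neg2 B.r_neg1)
  finally show ?thesis using i by (simp add: D_def B.minus_self)
 qed
 have D1: "D (\<one>\<^sub>R # v) = \<zero>" if v: "v \<in> tuples R (Suc m)" for v
 proof -
  obtain s u where s: "v = s # u" "s :. R" "u \<in> tuples R m" using v by (rule tuples_SucE)
  have "bar (%v. primitive F (\<one>\<^sub>R # v)) v = bar (%v. F (\<one>\<^sub>R # \<one>\<^sub>R # v)) v"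
   by (rule bar_cong[OF v]) (rule primitive_one)
  then have b: "bar (%v. primitive F (\<one>\<^sub>R # v)) v = F (\<one>\<^sub>R # v)" using cocycle_one[OF v] by simp
  have i: "F (\<one>\<^sub>R # v) :. B" "primitive F v :. B" using mlin_val[OF m] mlin_val[OF mp v] v by (simp_all add: tuples_Cons)
  have "hoch (primitive F) (\<one>\<^sub>R # v) = primitive F v \<ominus> (primitive F v \<ominus> F (\<one>\<^sub>R # v))"
   using b s i by (simp add: hoch_Cons f)
  also have "\<dots> = F (\<one>\<^sub>R # v)" using i by (simp add: B.minus_eq B.minus_add B.r_neg2 B.r_neg1)
  finally show ?thesis using i by (simp add: D_def B.minus_self)
 qed
 have Dw: "D (ev c # v) = \<zero>" if c: "c \<in> lists X" and v: "v \<in> tuples R (Suc m)" for c v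
  using c
 proof (induction c)
  case Nil then show ?case using D1[OF v] by simp
 next
  case (Cons x c)
  then have x: "x \<in> X" "x :. R" "c \<in> lists X" "ev c :. R" using X_in ev_in by auto
  have v': "ev c # v \<in> tuples R (Suc (Suc m))" using x v by (simp add: tuples_Cons)
  have z: "bar (%u. D (x # u)) (ev c # v) = \<zero>" by (rule bar_zero[OF v']) (rule Dx[OF x(1)])
  have i: "D ((x \<otimes>\<^sub>R ev c) # v) :. B" using mlin_val[OF mD] x v by (simp add: tuples_Cons)
  have "hoch D (x # ev c # v) = \<zero>" by (rule hD) (use v' x in "simp add: tuples_Cons")
  then have "\<ominus> D ((x \<otimes>\<^sub>R ev c) # v) = \<zero>" using z Cons.IH x i f by (simp add: hoch_Cons B.minus_eq)
  then show ?case using B.minus_minus[OF i] by simp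
 qed
 obtain r v where r: "w = r # v" "r :. R" "v \<in> tuples R (Suc m)" using w by (rule tuples_SucE)
 from r(2) have "D (r # v) = \<zero>"
 proof (induction rule: word_induct)
  case (word c) then show ?case by (rule Dw[OF _ r(3)])
 next
  case (add a b) then show ?case using mlin_first_add[OF mD r(3)] by simp
 next
  case (smult c a) then show ?case using mlin_first_smult[OF mD r(3)] by simp
 qed
 then show ?thesis using B.eq_if_minus_zero[OF mlin_val[OF m w] mlin_val[OF mlin_hoch[OF mp] w]] by (simp add: D_def r(1))
qed

end

end

end

section \<open>Hochschild cohomology in terms of \<open>mlin\<close> and \<open>hoch\<close>\<close>

lemma vs_iso_quot_hom:
 assumes "quot_setup K M I" and f: "f \<in> module_hom K M N" and surj: "f ` carrier M = carrier N"
  and ker: "!!x y. [|x :. M; y :. M|] ==> f x = f y \<longleftrightarrow> x \<ominus>\<^sub>M y \<in> I"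
 shows "vs_iso K (quot M I) N"
proof -
 interpret quot_setup K M I by fact
 define g where "g X = f (SOME x. x :. M & X = I +>\<^sub>M x)" for X
 have g: "g (I +>\<^sub>M x) = f x" if x: "x :. M" for x
 proof -
  have "\<exists>y. y :. M & I +>\<^sub>M x = I +>\<^sub>M y" using x by blast
  then have y: "(SOME y. y :. M & I +>\<^sub>M x = I +>\<^sub>M y) :. M &
   I +>\<^sub>M x = I +>\<^sub>M (SOME y. y :. M & I +>\<^sub>M x = I +>\<^sub>M y)" by (rule someI_ex)
  show ?thesis unfolding g_def
   by (rule sym, rule iffD2[OF ker[OF x conjunct1[OF y]]], rule iffD1[OF quot_eq[OF x conjunct1[OF y]] conjunct2[OF y]])
 qed
 have "g \<in> module_hom K (quot M I) N"
 proof (rule module_homI)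
  fix X assume "X :. (quot M I)"
  then obtain x where x: "x :. M" "X = I +>\<^sub>M x" by (auto simp: quot_carrier)
  show "g X :. N" using g[OF x(1)] x module_hom_in[OF f] by simp
  fix Y assume "Y :. (quot M I)"
  then obtain y where y: "y :. M" "Y = I +>\<^sub>M y" by (auto simp: quot_carrier)
  show "g (X \<oplus>\<^bsub>quot M I\<^esub> Y) = g X \<oplus>\<^sub>N g Y" using x y by (simp add: quot_add g module_hom_add[OF f])
 next
  fix c X assume c: "c :. K" and "X :. (quot M I)"
  then obtain x where x: "x :. M" "X = I +>\<^sub>M x" by (auto simp: quot_carrier)
  show "g (c \<odot>\<^bsub>quot M I\<^esub> X) = c \<odot>\<^sub>N g X" using x c by (simp add: quot_smult g module_hom_smult[OF f])
 qed
 moreover have "inj_on g (carrier (quot M I))"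
 proof (rule inj_onI)
  fix X Y assume a: "X :. (quot M I)" "Y :. (quot M I)" "g X = g Y"
  obtain x where x: "x :. M" "X = I +>\<^sub>M x" using a(1) by (auto simp: quot_carrier)
  obtain y where y: "y :. M" "Y = I +>\<^sub>M y" using a(2) by (auto simp: quot_carrier)
  show "X = Y" using a(3) ker[OF x(1) y(1)] quot_eq[OF x(1) y(1)] x y by (simp add: g)
 qed
 moreover have "g ` carrier (quot M I) = carrier N"
  unfolding surj[symmetric] quot_carrier image_image using g by simp
 ultimately show ?thesis by (auto simp: vs_iso_def bij_betw_def)
qed

lemma vs_iso_trans: "vs_iso K L M ==> vs_iso K M N ==> vs_iso K L N"
proof -
 assume "vs_iso K L M" "vs_iso K M N"
 then obtain f g where f: "f \<in> module_hom K L M" "bij_betw f (carrier L) (carrier M)"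
  and g: "g \<in> module_hom K M N" "bij_betw g (carrier M) (carrier N)" by (auto simp: vs_iso_def)
 have "bij_betw (%x. g (f x)) (carrier L) (carrier N)" using bij_betw_trans[OF f(2) g(2)] by (simp add: comp_def)
 then show ?thesis unfolding vs_iso_def using module_hom_comp[OF f(1) g(1)] by blast
qed

context bar_setup begin

text \<open>Cochains are extensional functions on tuples, while \<open>mlin\<close> and
  \<open>hoch\<close> act on plain functions. The two views agree because \<open>hoch F\<close> on
  longer tuples depends only on the values of \<open>F\<close> on tuples of the given
  length.\<close>

lemma hochschild_quot_setup:
 "quot_setup K (fun_space (tuples A (Suc n)) B
   {F. F \<in> extensional (tuples A (Suc n)) & mlin (Suc n) F & (\<forall>w \<in> tuples A (Suc (Suc n)). hoch F w = \<zero>)})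
   ((%F. restrict (hoch F) (tuples A (Suc n))) ` {F \<in> extensional (tuples A n). mlin n F})"
 (is "quot_setup K (fun_space ?T B ?Z) ?I")
proof -
 note [simp del] = mlin.simps(2)
 have hr: "hoch (restrict F (tuples A k)) w = hoch F w" if "w \<in> tuples A (Suc k)" for F w k
  by (rule hoch_cong[OF that]) simp
 have mr: "mlin k F ==> mlin k (restrict F (tuples A k))" for k F by (erule mlin_cong) simp
 have M: "module K (fun_space ?T B ?Z)"
 proof (rule fun_space_module[OF B.module_axioms])
  show "?Z <= ?T \<rightarrow>\<^sub>E carrier B" using mlin_val by (auto simp: PiE_def simp del: mlin.simps)
  have "hoch (%w. \<zero>) w = \<zero>" if "w \<in> tuples A (Suc (Suc n))" for w
   using hoch_smult[OF mlin_zero A.R.zero_closed that] hoch_val[OF mlin_zero that] by simp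
  then show "(\<lambda>w \<in> ?T. \<zero>) \<in> ?Z" using mr[OF mlin_zero] by (simp add: hr)
  show "(\<lambda>w \<in> ?T. F w \<oplus> G w) \<in> ?Z" if "F \<in> ?Z" "G \<in> ?Z" for F G
   using that mr[OF mlin_add, of "Suc n" F G] by (simp add: hr hoch_add[of "Suc n"])
  show "(\<lambda>w \<in> ?T. c \<odot> F w) \<in> ?Z" if "c :. K" "F \<in> ?Z" for c F
   using that mr[OF mlin_smult, of "Suc n" F c] by (simp add: hr hoch_smult[of "Suc n"])
 qed
 have "submodule K ?I (fun_space ?T B ?Z)"
  unfolding submodule_def fun_space_simps
 proof (intro conjI allI impI M)
  show "?I <= ?Z" using mr[OF mlin_hoch] hoch_hoch by (auto simp: hr)
  have z: "restrict (hoch (\<lambda>w \<in> tuples A n. \<zero>)) ?T = (\<lambda>w \<in> ?T. \<zero>)"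
  proof (rule restrict_ext)
   fix w assume "w \<in> ?T"
   then show "hoch (\<lambda>w \<in> tuples A n. \<zero>) w = \<zero>"
    using hoch_smult[OF mlin_zero A.R.zero_closed, of w n] hoch_val[OF mlin_zero, of w n] by (simp add: hr)
  qed
  show "(\<lambda>w \<in> ?T. \<zero>) \<in> ?I"
   by (rule rev_image_eqI[where x = "\<lambda>w \<in> tuples A n. \<zero>"], use mr[OF mlin_zero] in simp, rule z[symmetric])
  fix F G assume "F \<in> ?I" "G \<in> ?I"
  then obtain F' G' where F: "F = restrict (hoch F') ?T" "G = restrict (hoch G') ?T" "mlin n F'" "mlin n G'" by auto
  have e: "(\<lambda>w \<in> ?T. F w \<oplus> G w) = restrict (hoch (\<lambda>w \<in> tuples A n. F' w \<oplus> G' w)) ?T"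
   by (rule restrict_ext) (simp add: F(1,2) hr hoch_add[OF F(3,4)])
  show "(\<lambda>w \<in> ?T. F w \<oplus> G w) \<in> ?I"
   by (rule rev_image_eqI[where x = "\<lambda>w \<in> tuples A n. F' w \<oplus> G' w"], use mr[OF mlin_add[OF F(3,4)]] in simp, rule e)
 next
  fix c F assume c: "c :. K" and "F \<in> ?I"
  then obtain F' where F: "F = restrict (hoch F') ?T" "mlin n F'" by auto
  have e: "(\<lambda>w \<in> ?T. c \<odot> F w) = restrict (hoch (\<lambda>w \<in> tuples A n. c \<odot> F' w)) ?T"
   by (rule restrict_ext) (simp add: F(1) hr hoch_smult[OF F(2) c])
  show "(\<lambda>w \<in> ?T. c \<odot> F w) \<in> ?I"
   by (rule rev_image_eqI[where x = "\<lambda>w \<in> tuples A n. c \<odot> F' w"], use mr[OF mlin_smult[OF F(2) c]] in simp, rule e)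
 qed
 then show ?thesis using M by (simp add: quot_setup_def quot_setup_axioms_def)
qed

lemma hochschild_cohomology_eq:
 "hochschild_cohomology K A (bimod_via f (deg0 B)) (Suc n) = quot (fun_space (tuples A (Suc n)) B
   {F. F \<in> extensional (tuples A (Suc n)) & mlin (Suc n) F & (\<forall>w \<in> tuples A (Suc (Suc n)). hoch F w = \<zero>)})
   ((%F. restrict (hoch F) (tuples A (Suc n))) ` {F \<in> extensional (tuples A n). mlin n F})"
proof -
 have 1: "{F \<in> {F \<in> extensional (tuples A (Suc n)). mlin (Suc n) F}.
   hochschild_dif K A (bimod_via f (deg0 B)) (Suc n) F = (\<lambda>w \<in> tuples A (Suc n + 1). \<zero>)} =
  {F. F \<in> extensional (tuples A (Suc n)) & mlin (Suc n) F & (\<forall>w \<in> tuples A (Suc (Suc n)). hoch F w = \<zero>)}"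
 proof -
  have "restrict (hoch F) T = (\<lambda>w \<in> T. \<zero>) \<longleftrightarrow> (\<forall>w \<in> T. hoch F w = \<zero>)" for F T
   by (auto simp: fun_eq_iff restrict_def)
  then show ?thesis by (auto simp: hochschild_dif_eq)
 qed
 have 2: "hochschild_coboundaries K A (bimod_via f (deg0 B)) (Suc n) =
   (%F. restrict (hoch F) (tuples A (Suc n))) ` {F \<in> extensional (tuples A n). mlin n F}"
  unfolding hochschild_coboundaries_def nat.case hochschild_cochains_eq
  by (rule image_cong[OF refl]) (simp add: hochschild_dif_eq)
 show ?thesis unfolding hochschild_cohomology_def fun_space_bimod_via hochschild_cochains_eq bimod_via_simps 1 2 ..
qed

end

subsection \<open>The comparison double complex\<close>

locale comparison_setup = RS: resolution_setup K A R p + FB: free_bar_setup K R B "%r. \<rho> (p r)" X + HB: bar_setup K A B \<rho>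
 for K :: "('k, 'c) ring_scheme" and A :: "('k, 'a) module" and R :: "('k, 'r, 'd) dg_alg_scheme" and p
  and B :: "('k, 'b) module" (structure) and \<rho> and X :: "'r set"
begin

sublocale DR: der_setup K R B "%r. \<rho> (p r)"
 by (rule RS.R.der_setupI[OF FB.B.assoc_algebra_axioms FB.f_hom FB.\<phi>_Gr FB.\<phi>_dif])

lemma map_p: "w \<in> tuples R n ==> map p w \<in> tuples A n"
 using RS.p(2) by (auto simp: tuples_def)

lemma mlin_pullback: "HB.mlin n y ==> FB.mlin n (%w. y (map p w))"
proof (induction n arbitrary: y)
 case (Suc n)
 show ?case
 proof (rule FB.mlinI)
  show "FB.mlin n (%u. y (map p (a # u)))" if "a :. R" for a
   using Suc.IH[OF HB.mlin_slice[OF Suc.prems RS.p(2)[OF that]]] by simp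
 qed (simp_all add: RS.p HB.mlin_first_add[OF Suc.prems map_p] HB.mlin_first_smult[OF Suc.prems map_p])
qed simp

lemma vdeg_pullback: "HB.mlin n y ==> FB.vdeg n 0 (%w. y (map p w))"
proof (induction n arbitrary: y)
 case (Suc n)
 show ?case unfolding FB.vdeg.simps
 proof (intro allI ballI)
  fix i a assume a: "a \<in> Gr R i"
  show "FB.vdeg n (0 + i) (%u. y (map p (a # u)))"
  proof (cases "i = 0")
   case True
   then show ?thesis using Suc.IH[OF HB.mlin_slice[OF Suc.prems RS.p(2)[OF RS.R.Gr_in[OF a]]]] by simp
  next
   case False
   show ?thesis by (rule FB.vdeg_cong[OF FB.vdeg_zero])
     (simp add: RS.p_Gr[OF a False] HB.mlin_first_zero[OF Suc.prems map_p])
  qed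
 qed
qed simp

text \<open>In every summand one argument is a boundary, which \<open>p\<close> sends to
  zero.\<close>

lemma dv_pullback: "HB.mlin n y ==> w \<in> tuples R n ==> FB.dv (%w. y (map p w)) w = \<zero>"
proof (induction n arbitrary: y w)
 case (Suc n)
 obtain a u where w: "w = a # u" "a :. R" "u \<in> tuples R n" using Suc.prems(2) by (rule tuples_SucE)
 have "FB.dv (%v. y (p (sgn_inv K R a) # map p v)) u = \<zero>"
  by (rule Suc.IH[OF HB.mlin_slice[OF Suc.prems(1) RS.p(2)[OF RS.R.sgn_inv_in[OF w(2)]]] w(3)])
 then show ?case using w by (simp add: RS.p_dif HB.mlin_first_zero[OF Suc.prems(1) map_p])
qed (simp add: tuples_0)

lemma bar_pullback: "w \<in> tuples R (Suc n) ==> FB.bar (%w. y (map p w)) w = HB.bar y (map p w)"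
proof (induction n arbitrary: y w)
 case 0 then show ?case by (elim FB.tuples_1E) simp
next
 case (Suc n)
 obtain a b u where w: "w = a # b # u" "a :. R" "b :. R" "b # u \<in> tuples R (Suc n)"
  using Suc.prems by (rule FB.tuples_Suc2E)
 have "FB.bar (%v. y (p a # map p v)) (b # u) = HB.bar (%v. y (p a # v)) (map p (b # u))" by (rule Suc.IH[OF w(4)])
 then show ?case using w by (simp add: RS.p)
qed

lemma hoch_pullback: "w \<in> tuples R (Suc n) ==> FB.hoch (%w. y (map p w)) w = HB.hoch y (map p w)"
proof -
 assume w: "w \<in> tuples R (Suc n)"
 then obtain a u where "w = a # u" by (rule tuples_SucE)
 then show ?thesis using bar_pullback[OF w] by (simp add: FB.hoch_Cons HB.hoch_Cons)
qed

lemma mlin_section: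
 assumes i: "i \<in> module_hom K A R"
 shows "FB.mlin n F ==> HB.mlin n (%w. F (map i w))"
proof (induction n arbitrary: F)
 case (Suc n)
 have mi: "u \<in> tuples A n ==> map i u \<in> tuples R n" for u using module_hom_in[OF i] by (auto simp: tuples_def)
 show ?case
 proof (rule HB.mlinI)
  show "HB.mlin n (%u. F (map i (a # u)))" if "a :. A" for a
   using Suc.IH[OF FB.mlin_slice[OF Suc.prems module_hom_in[OF i that]]] by simp
 qed (simp_all add: module_hom_add[OF i] module_hom_smult[OF i] module_hom_in[OF i]
   FB.mlin_first_add[OF Suc.prems mi] FB.mlin_first_smult[OF Suc.prems mi])
qed simp

text \<open>The tensor power homotopy of \<open>slotop_homotopy\<close> for the contraction of
  \<open>R\<close>: on closed cochains \<open>F\<close> differs from its composite with the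
  projection \<open>i p\<close> in all arguments by the differential of a cochain of degree one
  less.\<close>

lemma column_homotopy:
 assumes m: "FB.mlin n F" and v: "FB.vdeg n q F" and z: "\<forall>w \<in> tuples R n. FB.dv F w = \<zero>"
 shows "\<exists>i G. i \<in> module_hom K A R & (\<forall>a \<in> carrier A. i a \<in> Gr R 0) & FB.mlin n G & FB.vdeg n (q - 1) G &
   (\<forall>w \<in> tuples R n. FB.dv G w = F w \<ominus> F (map (%a. i (p a)) w))"
proof -
 obtain i h where i: "i \<in> module_hom K A R" "!!a. a :. A ==> i a \<in> Gr R 0" "!!a. a :. A ==> p (i a) = a"
  and h: "h \<in> module_hom K R R" "!!n x. x \<in> Gr R n ==> h x \<in> Gr R (n - 1)"
  and ih: "!!x. x :. R ==> h (dif R x) \<oplus>\<^sub>R dif R (h x) = x \<ominus>\<^sub>R i (p x)"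
  by (rule RS.contraction) blast
 have i0: "i \<zero>\<^sub>A = \<zero>\<^sub>R" by (rule module_hom_zero[OF RS.A.module_axioms RS.R.module_axioms i(1)])
 let ?P = "%a. i (p a)"
 have P: "?P \<in> module_hom K R R" by (rule module_hom_comp[OF RS.p(1) i(1)])
 have ps: "p (sgn_inv K R a) = p a" if "a :. R" for a
  using that
 proof (induction rule: RS.R.homogeneous_induct)
  case (homogeneous n a)
  show ?case
  proof (cases "n = 0")
   case True then show ?thesis using homogeneous RS.R.Gr_in[OF homogeneous] by (simp add: RS.R.sgn_inv_Gr_eq ksign_def)
  next
   case False then show ?thesis using RS.p_Gr[OF homogeneous] RS.p_Gr[OF RS.R.sgn_inv_Gr[OF homogeneous]] by simp
  qed
 next
  case (add a b) then show ?case by (simp add: module_hom_add[OF RS.R.sgn_inv_hom] RS.R.sgn_inv_in RS.p)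
 qed
 have sP: "sgn_inv K R (?P a) = ?P a" if "a :. R" for a
  using RS.R.sgn_inv_Gr_eq[OF i(2)[OF RS.p(2)[OF that]]] RS.R.Gr_in[OF i(2)[OF RS.p(2)[OF that]]] by (simp add: ksign_def)
 have dP: "dif R (?P a) = \<zero>\<^sub>R" if "a :. R" for a
  using RS.R.dif_degree[OF i(2)[OF RS.p(2)[OF that]]] RS.nonpos[of 1] by simp
 \<comment> \<open>The contraction lowers the degree by one, so it changes the sign of the
   involution.\<close>
 have hs: "h (sgn_inv K R a) \<oplus>\<^sub>R sgn_inv K R (h a) = \<zero>\<^sub>R" if "a :. R" for a
  using that
 proof (induction rule: RS.R.homogeneous_induct)
  case (homogeneous n a)
  note a = RS.R.Gr_in[OF homogeneous] and ha = h(2)[OF homogeneous]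
  have k: "ksign K (n - 1) = \<ominus>\<^sub>K ksign K n" by (simp add: ksign_def)
  show ?case
   using RS.R.sgn_inv_Gr_eq[OF homogeneous] RS.R.sgn_inv_Gr_eq[OF ha] a RS.R.Gr_in[OF ha] RS.A.R.ksign_in[of n]
   by (simp add: module_hom_smult[OF h(1)] k RS.R.smult_l_minus RS.R.r_neg)
 next
  case (add a b)
  have c: "h (sgn_inv K R a) :. R" "h (sgn_inv K R b) :. R" "sgn_inv K R (h a) :. R" "sgn_inv K R (h b) :. R"
   using add(1,2) module_hom_in[OF h(1)] RS.R.sgn_inv_in by simp_all
  have "h (sgn_inv K R (a \<oplus>\<^sub>R b)) \<oplus>\<^sub>R sgn_inv K R (h (a \<oplus>\<^sub>R b)) =
    (h (sgn_inv K R a) \<oplus>\<^sub>R sgn_inv K R (h a)) \<oplus>\<^sub>R (h (sgn_inv K R b) \<oplus>\<^sub>R sgn_inv K R (h b))"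
   using add(1,2) c module_hom_in[OF h(1)]
   by (simp add: module_hom_add[OF RS.R.sgn_inv_hom] module_hom_add[OF h(1)] RS.R.sgn_inv_in RS.R.a_interchange)
  then show ?case using add(3,4) by simp
 qed
 have P_Gr: "?P a \<in> Gr R k" if a: "a \<in> Gr R k" for a k
 proof (cases "k = 0")
  case True then show ?thesis using i(2)[OF RS.p(2)[OF RS.R.Gr_in[OF a]]] by simp
 next
  case False then show ?thesis using RS.p_Gr[OF a False] RS.R.Gr_zero i0 by simp
 qed
 let ?G = "FB.slotop h ?P F"
 note mG = FB.mlin_slotop[OF h(1) P m]
 show ?thesis
 proof (intro exI[of _ i] exI[of _ ?G] conjI ballI i mG)
  have "FB.vdeg n (q + (- 1)) ?G" by (rule FB.vdeg_slotop[OF _ P_Gr v]) (simp add: h(2))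
  then show "FB.vdeg n (q - 1) ?G" by simp
  fix w assume w: "w \<in> tuples R n"
  have "FB.dv ?G w \<oplus> FB.slotop h ?P (FB.dv F) w = F w \<ominus> F (map ?P w)"
   by (rule FB.slotop_homotopy[where x = "dif R" and y = "sgn_inv K R" and h = h and P = ?P,
      OF RS.R.dif_linear RS.R.sgn_inv_hom h(1) P ih hs _ sP _ dP m w])
    (simp_all add: ps RS.p_dif i0)
  moreover have "FB.slotop h ?P (FB.dv F) w = \<zero>" by (rule FB.slotop_zero[OF h(1) P w bspec[OF z]])
  ultimately show "FB.dv ?G w = F w \<ominus> F (map ?P w)" using FB.mlin_val[OF FB.mlin_dv[OF mG] w] by simp
 qed
qed

text \<open>The image of \<open>i\<close> lies in degree 0, where a cochain of positive internal
  degree vanishes; only the coboundary term remains.\<close>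

lemma column_exact_pos:
 assumes m: "FB.mlin n F" and v: "FB.vdeg n (int (Suc q)) F" and z: "!!w. w \<in> tuples R n ==> FB.dv F w = \<zero>"
 shows "\<exists>G. FB.mlin n G & FB.vdeg n (int q) G & (\<forall>w \<in> tuples R n. FB.dv G w = F w)"
proof -
 have zz: "\<forall>w \<in> tuples R n. FB.dv F w = \<zero>" using z by blast
 obtain i G where iG: "i \<in> module_hom K A R & (\<forall>a \<in> carrier A. i a \<in> Gr R 0) & FB.mlin n G & FB.vdeg n (int (Suc q) - 1) G &
   (\<forall>w \<in> tuples R n. FB.dv G w = F w \<ominus> F (map (%a. i (p a)) w))"
  using column_homotopy[OF m v zz] by (elim exE)
 note i = conjunct1[OF iG] bspec[OF conjunct1[OF conjunct2[OF iG]]]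
 have G: "FB.mlin n G" "FB.vdeg n (int (Suc q) - 1) G" "!!w. w \<in> tuples R n ==> FB.dv G w = F w \<ominus> F (map (%a. i (p a)) w)"
  using iG by simp_all
 have "FB.dv G w = F w" if w: "w \<in> tuples R n" for w
 proof -
  have "F (map (%a. i (p a)) w) = \<zero>"
   by (rule FB.vdeg_Gr_zero[OF v]) (use w i(2) RS.p(2) in "auto simp: tuples_def")
  then show ?thesis using G(3)[OF w] FB.mlin_val[OF m w] by (simp add: FB.B.minus_zero_right)
 qed
 then show ?thesis using G(1,2) by (intro exI[of _ G]) simp
qed

text \<open>For internal degree 0 the cochain \<open>G\<close> has degree -1 and vanishes, so
  \<open>F\<close> equals its composite with \<open>i p\<close> and factors through \<open>p\<close>
  by the cochain \<open>F\<close> after \<open>i\<close>.\<close>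

lemma column_kernel:
 assumes m: "FB.mlin n F" and v: "FB.vdeg n 0 F" and z: "!!w. w \<in> tuples R n ==> FB.dv F w = \<zero>"
 shows "\<exists>y \<in> extensional (tuples A n). HB.mlin n y & (\<forall>w \<in> tuples R n. F w = y (map p w))"
proof -
 have zz: "\<forall>w \<in> tuples R n. FB.dv F w = \<zero>" using z by blast
 obtain i G where iG: "i \<in> module_hom K A R & (\<forall>a \<in> carrier A. i a \<in> Gr R 0) & FB.mlin n G & FB.vdeg n (0 - 1) G &
   (\<forall>w \<in> tuples R n. FB.dv G w = F w \<ominus> F (map (%a. i (p a)) w))"
  using column_homotopy[OF m v zz] by (elim exE)
 note i = conjunct1[OF iG] bspec[OF conjunct1[OF conjunct2[OF iG]]]
 have G: "FB.mlin n G" "FB.vdeg n (0 - 1) G" "!!w. w \<in> tuples R n ==> FB.dv G w = F w \<ominus> F (map (%a. i (p a)) w)"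
  using iG by simp_all
 let ?P = "%a. i (p a)" and ?y = "restrict (%w. F (map i w)) (tuples A n)"
 have G0: "G w = \<zero>" if "w \<in> tuples R n" for w using FB.vdeg_neg_zero[OF G(1,2) _ that] by simp
 have "F w = ?y (map p w)" if w: "w \<in> tuples R n" for w
 proof -
  have "FB.dv G w = \<zero>" by (rule FB.slotop_zero[OF RS.R.dif_linear RS.R.sgn_inv_hom w G0])
  then have "F w \<ominus> F (map ?P w) = \<zero>" using G(3)[OF w] by simp
  moreover have "map ?P w \<in> tuples R n" using w RS.p(2) module_hom_in[OF i(1)] by (auto simp: tuples_def)
  ultimately have "F w = F (map ?P w)" using FB.B.eq_if_minus_zero[OF FB.mlin_val[OF m w] FB.mlin_val[OF m]] by simp
  then show ?thesis using map_p[OF w] by (simp add: comp_def)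
 qed
 moreover have "HB.mlin n ?y" by (rule HB.mlin_cong[OF mlin_section[OF i(1) m]]) simp
 ultimately show ?thesis by (intro bexI[of _ ?y]) auto
qed

lemma map_p_surj: "w \<in> tuples A n ==> \<exists>w' \<in> tuples R n. map p w' = w"
proof (induction n arbitrary: w)
 case (Suc n)
 obtain a u where w: "w = a # u" "a :. A" "u \<in> tuples A n" using Suc.prems by (rule tuples_SucE)
 obtain r where "r \<in> Gr R 0" "p r = a" using RS.p_surj[OF w(2)] by blast
 moreover obtain u' where "u' \<in> tuples R n" "map p u' = u" using Suc.IH[OF w(3)] by blast
 ultimately show ?case using w(1) RS.R.Gr_in by (intro bexI[of _ "r # u'"]) (auto simp: tuples_Cons)
qed (simp add: tuples_0)

text \<open>The first index is one less than the number of arguments, so column 0 consists of linear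
  maps on \<open>R\<close>. Constants are omitted, so the kernel of the row differential there is
  the space of all derivations, inner ones included.\<close>

definition cc where "cc n q = {F \<in> extensional (tuples R (Suc n)). FB.mlin (Suc n) F & FB.vdeg (Suc n) (int q) F}"
definition M where "M n q = fun_space (tuples R (Suc n)) B (cc n q)"
definition bb where "bb n (q::nat) F = restrict (FB.hoch F) (tuples R (Suc (Suc n)))"
definition dd where "dd n (q::nat) F = restrict (FB.dv F) (tuples R (Suc n))"

lemma cc_restrict: "FB.mlin (Suc n) F ==> FB.vdeg (Suc n) (int q) F ==> restrict F (tuples R (Suc n)) \<in> cc n q"
 unfolding cc_def using FB.mlin_cong[of "Suc n" F "restrict F (tuples R (Suc n))"]
  FB.vdeg_cong[of "Suc n" "int q" F "restrict F (tuples R (Suc n))"] by simp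

lemma hoch_restrict: "w \<in> tuples R (Suc n) ==> FB.hoch (restrict F (tuples R n)) w = FB.hoch F w"
 by (erule FB.hoch_cong) simp

lemma dv_restrict: "w \<in> tuples R n ==> FB.dv (restrict F (tuples R n)) w = FB.dv F w"
 by (erule FB.slotop_cong[OF RS.R.dif_linear RS.R.sgn_inv_hom]) simp

lemma bb_zero_iff: "bb n q F = \<zero>\<^bsub>M (Suc n) q\<^esub> \<longleftrightarrow> (\<forall>w \<in> tuples R (Suc (Suc n)). FB.hoch F w = \<zero>)"
 by (auto simp: bb_def M_def fun_space_simps fun_eq_iff restrict_def)

lemma dd_zero_iff: "dd n q F = \<zero>\<^bsub>M n q'\<^esub> \<longleftrightarrow> (\<forall>w \<in> tuples R (Suc n). FB.dv F w = \<zero>)"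
 by (auto simp: dd_def M_def fun_space_simps fun_eq_iff restrict_def)

lemma cc_eqI: "F \<in> cc n q ==> (!!w. w \<in> tuples R (Suc n) ==> F w = G w) ==> restrict G (tuples R (Suc n)) = F"
 by (rule extensionalityI[of _ "tuples R (Suc n)"]) (auto simp: cc_def)

text \<open>Row exactness comes from \<open>primitive\<close>, column exactness from
  \<open>column_exact_pos\<close>. Restricting cochains to tuples of their own length does not
  affect \<open>hoch\<close> or \<open>dv\<close>, which evaluate them only there.\<close>

lemma double: "double_complex K M bb dd"
proof (rule double_complex.intro)
 note [simp del] = FB.mlin.simps(2) FB.vdeg.simps(2)
 note s = M_def fun_space_simps
 show "module K (M n q)" for n q
  unfolding M_def
 proof (rule fun_space_module[OF FB.B.module_axioms])
  show "cc n q <= tuples R (Suc n) \<rightarrow>\<^sub>E carrier B" using FB.mlin_val by (auto simp: cc_def PiE_def)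
  show "(\<lambda>w \<in> tuples R (Suc n). \<zero>) \<in> cc n q" by (rule cc_restrict[OF FB.mlin_zero FB.vdeg_zero])
  show "(\<lambda>w \<in> tuples R (Suc n). F w \<oplus> G w) \<in> cc n q" if "F \<in> cc n q" "G \<in> cc n q" for F G
   by (rule cc_restrict[OF FB.mlin_add FB.vdeg_add]) (use that in "simp_all add: cc_def")
  show "(\<lambda>w \<in> tuples R (Suc n). c \<odot> F w) \<in> cc n q" if "c :. K" "F \<in> cc n q" for c F
   by (rule cc_restrict[OF FB.mlin_smult FB.vdeg_smult]) (use that in "simp_all add: cc_def")
 qed
 show "bb n q \<in> module_hom K (M n q) (M (Suc n) q)" for n q
 proof (rule module_homI)
  show "bb n q F :. (M (Suc n) q)" if F: "F :. (M n q)" for F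
  proof -
   have m: "FB.mlin (Suc n) F" "FB.vdeg (Suc n) (int q) F" using F by (simp_all add: s cc_def)
   show ?thesis unfolding s bb_def by (rule cc_restrict[OF FB.mlin_hoch[OF m(1)] FB.vdeg_hoch[OF m]])
  qed
  show "bb n q (F \<oplus>\<^bsub>M n q\<^esub> G) = bb n q F \<oplus>\<^bsub>M (Suc n) q\<^esub> bb n q G" if "F :. (M n q)" "G :. (M n q)" for F G
   unfolding s bb_def by (rule restrict_ext) (use that in \<open>simp add: hoch_restrict FB.hoch_add[of "Suc n"] s cc_def\<close>)
  show "bb n q (c \<odot>\<^bsub>M n q\<^esub> F) = c \<odot>\<^bsub>M (Suc n) q\<^esub> bb n q F" if "c :. K" "F :. (M n q)" for c F
   unfolding s bb_def by (rule restrict_ext) (use that in \<open>simp add: hoch_restrict FB.hoch_smult[of "Suc n"] s cc_def\<close>)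
 qed
 show "dd n q \<in> module_hom K (M n q) (M n (Suc q))" for n q
 proof (rule module_homI)
  show "dd n q F :. (M n (Suc q))" if "F :. (M n q)" for F
  proof -
   have "FB.mlin (Suc n) F" "FB.vdeg (Suc n) (int q) F" using that by (simp_all add: s cc_def)
   moreover from FB.vdeg_dv[OF this(2)] have "FB.vdeg (Suc n) (int (Suc q)) (FB.dv F)" by (simp add: algebra_simps)
   ultimately show ?thesis unfolding s dd_def by (intro cc_restrict FB.mlin_dv)
  qed
  note a = FB.slotop_add[OF RS.R.dif_linear RS.R.sgn_inv_hom, of "Suc n"] FB.slotop_smult[OF RS.R.dif_linear RS.R.sgn_inv_hom, of "Suc n"]
  show "dd n q (F \<oplus>\<^bsub>M n q\<^esub> G) = dd n q F \<oplus>\<^bsub>M n (Suc q)\<^esub> dd n q G" if "F :. (M n q)" "G :. (M n q)" for F G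
   unfolding s dd_def by (rule restrict_ext) (use that in "simp add: dv_restrict a s cc_def")
  show "dd n q (c \<odot>\<^bsub>M n q\<^esub> F) = c \<odot>\<^bsub>M n (Suc q)\<^esub> dd n q F" if "c :. K" "F :. (M n q)" for c F
   unfolding s dd_def by (rule restrict_ext) (use that in "simp add: dv_restrict a s cc_def")
 qed
 show "bb (Suc n) q (bb n q F) = \<zero>\<^bsub>M (Suc (Suc n)) q\<^esub>" if "F :. (M n q)" for n q F
  unfolding bb_zero_iff unfolding bb_def using that FB.hoch_hoch[of "Suc n" F] by (simp add: s cc_def hoch_restrict)
 show "dd n (Suc q) (dd n q F) = \<zero>\<^bsub>M n (Suc (Suc q))\<^esub>" if "F :. (M n q)" for n q F
  unfolding dd_zero_iff unfolding dd_def using that FB.dv_dv[of "Suc n" F] by (simp add: s cc_def dv_restrict)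
 show "bb n (Suc q) (dd n q F) = dd (Suc n) q (bb n q F)" if "F :. (M n q)" for n q F
  unfolding bb_def dd_def
  by (rule restrict_ext) (use that FB.dv_hoch[of "Suc n" F] in "simp add: s cc_def dv_restrict hoch_restrict")
 show "\<exists>c \<in> carrier (M n q). bb n q c = F"
  if F: "F :. (M (Suc n) q)" and z: "bb (Suc n) q F = \<zero>\<^bsub>M (Suc (Suc n)) q\<^esub>" for n q F
 proof -
  have c: "F \<in> cc (Suc n) q" using F by (simp add: s)
  then have m: "FB.mlin (Suc (Suc n)) F" "FB.vdeg (Suc (Suc n)) (int q) F" by (simp_all add: cc_def)
  have z': "!!w. w \<in> tuples R (Suc (Suc (Suc n))) ==> FB.hoch F w = \<zero>" using z unfolding bb_zero_iff by blast
  let ?G = "restrict (FB.primitive F) (tuples R (Suc n))"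
  have "?G :. (M n q)"
   unfolding s by (rule cc_restrict[OF FB.mlin_primitive[OF m(1)] FB.vdeg_primitive[OF m]])
  moreover have "bb n q ?G = F"
  proof -
   have "bb n q ?G = restrict (FB.hoch (FB.primitive F)) (tuples R (Suc (Suc n)))"
    unfolding bb_def by (rule restrict_ext) (rule hoch_restrict)
   then show ?thesis using cc_eqI[OF c FB.hoch_primitive[OF m(1) z']] by simp
  qed
  ultimately show ?thesis by blast
 qed
 show "\<exists>c \<in> carrier (M n q). dd n q c = F"
  if F: "F :. (M n (Suc q))" and z: "dd n (Suc q) F = \<zero>\<^bsub>M n (Suc (Suc q))\<^esub>" for n q F
 proof -
  have c: "F \<in> cc n (Suc q)" using F by (simp add: s)
  then have m: "FB.mlin (Suc n) F" "FB.vdeg (Suc n) (int (Suc q)) F" by (simp_all add: cc_def)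
  have z': "!!w. w \<in> tuples R (Suc n) ==> FB.dv F w = \<zero>" using z unfolding dd_zero_iff by blast
  obtain G where G: "FB.mlin (Suc n) G" "FB.vdeg (Suc n) (int q) G" "!!w. w \<in> tuples R (Suc n) ==> F w = FB.dv G w"
   using column_exact_pos[OF m z'] by metis
  let ?G = "restrict G (tuples R (Suc n))"
  have "?G :. (M n q)" unfolding s by (rule cc_restrict[OF G(1,2)])
  moreover have "dd n q ?G = F"
  proof -
   have "dd n q ?G = restrict (FB.dv G) (tuples R (Suc n))"
    unfolding dd_def by (rule restrict_ext) (rule dv_restrict)
   then show ?thesis using cc_eqI[OF c G(3)] by simp
  qed
  ultimately show ?thesis by blast
 qed
qed

end

section \<open>The two edges and their comparison\<close>

context comparison_setup begin

sublocale DC: double_complex K M bb dd by (rule double)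

definition edge_der where "edge_der \<delta> = restrict (%w. \<delta> (hd w)) (tuples R (Suc 0))"
definition edge_hoch where "edge_hoch n y = restrict (%w. y (map p w)) (tuples R (Suc n))"

lemma M_carrier: "carrier (M n q) = cc n q"
 by (simp add: M_def fun_space_simps)

lemma edge_der_in:
 assumes d: "DR.der (int q) \<delta>" shows "edge_der \<delta> \<in> cc 0 q"
 unfolding edge_der_def
proof (rule cc_restrict)
 show "FB.mlin (Suc 0) (%w. \<delta> (hd w))" using DR.derD(1,4)[OF d] by (simp add: tuples_0)
 show "FB.vdeg (Suc 0) (int q) (%w. \<delta> (hd w))" using DR.derD(2)[OF d] by auto
qed

text \<open>For one argument the Hochschild cocycle condition is the Leibniz rule without signs, and
  \<open>edge_der_surj\<close> reads it in the other direction.\<close>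

lemma edge_der_bb:
 assumes d: "DR.der (int q) \<delta>" shows "bb 0 q (edge_der \<delta>) = \<zero>\<^bsub>M (Suc 0) q\<^esub>"
 unfolding bb_zero_iff
proof
 fix w assume w: "w \<in> tuples R (Suc (Suc 0))"
 then obtain a b where ab: "w = [a, b]" "a :. R" "b :. R" by (elim FB.tuples_Suc2E) (simp add: tuples_0)
 let ?x = "\<delta> a \<otimes> \<rho> (p b)" and ?y = "\<rho> (p a) \<otimes> \<delta> b"
 have c: "?x :. B" "?y :. B" using ab DR.derD(4)[OF d] FB.f(2) by simp_all
 have "FB.hoch (edge_der \<delta>) w = ?y \<ominus> ((?x \<oplus> ?y) \<ominus> ?x)"
  unfolding edge_der_def hoch_restrict[OF w] using ab DR.derD(3)[OF d ab(2,3)] by (simp add: FB.hoch_Cons)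
 also have "(?x \<oplus> ?y) \<ominus> ?x = ?y" using c by (simp add: FB.B.a_comm[of ?x ?y] FB.B.minus_eq FB.B.a_assoc FB.B.r_neg)
 finally show "FB.hoch (edge_der \<delta>) w = \<zero>" using c by (simp add: FB.B.minus_self)
qed

lemma edge_der_dd:
 assumes d: "DR.der (int q) \<delta>" shows "dd 0 q (edge_der \<delta>) = edge_der (%x. \<delta> (dif R x))"
 unfolding dd_def edge_der_def
proof (rule restrict_ext)
 fix w assume w: "w \<in> tuples R (Suc 0)"
 then obtain a where a: "w = [a]" "a :. R" by (rule FB.tuples_1E)
 show "FB.dv (restrict (%w. \<delta> (hd w)) (tuples R (Suc 0))) w = \<delta> (dif R (hd w))"
  unfolding dv_restrict[OF w] using a DR.derD(4)[OF d RS.R.dif_in[OF a(2)]] by simp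
qed

lemma edge_der_surj:
 assumes F: "F \<in> cc 0 q" and z: "bb 0 q F = \<zero>\<^bsub>M (Suc 0) q\<^esub>"
 shows "\<exists>\<delta>. DR.der (int q) \<delta> & \<delta> \<in> extensional (carrier R) & edge_der \<delta> = F"
proof -
 let ?d = "%a. F [a]"
 have m: "FB.mlin (Suc 0) F" "FB.vdeg (Suc 0) (int q) F" using F by (simp_all add: cc_def)
 have h: "?d \<in> module_hom K R B" using FB.mlin_hom[OF m(1), of "[]"] by (simp add: tuples_0)
 have "DR.der (int q) ?d"
 proof (rule DR.der_homogeneousI[OF h])
  show "F [x] = \<zero>" if "x \<in> Gr R n" "n ~= - int q" for n x
   using FB.vdeg_slice[OF m(2) that(1)] that(2) by simp
  fix n x y assume x: "x \<in> Gr R n" and y: "y :. R"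
  note xr = RS.R.Gr_in[OF x]
  let ?X = "\<rho> (p x) \<otimes> F [y]" and ?Y = "F [x \<otimes>\<^sub>R y]" and ?Z = "F [x] \<otimes> \<rho> (p y)"
  have c: "?X :. B" "?Y :. B" "?Z :. B"
   using module_hom_in[OF h] xr y FB.f(2) by simp_all
  have "FB.hoch F [x, y] = \<zero>" using z xr y unfolding bb_zero_iff by (simp add: tuples_def)
  then have "?X \<ominus> (?Y \<ominus> ?Z) = \<zero>" by (simp add: FB.hoch_Cons)
  then have X: "?X = ?Y \<ominus> ?Z" using FB.B.eq_if_minus_zero[of ?X "?Y \<ominus> ?Z"] c by simp
  show "?Y = ?Z \<oplus> ?X" unfolding X
   using c by (simp add: FB.B.minus_eq FB.B.a_comm[of ?Z] FB.B.a_assoc FB.B.l_neg)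
 qed
 then have "DR.der (int q) (restrict ?d (carrier R))" by (rule DR.der_cong) simp
 moreover have "edge_der (restrict ?d (carrier R)) = F"
  unfolding edge_der_def by (rule cc_eqI[OF F]) (elim FB.tuples_1E, simp)
 ultimately show ?thesis by (intro exI[of _ "restrict ?d (carrier R)"]) simp
qed

lemma edge_der_inj:
 assumes "edge_der \<delta> = edge_der \<eta>" "a :. R" shows "\<delta> a = \<eta> a"
 using fun_cong[OF assms(1), of "[a]"] assms(2) by (simp add: edge_der_def tuples_Cons tuples_0)

lemma edge_hoch_in: "HB.mlin (Suc n) y ==> edge_hoch n y \<in> cc n 0"
 unfolding edge_hoch_def by (rule cc_restrict[OF mlin_pullback], assumption) (simp only: of_nat_0 vdeg_pullback)

lemma edge_hoch_dd: "HB.mlin (Suc n) y ==> dd n 0 (edge_hoch n y) = \<zero>\<^bsub>M n (Suc 0)\<^esub>"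
 unfolding dd_zero_iff edge_hoch_def by (auto simp: dv_restrict dv_pullback simp del: FB.slotop.simps HB.mlin.simps)

lemma edge_hoch_bb: "bb n 0 (edge_hoch n y) = edge_hoch (Suc n) (HB.hoch y)"
 unfolding bb_def edge_hoch_def by (rule restrict_ext) (simp add: hoch_restrict hoch_pullback)

lemma edge_hoch_restrict: "edge_hoch n (restrict y (tuples A (Suc n))) = edge_hoch n y"
 unfolding edge_hoch_def by (rule restrict_ext) (simp add: map_p)

text \<open>Every tuple over \<open>A\<close> lifts to \<open>R\<close> because \<open>p\<close> is
  onto.\<close>

lemma edge_hoch_inj:
 assumes "edge_hoch n y = edge_hoch n y'" "w \<in> tuples A (Suc n)" shows "y w = y' w"
proof -
 obtain v where "v \<in> tuples R (Suc n)" "map p v = w" using map_p_surj[OF assms(2)] by blast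
 then show ?thesis using fun_cong[OF assms(1), of v] by (simp add: edge_hoch_def)
qed

lemma edge_hoch_surj:
 assumes F: "F \<in> cc n 0" and z: "dd n 0 F = \<zero>\<^bsub>M n (Suc 0)\<^esub>"
 shows "\<exists>y \<in> extensional (tuples A (Suc n)). HB.mlin (Suc n) y & edge_hoch n y = F"
proof -
 have m: "FB.mlin (Suc n) F" "FB.vdeg (Suc n) 0 F" using F unfolding cc_def by (simp_all only: mem_Collect_eq of_nat_0)
 have z': "!!w. w \<in> tuples R (Suc n) ==> FB.dv F w = \<zero>" using z unfolding dd_zero_iff by blast
 obtain y where y: "y \<in> extensional (tuples A (Suc n))" "HB.mlin (Suc n) y" "!!w. w \<in> tuples R (Suc n) ==> F w = y (map p w)"
  using column_kernel[OF m z'] by blast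
 have "edge_hoch n y = F" unfolding edge_hoch_def by (rule cc_eqI[OF F y(3)])
 then show ?thesis using y(1,2) by blast
qed

lemma edge_hoch_bb_zero:
 "bb n 0 (edge_hoch n y) = \<zero>\<^bsub>M (Suc n) 0\<^esub> \<longleftrightarrow> (\<forall>w \<in> tuples A (Suc (Suc n)). HB.hoch y w = \<zero>)"
proof -
 have z: "\<zero>\<^bsub>M (Suc n) 0\<^esub> = edge_hoch (Suc n) (%w. \<zero>)" by (simp add: M_def fun_space_simps edge_hoch_def)
 show ?thesis unfolding edge_hoch_bb z
 proof
  assume "edge_hoch (Suc n) (HB.hoch y) = edge_hoch (Suc n) (%w. \<zero>)"
  then show "\<forall>w \<in> tuples A (Suc (Suc n)). HB.hoch y w = \<zero>" using edge_hoch_inj by blast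
 next
  assume "\<forall>w \<in> tuples A (Suc (Suc n)). HB.hoch y w = \<zero>"
  then show "edge_hoch (Suc n) (HB.hoch y) = edge_hoch (Suc n) (%w. \<zero>)"
   unfolding edge_hoch_def by (intro restrict_ext) (simp only: map_p)
 qed
qed

text \<open>Derivations of degree \<open>q + 1\<close> sit at position \<open>0\<close>,
  \<open>q + 1\<close>. The staircase of \<open>q + 1\<close> steps ends at position
  \<open>q + 1\<close>, \<open>0\<close>, where a cochain pulled back from \<open>A\<close> has
  \<open>q + 2\<close> arguments.\<close>

lemma der_cohomology_iso_hochschild:
 "vs_iso K (dg_der_cohomology K R (bimod_via (%r. \<rho> (p r)) (deg0 B)) (int (Suc q)))
  (hochschild_cohomology K A (bimod_via \<rho> (deg0 B)) (Suc (Suc q)))"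
 unfolding DR.cohomology_eq HB.hochschild_cohomology_eq
proof (rule vs_iso_quotI[OF DR.cohomology_quot_setup HB.hochschild_quot_setup,
  where Z = "%\<delta> y. DC.zigzag (Suc q) 0 (edge_der \<delta>) (edge_hoch (Suc q) y)"], unfold fun_space_simps)
 note [simp del] = HB.mlin.simps(2) FB.mlin.simps(2) DC.zigzag.simps(2)
 let ?m = "Suc q"
 let ?Z = "{F. F \<in> extensional (tuples A (Suc ?m)) & HB.mlin (Suc ?m) F & (\<forall>w \<in> tuples A (Suc (Suc ?m)). HB.hoch F w = \<zero>)}"
 let ?I = "(%F. restrict (HB.hoch F) (tuples A (Suc ?m))) ` {F \<in> extensional (tuples A ?m). HB.mlin ?m F}"
 have ed: "edge_der \<delta> :. (M 0 ?m)" "bb 0 ?m (edge_der \<delta>) = \<zero>\<^bsub>M (Suc 0) ?m\<^esub>" "dd 0 ?m (edge_der \<delta>) = \<zero>\<^bsub>M 0 (Suc ?m)\<^esub>"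
  if "\<delta> \<in> DR.Zc (int ?m)" for \<delta>
 proof -
  have d: "DR.der (int ?m) \<delta>" "!!x. x :. R ==> \<delta> (dif R x) = \<zero>" using that by (simp_all add: DR.Zc_def)
  show "edge_der \<delta> :. (M 0 ?m)" unfolding M_carrier by (rule edge_der_in[OF d(1)])
  show "bb 0 ?m (edge_der \<delta>) = \<zero>\<^bsub>M (Suc 0) ?m\<^esub>" by (rule edge_der_bb[OF d(1)])
  show "dd 0 ?m (edge_der \<delta>) = \<zero>\<^bsub>M 0 (Suc ?m)\<^esub>"
   unfolding edge_der_dd[OF d(1)] unfolding M_def fun_space_simps edge_der_def
   by (rule restrict_ext) (elim FB.tuples_1E, simp add: d(2))
 qed
 have eh: "edge_hoch ?m y :. (M ?m 0)" "bb ?m 0 (edge_hoch ?m y) = \<zero>\<^bsub>M (Suc ?m) 0\<^esub>" "dd ?m 0 (edge_hoch ?m y) = \<zero>\<^bsub>M ?m (Suc 0)\<^esub>"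
  if "y \<in> ?Z" for y
  unfolding M_carrier edge_hoch_bb_zero using that by (simp_all add: edge_hoch_in edge_hoch_dd)
 show "\<exists>y \<in> ?Z. DC.zigzag ?m 0 (edge_der \<delta>) (edge_hoch ?m y)" if d: "\<delta> \<in> DR.Zc (int ?m)" for \<delta>
 proof -
  obtain F where F: "F :. (M ?m 0)" "DC.zigzag ?m 0 (edge_der \<delta>) F"
   "dd ?m 0 F = \<zero>\<^bsub>M ?m (Suc 0)\<^esub>" "bb ?m 0 F = \<zero>\<^bsub>M (Suc ?m) 0\<^esub>"
   using DC.zigzag_total[OF ed(1)[OF d] ed(3)[OF d] ed(2)[OF d]] unfolding add_0 by blast
  obtain y where y: "y \<in> extensional (tuples A (Suc ?m))" "HB.mlin (Suc ?m) y" "edge_hoch ?m y = F"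
   using edge_hoch_surj[OF F(1)[unfolded M_carrier] F(3)] by blast
  have "y \<in> ?Z" using y F(4) edge_hoch_bb_zero[of ?m y] by simp
  then show ?thesis using F(2) y(3) by blast
 qed
 show "\<exists>\<delta> \<in> DR.Zc (int ?m). DC.zigzag ?m 0 (edge_der \<delta>) (edge_hoch ?m y)" if y: "y \<in> ?Z" for y
 proof -
  obtain u where u: "u :. (M 0 ?m)" "DC.zigzag ?m 0 u (edge_hoch ?m y)"
   "dd 0 ?m u = \<zero>\<^bsub>M 0 (Suc ?m)\<^esub>" "bb 0 ?m u = \<zero>\<^bsub>M (Suc 0) ?m\<^esub>"
   using DC.zigzag_surj[OF eh(1)[OF y] eh(3)[OF y] eh(2)[OF y] add_0] by blast
  obtain \<delta> where d: "DR.der (int ?m) \<delta>" "\<delta> \<in> extensional (carrier R)" "edge_der \<delta> = u"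
   using edge_der_surj[OF u(1)[unfolded M_carrier] u(4)] by blast
  have "edge_der (%x. \<delta> (dif R x)) = edge_der (%x. \<zero>)"
   using u(3) unfolding d(3)[symmetric] edge_der_dd[OF d(1)] by (simp add: M_def fun_space_simps edge_der_def)
  then have "\<delta> (dif R x) = \<zero>" if "x :. R" for x by (rule edge_der_inj[OF _ that])
  then have "\<delta> \<in> DR.Zc (int ?m)" using d(1,2) by (simp add: DR.Zc_def)
  then show ?thesis using u(2) d(3) by blast
 qed
 show "DC.zigzag ?m 0 (edge_der (\<lambda>x \<in> carrier R. \<delta> x \<oplus> \<delta>' x)) (edge_hoch ?m (\<lambda>w \<in> tuples A (Suc ?m). y w \<oplus> y' w))"
  if z: "DC.zigzag ?m 0 (edge_der \<delta>) (edge_hoch ?m y)" "DC.zigzag ?m 0 (edge_der \<delta>') (edge_hoch ?m y')"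
   and d: "\<delta> \<in> DR.Zc (int ?m)" "\<delta>' \<in> DR.Zc (int ?m)" for \<delta> \<delta>' y y'
 proof -
  have 1: "edge_der (\<lambda>x \<in> carrier R. \<delta> x \<oplus> \<delta>' x) = edge_der \<delta> \<oplus>\<^bsub>M 0 ?m\<^esub> edge_der \<delta>'"
   unfolding M_def fun_space_simps edge_der_def by (rule restrict_ext) (elim FB.tuples_1E, simp add: tuples_def)
  have 2: "edge_hoch ?m (\<lambda>w \<in> tuples A (Suc ?m). y w \<oplus> y' w) = edge_hoch ?m y \<oplus>\<^bsub>M ?m 0\<^esub> edge_hoch ?m y'"
   unfolding M_def fun_space_simps edge_hoch_restrict unfolding edge_hoch_def by (rule restrict_ext) simp
  show ?thesis unfolding 1 2 using DC.zigzag_add[OF z ed(1)[OF d(1)] ed(1)[OF d(2)]] unfolding add_0 .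
 qed
 show "DC.zigzag ?m 0 (edge_der (\<lambda>x \<in> carrier R. c \<odot> \<delta> x)) (edge_hoch ?m (\<lambda>w \<in> tuples A (Suc ?m). c \<odot> y w))"
  if z: "DC.zigzag ?m 0 (edge_der \<delta>) (edge_hoch ?m y)" and c: "c :. K" and d: "\<delta> \<in> DR.Zc (int ?m)" for c \<delta> y
 proof -
  have 1: "edge_der (\<lambda>x \<in> carrier R. c \<odot> \<delta> x) = c \<odot>\<^bsub>M 0 ?m\<^esub> edge_der \<delta>"
   unfolding M_def fun_space_simps edge_der_def by (rule restrict_ext) (elim FB.tuples_1E, simp add: tuples_def)
  have 2: "edge_hoch ?m (\<lambda>w \<in> tuples A (Suc ?m). c \<odot> y w) = c \<odot>\<^bsub>M ?m 0\<^esub> edge_hoch ?m y"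
   unfolding M_def fun_space_simps edge_hoch_restrict unfolding edge_hoch_def by (rule restrict_ext) simp
  show ?thesis unfolding 1 2 using DC.zigzag_smult[OF z ed(1)[OF d] c] unfolding add_0 .
 qed
 show "\<delta> \<in> DR.Bc (int ?m) \<longleftrightarrow> y \<in> ?I"
  if z: "DC.zigzag ?m 0 (edge_der \<delta>) (edge_hoch ?m y)" and d: "\<delta> \<in> DR.Zc (int ?m)" and y: "y \<in> ?Z" for \<delta> y
 proof
  \<comment> \<open>A coboundary is \<open>dd\<close> of the edge element of a derivation of degree
    \<open>q\<close>, which \<open>bb\<close> kills; this is the starting point of
    \<open>zigzag_boundary\<close>.\<close>
  assume "\<delta> \<in> DR.Bc (int ?m)"
  then obtain \<eta> where \<eta>: "DR.der (int q) \<eta>" "\<delta> = (\<lambda>x \<in> carrier R. \<eta> (dif R x))" by (auto simp: DR.Bc_iff)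
  have k: "edge_der \<eta> :. (M 0 q)" unfolding M_carrier by (rule edge_der_in[OF \<eta>(1)])
  have e: "edge_der \<delta> = dd 0 q (edge_der \<eta>)"
   unfolding edge_der_dd[OF \<eta>(1)] \<eta>(2) unfolding edge_der_def by (rule restrict_ext) (elim FB.tuples_1E, simp)
  obtain l where l: "l :. (M q 0)" "dd q 0 l = \<zero>\<^bsub>M q (Suc 0)\<^esub>" "bb q 0 l = edge_hoch ?m y"
   using DC.zigzag_boundary[OF z[unfolded e] k edge_der_bb[OF \<eta>(1)]] unfolding add_0 by blast
  obtain x where x: "x \<in> extensional (tuples A ?m)" "HB.mlin ?m x" "edge_hoch q x = l"
   using edge_hoch_surj[OF l(1)[unfolded M_carrier] l(2)] by blast
  have "edge_hoch ?m (HB.hoch x) = edge_hoch ?m y" using l(3) unfolding x(3)[symmetric] edge_hoch_bb .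
  then have "y w = HB.hoch x w" if "w \<in> tuples A (Suc ?m)" for w using edge_hoch_inj[OF _ that] by metis
  then have "y = restrict (HB.hoch x) (tuples A (Suc ?m))"
   using y by (intro extensionalityI[of y "tuples A (Suc ?m)"]) simp_all
  then show "y \<in> ?I" using x(1,2) by blast
 next
  \<comment> \<open>A Hochschild coboundary is \<open>bb\<close> of the pullback of a cochain in
    \<open>q + 1\<close> arguments. The element \<open>k\<close> found in column 0 is killed by
    \<open>bb\<close>, so it comes from a derivation.\<close>
  assume "y \<in> ?I"
  then obtain x where x: "HB.mlin ?m x" "y = restrict (HB.hoch x) (tuples A (Suc ?m))" by blast
  have e: "edge_hoch ?m y = bb (0 + q) 0 (edge_hoch q x)" unfolding x(2) edge_hoch_restrict edge_hoch_bb add_0 ..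
  have l: "edge_hoch q x :. (M (0 + q) 0)" "dd (0 + q) 0 (edge_hoch q x) = \<zero>\<^bsub>M (0 + q) (Suc 0)\<^esub>"
   unfolding add_0 M_carrier by (rule edge_hoch_in[OF x(1)], rule edge_hoch_dd[OF x(1)])
  obtain k where k: "k :. (M 0 q)" "bb 0 q k = \<zero>\<^bsub>M (Suc 0) q\<^esub>" "dd 0 q k = edge_der \<delta>"
   using DC.zigzag_boundary_conv[OF z[unfolded e] l] by blast
  obtain \<eta> where \<eta>: "DR.der (int q) \<eta>" "\<eta> \<in> extensional (carrier R)" "edge_der \<eta> = k"
   using edge_der_surj[OF k(1)[unfolded M_carrier] k(2)] by blast
  have "edge_der \<delta> = edge_der (%x. \<eta> (dif R x))" using k(3) unfolding \<eta>(3)[symmetric] edge_der_dd[OF \<eta>(1)] by simp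
  then have "\<delta> x = \<eta> (dif R x)" if "x :. R" for x by (rule edge_der_inj[OF _ that])
  then have "\<delta> = (\<lambda>x \<in> carrier R. \<eta> (dif R x))"
   using d by (intro extensionalityI[of \<delta> "carrier R"]) (simp_all add: DR.Zc_def)
  then show "\<delta> \<in> DR.Bc (int ?m)" unfolding DR.Bc_iff using \<eta>(1,2) by (intro exI[of _ \<eta>]) simp
 qed
qed

text \<open>Degree 0 is settled directly: a closed derivation of degree 0 factors through
  \<open>p\<close>, and no nonzero coboundary exists. Composition with the linear section
  \<open>i\<close> is the isomorphism.\<close>

lemma der_cohomology_zero_iso_Der:
 "vs_iso K (dg_der_cohomology K R (bimod_via (%r. \<rho> (p r)) (deg0 B)) 0) (Der_space K A (bimod_via \<rho> (deg0 B)))"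
 unfolding DR.cohomology_eq
proof -
 obtain i h where i: "i \<in> module_hom K A R" "!!a. a :. A ==> i a \<in> Gr R 0" "!!a. a :. A ==> p (i a) = a"
  and h: "h \<in> module_hom K R R" "!!n x. x \<in> Gr R n ==> h x \<in> Gr R (n - 1)"
  and ih: "!!x. x :. R ==> h (dif R x) \<oplus>\<^sub>R dif R (h x) = x \<ominus>\<^sub>R i (p x)"
  by (rule RS.contraction) blast
 let ?D = "{y \<in> module_hom K A B \<inter> extensional (carrier A).
  \<forall>a \<in> carrier A. \<forall>b \<in> carrier A. y (a \<otimes>\<^sub>A b) = y a \<otimes> \<rho> b \<oplus> \<rho> a \<otimes> y b}"
 have D: "Der_space K A (bimod_via \<rho> (deg0 B)) = fun_space (carrier A) B ?D"
  by (simp add: Der_space_def fun_space_bimod_via module_hom_bimod_via bimod_via_simps)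
 have dG: "dif R (h x) :. R" "h (dif R x) :. R" "i (p x) :. R" if "x :. R" for x
  using that module_hom_in[OF h(1)] RS.R.dif_in module_hom_in[OF i(1)] RS.p(2) by auto
 \<comment> \<open>By the homotopy identity the two values differ by \<open>\<delta>\<close> on
   \<open>h (dif R r)\<close> and on a boundary. The latter is zero since \<open>\<delta>\<close> is
   closed; the former since \<open>dif R r\<close> vanishes for \<open>n = 0\<close> and
   \<open>\<delta>\<close> vanishes on degree \<open>n\<close> otherwise.\<close>
 have factor: "\<delta> r = \<delta> (i (p r))" if d: "\<delta> \<in> DR.Zc 0" and r: "r :. R" for \<delta> r
  using r
 proof (induction rule: RS.R.homogeneous_induct)
  case (homogeneous n r)
  note r = RS.R.Gr_in[OF homogeneous]
  have dd: "DR.der 0 \<delta>" and z: "!!x. x :. R ==> \<delta> (dif R x) = \<zero>" using d by (auto simp: DR.Zc_def)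
  note hom = DR.derD(1)[OF dd]
  have z0: "\<delta> \<zero>\<^sub>R = \<zero>" by (rule module_hom_zero[OF RS.R.module_axioms FB.B.module_axioms hom])
  have "\<delta> (h (dif R r)) = \<zero>"
  proof (cases "n = 0")
   case True
   then have "dif R r = \<zero>\<^sub>R" using RS.R.dif_degree[OF homogeneous] RS.nonpos[of 1] by simp
   then show ?thesis using z0 by (simp add: module_hom_zero[OF RS.R.module_axioms RS.R.module_axioms h(1)])
  next
   case False
   have "h (dif R r) \<in> Gr R n" using h(2)[OF RS.R.dif_degree[OF homogeneous]] by simp
   then show ?thesis by (rule DR.derD(2)[OF dd]) (use False in simp)
  qed
  then have "\<delta> (h (dif R r) \<oplus>\<^sub>R dif R (h r)) = \<zero>"
   using dG[OF r] z[OF module_hom_in[OF h(1) r]] by (simp add: module_hom_add[OF hom])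
  then have "\<delta> r \<ominus> \<delta> (i (p r)) = \<zero>"
   unfolding ih[OF r] using module_hom_minus[OF RS.R.module_axioms FB.B.module_axioms hom r dG(3)[OF r]] by simp
  then show ?case by (rule FB.B.eq_if_minus_zero[OF DR.derD(4)[OF dd r] DR.derD(4)[OF dd dG(3)[OF r]]])
 next
  case (add a b)
  have "DR.der 0 \<delta>" using d by (simp add: DR.Zc_def)
  note hom = DR.derD(1)[OF this]
  show ?case using add dG(3) RS.p by (simp add: module_hom_add[OF hom] module_hom_add[OF i(1)])
 qed
 let ?f = "%\<delta>. \<lambda>a \<in> carrier A. \<delta> (i a)"
 interpret Q: quot_setup K "fun_space (carrier R) B (DR.Zc 0)" "DR.Bc 0" by (rule DR.cohomology_quot_setup)
 have Zd: "DR.der 0 \<delta>" "\<delta> \<in> extensional (carrier R)" "x :. R ==> \<delta> (dif R x) = \<zero>" if "\<delta> \<in> DR.Zc 0" for \<delta> x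
  using that by (simp_all add: DR.Zc_def)
 have iR: "a :. A ==> i a :. R" for a by (rule module_hom_in[OF i(1)])
 \<comment> \<open>A derivation of degree -1 is supported on degree 1 of \<open>R\<close>, which is
   zero.\<close>
 have Bc0: "DR.Bc 0 = {\<zero>\<^bsub>fun_space (carrier R) B (DR.Zc 0)\<^esub>}"
 proof
  show "{\<zero>\<^bsub>fun_space (carrier R) B (DR.Zc 0)\<^esub>} <= DR.Bc 0" using Q.I_zero by simp
  show "DR.Bc 0 <= {\<zero>\<^bsub>fun_space (carrier R) B (DR.Zc 0)\<^esub>}"
  proof
   fix \<beta> assume "\<beta> \<in> DR.Bc 0"
   then obtain \<eta> where \<eta>: "DR.der (- 1) \<eta>" "\<beta> = (\<lambda>x \<in> carrier R. \<eta> (dif R x))" by (auto simp: DR.Bc_iff)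
   have "\<eta> x = \<zero>" if "x :. R" for x
    using that
   proof (induction rule: RS.R.homogeneous_induct)
    case (homogeneous n x)
    show ?case
    proof (cases "n = 1")
     case True
     then have "x = \<zero>\<^sub>R" using homogeneous RS.nonpos[of 1] by simp
     then show ?thesis using module_hom_zero[OF RS.R.module_axioms FB.B.module_axioms DR.derD(1)[OF \<eta>(1)]] by simp
    next
     case False then show ?thesis using DR.derD(2)[OF \<eta>(1) homogeneous] by simp
    qed
   next
    case (add x y) then show ?case by (simp add: module_hom_add[OF DR.derD(1)[OF \<eta>(1)]])
   qed
   then show "\<beta> \<in> {\<zero>\<^bsub>fun_space (carrier R) B (DR.Zc 0)\<^esub>}"
    unfolding \<eta>(2) fun_space_simps by (auto intro!: restrict_ext simp: RS.R.dif_in)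
  qed
 qed
 show "vs_iso K (quot (fun_space (carrier R) B (DR.Zc 0)) (DR.Bc 0)) (Der_space K A (bimod_via \<rho> (deg0 B)))"
  unfolding D
 proof (rule vs_iso_quot_hom[OF DR.cohomology_quot_setup, where f = ?f])
  have fD: "?f \<delta> \<in> ?D" if d: "\<delta> \<in> DR.Zc 0" for \<delta>
  proof -
   note dd = Zd(1)[OF d] and hom = DR.derD(1)[OF Zd(1)[OF d]]
   have "?f \<delta> \<in> module_hom K A B"
    by (rule module_homI) (simp_all add: iR DR.derD(4)[OF dd] module_hom_add[OF i(1)] module_hom_smult[OF i(1)] module_hom_add[OF hom] module_hom_smult[OF hom])
   \<comment> \<open>The section \<open>i\<close> is not multiplicative, but \<open>i (a b)\<close>
     and \<open>i a\<close> times \<open>i b\<close> have the same image under \<open>p\<close>, and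
     \<open>\<delta>\<close> sees only that image.\<close>
   moreover have "\<delta> (i (a \<otimes>\<^sub>A b)) = \<delta> (i a) \<otimes> \<rho> b \<oplus> \<rho> a \<otimes> \<delta> (i b)" if ab: "a :. A" "b :. A" for a b
   proof -
    have "\<delta> (i a \<otimes>\<^sub>R i b) = \<delta> (i (p (i a \<otimes>\<^sub>R i b)))" by (rule factor[OF d]) (simp add: iR ab)
    then have "\<delta> (i (a \<otimes>\<^sub>A b)) = \<delta> (i a \<otimes>\<^sub>R i b)" using ab by (simp add: RS.p iR i(3))
    then show ?thesis using DR.derD(3)[OF dd iR[OF ab(1)] iR[OF ab(2)]] ab by (simp add: i(3))
   qed
   ultimately show ?thesis by simp
  qed
  show "?f \<in> module_hom K (fun_space (carrier R) B (DR.Zc 0)) (fun_space (carrier A) B ?D)"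
  proof (rule module_homI, unfold fun_space_simps)
   show "?f \<delta> \<in> ?D" if "\<delta> \<in> DR.Zc 0" for \<delta> by (rule fD[OF that])
   show "?f (\<lambda>x \<in> carrier R. \<delta> x \<oplus> \<delta>' x) = (\<lambda>x \<in> carrier A. ?f \<delta> x \<oplus> ?f \<delta>' x)" for \<delta> \<delta>'
    by (rule restrict_ext) (simp add: iR)
   show "?f (\<lambda>x \<in> carrier R. c \<odot> \<delta> x) = (\<lambda>x \<in> carrier A. c \<odot> ?f \<delta> x)" for c \<delta>
    by (rule restrict_ext) (simp add: iR)
  qed
  have "\<exists>\<delta> \<in> DR.Zc 0. ?f \<delta> = y" if y: "y \<in> ?D" for y
  proof -
   have hom: "y \<in> module_hom K A B" and ye: "y \<in> extensional (carrier A)"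
    and ym: "!!a b. [|a :. A; b :. A|] ==> y (a \<otimes>\<^sub>A b) = y a \<otimes> \<rho> b \<oplus> \<rho> a \<otimes> y b" using y by auto
   have y0: "y \<zero>\<^sub>A = \<zero>" by (rule module_hom_zero[OF RS.A.module_axioms FB.B.module_axioms hom])
   have d: "DR.der 0 (%r. y (p r))"
    by (rule DR.der_homogeneousI[OF module_hom_comp[OF RS.p(1) hom]])
     (simp_all add: RS.p_Gr y0 RS.p RS.R.Gr_in ym)
   have "DR.der 0 (\<lambda>r \<in> carrier R. y (p r))" by (rule DR.der_cong[OF d]) simp
   then have "(\<lambda>r \<in> carrier R. y (p r)) \<in> DR.Zc 0" by (simp add: DR.Zc_def RS.R.dif_in RS.p_dif y0)
   moreover have "?f (\<lambda>r \<in> carrier R. y (p r)) = y"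
    by (rule extensionalityI[OF _ ye]) (simp_all add: iR i(3))
   ultimately show ?thesis by blast
  qed
  then show "?f ` carrier (fun_space (carrier R) B (DR.Zc 0)) = carrier (fun_space (carrier A) B ?D)"
   unfolding fun_space_simps using fD by blast
  fix \<delta> \<delta>' assume d: "\<delta> :. (fun_space (carrier R) B (DR.Zc 0))" "\<delta>' :. (fun_space (carrier R) B (DR.Zc 0))"
  then have d': "\<delta> \<in> DR.Zc 0" "\<delta>' \<in> DR.Zc 0" by (simp_all only: fun_space_simps)
  have "?f \<delta> = ?f \<delta>' \<longleftrightarrow> \<delta> = \<delta>'"
  proof
   assume e: "?f \<delta> = ?f \<delta>'"
   have "\<delta> r = \<delta>' r" if r: "r :. R" for r
    using factor[OF d'(1) r] factor[OF d'(2) r] fun_cong[OF e, of "p r"] RS.p(2)[OF r] by simp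
   then show "\<delta> = \<delta>'" by (rule extensionalityI[OF Zd(2)[OF d'(1)] Zd(2)[OF d'(2)]])
  qed simp
  then show "?f \<delta> = ?f \<delta>' \<longleftrightarrow> \<delta> \<ominus>\<^bsub>fun_space (carrier R) B (DR.Zc 0)\<^esub> \<delta>' \<in> DR.Bc 0"
   unfolding Bc0 using Q.M.eq_if_minus_zero[OF d] Q.M.minus_self[OF d(1)] by blast
 qed
qed

end

section \<open>Tangent spaces of the derived representation scheme\<close>

theorem proposition1:
  fixes K :: "'k ring" and V :: "('k, 'v) module" and A :: "('k, 'a) module"
    and R :: "('k, 'r) dg_alg" and p :: "'r \<Rightarrow> 'a" and \<rho> :: "'a \<Rightarrow> 'v \<Rightarrow> 'v"
  assumes "field K"
    and "vectorspace K V" and "vectorspace.fin_dim K V"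
    and "assoc_algebra K A"
    and "\<rho> \<in> alg_hom K A (End_alg K V)"
    and "almost_free_resolution K A R p"
  shows "vs_iso K (derived_tangent K R V (\<lambda>r. \<rho> (p r)) 0)
           (Der_space K A (bimod_via \<rho> (deg0 (End_alg K V)))) \<and>
         (\<forall>i::nat. i \<ge> 1 \<longrightarrow>
           vs_iso K (derived_tangent K R V (\<lambda>r. \<rho> (p r)) (int i))
             (hochschild_cohomology K A (bimod_via \<rho> (deg0 (End_alg K V))) (i + 1)))"
proof -
 let ?E = "End_alg K V" and ?\<phi> = "%r. \<rho> (p r)"
 have E: "assoc_algebra K ?E" by (rule End_alg_assoc_algebra[OF assms(2)])
 have R: "dg_algebra K R" "free_graded K R" "quasi_iso K R (deg0 A) p" and nonpos: "!!n. n > 0 ==> Gr R n = {\<zero>\<^sub>R}"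
  using assms(6) by (simp_all add: almost_free_resolution_def)
 interpret R: dg_algebra K R by fact
 interpret RS: resolution_setup K A R p
  by (rule resolution_setup.intro, fact, fact, rule resolution_setup_axioms.intro, fact, erule nonpos)
 interpret E: assoc_algebra K ?E by fact
 note \<rho> = alg_homD[OF assms(5)]
 have \<phi>: "?\<phi> \<in> alg_hom K R ?E"
  unfolding alg_hom_def
  by (intro IntI module_hom_comp[OF RS.p(1) \<rho>(1)] ring_hom_memI) (simp_all add: RS.p \<rho>)
 have "\<rho> \<zero>\<^sub>A = \<zero>\<^bsub>?E\<^esub>" by (rule module_hom_zero[OF RS.A.module_axioms E.module_axioms \<rho>(1)])
 then have van: "!!n x. x \<in> Gr R n ==> n ~= 0 ==> \<rho> (p x) = \<zero>\<^bsub>?E\<^esub>"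
  "!!x. x :. R ==> \<rho> (p (dif R x)) = \<zero>\<^bsub>?E\<^esub>"
  by (simp_all add: RS.p_Gr RS.p_dif)
 obtain X where X: "X <= (\<Union>n. Gr R n)"
  "bij_betw (lin_ext K R (%w. foldr (mult R) w \<one>\<^sub>R)) (carrier (free_alg K X)) (carrier R)"
  using R(2) unfolding free_graded_def by (elim exE conjE)
 have bs: "bar_setup K R ?E ?\<phi>"
  by (rule bar_setup.intro, rule R.assoc_algebra_axioms, fact, rule bar_setup_axioms.intro, fact)
 have db: "dg_bar_setup K R ?E ?\<phi>"
  unfolding dg_bar_setup_def dg_bar_setup_axioms_def
  by (intro conjI allI impI; (rule bs | rule R.dg_algebra_axioms | (erule van(1), assumption) | erule van(2) | erule nonpos))
 have fb: "free_bar_setup K R ?E ?\<phi> X"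
  unfolding free_bar_setup_def free_bar_setup_axioms_def free_algebra_def
  by (intro conjI; (rule db | rule assms(1) | rule X(1) | rule X(2)))
 have hb: "bar_setup K A ?E \<rho>"
  by (rule bar_setup.intro, fact, fact, rule bar_setup_axioms.intro, fact)
 interpret C: comparison_setup K A R p ?E \<rho> X
  by (rule comparison_setup.intro[OF RS.resolution_setup_axioms fb hb])
 obtain B e ent where mu: "matrix_units K ?E (B :: 'v set) e ent" using End_matrix_units[OF assms(2,3)] by (elim exE)
 have rs: "rep_setup K R V B e ent ?\<phi>" by (rule rep_setup.intro, fact, fact, rule rep_setup_axioms.intro, fact, erule van(1), assumption, erule van(2))
 \<comment> \<open>The matrix argument needs an index \<open>t\<close> to read off scalars, so the
   zero vector space is separated; there the base point is a default value.\<close>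
 have dt: "vs_iso K (derived_tangent K R V ?\<phi> i) (dg_der_cohomology K R (bimod_via ?\<phi> (deg0 ?E)) i)" for i
 proof (cases "B = {}")
  case True
  then show ?thesis by (rule rep_setup.derived_tangent_iso_trivial[OF rs])
 next
  case False
  then obtain t where "t \<in> B" by blast
  then have "rep_point_setup K R V B e ent ?\<phi> t" by (intro rep_point_setup.intro[OF rs] rep_point_setup_axioms.intro)
  then show ?thesis by (rule rep_point_setup.derived_tangent_iso)
 qed
 show ?thesis
 proof (intro conjI allI impI)
  show "vs_iso K (derived_tangent K R V ?\<phi> 0) (Der_space K A (bimod_via \<rho> (deg0 ?E)))"
   by (rule vs_iso_trans[OF dt C.der_cohomology_zero_iso_Der])
  fix i :: nat assume "i \<ge> 1"
  then obtain q where "i = Suc q" by (cases i) auto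
  then show "vs_iso K (derived_tangent K R V ?\<phi> (int i)) (hochschild_cohomology K A (bimod_via \<rho> (deg0 ?E)) (i + 1))"
   using vs_iso_trans[OF dt C.der_cohomology_iso_hochschild[of q]] by simp
 qed
qed

end
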